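(* Let $s>1$, $1<p<\infty$, $1\le q\le\infty$, and let $\mu$ be a complex measure on $\mathbb{R}$ such that $$L_1(\lambda)=\int_{\mathbb{R}} e^{\lambda\left(|\xi|^{1/s}\log|\xi|\right)}\,d|\mu|(\xi)<\infty$$ for every $\lambda>0$, and such that $\mu(\mathbb{R})=0$. Let $f$ be the inverse Fourier transform of $\mu$, i.e. $f(t)=\frac{1}{\sqrt{2\pi}}\int_{\mathbb{R}}e^{i\xi t}\,d\mu(\xi)$ for $t\in\mathbb{R}$. Then $f\in C^\infty(\mathbb{R})$ and the composition operator $T_f:u\mapsto f\circ u$ maps $\mathcal{GM}^s_{p,q}(\mathbb{R}^n)$ into $\mathcal{GM}^s_{p,q}(\mathbb{R}^n)$; that is, $f\circ u\in\mathcal{GM}^s_{p,q}(\mathbb{R}^n)$ for every real-valued $u\in\mathcal{GM}^s_{p,q}(\mathbb{R}^n)$.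
   Context: The Fourier transform is $\mathcal{F}f(\xi)=(2\pi)^{-n/2}\int_{\mathbb{R}^n}f(x)e^{-ix\cdot\xi}\,dx$, extended to tempered distributions. Fix a function $\rho\in C_0^\infty(\mathbb{R}^n)$ with $\rho:\mathbb{R}^n\to[0,1]$, $\operatorname{supp}\rho\subset[-1,1]^n$ and $\rho=1$ on $[-\tfrac12,\tfrac12]^n$. For $k\in\mathbb{Z}^n$ put $\rho_k(\xi)=\rho(\xi-k)$, $\sigma_k=\rho_k\big(\sum_{m\in\mathbb{Z}^n}\rho_m\big)^{-1}$ and $\Box_k f=\mathcal{F}^{-1}(\sigma_k\mathcal{F}f)$. For $1\le p,q\le\infty$ and $s>0$ the Gevrey-modulation space $\mathcal{GM}^s_{p,q}(\mathbb{R}^n)$ is the set of all $f\in L^p(\mathbb{R}^n)$ (complex-valued functions) with $$\|f\|_{\mathcal{GM}^s_{p,q}}=\Big(\sum_{k\in\mathbb{Z}^n}e^{q|k|^{1/s}}\|\Box_kf\|_{L^p}^q\Big)^{1/q}<\infty$$ (for $q=\infty$: $\sup_{k}e^{|k|^{1/s}}\|\Box_kf\|_{L^p}$), where $|k|$ is the Euclidean norm. $|\mu|$ denotes the total variation measure of $\mu$; the integrand is taken to be $1$ at $\xi=0$. *)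

theory Defs
  imports "HOL-Analysis.Analysis" "HOL-Probability.Essential_Supremum"
begin

text \<open>Smooth functions\<close>

definition dderiv :: "'a::euclidean_space \<Rightarrow> ('a \<Rightarrow> 'b::real_normed_vector) \<Rightarrow> 'a \<Rightarrow> 'b" where
  "dderiv b f x = frechet_derivative f (at x) b"

text \<open>Iterated partial derivatives are indexed by lists of basis vectors.\<close>

definition iter_deriv ::
    "'a::euclidean_space list \<Rightarrow> ('a \<Rightarrow> 'b::real_normed_vector) \<Rightarrow> 'a \<Rightarrow> 'b" where
  "iter_deriv bs f = foldr dderiv bs f"

definition C_infinity :: "('a::euclidean_space \<Rightarrow> 'b::real_normed_vector) \<Rightarrow> bool" where
  "C_infinity f \<longleftrightarrow> (\<forall>bs \<in> lists Basis. \<forall>x. iter_deriv bs f differentiable (at x))"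

definition schwartz :: "('a::euclidean_space \<Rightarrow> complex) set" where
  "schwartz = {\<phi>. C_infinity \<phi> \<and>
     (\<forall>N. \<forall>bs \<in> lists Basis. bounded (range (\<lambda>x. (1 + norm x) ^ N *\<^sub>R iter_deriv bs \<phi> x)))}"

text \<open>Fourier transform of Schwartz functions and of tempered distributions\<close>

definition fourier :: "(real ^ 'n \<Rightarrow> complex) \<Rightarrow> real ^ 'n \<Rightarrow> complex" where
  "fourier \<phi> \<xi> = complex_of_real ((2 * pi) powr (- (real CARD('n) / 2))) *
     (LINT x|lebesgue. \<phi> x * exp (- (\<i> * complex_of_real (x \<bullet> \<xi>))))"

definition inv_fourier :: "(real ^ 'n \<Rightarrow> complex) \<Rightarrow> real ^ 'n \<Rightarrow> complex" where
  "inv_fourier \<phi> x = complex_of_real ((2 * pi) powr (- (real CARD('n) / 2))) *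
     (LINT \<xi>|lebesgue. \<phi> \<xi> * exp (\<i> * complex_of_real (x \<bullet> \<xi>)))"

text \<open>A distribution is given by its (bilinear, not sesquilinear) action on test functions; only
  the values at Schwartz functions matter.  The operations below, defined by duality, map
  tempered distributions (functionals that are linear and continuous on the Schwartz space)
  to tempered distributions; nothing else about the functional enters their definition.\<close>

type_synonym 'n distr = "(real ^ 'n \<Rightarrow> complex) \<Rightarrow> complex"

definition distr_of :: "(real ^ 'n \<Rightarrow> complex) \<Rightarrow> 'n distr" where
  "distr_of f = (\<lambda>\<phi>. LINT x|lebesgue. f x * \<phi> x)"

definition distr_fourier :: "'n distr \<Rightarrow> 'n::finite distr" where
  "distr_fourier T = (\<lambda>\<phi>. T (fourier \<phi>))"

definition distr_inv_fourier :: "'n distr \<Rightarrow> 'n::finite distr" where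
  "distr_inv_fourier T = (\<lambda>\<phi>. T (inv_fourier \<phi>))"

definition distr_mult :: "(real ^ 'n \<Rightarrow> complex) \<Rightarrow> 'n distr \<Rightarrow> 'n::finite distr" where
  "distr_mult \<sigma> T = (\<lambda>\<phi>. T (\<lambda>x. \<sigma> x * \<phi> x))"

text \<open>Lebesgue spaces.  Exponents and norms take values in \<^typ>\<open>ennreal\<close>.\<close>

definition ennreal_powr :: "ennreal \<Rightarrow> real \<Rightarrow> ennreal" where \<comment> \<open>for positive exponents\<close>
  "ennreal_powr x a = (if x = \<infinity> then \<infinity> else ennreal (enn2real x powr a))"

definition Lp_norm :: "ennreal \<Rightarrow> (real ^ 'n \<Rightarrow> complex) \<Rightarrow> ennreal" where
  "Lp_norm p f =
     (if p = \<infinity> then esssup lebesgue (\<lambda>x. ennreal (cmod (f x)))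
      else ennreal_powr (\<integral>\<^sup>+x. ennreal (cmod (f x) powr enn2real p) \<partial>lebesgue) (1 / enn2real p))"

definition Lp :: "ennreal \<Rightarrow> (real ^ 'n \<Rightarrow> complex) set" where
  "Lp p = {f \<in> borel_measurable lebesgue. Lp_norm p f < \<infinity>}"

text \<open>The function representing a distribution is unique up to null sets, so the infimum
  is over a single value, or over the empty set (giving \<open>\<infinity>\<close>) if the distribution is not in
  \<open>L\<^sup>p\<close>.\<close>

definition distr_Lp_norm :: "ennreal \<Rightarrow> 'n::finite distr \<Rightarrow> ennreal" where
  "distr_Lp_norm p T = (INF g \<in> {g \<in> Lp p. \<forall>\<phi> \<in> schwartz. T \<phi> = distr_of g \<phi>}. Lp_norm p g)"

text \<open>Frequency-uniform decomposition and Gevrey-modulation spaces\<close>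

definition lattice_pt :: "int ^ 'n \<Rightarrow> real ^ 'n" where
  "lattice_pt k = (\<chi> i. real_of_int (k $ i))"

definition freq_window :: "(real ^ 'n \<Rightarrow> real) \<Rightarrow> bool" where
  "freq_window \<rho> \<longleftrightarrow> C_infinity \<rho> \<and> (\<forall>\<xi>. 0 \<le> \<rho> \<xi> \<and> \<rho> \<xi> \<le> 1) \<and>
     closure {\<xi>. \<rho> \<xi> \<noteq> 0} \<subseteq> {\<xi>. \<forall>i. \<bar>\<xi> $ i\<bar> \<le> 1} \<and>
     (\<forall>\<xi>. (\<forall>i. \<bar>\<xi> $ i\<bar> \<le> 1 / 2) \<longrightarrow> \<rho> \<xi> = 1)"

definition sigma_fn :: "(real ^ 'n \<Rightarrow> real) \<Rightarrow> int ^ 'n \<Rightarrow> real ^ 'n \<Rightarrow> real" where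
  "sigma_fn \<rho> k \<xi> = \<rho> (\<xi> - lattice_pt k) * inverse (\<Sum>\<^sub>\<infinity>m. \<rho> (\<xi> - lattice_pt m))"

definition box_op :: "(real ^ 'n \<Rightarrow> real) \<Rightarrow> int ^ 'n \<Rightarrow> (real ^ 'n \<Rightarrow> complex) \<Rightarrow> 'n distr" where
  "box_op \<rho> k f = distr_inv_fourier
     (distr_mult (\<lambda>\<xi>. complex_of_real (sigma_fn \<rho> k \<xi>)) (distr_fourier (distr_of f)))"

definition GM_norm :: "(real ^ 'n \<Rightarrow> real) \<Rightarrow> real \<Rightarrow> ennreal \<Rightarrow> ennreal \<Rightarrow>
    (real ^ 'n \<Rightarrow> complex) \<Rightarrow> ennreal" where
  "GM_norm \<rho> s p q f =
     (if q = \<infinity>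
      then (SUP k. ennreal (exp (norm (lattice_pt k) powr (1 / s))) *
                   distr_Lp_norm p (box_op \<rho> k f))
      else ennreal_powr
             (\<Sum>\<^sub>\<infinity>k. ennreal (exp (enn2real q * norm (lattice_pt k) powr (1 / s))) *
                   ennreal_powr (distr_Lp_norm p (box_op \<rho> k f)) (enn2real q))
             (1 / enn2real q))"

definition GM :: "(real ^ 'n \<Rightarrow> real) \<Rightarrow> real \<Rightarrow> ennreal \<Rightarrow> ennreal \<Rightarrow> (real ^ 'n \<Rightarrow> complex) set" where
  "GM \<rho> s p q = {f \<in> Lp p. GM_norm \<rho> s p q f < \<infinity>}"

text \<open>Complex measures on the sigma-algebra of \<open>M\<close> (the measure carried by \<open>M\<close> is
  irrelevant)\<close>

definition complex_measure :: "'a measure \<Rightarrow> ('a set \<Rightarrow> complex) \<Rightarrow> bool" where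
  "complex_measure M \<mu> \<longleftrightarrow>
     (\<forall>A :: nat \<Rightarrow> 'a set. range A \<subseteq> sets M \<longrightarrow> disjoint_family A \<longrightarrow>
        (\<lambda>i. \<mu> (A i)) sums \<mu> (\<Union>i. A i))"

definition total_variation :: "'a measure \<Rightarrow> ('a set \<Rightarrow> complex) \<Rightarrow> 'a measure" where
  "total_variation M \<mu> = measure_of (space M) (sets M)
     (\<lambda>A. SUP E \<in> {E :: nat \<Rightarrow> 'a set. range E \<subseteq> sets M \<and> disjoint_family E \<and> (\<Union>i. E i) = A}.
            \<Sum>i. ennreal (cmod (\<mu> (E i))))"

text \<open>The positive part in the Jordan decomposition of a finite signed measure \<open>\<nu>\<close>; note that
  \<^const>\<open>ennreal\<close> sends negative numbers to \<open>0\<close>.\<close>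

definition upper_variation :: "'a measure \<Rightarrow> ('a set \<Rightarrow> real) \<Rightarrow> 'a measure" where
  "upper_variation M \<nu> = measure_of (space M) (sets M)
     (\<lambda>A. SUP B \<in> {B \<in> sets M. B \<subseteq> A}. ennreal (\<nu> B))"

definition signed_integral :: "'a measure \<Rightarrow> ('a set \<Rightarrow> real) \<Rightarrow> ('a \<Rightarrow> complex) \<Rightarrow> complex" where
  "signed_integral M \<nu> g =
     (LINT x|upper_variation M \<nu>. g x) - (LINT x|upper_variation M (\<lambda>A. - \<nu> A). g x)"

definition complex_integral :: "'a measure \<Rightarrow> ('a set \<Rightarrow> complex) \<Rightarrow> ('a \<Rightarrow> complex) \<Rightarrow> complex" where
  "complex_integral M \<mu> g =
     signed_integral M (\<lambda>A. Re (\<mu> A)) g + \<i> * signed_integral M (\<lambda>A. Im (\<mu> A)) g"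

end

theory Submission
  imports Defs "HOL-Probability.Characteristic_Functions" "HOL-Real_Asymp.Real_Asymp"
begin

text \<open>Since \<open>\<mu>(\<real>) = 0\<close>, \<open>f \<circ> u\<close> is an integral of \<open>e\<^sub>\<xi> = exp (i \<xi> u) - 1\<close> over \<open>\<xi>\<close>, so by Minkowski's
  inequality it suffices to bound the weighted block norms of \<open>e\<^sub>\<xi>\<close> by \<open>exp (\<lambda> \<bar>\<xi>\<bar>\<^sup>a log \<bar>\<xi>\<bar>)\<close>, where
  \<open>a = 1/s < 1\<close>. For bounded \<open>\<xi>\<close> this is the exponential series; larger \<open>\<xi>\<close> are reached by doubling,
  \<open>e\<^sub>2\<^sub>\<xi> = e\<^sub>\<xi>\<^sup>2 + 2 e\<^sub>\<xi>\<close>. In the square only pairs of blocks \<open>l, m\<close> with \<open>l + m\<close> near \<open>k\<close> contribute to the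
  block \<open>k\<close>, and \<open>\<bar>l + m\<bar>\<^sup>a \<le> max \<bar>l\<bar>\<^sup>a \<bar>m\<bar>\<^sup>a + (2\<^sup>a - 1) min \<bar>l\<bar>\<^sup>a \<bar>m\<bar>\<^sup>a\<close>: one factor carries the full weight, the
  other only its power \<open>2\<^sup>a - 1\<close>. Interpolating the latter with the trivial bound \<open>\<bar>e\<^sub>\<xi>\<bar> \<le> 2\<close> (here \<open>u\<close> is
  real), a doubling multiplies the exponent by \<open>1 + (2\<^sup>a - 1) = 2\<^sup>a\<close> up to logarithmic terms, so
  \<open>log\<^sub>2 \<bar>\<xi>\<bar>\<close> doublings give \<open>\<bar>\<xi>\<bar>\<^sup>a log \<bar>\<xi>\<bar>\<close>.\<close>

section \<open>Variation measures\<close>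

text \<open>The obstacle is growth in \<xi>. The product estimate by itself makes the weighted class
  an algebra, and the exponential series then yields a bound exponential in |\<xi>|, while the
  hypothesis on \<mu> controls only integrals of exp (\<lambda> |\<xi>|^a log |\<xi>|). Doubling
  with the mere algebra estimate would square the norm and be no better. What helps is that the
  second factor needs a power of its weight strictly below 1, which leaves room for the bound
  |e_\<xi>| \<le> 2, uniform in \<xi>. The second factor can be placed in L^\<infinity> because
  blocks are band-limited, so that L^p bounds imply uniform ones; summation over blocks costs each
  doubling a polynomial factor, for which the logarithm leaves room. The exponent q stays outside
  the analysis: the weighted block norms of u are majorized by one sequence \<open>b\<close>, all
  later functions are compared with \<open>b\<close> block by block, and only the summability of
  \<open>b\<close> is passed on. Elements of GM are determined up to null sets and measurable for
  the completed measure; the estimates are made for a continuous representative, which the decay of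
  the blocks provides.\<close>

lemma countably_additive_if_sub_super:
  fixes F :: "'a set \<Rightarrow> ennreal"
  assumes sub: "\<And>A :: nat \<Rightarrow> 'a set. range A \<subseteq> sets M \<Longrightarrow> disjoint_family A \<Longrightarrow>
      F (\<Union>i. A i) \<le> (\<Sum>i. F (A i))"
    and super: "\<And>A B. A \<in> sets M \<Longrightarrow> B \<in> sets M \<Longrightarrow> A \<inter> B = {} \<Longrightarrow> F A + F B \<le> F (A \<union> B)"
  shows "countably_additive (sets M) F"
  unfolding countably_additive_def
proof (intro allI impI)
  fix A :: "nat \<Rightarrow> 'a set"
  assume A: "range A \<subseteq> sets M" "disjoint_family A" "(\<Union>i. A i) \<in> sets M"
  have fin: "(\<Sum>i<n. F (A i)) \<le> F (\<Union>i<n. A i)" for n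
  proof (induction n)
    case (Suc n)
    have "(\<Sum>i<Suc n. F (A i)) \<le> F (\<Union>i<n. A i) + F (A n)"
      using Suc by (simp add: add_right_mono)
    also have "\<dots> \<le> F ((\<Union>i<n. A i) \<union> A n)"
      using A by (intro super) (auto simp: disjoint_family_on_def, (metis IntI empty_iff less_irrefl)?)
    also have "(\<Union>i<n. A i) \<union> A n = (\<Union>i<Suc n. A i)"
      by (auto simp: less_Suc_eq)
    finally show ?case .
  qed simp
  have "(\<Sum>i<n. F (A i)) \<le> F (\<Union>i. A i)" for n
  proof -
    have m: "(\<Union>i<n. A i) \<in> sets M" using A by auto
    \<comment> \<open>Superadditivity contains monotonicity, as the value on the remaining part is
      nonnegative.\<close>
    have "F (\<Union>i<n. A i) \<le> F (\<Union>i<n. A i) + F ((\<Union>i. A i) - (\<Union>i<n. A i))"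
      by simp
    also have "\<dots> \<le> F ((\<Union>i<n. A i) \<union> ((\<Union>i. A i) - (\<Union>i<n. A i)))"
      using A m by (intro super) auto
    also have "(\<Union>i<n. A i) \<union> ((\<Union>i. A i) - (\<Union>i<n. A i)) = (\<Union>i. A i)" by auto
    finally show ?thesis using fin order_trans by blast
  qed
  then have "(\<Sum>i. F (A i)) \<le> F (\<Union>i. A i)"
    by (simp add: suminf_eq_SUP SUP_least)
  then show "(\<Sum>i. F (A i)) = F (\<Union>i. A i)"
    using sub[OF A(1,2)] by (rule antisym)
qed

lemma SUP_add_SUP_le:
  fixes f g :: "_ \<Rightarrow> ennreal"
  assumes "I \<noteq> {}" "J \<noteq> {}" "\<And>i j. i \<in> I \<Longrightarrow> j \<in> J \<Longrightarrow> f i + g j \<le> c"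
  shows "(SUP i\<in>I. f i) + (SUP j\<in>J. g j) \<le> c"
proof -
  have "(SUP i\<in>I. f i) + g j \<le> c" if "j \<in> J" for j
    using assms(3) that by (subst ennreal_SUP_add_left[OF assms(1), symmetric]) (auto intro!: SUP_least)
  then show ?thesis
    by (subst ennreal_SUP_add_right[OF assms(2)]) (auto intro!: SUP_least)
qed

lemma ennreal_le_suminf: "f i \<le> (\<Sum>i. f i)" for f :: "nat \<Rightarrow> ennreal"
  using sum_le_suminf[of f "{i}"] by simp

lemma disjoint_family_binaryset: "A \<inter> B = {} \<Longrightarrow> disjoint_family (binaryset A B)"
  by (auto simp: binaryset_def disjoint_family_on_def)

text \<open>Values in an arbitrary normed space let the same lemmas serve a complex measure and its
  real and imaginary parts.\<close>

definition signed_additive :: "'a measure \<Rightarrow> ('a set \<Rightarrow> 'b::real_normed_vector) \<Rightarrow> bool" where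
  "signed_additive M \<nu> \<longleftrightarrow>
     (\<forall>A :: nat \<Rightarrow> 'a set. range A \<subseteq> sets M \<longrightarrow> disjoint_family A \<longrightarrow>
        (\<lambda>i. \<nu> (A i)) sums \<nu> (\<Union>i. A i))"

lemma complex_measure_iff_signed_additive: "complex_measure M \<mu> \<longleftrightarrow> signed_additive M \<mu>"
  by (simp add: complex_measure_def signed_additive_def)

lemma signed_additive_bounded_linear:
  "bounded_linear L \<Longrightarrow> signed_additive M \<nu> \<Longrightarrow> signed_additive M (\<lambda>A. L (\<nu> A))"
  unfolding signed_additive_def by (auto intro: bounded_linear.sums)

text \<open>The constant sequence of empty sets is disjoint, and a convergent series of constant
  terms has terms 0.\<close>

lemma signed_additive_empty:
  assumes "signed_additive M \<nu>" shows "\<nu> {} = 0"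
proof -
  have "(\<lambda>i::nat. \<nu> {}) sums \<nu> (\<Union>i::nat. {})"
    using assms[unfolded signed_additive_def, rule_format, of "\<lambda>_. {}"]
    by (auto simp: disjoint_family_on_def)
  then have "(\<lambda>i::nat. \<nu> {}) \<longlonglongrightarrow> 0"
    using summable_LIMSEQ_zero sums_summable by blast
  then show ?thesis by (simp add: LIMSEQ_const_iff)
qed

lemma signed_additive_Un:
  assumes sa: "signed_additive M \<nu>" and "A \<in> sets M" "B \<in> sets M" "A \<inter> B = {}"
  shows "\<nu> (A \<union> B) = \<nu> A + \<nu> B"
proof -
  have "(\<lambda>i. \<nu> (binaryset A B i)) sums \<nu> (\<Union>i. binaryset A B i)"
    using assms by (intro sa[unfolded signed_additive_def, rule_format])
      (auto simp: binaryset_def disjoint_family_on_def split: if_splits)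
  moreover have "(\<lambda>i. \<nu> (binaryset A B i)) sums (\<nu> A + \<nu> B)"
    using signed_additive_empty[OF sa] by (intro binaryset_sums)
  ultimately show ?thesis
    by (simp add: UN_binaryset_eq sums_unique2)
qed

text \<open>\<open>measure_of\<close> takes the prescribed values only for a countably additive set
  function, so additivity of the supremum has to be proved. A subset of a union is cut along the
  pieces; conversely, subsets of two disjoint sets are united.\<close>

lemma emeasure_upper_variation:
  fixes \<nu> :: "'a set \<Rightarrow> real"
  assumes sa: "signed_additive M \<nu>" and A: "A \<in> sets M"
  shows "emeasure (upper_variation M \<nu>) A = (SUP B \<in> {B \<in> sets M. B \<subseteq> A}. ennreal (\<nu> B))"
proof -
  let ?F = "\<lambda>A. SUP B \<in> {B \<in> sets M. B \<subseteq> A}. ennreal (\<nu> B)"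
  have up: "ennreal (\<nu> B) \<le> ?F A" if "B \<in> sets M" "B \<subseteq> A" for A B
    using that by (intro SUP_upper) auto
  have sub: "?F (\<Union>i. A i) \<le> (\<Sum>i. ?F (A i))" if A: "range A \<subseteq> sets M" "disjoint_family A" for A :: "nat \<Rightarrow> 'a set"
  proof (rule SUP_least)
    fix B assume "B \<in> {B \<in> sets M. B \<subseteq> (\<Union>i. A i)}"
    then have B: "B \<in> sets M" "B \<subseteq> (\<Union>i. A i)" by auto
    have "(\<lambda>i. \<nu> (B \<inter> A i)) sums \<nu> (\<Union>i. B \<inter> A i)"
      using A B by (intro sa[unfolded signed_additive_def, rule_format]) (auto simp: disjoint_family_on_def)
    moreover have "(\<Union>i. B \<inter> A i) = B" using B by auto
    ultimately have s: "(\<lambda>n. \<Sum>i<n. \<nu> (B \<inter> A i)) \<longlonglongrightarrow> \<nu> B" by (simp add: sums_def)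
    have "ennreal (\<Sum>i<n. \<nu> (B \<inter> A i)) \<le> (\<Sum>i. ?F (A i))" for n
    proof -
      \<comment> \<open>Terms may be negative. Dropping those can only increase the sum, and
        \<open>ennreal\<close> commutes with the sum of the others.\<close>
      have "ennreal (\<Sum>i<n. \<nu> (B \<inter> A i)) \<le> ennreal (\<Sum>i<n. max 0 (\<nu> (B \<inter> A i)))"
        by (intro ennreal_leI sum_mono) auto
      also have "\<dots> = (\<Sum>i<n. ennreal (max 0 (\<nu> (B \<inter> A i))))"
        by (subst sum_ennreal) auto
      also have "\<dots> = (\<Sum>i<n. ennreal (\<nu> (B \<inter> A i)))"
        by (intro sum.cong refl) (auto simp: max_def ennreal_neg)
      also have "\<dots> \<le> (\<Sum>i<n. ?F (A i))"
        using A B by (intro sum_mono up) auto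
      also have "\<dots> \<le> (\<Sum>i. ?F (A i))" by (intro sum_le_suminf) auto
      finally show ?thesis .
    qed
    moreover have "(\<lambda>n. ennreal (\<Sum>i<n. \<nu> (B \<inter> A i))) \<longlonglongrightarrow> ennreal (\<nu> B)"
      by (intro tendsto_ennrealI s)
    ultimately show "ennreal (\<nu> B) \<le> (\<Sum>i. ?F (A i))"
      by (meson LIMSEQ_le_const2)
  qed
  have super: "?F A + ?F B \<le> ?F (A \<union> B)" if AB: "A \<in> sets M" "B \<in> sets M" "A \<inter> B = {}" for A B
  proof -
    have "ennreal (\<nu> C) + ennreal (\<nu> D) \<le> ?F (A \<union> B)" if C: "C \<in> sets M" "C \<subseteq> A" and D: "D \<in> sets M" "D \<subseteq> B" for C D
    \<comment> \<open>A competitor with negative value counts as 0 under \<open>ennreal\<close>; it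
      is left out of the union, which it would only make smaller in measure.\<close>
    proof (cases "\<nu> C \<ge> 0")
      case True
      show ?thesis
      proof (cases "\<nu> D \<ge> 0")
        case T2: True
        have "C \<inter> D = {}" using C D AB by blast
        then have "ennreal (\<nu> C) + ennreal (\<nu> D) = ennreal (\<nu> (C \<union> D))"
          using signed_additive_Un[OF sa C(1) D(1)] True T2 by (simp add: ennreal_plus[symmetric] del: ennreal_plus)
        then show ?thesis using C D up[of "C \<union> D" "A \<union> B"] by auto
      next
        case False
        then show ?thesis using C up[of C "A \<union> B"] by (auto simp: ennreal_neg)
      qed
    next
      case False
      then show ?thesis using D up[of D "A \<union> B"] by (auto simp: ennreal_neg)
    qed
    then show ?thesis
      using AB by (intro SUP_add_SUP_le) auto
  qed
  show ?thesis
  proof (rule emeasure_measure_of[OF upper_variation_def])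
    show "sets M \<subseteq> Pow (space M)" by (rule sets.space_closed)
    show "positive (sets (upper_variation M \<nu>)) ?F"
      using signed_additive_empty[OF sa] by (auto simp: positive_def)
    show "countably_additive (sets (upper_variation M \<nu>)) ?F"
      using sub super by (auto simp: upper_variation_def intro!: countably_additive_if_sub_super)
  qed (use A in \<open>auto simp: upper_variation_def\<close>)
qed

lemma sets_upper_variation [simp, measurable_cong]: "sets (upper_variation M \<nu>) = sets M"
  and space_upper_variation [simp]: "space (upper_variation M \<nu>) = space M"
  by (auto simp: upper_variation_def)

lemma sets_total_variation [simp, measurable_cong]: "sets (total_variation M \<mu>) = sets M"
  and space_total_variation [simp]: "space (total_variation M \<mu>) = space M"
  by (auto simp: total_variation_def)

text \<open>Additivity rewrites \<nu> B as \<nu> A - \<nu> (A - B). So the supremum of \<nu> over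
  subsets of A is at most \<nu> A plus the supremum of -\<nu>, and symmetrically; finiteness permits
  the subtraction.\<close>

lemma jordan_decomposition:
  fixes \<nu> :: "'a set \<Rightarrow> real"
  assumes sa: "signed_additive M \<nu>" and A: "A \<in> sets M"
    and fin: "emeasure (upper_variation M \<nu>) A < \<infinity>"
      "emeasure (upper_variation M (\<lambda>A. - \<nu> A)) A < \<infinity>"
  shows "measure (upper_variation M \<nu>) A - measure (upper_variation M (\<lambda>A. - \<nu> A)) A = \<nu> A"
proof -
  let ?P = "upper_variation M \<nu>" and ?N = "upper_variation M (\<lambda>A. - \<nu> A)"
  have sa': "signed_additive M (\<lambda>A. - \<nu> A)"
    using sa by (rule signed_additive_bounded_linear[OF bounded_linear_minus[OF bounded_linear_ident]])
  have P: "emeasure ?P A = ennreal (measure ?P A)" and N: "emeasure ?N A = ennreal (measure ?N A)"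
    using fin by (auto intro!: emeasure_eq_ennreal_measure)
  have le_P: "\<nu> B \<le> measure ?P A" if "B \<in> sets M" "B \<subseteq> A" for B
  proof -
    have "ennreal (\<nu> B) \<le> ennreal (measure ?P A)"
      using that unfolding P[symmetric] emeasure_upper_variation[OF sa A] by (intro SUP_upper) auto
    then show ?thesis by (simp add: ennreal_le_iff)
  qed
  have le_N: "- \<nu> B \<le> measure ?N A" if "B \<in> sets M" "B \<subseteq> A" for B
  proof -
    have "ennreal (- \<nu> B) \<le> ennreal (measure ?N A)"
      using that unfolding N[symmetric] emeasure_upper_variation[OF sa' A] by (intro SUP_upper) auto
    then show ?thesis by (simp add: ennreal_le_iff)
  qed
  have split: "\<nu> A = \<nu> B + \<nu> (A - B)" if "B \<in> sets M" "B \<subseteq> A" for B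
    using signed_additive_Un[OF sa that(1), of "A - B"] A that
    by (metis Diff_disjoint Diff_partition sets.Diff)
  have "ennreal (measure ?P A) \<le> ennreal (measure ?N A + \<nu> A)"
    unfolding P[symmetric] emeasure_upper_variation[OF sa A]
  proof (intro SUP_least ennreal_leI)
    fix B assume "B \<in> {B \<in> sets M. B \<subseteq> A}"
    then show "\<nu> B \<le> measure ?N A + \<nu> A" using split[of B] le_N[of "A - B"] A by auto
  qed
  moreover have "0 \<le> measure ?N A + \<nu> A" using le_N[of A] A by auto
  ultimately have 1: "measure ?P A \<le> measure ?N A + \<nu> A" by (simp add: ennreal_le_iff)
  have "ennreal (measure ?N A) \<le> ennreal (measure ?P A - \<nu> A)"
    unfolding N[symmetric] emeasure_upper_variation[OF sa' A]
  proof (intro SUP_least ennreal_leI)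
    fix B assume "B \<in> {B \<in> sets M. B \<subseteq> A}"
    then show "- \<nu> B \<le> measure ?P A - \<nu> A" using split[of B] le_P[of "A - B"] A by auto
  qed
  moreover have "0 \<le> measure ?P A - \<nu> A" using le_P[of A] A by auto
  ultimately have 2: "measure ?N A \<le> measure ?P A - \<nu> A" by (simp add: ennreal_le_iff)
  show ?thesis using 1 2 by linarith
qed

text \<open>A partition of a union is refined by intersecting it with the parts, which gives
  subadditivity; partitions of two disjoint sets are merged into a single sequence, which gives
  superadditivity.\<close>

lemma emeasure_total_variation:
  assumes sa: "signed_additive M \<mu>" and A: "A \<in> sets M"
  shows "emeasure (total_variation M \<mu>) A =
    (SUP E \<in> {E :: nat \<Rightarrow> 'a set. range E \<subseteq> sets M \<and> disjoint_family E \<and> (\<Union>i. E i) = A}.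
            \<Sum>i. ennreal (cmod (\<mu> (E i))))"
proof -
  let ?D = "\<lambda>A. {E :: nat \<Rightarrow> 'a set. range E \<subseteq> sets M \<and> disjoint_family E \<and> (\<Union>i. E i) = A}"
  let ?F = "\<lambda>A. SUP E \<in> ?D A. \<Sum>i. ennreal (cmod (\<mu> (E i)))"
  have up: "(\<Sum>i. ennreal (cmod (\<mu> (E i)))) \<le> ?F A" if "E \<in> ?D A" for A E
    using that by (intro SUP_upper)
  have sub: "?F (\<Union>i. A i) \<le> (\<Sum>i. ?F (A i))" if A: "range A \<subseteq> sets M" "disjoint_family A" for A :: "nat \<Rightarrow> 'a set"
  proof (rule SUP_least)
    fix E assume "E \<in> ?D (\<Union>i. A i)"
    then have E: "range E \<subseteq> sets M" "disjoint_family E" "(\<Union>i. E i) = (\<Union>i. A i)" by auto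
    have *: "ennreal (cmod (\<mu> (E j))) \<le> (\<Sum>i. ennreal (cmod (\<mu> (E j \<inter> A i))))" for j
    proof -
      have "(\<lambda>i. \<mu> (E j \<inter> A i)) sums \<mu> (\<Union>i. E j \<inter> A i)"
        using A E by (intro sa[unfolded signed_additive_def, rule_format]) (auto simp: disjoint_family_on_def)
      moreover have "(\<Union>i. E j \<inter> A i) = E j" using E by auto
      ultimately have s: "(\<lambda>n. \<Sum>i<n. \<mu> (E j \<inter> A i)) \<longlonglongrightarrow> \<mu> (E j)" by (simp add: sums_def)
      have "(\<lambda>n. ennreal (cmod (\<Sum>i<n. \<mu> (E j \<inter> A i)))) \<longlonglongrightarrow> ennreal (cmod (\<mu> (E j)))"
        by (intro tendsto_ennrealI tendsto_norm s)
      moreover have "ennreal (cmod (\<Sum>i<n. \<mu> (E j \<inter> A i))) \<le> (\<Sum>i. ennreal (cmod (\<mu> (E j \<inter> A i))))" for n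
      proof -
        have "ennreal (cmod (\<Sum>i<n. \<mu> (E j \<inter> A i))) \<le> ennreal (\<Sum>i<n. cmod (\<mu> (E j \<inter> A i)))"
          by (intro ennreal_leI norm_sum)
        also have "\<dots> = (\<Sum>i<n. ennreal (cmod (\<mu> (E j \<inter> A i))))" by (subst sum_ennreal) auto
        also have "\<dots> \<le> (\<Sum>i. ennreal (cmod (\<mu> (E j \<inter> A i))))" by (intro sum_le_suminf) auto
        finally show ?thesis .
      qed
      ultimately show ?thesis by (meson LIMSEQ_le_const2)
    qed
    have "(\<Sum>j. ennreal (cmod (\<mu> (E j)))) \<le> (\<Sum>j. \<Sum>i. ennreal (cmod (\<mu> (E j \<inter> A i))))"
      by (intro suminf_le * ) auto
    also have "\<dots> = (\<integral>\<^sup>+j. \<integral>\<^sup>+i. ennreal (cmod (\<mu> (E j \<inter> A i))) \<partial>count_space UNIV \<partial>count_space UNIV)"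
      by (simp add: nn_integral_count_space_nat)
    also have "\<dots> = (\<integral>\<^sup>+i. \<integral>\<^sup>+j. ennreal (cmod (\<mu> (E j \<inter> A i))) \<partial>count_space UNIV \<partial>count_space UNIV)"
      by (rule nn_integral_count_space_nn_integral) auto
    also have "\<dots> = (\<Sum>i. \<Sum>j. ennreal (cmod (\<mu> (E j \<inter> A i))))"
      by (simp add: nn_integral_count_space_nat)
    also have "\<dots> \<le> (\<Sum>i. ?F (A i))"
    proof (intro suminf_le up)
      fix i
      have "disjoint_family (\<lambda>j. E j \<inter> A i)"
        using E(2) unfolding disjoint_family_on_def by blast
      then show "(\<lambda>j. E j \<inter> A i) \<in> ?D (A i)"
        using A(1) E(1,3) by auto
    qed auto
    finally show "(\<Sum>j. ennreal (cmod (\<mu> (E j)))) \<le> (\<Sum>i. ?F (A i))" .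
  qed
  have super: "?F A + ?F B \<le> ?F (A \<union> B)" if AB: "A \<in> sets M" "B \<in> sets M" "A \<inter> B = {}" for A B
  proof -
    have le: "(\<Sum>i. ennreal (cmod (\<mu> (E i)))) + (\<Sum>i. ennreal (cmod (\<mu> (G i)))) \<le> ?F (A \<union> B)"
      if E: "E \<in> ?D A" and G: "G \<in> ?D B" for E G
    proof -
      \<comment> \<open>Even indices enumerate E and odd ones G, so that 2 n terms of H match n
        terms of each.\<close>
      define H where "H i = (if even i then E (i div 2) else G (i div 2))" for i
      have "disjoint_family H"
        unfolding disjoint_family_on_def
      proof (intro ballI impI)
        fix i j :: nat assume "i \<noteq> j"
        have sub: "E i \<subseteq> A" "G i \<subseteq> B" for i using E G by auto
        have dis: "E i \<inter> E j = {}" "G i \<inter> G j = {}" if "i \<noteq> j" for i j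
          using E G that by (auto simp: disjoint_family_on_def)
        have neq: "i div 2 \<noteq> j div 2" if "even i = even j"
          using \<open>i \<noteq> j\<close> that by (metis even_two_times_div_two odd_two_times_div_two_succ)
        have cross: "E a \<inter> G b = {}" "G b \<inter> E a = {}" for a b using sub[of a] sub[of b] AB(3) by auto
        show "H i \<inter> H j = {}"
          using dis[OF neq] cross by (cases "even i"; cases "even j") (simp_all add: H_def)
      qed
      moreover have "(\<Union>i. H i) = A \<union> B"
      proof (intro antisym)
        have H: "H (2 * i) = E i" "H (2 * i + 1) = G i" for i by (simp_all add: H_def)
        have "E i \<subseteq> (\<Union>i. H i)" "G i \<subseteq> (\<Union>i. H i)" for i
          using UN_upper[of "2 * i" UNIV H] UN_upper[of "2 * i + 1" UNIV H] unfolding H by auto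
        then have "(\<Union>i. E i) \<union> (\<Union>i. G i) \<subseteq> (\<Union>i. H i)" by (intro Un_least UN_least)
        then show "A \<union> B \<subseteq> (\<Union>i. H i)" using E G by simp
        have "E i \<subseteq> A" "G i \<subseteq> B" for i using E G by auto
        then have "H i \<subseteq> A \<union> B" for i by (simp add: H_def le_supI1 le_supI2)
        then show "(\<Union>i. H i) \<subseteq> A \<union> B" by (rule UN_least)
      qed
      moreover have "range H \<subseteq> sets M"
        using E G by (intro image_subsetI) (simp add: H_def image_subset_iff)
      ultimately have "H \<in> ?D (A \<union> B)" by simp
      then have le: "(\<Sum>i. ennreal (cmod (\<mu> (H i)))) \<le> ?F (A \<union> B)" by (rule up)
      have "(\<Sum>i<n. ennreal (cmod (\<mu> (E i)))) + (\<Sum>i<n. ennreal (cmod (\<mu> (G i)))) = (\<Sum>i<2*n. ennreal (cmod (\<mu> (H i))))" for n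
      proof (induction n)
        case (Suc n)
        have "H (2 * n) = E n" "H (Suc (2 * n)) = G n" by (simp_all add: H_def)
        then have "(\<Sum>i<2 * Suc n. ennreal (cmod (\<mu> (H i)))) =
            (\<Sum>i<2 * n. ennreal (cmod (\<mu> (H i)))) + ennreal (cmod (\<mu> (E n))) + ennreal (cmod (\<mu> (G n)))"
          by simp
        then show ?case unfolding Suc.IH[symmetric] by (simp add: ac_simps)
      qed simp
      also have "\<dots> n \<le> ?F (A \<union> B)" for n
        by (rule order_trans[OF sum_le_suminf le]) simp_all
      finally have fin: "(\<Sum>i<n. ennreal (cmod (\<mu> (E i)))) + (\<Sum>i<n. ennreal (cmod (\<mu> (G i)))) \<le> ?F (A \<union> B)" for n .
      have "(\<lambda>n. (\<Sum>i<n. ennreal (cmod (\<mu> (E i)))) + (\<Sum>i<n. ennreal (cmod (\<mu> (G i))))) \<longlonglongrightarrow>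
         (\<Sum>i. ennreal (cmod (\<mu> (E i)))) + (\<Sum>i. ennreal (cmod (\<mu> (G i))))"
        by (intro tendsto_add summable_LIMSEQ summableI)
      then show ?thesis by (rule LIMSEQ_le_const2) (use fin in blast)
    qed
    have ne: "?D A \<noteq> {}" if "A \<in> sets M" for A
    proof -
      have "binaryset A {} \<in> ?D A"
        using that by (simp add: UN_binaryset_eq range_binaryset_eq disjoint_family_binaryset)
      then show ?thesis by blast
    qed
    show ?thesis
      by (rule SUP_add_SUP_le[OF ne[OF AB(1)] ne[OF AB(2)] le])
  qed
  have "(\<Sum>i. ennreal (cmod (\<mu> (E i)))) = 0" if "E \<in> ?D {}" for E
  proof -
    have "E i = {}" for i using that by blast
    then show ?thesis using signed_additive_empty[OF sa] by simp
  qed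
  then have "?F {} \<le> 0" by (intro SUP_least) (simp only: le_zero_eq)
  then have empty: "?F {} = 0" by (simp only: le_zero_eq)
  show ?thesis
  proof (rule emeasure_measure_of[OF total_variation_def])
    show "sets M \<subseteq> Pow (space M)" by (rule sets.space_closed)
    show "positive (sets (total_variation M \<mu>)) ?F"
      using empty unfolding positive_def .
    show "countably_additive (sets (total_variation M \<mu>)) ?F"
      unfolding sets_total_variation by (rule countably_additive_if_sub_super[OF sub super])
  qed (use A in simp)
qed

text \<open>For B inside A, the partition of A into B and A - B already competes in the total
  variation. L stands for one of the functionals Re, -Re, Im, -Im.\<close>

lemma upper_variation_le_total_variation:
  assumes sa: "signed_additive M \<mu>" and L: "bounded_linear L" "\<And>z. \<bar>L z\<bar> \<le> cmod z"
    and A: "A \<in> sets M"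
  shows "emeasure (upper_variation M (\<lambda>A. L (\<mu> A))) A \<le> emeasure (total_variation M \<mu>) A"
proof -
  have sa': "signed_additive M (\<lambda>A. L (\<mu> A))" by (rule signed_additive_bounded_linear[OF L(1) sa])
  show ?thesis
    unfolding emeasure_upper_variation[OF sa' A]
  proof (rule SUP_least)
    fix B assume B: "B \<in> {B \<in> sets M. B \<subseteq> A}"
    have "ennreal (L (\<mu> B)) \<le> ennreal (cmod (\<mu> B))"
      using L(2)[of "\<mu> B"] by (intro ennreal_leI) auto
    also have "\<dots> = ennreal (cmod (\<mu> (binaryset B (A - B) 0)))" by (simp add: binaryset_def)
    also have "\<dots> \<le> (\<Sum>i. ennreal (cmod (\<mu> (binaryset B (A - B) i))))"
      by (rule ennreal_le_suminf)
    also have "\<dots> \<le> emeasure (total_variation M \<mu>) A"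
      unfolding emeasure_total_variation[OF sa A]
    proof (rule SUP_upper)
      have "range (binaryset B (A - B)) \<subseteq> sets M" using A B by (auto simp: range_binaryset_eq)
      moreover have "B \<union> (A - B) = A" using B by auto
      ultimately show "binaryset B (A - B) \<in> {E. range E \<subseteq> sets M \<and> disjoint_family E \<and> (\<Union>i. E i) = A}"
        by (simp add: UN_binaryset_eq disjoint_family_binaryset)
    qed
    finally show "ennreal (L (\<mu> B)) \<le> emeasure (total_variation M \<mu>) A" .
  qed
qed

lemma nn_integral_mono_emeasure:
  assumes sets: "sets M = sets N" and le: "\<And>A. A \<in> sets M \<Longrightarrow> emeasure M A \<le> emeasure N A"
  shows "integral\<^sup>N M f \<le> integral\<^sup>N N f"
proof -
  have "M \<le> N"
  proof -
    have "emeasure M A \<le> emeasure N A" for A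
      using le[of A] by (cases "A \<in> sets M") (auto simp: emeasure_notin_sets)
    then show ?thesis
      using sets sets_eq_imp_space_eq[OF sets] by (simp add: less_eq_measure.simps le_fun_def)
  qed
  then show ?thesis by (rule nn_integral_mono_measure[OF sets])
qed

text \<open>Replaces the complex measure by four finite positive ones, to which Minkowski's
  inequality and dominated convergence apply and which inherit all exponential moments from the
  total variation. The last clause later turns the assumption that \<mu> has total mass 0 into a
  cancellation of constants.\<close>

lemma complex_integral_decomposition:
  assumes \<mu>: "complex_measure M \<mu>" and fin: "emeasure (total_variation M \<mu>) (space M) < \<infinity>"
  obtains m :: "nat \<Rightarrow> 'a measure"
  where "\<And>i. finite_measure (m i)" "\<And>i. sets (m i) = sets M"
    "\<And>i h. integral\<^sup>N (m i) h \<le> integral\<^sup>N (total_variation M \<mu>) h"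
    "\<And>g. complex_integral M \<mu> g =
      ((LINT x|m 0. g x) - (LINT x|m 1. g x)) + \<i> * ((LINT x|m 2. g x) - (LINT x|m 3. g x))"
    "complex_integral M \<mu> (\<lambda>_. 1) = \<mu> (space M)"
proof -
  define l where "l i = (if i = 0 then Re else if i = 1 then (\<lambda>z. - Re z) else if i = 2 then Im else (\<lambda>z. - Im z))" for i :: nat
  define m where "m i = upper_variation M (\<lambda>A. l i (\<mu> A))" for i
  have sa: "signed_additive M \<mu>" using \<mu> by (simp add: complex_measure_iff_signed_additive)
  have l: "bounded_linear (l i)" "\<bar>l i z\<bar> \<le> cmod z" for i z
    by (auto simp: l_def bounded_linear_Re bounded_linear_Im bounded_linear_minus abs_Re_le_cmod abs_Im_le_cmod)
  have sets: "sets (m i) = sets M" and sp: "space (m i) = space M" for i by (auto simp: m_def)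
  have le: "emeasure (m i) A \<le> emeasure (total_variation M \<mu>) A" if "A \<in> sets M" for i A
    unfolding m_def by (rule upper_variation_le_total_variation[OF sa l that])
  have fm: "emeasure (m i) (space M) < \<infinity>" for i
    using le[of "space M" i] fin by (auto intro: le_less_trans)
  have finm: "finite_measure (m i)" for i
    using fm[of i] by (intro finite_measureI) (auto simp: sp)
  have nn: "integral\<^sup>N (m i) h \<le> integral\<^sup>N (total_variation M \<mu>) h" for i h
    by (rule nn_integral_mono_emeasure) (auto simp: sets le)
  have ci: "complex_integral M \<mu> g =
      ((LINT x|m 0. g x) - (LINT x|m 1. g x)) + \<i> * ((LINT x|m 2. g x) - (LINT x|m 3. g x))" for g
    by (simp add: complex_integral_def signed_integral_def m_def l_def)
  have "measure (m 0) (space M) - measure (m 1) (space M) = Re (\<mu> (space M))"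
    using jordan_decomposition[OF signed_additive_bounded_linear[OF bounded_linear_Re sa], of "space M"]
      fm[of 0] fm[of 1] by (simp add: m_def l_def)
  moreover have "measure (m 2) (space M) - measure (m 3) (space M) = Im (\<mu> (space M))"
    using jordan_decomposition[OF signed_additive_bounded_linear[OF bounded_linear_Im sa], of "space M"]
      fm[of 2] fm[of 3] by (simp add: m_def l_def)
  ultimately have "complex_integral M \<mu> (\<lambda>_. 1) = \<mu> (space M)"
    unfolding ci by (auto simp: sp complex_eq_iff scaleR_conv_of_real)
  then show thesis using finm sets nn ci by (rule that[rotated -1])
qed

section \<open>Inequalities for p-th power integrals\<close>

text \<open>Young's inequality for x / A and 1, multiplied by A. The scale A is free, with equality
  at x = A.\<close>

lemma young_powr:
  fixes x A p :: real
  assumes "p \<ge> 1" "A > 0" "x \<ge> 0"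
  shows "x \<le> A powr (1 - p) * x powr p / p + (1 - 1 / p) * A"
proof (cases "p = 1")
  case False
  then have p: "p > 1" using assms by simp
  have q: "p / (p - 1) > 1" using p by (simp add: field_simps)
  have c: "1 / p + 1 / (p / (p - 1)) = 1" using p by (simp add: field_simps)
  have "x / A * 1 \<le> (x / A) powr p / p + 1 powr (p / (p - 1)) / (p / (p - 1))"
    using assms by (intro Youngs_inequality[OF p q c]) auto
  then have "A * (x / A) \<le> A * ((x / A) powr p / p + (1 - 1 / p))"
    using assms p by (intro mult_left_mono) (auto simp: field_simps)
  also have "\<dots> = A * (x powr p / A powr p) / p + (1 - 1 / p) * A"
    using assms by (simp add: powr_divide field_simps)
  also have "A * (x powr p / A powr p) = A powr (1 - p) * x powr p"
    using assms by (simp add: powr_diff)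
  finally show ?thesis using assms by simp
qed (use assms in auto)

text \<open>Hoelder's inequality against the constant 1, obtained by integrating
  \<open>young_powr\<close> at the best scale.\<close>

lemma nn_integral_powr_jensen:
  fixes g :: "'a \<Rightarrow> real"
  assumes p: "p \<ge> 1" and [measurable]: "g \<in> borel_measurable M" and g: "\<And>x. x \<in> space M \<Longrightarrow> 0 \<le> g x"
    and T: "emeasure M (space M) \<le> ennreal T" "T > 0"
    and E: "(\<integral>\<^sup>+x. ennreal (g x powr p) \<partial>M) \<le> ennreal E" "E \<ge> 0"
  shows "(\<integral>\<^sup>+x. ennreal (g x) \<partial>M) \<le> ennreal (T powr (1 - 1 / p) * E powr (1 / p))"
proof (cases "E = 0")
  case True
  then have "AE x in M. ennreal (g x powr p) = 0"
    using E by (subst nn_integral_0_iff_AE[symmetric]) auto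
  then have "AE x in M. ennreal (g x) = 0"
    using AE_space by eventually_elim (auto dest: g simp: ennreal_eq_0_iff powr_eq_0_iff)
  then have "(\<integral>\<^sup>+x. ennreal (g x) \<partial>M) = 0" by (subst nn_integral_0_iff_AE) auto
  then show ?thesis by simp
next
  case False
  then have E0: "E > 0" using E by simp
  \<comment> \<open>The scale for which A powr (1 - p) times E equals A times T, so that the two
    terms of Young's inequality add up to A times T.\<close>
  define A where "A = (E / T) powr (1 / p)"
  have A: "A > 0" using E0 T by (simp add: A_def)
  have "(\<integral>\<^sup>+x. ennreal (g x) \<partial>M) \<le>
      (\<integral>\<^sup>+x. ennreal (A powr (1 - p) / p) * ennreal (g x powr p) + ennreal ((1 - 1 / p) * A) \<partial>M)"
    using young_powr[OF p A] g p A
    by (intro nn_integral_mono) (simp add: ennreal_mult'[symmetric] ennreal_plus[symmetric] del: ennreal_plus)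
  also have "\<dots> = ennreal (A powr (1 - p) / p) * (\<integral>\<^sup>+x. ennreal (g x powr p) \<partial>M) + ennreal ((1 - 1 / p) * A) * emeasure M (space M)"
    by (subst nn_integral_add) (auto simp: nn_integral_cmult)
  also have "\<dots> \<le> ennreal (A powr (1 - p) / p) * ennreal E + ennreal ((1 - 1 / p) * A) * ennreal T"
    using E T by (intro add_mono mult_left_mono) auto
  also have "\<dots> = ennreal (A powr (1 - p) / p * E + (1 - 1 / p) * A * T)"
    using p A E0 T by (simp add: ennreal_mult'[symmetric] ennreal_plus[symmetric] del: ennreal_plus)
  also have "A powr (1 - p) / p * E + (1 - 1 / p) * A * T = A * T"
  proof -
    have "A powr p = E / T" using E0 T p by (simp add: A_def powr_powr)
    then have "A powr (1 - p) * E = A * T" using A E0 T by (simp add: powr_diff field_simps)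
    then show ?thesis using p by (simp add: field_simps)
  qed
  also have "A * T = T powr (1 - 1 / p) * E powr (1 / p)"
    using E0 T by (simp add: A_def powr_divide powr_diff)
  finally show ?thesis .
qed

text \<open>Jensen's inequality for the measure with density \<alpha>, applied to g / \<alpha>,
  followed by Tonelli. The form with a majorant \<alpha> of the slice norms and a function H merely
  dominated by the integral lets the one lemma serve convolutions, series over lattice points and
  superpositions over \<xi>.\<close>

lemma minkowski_integral:
  fixes g :: "'a \<Rightarrow> 'b \<Rightarrow> real" and \<alpha> :: "'b \<Rightarrow> real"
  assumes "pair_sigma_finite X Y" and p: "p \<ge> 1"
    and [measurable]: "case_prod g \<in> borel_measurable (X \<Otimes>\<^sub>M Y)" "\<alpha> \<in> borel_measurable Y"
    and g: "\<And>x y. 0 \<le> g x y" and \<alpha>: "\<And>y. 0 < \<alpha> y"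
    and le: "\<And>y. y \<in> space Y \<Longrightarrow> (\<integral>\<^sup>+x. ennreal (g x y powr p) \<partial>X) \<le> ennreal (\<alpha> y powr p)"
    and T: "(\<integral>\<^sup>+y. ennreal (\<alpha> y) \<partial>Y) \<le> ennreal T" "T > 0"
    and H: "\<And>x. 0 \<le> H x" "\<And>x. x \<in> space X \<Longrightarrow> ennreal (H x) \<le> (\<integral>\<^sup>+y. ennreal (g x y) \<partial>Y)"
  shows "(\<integral>\<^sup>+x. ennreal (H x powr p) \<partial>X) \<le> ennreal (T powr p)"
proof -
  interpret pair_sigma_finite X Y by fact
  let ?e = "\<lambda>x. \<integral>\<^sup>+y. ennreal (g x y powr p * \<alpha> y powr (1 - p)) \<partial>Y"
  have pw: "ennreal (H x powr p) \<le> ennreal (T powr (p - 1)) * ?e x" if x: "x \<in> space X" for x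
  proof (cases "?e x = \<infinity>")
    case True
    then show ?thesis using T by (simp add: ennreal_mult_top)
  next
    case False
    then obtain e where e: "?e x = ennreal e" "e \<ge> 0" by (cases "?e x") auto
    have [measurable]: "g x \<in> borel_measurable Y"
      using measurable_compose[OF measurable_Pair1'[OF x] assms(3)] by simp
    have a: "\<alpha> y * (g x y / \<alpha> y) = g x y" for y using \<alpha>[of y] by simp
    have b: "\<alpha> y * (g x y / \<alpha> y) powr p = g x y powr p * \<alpha> y powr (1 - p)" for y
      using \<alpha>[of y] g[of x y] by (simp add: powr_divide powr_diff)
    let ?N = "density Y (\<lambda>y. ennreal (\<alpha> y))"
    have "ennreal (H x) \<le> (\<integral>\<^sup>+y. ennreal (g x y) \<partial>Y)" by (rule H(2)[OF x])
    also have "\<dots> = (\<integral>\<^sup>+y. ennreal (g x y / \<alpha> y) \<partial>?N)"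
      using a \<alpha> by (subst nn_integral_density) (auto simp: ennreal_mult'[symmetric] less_imp_le)
    also have "\<dots> \<le> ennreal (T powr (1 - 1 / p) * e powr (1 / p))"
    proof (rule nn_integral_powr_jensen[OF p])
      show "emeasure ?N (space ?N) \<le> ennreal T"
        using T(1) by (subst emeasure_density) (auto cong: nn_integral_cong simp: indicator_def)
      have "(\<integral>\<^sup>+y. ennreal ((g x y / \<alpha> y) powr p) \<partial>?N) = ?e x"
        using b \<alpha> by (subst nn_integral_density) (auto simp: ennreal_mult'[symmetric] less_imp_le)
      then show "(\<integral>\<^sup>+y. ennreal ((g x y / \<alpha> y) powr p) \<partial>?N) \<le> ennreal e" using e by simp
    qed (use T e g \<alpha> in \<open>auto simp: less_imp_le\<close>)
    finally have "H x \<le> T powr (1 - 1 / p) * e powr (1 / p)"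
      by (simp add: ennreal_le_iff)
    then have "H x powr p \<le> (T powr (1 - 1 / p) * e powr (1 / p)) powr p"
      using p H(1) by (intro powr_mono2) auto
    also have "\<dots> = T powr ((1 - 1 / p) * p) * e powr (1 / p * p)"
      by (simp add: powr_mult powr_powr)
    also have "\<dots> = T powr (p - 1) * e"
      using p e by (simp add: left_diff_distrib)
    finally show ?thesis using e by (simp add: ennreal_mult'[symmetric] ennreal_leI)
  qed
  have "(\<integral>\<^sup>+x. ennreal (H x powr p) \<partial>X) \<le> (\<integral>\<^sup>+x. ennreal (T powr (p - 1)) * ?e x \<partial>X)"
    by (intro nn_integral_mono pw)
  also have "\<dots> = ennreal (T powr (p - 1)) * (\<integral>\<^sup>+x. ?e x \<partial>X)"
    by (subst nn_integral_cmult) auto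
  also have "(\<integral>\<^sup>+x. ?e x \<partial>X) = (\<integral>\<^sup>+y. \<integral>\<^sup>+x. ennreal (g x y powr p * \<alpha> y powr (1 - p)) \<partial>X \<partial>Y)"
    by (rule Fubini'[symmetric]) measurable
  also have "\<dots> \<le> (\<integral>\<^sup>+y. ennreal (\<alpha> y) \<partial>Y)"
  proof (rule nn_integral_mono)
    fix y assume y: "y \<in> space Y"
    have [measurable]: "(\<lambda>x. g x y) \<in> borel_measurable X"
      using measurable_compose[OF measurable_Pair2'[OF y] assms(3)] by simp
    have "(\<integral>\<^sup>+x. ennreal (g x y powr p * \<alpha> y powr (1 - p)) \<partial>X) =
        ennreal (\<alpha> y powr (1 - p)) * (\<integral>\<^sup>+x. ennreal (g x y powr p) \<partial>X)"
      by (subst nn_integral_cmult[symmetric]) (auto simp: ennreal_mult'[symmetric] mult.commute)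
    also have "\<dots> \<le> ennreal (\<alpha> y powr (1 - p)) * ennreal (\<alpha> y powr p)"
      by (intro mult_left_mono le y) auto
    also have "\<dots> = ennreal (\<alpha> y)"
      using \<alpha>[of y] by (simp add: ennreal_mult'[symmetric] powr_add[symmetric])
    finally show "(\<integral>\<^sup>+x. ennreal (g x y powr p * \<alpha> y powr (1 - p)) \<partial>X) \<le> ennreal (\<alpha> y)" .
  qed
  also have "\<dots> \<le> ennreal T" by (rule T)
  also have "ennreal (T powr (p - 1)) * ennreal T = ennreal (T powr p)"
    using T(2) by (simp add: ennreal_mult'[symmetric] powr_diff)
  finally show ?thesis by (simp add: mult_left_mono)
qed

lemma fubini_swap:
  fixes f :: "'a \<Rightarrow> 'b \<Rightarrow> complex"
  assumes "pair_sigma_finite M N" and [measurable]: "case_prod f \<in> borel_measurable (M \<Otimes>\<^sub>M N)"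
    and fin: "(\<integral>\<^sup>+x. \<integral>\<^sup>+y. ennreal (cmod (f x y)) \<partial>N \<partial>M) < \<infinity>"
  shows "(LINT x|M. LINT y|N. f x y) = (LINT y|N. LINT x|M. f x y)"
    and "integrable M (\<lambda>x. LINT y|N. f x y)"
proof -
  interpret pair_sigma_finite M N by fact
  have "(\<integral>\<^sup>+z. ennreal (cmod (case_prod f z)) \<partial>(M \<Otimes>\<^sub>M N)) = (\<integral>\<^sup>+x. \<integral>\<^sup>+y. ennreal (cmod (f x y)) \<partial>N \<partial>M)"
    by (subst M2.nn_integral_fst[symmetric]) auto
  then have int: "integrable (M \<Otimes>\<^sub>M N) (case_prod f)"
    using fin by (intro integrableI_bounded) auto
  show "(LINT x|M. LINT y|N. f x y) = (LINT y|N. LINT x|M. f x y)"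
    using Fubini_integral[OF int] by simp
  show "integrable M (\<lambda>x. LINT y|N. f x y)"
    using integrable_fst[OF int] .
qed

lemma cmod_integral_le_nn_integral: "ennreal (cmod (LINT x|M. f x)) \<le> (\<integral>\<^sup>+x. ennreal (cmod (f x)) \<partial>M)"
  by (cases "integrable M f") (auto simp: integral_norm_bound_ennreal not_integrable_integral_eq)

lemma pair_sigma_finite_lborel: "pair_sigma_finite lborel lborel"
  by (simp add: pair_sigma_finite_def lborel.sigma_finite_measure_axioms)

section \<open>Translations and dilations\<close>

lemma distr_lborel_reflect: "distr lborel borel (\<lambda>z. x - z) = (lborel :: 'a::euclidean_space measure)"
proof -
  show ?thesis using lborel_affine[of "-1" x] by (simp add: density_1)
qed

lemma nn_integral_lborel_reflect:
  fixes f :: "'a::euclidean_space \<Rightarrow> ennreal"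
  assumes [measurable]: "f \<in> borel_measurable borel"
  shows "(\<integral>\<^sup>+z. f (x - z) \<partial>lborel) = (\<integral>\<^sup>+z. f z \<partial>lborel)"
  by (subst (2) distr_lborel_reflect[of x, symmetric]) (subst nn_integral_distr, auto)

lemma integral_lborel_reflect:
  fixes f :: "'a::euclidean_space \<Rightarrow> complex"
  assumes [measurable]: "f \<in> borel_measurable borel"
  shows "(LINT z|lborel. f (x - z)) = (LINT z|lborel. f z)"
  by (subst (2) distr_lborel_reflect[of x, symmetric]) (subst integral_distr, auto)

lemma nn_integral_lborel_shift:
  fixes f :: "'a::euclidean_space \<Rightarrow> ennreal"
  assumes [measurable]: "f \<in> borel_measurable borel"
  shows "(\<integral>\<^sup>+z. f (z - x) \<partial>lborel) = (\<integral>\<^sup>+z. f z \<partial>lborel)"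
  by (subst (2) lborel_distr_plus[of "- x", symmetric]) (subst nn_integral_distr, auto)

lemma integral_lborel_shift:
  fixes f :: "'a::euclidean_space \<Rightarrow> complex"
  assumes [measurable]: "f \<in> borel_measurable borel"
  shows "(LINT z|lborel. f (z - x)) = (LINT z|lborel. f z)"
  by (subst (2) lborel_distr_plus[of "- x", symmetric]) (subst integral_distr, auto)

lemma integral_lborel_scale:
  fixes f :: "'a::euclidean_space \<Rightarrow> complex"
  assumes [measurable]: "f \<in> borel_measurable borel" and c: "c > 0"
  shows "(LINT z|lborel. f z) = of_real (c ^ DIM('a)) * (LINT z|lborel. f (x + c *\<^sub>R z))"
  using c by (subst lborel_affine[of c x], simp)
    (subst integral_density, auto simp: integral_distr scaleR_conv_of_real)

section \<open>Convolution with rapidly decaying kernels\<close>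

text \<open>A tensor product, so that its integral factorizes and a Fourier integral is bounded by
  it as soon as two derivatives in each coordinate are available.\<close>

definition decay :: "'a::euclidean_space \<Rightarrow> real" where
  "decay z = (\<Prod>b\<in>Basis. 1 / (1 + (z \<bullet> b)\<^sup>2))"

lemma decay_pos: "0 < decay z"
  unfolding decay_def by (intro prod_pos) (simp add: add_pos_nonneg)

lemma decay_nonneg [simp]: "0 \<le> decay z"
  using decay_pos less_imp_le by blast

lemma decay_le_1: "decay z \<le> 1"
  unfolding decay_def by (intro prod_le_1) (auto simp: field_simps add_pos_nonneg)

lemma decay_minus [simp]: "decay (- z) = decay z"
  by (simp add: decay_def)

lemma decay_measurable [measurable]: "decay \<in> borel_measurable borel"
  unfolding decay_def by measurable

lemma nn_integral_cauchy: "(\<integral>\<^sup>+x. ennreal (1 / (1 + x\<^sup>2)) \<partial>lborel) \<le> ennreal pi"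
proof -
  let ?f = "\<lambda>x::real. 1 / (1 + x\<^sup>2)"
  have half: "(\<integral>\<^sup>+x. ennreal (?f x) * indicator {0..} x \<partial>lborel) = ennreal (pi / 2)"
  proof -
    have "(\<integral>\<^sup>+x. ennreal (?f x) * indicator {0..} x \<partial>lborel) = pi / 2 - arctan 0"
      by (rule nn_integral_FTC_atLeast)
        (auto intro!: derivative_eq_intros tendsto_arctan_at_top simp: field_simps)
    then show ?thesis by simp
  qed
  have "(\<integral>\<^sup>+x. ennreal (?f x) * indicator {..0} x \<partial>lborel) = (\<integral>\<^sup>+x. ennreal (?f (0 - x)) * indicator {..0} (0 - x) \<partial>lborel)"
    by (subst nn_integral_lborel_reflect) auto
  also have "\<dots> = (\<integral>\<^sup>+x. ennreal (?f x) * indicator {0..} x \<partial>lborel)"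
    by (intro nn_integral_cong) (auto simp: indicator_def)
  finally have half': "(\<integral>\<^sup>+x. ennreal (?f x) * indicator {..0} x \<partial>lborel) = ennreal (pi / 2)"
    using half by simp
  have "(\<integral>\<^sup>+x. ennreal (?f x) \<partial>lborel) \<le> (\<integral>\<^sup>+x. ennreal (?f x) * indicator {..0} x + ennreal (?f x) * indicator {0..} x \<partial>lborel)"
    by (intro nn_integral_mono) (auto simp: indicator_def)
  also have "\<dots> = ennreal (pi / 2) + ennreal (pi / 2)"
    by (subst nn_integral_add) (auto simp: half half')
  finally show ?thesis by (simp add: ennreal_plus[symmetric] del: ennreal_plus)
qed

definition decay_mass :: "'a::euclidean_space itself \<Rightarrow> real" where
  "decay_mass _ = pi ^ DIM('a)"

lemma decay_mass_pos [simp]: "0 < decay_mass TYPE('a::euclidean_space)"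
  by (simp add: decay_mass_def)

lemma nn_integral_decay: "(\<integral>\<^sup>+z. ennreal (decay (z::'a::euclidean_space)) \<partial>lborel) \<le> ennreal (decay_mass TYPE('a))"
proof -
  have "(\<integral>\<^sup>+z. ennreal (decay (z::'a)) \<partial>lborel) = (\<integral>\<^sup>+z. (\<Prod>b\<in>(Basis::'a set). ennreal (1 / (1 + (z \<bullet> b)\<^sup>2))) \<partial>lborel)"
    unfolding decay_def by (intro nn_integral_cong prod_ennreal[symmetric]) (simp add: add_pos_nonneg)
  also have "\<dots> = (\<Prod>b\<in>(Basis::'a set). \<integral>\<^sup>+x. ennreal (1 / (1 + x\<^sup>2)) \<partial>lborel)"
    by (rule nn_integral_lborel_prod) auto
  also have "\<dots> \<le> ennreal (decay_mass TYPE('a))"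
  proof -
    obtain c where c: "(\<integral>\<^sup>+x. ennreal (1 / (1 + x\<^sup>2)) \<partial>lborel) = ennreal c" "0 \<le> c" "c \<le> pi"
      using nn_integral_cauchy
      by (cases "\<integral>\<^sup>+x. ennreal (1 / (1 + x\<^sup>2)) \<partial>lborel") (auto simp: top_unique)
    then show ?thesis by (simp add: decay_mass_def ennreal_power ennreal_leI power_mono)
  qed
  finally show ?thesis .
qed

text \<open>A bound on p-th powers rather than on the norm fits the conclusion of
  \<open>minkowski_integral\<close> and avoids roots; \<open>Lp_norm_le_iff\<close> translates
  it.\<close>

definition lp_le :: "real \<Rightarrow> ('a::euclidean_space \<Rightarrow> complex) \<Rightarrow> real \<Rightarrow> bool" where
  "lp_le p g A \<longleftrightarrow> (\<integral>\<^sup>+x. ennreal (cmod (g x) powr p) \<partial>lborel) \<le> ennreal (A powr p)"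

definition conv :: "('a::euclidean_space \<Rightarrow> complex) \<Rightarrow> ('a \<Rightarrow> complex) \<Rightarrow> 'a \<Rightarrow> complex" where
  "conv K g x = (LINT z|lborel. K z * g (x - z))"

definition decaying :: "real \<Rightarrow> ('a::euclidean_space \<Rightarrow> complex) \<Rightarrow> bool" where
  "decaying C K \<longleftrightarrow> K \<in> borel_measurable borel \<and> (\<forall>z. cmod (K z) \<le> C * decay z)"

text \<open>Both bounded functions and \<open>L\<^sup>p\<close> functions are tame, and convolution with a decaying kernel
  maps tame functions to bounded ones; this is what makes iterated convolutions associative.\<close>

definition tame :: "real \<Rightarrow> ('a::euclidean_space \<Rightarrow> complex) \<Rightarrow> bool" where
  "tame B g \<longleftrightarrow> g \<in> borel_measurable borel \<and>
     (\<forall>x. (\<integral>\<^sup>+z. ennreal (decay z * cmod (g (x - z))) \<partial>lborel) \<le> ennreal B)"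

lemma lp_le_mono: "lp_le p g A \<Longrightarrow> 0 \<le> A \<Longrightarrow> A \<le> B \<Longrightarrow> p \<ge> 0 \<Longrightarrow> lp_le p g B"
  unfolding lp_le_def by (erule order_trans) (auto intro!: ennreal_leI powr_mono2)

lemma decaying_measurable: "decaying C K \<Longrightarrow> K \<in> borel_measurable borel"
  by (simp add: decaying_def)

lemma tame_measurable: "tame B g \<Longrightarrow> g \<in> borel_measurable borel"
  by (simp add: tame_def)

lemma decaying_nonneg:
  fixes K :: "'a::euclidean_space \<Rightarrow> complex"
  assumes "decaying C K" shows "0 \<le> C"
proof -
  have "cmod (K 0) \<le> C * decay (0::'a)" using assms by (simp add: decaying_def)
  then have "0 \<le> C * decay (0::'a)" using norm_ge_zero order_trans by blast
  then show ?thesis using decay_pos[of "0::'a"] by (simp add: zero_le_mult_iff)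
qed

lemma decaying_integrable:
  fixes K :: "'a::euclidean_space \<Rightarrow> complex"
  assumes "decaying C K" shows "integrable lborel K"
proof (rule integrableI_bounded)
  show "K \<in> borel_measurable lborel" using decaying_measurable[OF assms] by simp
  have "(\<integral>\<^sup>+z. ennreal (cmod (K z)) \<partial>lborel) \<le> (\<integral>\<^sup>+z. ennreal C * ennreal (decay (z::'a)) \<partial>lborel)"
    by (intro nn_integral_mono) (use assms decaying_nonneg[OF assms] in
      \<open>auto simp: decaying_def ennreal_mult'[symmetric] intro!: ennreal_leI\<close>)
  also have "\<dots> = ennreal C * (\<integral>\<^sup>+z. ennreal (decay (z::'a)) \<partial>lborel)"
    by (rule nn_integral_cmult) auto
  also have "\<dots> < \<infinity>"
    using le_less_trans[OF nn_integral_decay[where 'a='a] ennreal_less_top]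
    by (simp add: ennreal_mult_less_top)
  finally show "(\<integral>\<^sup>+z. ennreal (norm (K z)) \<partial>lborel) < \<infinity>" by simp
qed

lemma conv_bound_nn:
  assumes K: "decaying C K"
  shows "ennreal (cmod (conv K g x)) \<le> (\<integral>\<^sup>+z. ennreal (C * decay z * cmod (g (x - z))) \<partial>lborel)"
proof -
  have "ennreal (cmod (conv K g x)) \<le> (\<integral>\<^sup>+z. ennreal (cmod (K z * g (x - z))) \<partial>lborel)"
    unfolding conv_def by (rule cmod_integral_le_nn_integral)
  also have "\<dots> \<le> (\<integral>\<^sup>+z. ennreal (C * decay z * cmod (g (x - z))) \<partial>lborel)"
    using K by (intro nn_integral_mono ennreal_leI) (auto simp: norm_mult decaying_def mult_right_mono)
  finally show ?thesis .
qed

lemma tame_nn_bound: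
  assumes g: "tame B g" and C: "0 \<le> C"
  shows "(\<integral>\<^sup>+z. ennreal (C * decay z * cmod (g (x - z))) \<partial>lborel) \<le> ennreal (C * B)"
proof -
  have [measurable]: "g \<in> borel_measurable borel" using g by (rule tame_measurable)
  have "(\<integral>\<^sup>+z. ennreal (C * decay z * cmod (g (x - z))) \<partial>lborel) =
      ennreal C * (\<integral>\<^sup>+z. ennreal (decay z * cmod (g (x - z))) \<partial>lborel)"
    using C by (subst nn_integral_cmult[symmetric]) (auto simp: ennreal_mult'[symmetric] mult.assoc)
  also have "\<dots> \<le> ennreal C * ennreal B"
    using g by (intro mult_left_mono) (auto simp: tame_def)
  finally show ?thesis using C by (simp add: ennreal_mult')
qed

lemma conv_integrable:
  assumes K: "decaying C K" and g: "tame B g"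
  shows "integrable lborel (\<lambda>z. K z * g (x - z))"
proof (rule integrableI_bounded)
  have [measurable]: "g \<in> borel_measurable borel" "K \<in> borel_measurable borel"
    using g K by (auto intro: tame_measurable decaying_measurable)
  show "(\<lambda>z. K z * g (x - z)) \<in> borel_measurable lborel" by measurable
  have "(\<integral>\<^sup>+z. ennreal (norm (K z * g (x - z))) \<partial>lborel) \<le> (\<integral>\<^sup>+z. ennreal (C * decay z * cmod (g (x - z))) \<partial>lborel)"
    using K by (intro nn_integral_mono ennreal_leI) (auto simp: norm_mult decaying_def mult_right_mono)
  also have "\<dots> \<le> ennreal (C * B)" by (rule tame_nn_bound[OF g decaying_nonneg[OF K]])
  finally show "(\<integral>\<^sup>+z. ennreal (norm (K z * g (x - z))) \<partial>lborel) < \<infinity>"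
    by (simp add: order.strict_trans1)
qed

lemma conv_bounded:
  assumes K: "decaying C K" and g: "tame B g" and B: "0 \<le> B"
  shows "cmod (conv K g x) \<le> C * B"
proof -
  have "ennreal (cmod (conv K g x)) \<le> ennreal (C * B)"
    using conv_bound_nn[OF K] tame_nn_bound[OF g decaying_nonneg[OF K]] by (rule order_trans)
  then show ?thesis using B decaying_nonneg[OF K] by (simp add: ennreal_le_iff)
qed

lemma conv_measurable:
  assumes [measurable]: "K \<in> borel_measurable borel" "g \<in> borel_measurable borel"
  shows "conv K g \<in> borel_measurable borel"
proof -
  have "(\<lambda>x. LINT z|lborel. K z * g (x - z)) \<in> borel_measurable borel"
    by (rule lborel.borel_measurable_lebesgue_integral) measurable
  then show ?thesis by (simp add: conv_def[abs_def])
qed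

lemma tame_bounded:
  assumes [measurable]: "g \<in> borel_measurable borel" and "\<And>x. cmod (g x) \<le> M"
  shows "tame (decay_mass TYPE('a) * M) (g :: 'a::euclidean_space \<Rightarrow> complex)"
proof -
  have M: "0 \<le> M" using assms(2) norm_ge_zero order_trans by blast
  have "(\<integral>\<^sup>+z. ennreal (decay z * cmod (g (x - z))) \<partial>lborel) \<le> ennreal (decay_mass TYPE('a) * M)" for x
  proof -
    have "(\<integral>\<^sup>+z. ennreal (decay z * cmod (g (x - z))) \<partial>lborel) \<le> (\<integral>\<^sup>+z. ennreal M * ennreal (decay (z::'a)) \<partial>lborel)"
      using M by (intro nn_integral_mono)
        (simp add: ennreal_mult'[symmetric] mult.commute[of M] ennreal_leI mult_left_mono assms(2))
    also have "\<dots> = ennreal M * (\<integral>\<^sup>+z. ennreal (decay (z::'a)) \<partial>lborel)"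
      by (rule nn_integral_cmult) auto
    also have "\<dots> \<le> ennreal M * ennreal (decay_mass TYPE('a))"
      by (intro mult_left_mono nn_integral_decay) auto
    finally show ?thesis using M by (simp add: ennreal_mult'[symmetric] mult.commute)
  qed
  then show ?thesis by (simp add: tame_def)
qed

text \<open>Jensen's inequality for the measure with density \<open>decay\<close>, whose mass is at
  most \<open>decay_mass\<close>. In the p-th power integral the weight, being at most 1, is
  dropped, so the bound does not depend on x.\<close>

lemma tame_lp:
  assumes [measurable]: "g \<in> borel_measurable borel" and p: "p \<ge> 1" and g: "lp_le p g A" and A: "0 \<le> A"
  shows "tame (decay_mass TYPE('a) powr (1 - 1 / p) * A) (g :: 'a::euclidean_space \<Rightarrow> complex)"
proof -
  have "(\<integral>\<^sup>+z. ennreal (decay z * cmod (g (x - z))) \<partial>lborel) \<le> ennreal (decay_mass TYPE('a) powr (1 - 1 / p) * A)" for x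
  proof -
    let ?N = "density lborel (\<lambda>z::'a. ennreal (decay z))"
    have "(\<integral>\<^sup>+z. ennreal (decay z * cmod (g (x - z))) \<partial>lborel) = (\<integral>\<^sup>+z. ennreal (cmod (g (x - z))) \<partial>?N)"
      by (subst nn_integral_density) (auto simp: ennreal_mult'[symmetric])
    also have "\<dots> \<le> ennreal (decay_mass TYPE('a) powr (1 - 1 / p) * (A powr p) powr (1 / p))"
    proof (rule nn_integral_powr_jensen[OF p])
      show "emeasure ?N (space ?N) \<le> ennreal (decay_mass TYPE('a))"
        using nn_integral_decay[where 'a='a] by (subst emeasure_density) auto
      have "(\<integral>\<^sup>+z. ennreal (cmod (g (x - z)) powr p) \<partial>?N) = (\<integral>\<^sup>+z. ennreal (decay z * cmod (g (x - z)) powr p) \<partial>lborel)"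
        by (subst nn_integral_density) (auto simp: ennreal_mult'[symmetric])
      also have "\<dots> \<le> (\<integral>\<^sup>+z. ennreal (cmod (g (x - z)) powr p) \<partial>lborel)"
        by (intro nn_integral_mono ennreal_leI) (auto intro!: mult_left_le_one_le decay_le_1)
      also have "\<dots> \<le> ennreal (A powr p)"
        using g by (subst nn_integral_lborel_reflect) (auto simp: lp_le_def)
      finally show "(\<integral>\<^sup>+z. ennreal (cmod (g (x - z)) powr p) \<partial>?N) \<le> ennreal (A powr p)" .
    qed auto
    also have "(A powr p) powr (1 / p) = A" using p A by (simp add: powr_powr)
    finally show ?thesis .
  qed
  then show ?thesis by (simp add: tame_def)
qed

text \<open>Young's convolution inequality: \<open>conv K g\<close> is a superposition of translates
  of g, all of the same L^p norm, with weights majorized by C times \<open>decay\<close>.\<close>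

lemma conv_lp:
  fixes K :: "'a::euclidean_space \<Rightarrow> complex"
  assumes K: "decaying C K" and [measurable]: "g \<in> borel_measurable borel" and p: "p \<ge> 1"
    and g: "lp_le p g A" and A: "0 < A" and C: "0 < C"
  shows "lp_le p (conv K g) (C * decay_mass TYPE('a) * A)"

proof -
  have A': "(\<integral>\<^sup>+x. ennreal (cmod (g x) powr p) \<partial>lborel) \<le> ennreal (A powr p)" using g by (simp add: lp_le_def)
  show ?thesis
    unfolding lp_le_def
  proof (rule minkowski_integral[OF pair_sigma_finite_lborel p,
        where g = "\<lambda>x z. C * decay z * cmod (g (x - z))" and \<alpha> = "\<lambda>z. C * decay z * A"])
    fix z :: 'a
    have "(\<integral>\<^sup>+x. ennreal ((C * decay z * cmod (g (x - z))) powr p) \<partial>lborel) =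
       (\<integral>\<^sup>+x. ennreal ((C * decay z) powr p) * ennreal (cmod (g (x - z)) powr p) \<partial>lborel)"
      using C by (intro nn_integral_cong) (simp add: powr_mult ennreal_mult'[symmetric])
    also have "\<dots> = ennreal ((C * decay z) powr p) * (\<integral>\<^sup>+x. ennreal (cmod (g (x - z)) powr p) \<partial>lborel)"
      by (rule nn_integral_cmult) measurable
    also have "(\<integral>\<^sup>+x. ennreal (cmod (g (x - z)) powr p) \<partial>lborel) = (\<integral>\<^sup>+x. ennreal (cmod (g x) powr p) \<partial>lborel)"
      by (rule nn_integral_lborel_shift) measurable
    also have "ennreal ((C * decay z) powr p) * \<dots> \<le> ennreal ((C * decay z) powr p) * ennreal (A powr p)"
      by (intro mult_left_mono A') auto
    also have "\<dots> = ennreal ((C * decay z * A) powr p)"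
      using C A by (simp add: powr_mult ennreal_mult'[symmetric])
    finally show "(\<integral>\<^sup>+x. ennreal ((C * decay z * cmod (g (x - z))) powr p) \<partial>lborel) \<le> ennreal ((C * decay z * A) powr p)" .
  next
    have "(\<integral>\<^sup>+z. ennreal (C * decay (z::'a) * A) \<partial>lborel) = ennreal (C * A) * (\<integral>\<^sup>+z. ennreal (decay (z::'a)) \<partial>lborel)"
      using C A by (subst nn_integral_cmult[symmetric]) (auto simp: ennreal_mult'[symmetric] ac_simps)
    also have "\<dots> \<le> ennreal (C * A) * ennreal (decay_mass TYPE('a))"
      by (intro mult_left_mono nn_integral_decay) auto
    finally show "(\<integral>\<^sup>+z. ennreal (C * decay (z::'a) * A) \<partial>lborel) \<le> ennreal (C * decay_mass TYPE('a) * A)"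
      using C A decay_mass_pos[where 'a='a] by (simp add: ennreal_mult'[symmetric] ac_simps flip: ennreal_mult del: decay_mass_pos)
  qed (use C A conv_bound_nn[OF K] in \<open>auto simp: decay_pos\<close>)
qed

text \<open>Shifting the inner variable by z moves z from g into L, after which the integrals can be
  exchanged: tameness bounds the inner integral uniformly in z, and K is integrable.\<close>

lemma conv_assoc:
  assumes K: "decaying C K" and L: "decaying C' L" and g: "tame B g"
  shows "conv K (conv L g) = conv (conv K L) g"
proof
  fix x
  have [measurable]: "g \<in> borel_measurable borel" "K \<in> borel_measurable borel" "L \<in> borel_measurable borel"
    using g K L by (auto intro: tame_measurable decaying_measurable)
  have "conv K (conv L g) x = (LINT z|lborel. LINT y|lborel. K z * (L y * g (x - z - y)))"
    by (simp add: conv_def)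
  also have "\<dots> = (LINT z|lborel. LINT y|lborel. K z * L (y - z) * g (x - y))"
  proof (rule Bochner_Integration.integral_cong[OF refl])
    fix z
    have "(LINT y|lborel. K z * (L y * g (x - z - y))) = (LINT y|lborel. K z * (L (y - z) * g (x - z - (y - z))))"
      by (rule integral_lborel_shift[symmetric]) measurable
    then show "(LINT y|lborel. K z * (L y * g (x - z - y))) = (LINT y|lborel. K z * L (y - z) * g (x - y))"
      by (simp add: mult.assoc)
  qed
  also have "\<dots> = (LINT y|lborel. LINT z|lborel. K z * L (y - z) * g (x - y))"
  proof (rule fubini_swap[OF pair_sigma_finite_lborel])
    have "(\<integral>\<^sup>+z. \<integral>\<^sup>+y. ennreal (cmod (K z * L (y - z) * g (x - y))) \<partial>lborel \<partial>lborel) \<le>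
        (\<integral>\<^sup>+z. ennreal (cmod (K z)) * ennreal (C' * B) \<partial>lborel)"
    proof (rule nn_integral_mono)
      fix z
      have "(\<integral>\<^sup>+y. ennreal (cmod (K z * L (y - z) * g (x - y))) \<partial>lborel) =
         (\<integral>\<^sup>+y. ennreal (cmod (K z)) * ennreal (cmod (L (y - z) * g (x - y))) \<partial>lborel)"
        by (simp add: norm_mult ennreal_mult'[symmetric] mult.assoc)
      also have "\<dots> = ennreal (cmod (K z)) * (\<integral>\<^sup>+y. ennreal (cmod (L (y - z) * g ((x - z) - (y - z)))) \<partial>lborel)"
        by (subst nn_integral_cmult) auto
      also have "(\<integral>\<^sup>+y. ennreal (cmod (L (y - z) * g ((x - z) - (y - z)))) \<partial>lborel) =
          (\<integral>\<^sup>+y. ennreal (cmod (L y * g ((x - z) - y))) \<partial>lborel)"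
        by (rule nn_integral_lborel_shift) measurable
      also have "\<dots> \<le> (\<integral>\<^sup>+y. ennreal (C' * decay y * cmod (g (x - z - y))) \<partial>lborel)"
        using L by (intro nn_integral_mono ennreal_leI) (auto simp: norm_mult decaying_def mult_right_mono)
      also have "\<dots> \<le> ennreal (C' * B)" by (rule tame_nn_bound[OF g decaying_nonneg[OF L]])
      finally show "(\<integral>\<^sup>+y. ennreal (cmod (K z * L (y - z) * g (x - y))) \<partial>lborel) \<le> ennreal (cmod (K z)) * ennreal (C' * B)"
        by (simp add: mult_left_mono)
    qed
    also have "\<dots> = (\<integral>\<^sup>+z. ennreal (cmod (K z)) \<partial>lborel) * ennreal (C' * B)"
      by (rule nn_integral_multc) measurable
    also have "\<dots> < \<infinity>"
      using decaying_integrable[OF K] by (simp add: integrable_iff_bounded ennreal_mult_less_top)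
    finally show "(\<integral>\<^sup>+z. \<integral>\<^sup>+y. ennreal (cmod (K z * L (y - z) * g (x - y))) \<partial>lborel \<partial>lborel) < \<infinity>" .
  qed measurable
  also have "\<dots> = conv (conv K L) g x" by (simp add: conv_def)
  finally show "conv K (conv L g) x = conv (conv K L) g x" .
qed

text \<open>Kernels at points at distance at most 1 thus have a common integrable majorant, as
  dominated convergence with moving x requires. The 3 comes from s^2 \<le> 2 (s + t)^2 + 2 t^2 and
  t^2 \<le> 1 in each coordinate.\<close>

lemma decay_shift_le:
  fixes z h :: "'a::euclidean_space"
  assumes "norm h \<le> 1"
  shows "decay (z + h) \<le> 3 ^ DIM('a) * decay z"
proof -
  have "1 / (1 + ((z + h) \<bullet> b)\<^sup>2) \<le> 3 * (1 / (1 + (z \<bullet> b)\<^sup>2))" if "b \<in> Basis" for b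
  proof -
    define s t where "s = z \<bullet> b" and "t = h \<bullet> b"
    have t: "\<bar>t\<bar> \<le> 1" using Basis_le_norm[OF that, of h] assms by (simp add: t_def)
    have "t\<^sup>2 \<le> 1" using t by (simp add: abs_square_le_1)
    moreover have "s\<^sup>2 \<le> 2 * (s + t)\<^sup>2 + 2 * t\<^sup>2"
      using zero_le_power2[of "s + 2 * t"] by (simp add: power2_eq_square algebra_simps)
    ultimately have "1 + s\<^sup>2 \<le> 3 * (1 + (s + t)\<^sup>2)"
      using zero_le_power2[of "s + t"] by (smt (verit))
    then show ?thesis by (simp add: s_def t_def inner_add_left field_simps add_pos_nonneg)
  qed
  then have "decay (z + h) \<le> (\<Prod>b\<in>Basis. 3 * (1 / (1 + (z \<bullet> b)\<^sup>2)))"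
    unfolding decay_def by (intro prod_mono) (auto simp: add_pos_nonneg)
  then show ?thesis by (simp add: decay_def prod.distrib del: times_divide_eq_right)
qed

lemma conv_flip:
  assumes [measurable]: "K \<in> borel_measurable borel" "g \<in> borel_measurable borel"
  shows "conv K g x = (LINT z|lborel. K (x - z) * g z)"
  unfolding conv_def by (subst integral_lborel_reflect[of _ x, symmetric]) auto

text \<open>After \<open>conv_flip\<close> the variable x sits in the kernel alone, so dominated
  convergence works for an arbitrary tame g.\<close>

lemma conv_continuous:
  assumes K: "decaying C K" "continuous_on UNIV K" and g: "tame B g"
  shows "continuous_on UNIV (conv K g)"
proof -
  have [measurable]: "g \<in> borel_measurable borel" "K \<in> borel_measurable borel"
    using g K by (auto intro: tame_measurable decaying_measurable)
  have "(\<lambda>n. conv K g (X n)) \<longlonglongrightarrow> conv K g x" if X: "X \<longlonglongrightarrow> x" for X x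
  proof -
    obtain N where N: "\<And>n. n \<ge> N \<Longrightarrow> norm (X n - x) \<le> 1"
      using X[THEN LIMSEQ_D, of 1] less_imp_le by (metis zero_less_one)
    have "(\<lambda>n. LINT z|lborel. K (X (n + N) - z) * g z) \<longlonglongrightarrow> (LINT z|lborel. K (x - z) * g z)"
    proof (rule integral_dominated_convergence)
      show "integrable lborel (\<lambda>z. 3 ^ DIM('a) * C * decay (x - z) * cmod (g z))"
      proof (rule integrableI_bounded)
        have "(\<integral>\<^sup>+z. ennreal (norm (3 ^ DIM('a) * C * decay (x - z) * cmod (g z))) \<partial>lborel) =
           (\<integral>\<^sup>+z. ennreal (3 ^ DIM('a) * C * decay z * cmod (g (x - z))) \<partial>lborel)"
          using decaying_nonneg[OF K(1)]
          by (subst nn_integral_lborel_reflect[of _ x, symmetric]) (auto simp: abs_mult)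
        also have "\<dots> \<le> ennreal (3 ^ DIM('a) * C * B)"
          using decaying_nonneg[OF K(1)] by (intro tame_nn_bound[OF g]) auto
        finally show "(\<integral>\<^sup>+z. ennreal (norm (3 ^ DIM('a) * C * decay (x - z) * cmod (g z))) \<partial>lborel) < \<infinity>"
          by (simp add: order.strict_trans1)
      qed measurable
      show "AE z in lborel. norm (K (X (n + N) - z) * g z) \<le> 3 ^ DIM('a) * C * decay (x - z) * cmod (g z)" for n
      proof (intro AE_I2)
        fix z
        have d: "decay ((x - z) + (X (n + N) - x)) \<le> 3 ^ DIM('a) * decay (x - z)"
          using N[of "n + N"] by (intro decay_shift_le) auto
        have "cmod (K (X (n + N) - z)) \<le> C * decay ((x - z) + (X (n + N) - x))" using K by (simp add: decaying_def)
        also have "\<dots> \<le> C * (3 ^ DIM('a) * decay (x - z))" by (rule mult_left_mono[OF d decaying_nonneg[OF K(1)]])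
        finally have "cmod (K (X (n + N) - z)) \<le> 3 ^ DIM('a) * C * decay (x - z)" by (simp add: ac_simps)
        then show "norm (K (X (n + N) - z) * g z) \<le> 3 ^ DIM('a) * C * decay (x - z) * cmod (g z)"
          by (simp add: norm_mult mult_right_mono)
      qed
      show "AE z in lborel. (\<lambda>n. K (X (n + N) - z) * g z) \<longlonglongrightarrow> K (x - z) * g z"
      proof (intro AE_I2 tendsto_mult tendsto_const)
        fix z
        have "isCont K (x - z)" using K(2) by (simp add: continuous_on_eq_continuous_at)
        moreover have "(\<lambda>n. X (n + N) - z) \<longlonglongrightarrow> x - z"
          using X by (intro tendsto_intros LIMSEQ_ignore_initial_segment)
        ultimately show "(\<lambda>n. K (X (n + N) - z)) \<longlonglongrightarrow> K (x - z)" by (rule isCont_tendsto_compose)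
      qed
    qed measurable
    then have "(\<lambda>n. conv K g (X (n + N))) \<longlonglongrightarrow> conv K g x" by (simp add: conv_flip)
    then show ?thesis by (rule LIMSEQ_offset)
  qed
  then show ?thesis by (auto simp: continuous_on_eq_continuous_at continuous_at_sequentially o_def)
qed

section \<open>Smooth compactly supported functions\<close>

lemma C_infinity_differentiable: "C_infinity f \<Longrightarrow> f differentiable (at x)"
  by (drule C_infinity_def[THEN iffD1], drule bspec[of _ _ "[]"]) (auto simp: iter_deriv_def)

lemma C_infinity_dderiv: assumes "C_infinity f" "b \<in> Basis" shows "C_infinity (dderiv b f)"
  unfolding C_infinity_def
proof (intro ballI allI)
  fix bs :: "'a list" and x assume bs: "bs \<in> lists Basis"
  have "iter_deriv bs (dderiv b f) = iter_deriv (bs @ [b]) f" by (simp add: iter_deriv_def)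
  moreover have "bs @ [b] \<in> lists Basis" using bs assms by simp
  ultimately show "iter_deriv bs (dderiv b f) differentiable at x"
    using assms(1) unfolding C_infinity_def by metis
qed

lemma C_infinity_continuous: "C_infinity f \<Longrightarrow> continuous_on UNIV f"
  by (meson C_infinity_differentiable continuous_at_imp_continuous_on differentiable_imp_continuous_within)

lemma C_infinity_measurable: "C_infinity f \<Longrightarrow> f \<in> borel_measurable borel"
  for f :: "'a::euclidean_space \<Rightarrow> 'b::{real_normed_vector, second_countable_topology}"
  by (intro borel_measurable_continuous_onI C_infinity_continuous)

lemma C_infinity_line_derivative:
  assumes "C_infinity f"
  shows "((\<lambda>t. f (x + t *\<^sub>R b)) has_derivative (\<lambda>s. s *\<^sub>R dderiv b f (x + t *\<^sub>R b))) (at t)"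
proof -
  let ?D = "frechet_derivative f (at (x + t *\<^sub>R b))"
  have D: "(f has_derivative ?D) (at (x + t *\<^sub>R b))"
    using C_infinity_differentiable[OF assms] by (simp add: frechet_derivative_works)
  have "((\<lambda>t. f (x + t *\<^sub>R b)) has_derivative (\<lambda>s. ?D (s *\<^sub>R b))) (at t)"
    by (rule has_derivative_compose[of "\<lambda>t. x + t *\<^sub>R b" "\<lambda>s. s *\<^sub>R b" t UNIV f ?D, simplified o_def])
      (auto intro!: derivative_eq_intros D)
  then show ?thesis
    using has_derivative_linear[OF D] by (simp add: dderiv_def linear_cmul)
qed

definition bump :: "('a::euclidean_space \<Rightarrow> complex) \<Rightarrow> bool" where
  "bump \<tau> \<longleftrightarrow> C_infinity \<tau> \<and> (\<exists>R. \<forall>\<xi>. R < norm \<xi> \<longrightarrow> \<tau> \<xi> = 0)"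

lemma bump_dderiv:
  assumes "bump \<tau>" "b \<in> Basis" shows "bump (dderiv b \<tau>)"
proof -
  obtain R where R: "\<And>\<xi>. R < norm \<xi> \<Longrightarrow> \<tau> \<xi> = 0" using assms by (auto simp: bump_def)
  have "dderiv b \<tau> \<xi> = 0" if "R < norm \<xi>" for \<xi>
  proof -
    have "open {x::'a. R < norm x}" by (intro open_Collect_less continuous_intros)
    then have "(\<tau> has_derivative (\<lambda>_. 0)) (at \<xi>)"
      using that R by (intro has_derivative_transform_within_open[OF has_derivative_const[of 0]]) auto
    then show ?thesis by (simp add: dderiv_def frechet_derivative_at[symmetric])
  qed
  then show ?thesis using C_infinity_dderiv assms by (auto simp: bump_def)
qed

lemma bump_measurable: "bump \<tau> \<Longrightarrow> \<tau> \<in> borel_measurable borel"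
  by (simp add: bump_def C_infinity_measurable)

lemma bump_dominated:
  assumes "bump \<tau>"
  obtains M R where "\<And>\<xi>. cmod (\<tau> \<xi>) \<le> M * indicator (cball 0 R) \<xi>" "0 \<le> M"
proof -
  obtain R where R: "\<And>\<xi>. R < norm \<xi> \<Longrightarrow> \<tau> \<xi> = 0" using assms by (auto simp: bump_def)
  have "compact (\<tau> ` cball 0 R)"
    using assms C_infinity_continuous
    by (intro compact_continuous_image) (auto simp: bump_def intro: continuous_on_subset)
  then obtain M where M: "\<And>\<xi>. norm \<xi> \<le> R \<Longrightarrow> cmod (\<tau> \<xi>) \<le> M" "M > 0"
    by (force dest!: compact_imp_bounded simp: bounded_pos)
  have "cmod (\<tau> \<xi>) \<le> M * indicator (cball 0 R) \<xi>" for \<xi>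
    using M(1)[of \<xi>] R[of \<xi>] by (auto simp: indicator_def not_le)
  then show thesis using M(2) less_imp_le by (intro that[of M R]) auto
qed

lemma integrable_indicator_cball: "integrable lborel (\<lambda>x. M * indicator (cball (0::'a::euclidean_space) R) x :: real)"
  by (intro integrable_mult_right integrable_real_indicator)
    (use emeasure_bounded_finite[OF bounded_cball[of "0::'a" R]] in simp_all)

lemma bump_integrable: assumes "bump \<tau>" shows "integrable lborel \<tau>"
proof -
  obtain M R where M: "\<And>\<xi>. cmod (\<tau> \<xi>) \<le> M * indicator (cball 0 R) \<xi>" using bump_dominated[OF assms] by blast
  show ?thesis
    using bump_measurable[OF assms]
    by (intro Bochner_Integration.integrable_bound[OF integrable_indicator_cball[of M R]] AE_I2)
      (use M in \<open>auto intro: order_trans abs_ge_self\<close>)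
qed

lemma bump_bounded: assumes "bump \<tau>" obtains M where "\<And>\<xi>. cmod (\<tau> \<xi>) \<le> M" "0 \<le> M"
proof -
  obtain M R where M: "\<And>\<xi>. cmod (\<tau> \<xi>) \<le> M * indicator (cball 0 R) \<xi>" "0 \<le> M" using bump_dominated[OF assms] by blast
  have "M * indicator (cball 0 R) \<xi> \<le> M" for \<xi>::'a using M(2) by (auto simp: indicator_def)
  then show thesis using M order_trans by (intro that[of M]) blast+
qed

section \<open>Fourier integrals\<close>

lemma cis_measurable [measurable]: "cis \<in> borel_measurable borel"
  by (intro borel_measurable_continuous_onI continuous_intros)

text \<open>The inverse Fourier integral without its normalizing constant.\<close>

definition fint :: "('a::euclidean_space \<Rightarrow> complex) \<Rightarrow> 'a \<Rightarrow> complex" where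
  "fint \<tau> z = (LINT \<xi>|lborel. \<tau> \<xi> * cis (z \<bullet> \<xi>))"

lemma integrable_mult_cis:
  assumes "integrable lborel \<tau>" and [measurable]: "h \<in> borel_measurable borel"
  shows "integrable lborel (\<lambda>x. \<tau> x * cis (h x))"
  using assms(1) by (rule Bochner_Integration.integrable_bound)
    (use assms in \<open>auto simp: norm_mult dest: borel_measurable_integrable\<close>)

lemma fint_bounded: assumes "integrable lborel \<tau>"
  shows "cmod (fint \<tau> z) \<le> (LINT \<xi>|lborel. cmod (\<tau> \<xi>))"
  unfolding fint_def by (rule order_trans[OF integral_norm_bound]) (simp add: norm_mult)

lemma fint_continuous:
  assumes "integrable lborel \<tau>" shows "continuous_on UNIV (fint \<tau>)"
proof -
  have "(\<lambda>n. fint \<tau> (X n)) \<longlonglongrightarrow> fint \<tau> x" if X: "X \<longlonglongrightarrow> x" for X x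
    unfolding fint_def
  proof (rule integral_dominated_convergence[where w = "\<lambda>\<xi>. cmod (\<tau> \<xi>)"])
    show "AE \<xi> in lborel. (\<lambda>n. \<tau> \<xi> * cis (X n \<bullet> \<xi>)) \<longlonglongrightarrow> \<tau> \<xi> * cis (x \<bullet> \<xi>)"
      using X by (intro AE_I2 tendsto_intros)
  qed (use assms in \<open>auto simp: norm_mult dest: borel_measurable_integrable\<close>)
  then show ?thesis by (auto simp: continuous_on_eq_continuous_at continuous_at_sequentially o_def)
qed

lemma LIMSEQ_inverse_Suc_complex: "(\<lambda>n. of_real (inverse (real (Suc n)))) \<longlonglongrightarrow> (0 :: complex)"
  using tendsto_of_real[OF LIMSEQ_inverse_real_of_nat, where ?'a=complex] by simp

lemma cis_difference_quotient:
  "(\<lambda>n. (cis (inverse (real (Suc n)) * c) - 1) * of_real (real (Suc n))) \<longlonglongrightarrow> \<i> * of_real c"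
proof -
  have "((\<lambda>z. exp (z * (\<i> * of_real c))) has_field_derivative (\<i> * of_real c)) (at 0)"
    by (auto intro!: derivative_eq_intros)
  then have "((\<lambda>z. (exp (z * (\<i> * of_real c)) - 1) / z) \<longlongrightarrow> \<i> * of_real c) (at 0)"
    by (simp add: has_field_derivative_iff)
  moreover have "filterlim (\<lambda>n. complex_of_real (inverse (real (Suc n)))) (at 0) sequentially"
    unfolding filterlim_at
    using LIMSEQ_inverse_Suc_complex by (auto intro!: eventuallyI simp del: of_nat_Suc of_real_inverse)
  ultimately have "(\<lambda>n. (exp (of_real (inverse (real (Suc n))) * (\<i> * of_real c)) - 1) / of_real (inverse (real (Suc n)))) \<longlonglongrightarrow> \<i> * of_real c"
    by (rule filterlim_compose)
  then show ?thesis by (simp add: cis_conv_exp divide_inverse ac_simps)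
qed

lemma has_derivative_line_quotient:
  fixes f :: "real \<Rightarrow> 'a::real_normed_vector"
  assumes "(f has_derivative (\<lambda>s. s *\<^sub>R d)) (at 0)"
  shows "((\<lambda>t. (f t - f 0) /\<^sub>R t) \<longlongrightarrow> d) (at 0)"
proof -
  have "((\<lambda>y. norm (f y - f 0 - y *\<^sub>R d) / norm y) \<longlongrightarrow> 0) (at 0)"
    using assms by (simp add: has_derivative_iff_norm)
  then have "((\<lambda>t. norm ((f t - f 0) /\<^sub>R t - d)) \<longlongrightarrow> 0) (at 0)"
  proof (rule Lim_transform_eventually)
    have "norm (f t - f 0 - t *\<^sub>R d) / norm t = norm ((f t - f 0) /\<^sub>R t - d)" if "t \<noteq> 0" for t
    proof -
      have "(f t - f 0) /\<^sub>R t - d = (f t - f 0 - t *\<^sub>R d) /\<^sub>R t" using that by (simp add: scaleR_diff_right)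
      then show ?thesis by (simp add: divide_inverse_commute)
    qed
    then show "\<forall>\<^sub>F t in at 0. norm (f t - f 0 - t *\<^sub>R d) / norm t = norm ((f t - f 0) /\<^sub>R t - d)"
      by (auto simp: eventually_at_filter)
  qed
  then show ?thesis by (rule LIM_zero_cancel[OF tendsto_norm_zero_cancel])
qed

text \<open>Integration by parts through difference quotients: translating \<tau> multiplies its
  Fourier integral by a phase, and both sides converge as the step tends to 0.\<close>

lemma fint_dderiv:
  assumes \<tau>: "bump \<tau>" and b: "b \<in> Basis"
  shows "fint (dderiv b \<tau>) z = - \<i> * of_real (z \<bullet> b) * fint \<tau> z"
proof -
  have C: "C_infinity \<tau>" using \<tau> by (simp add: bump_def)
  have [measurable]: "\<tau> \<in> borel_measurable borel" "dderiv b \<tau> \<in> borel_measurable borel"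
    using \<tau> bump_dderiv[OF \<tau> b] by (auto intro: bump_measurable)
  obtain M R where M: "\<And>\<xi>. cmod (dderiv b \<tau> \<xi>) \<le> M * indicator (cball 0 R) \<xi>" "0 \<le> M"
    using bump_dominated[OF bump_dderiv[OF \<tau> b]] by blast
  define h where "h n = inverse (real (Suc n))" for n
  have h: "0 < h n" "h n \<le> 1" for n by (auto simp: h_def inverse_le_1_iff)
  have hlim: "h \<longlonglongrightarrow> 0" unfolding h_def[abs_def] by (rule LIMSEQ_inverse_real_of_nat)
  define I where "I n = (LINT \<xi>|lborel. (\<tau> (\<xi> + h n *\<^sub>R b) - \<tau> \<xi>) * of_real (real (Suc n)) * cis (z \<bullet> \<xi>))" for n
  have "I \<longlonglongrightarrow> fint (dderiv b \<tau>) z"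
    unfolding I_def[abs_def] fint_def
  \<comment> \<open>By the mean value inequality the quotient is bounded by the derivative at a
    point displaced by at most 1, hence the radius R + 1.\<close>
  proof (rule integral_dominated_convergence[where w = "\<lambda>\<xi>. M * indicator (cball 0 (R + 1)) \<xi>"])
    show "integrable lborel (\<lambda>\<xi>::'a. M * indicator (cball 0 (R + 1)) \<xi>)" by (rule integrable_indicator_cball)
    show "AE \<xi> in lborel. norm ((\<tau> (\<xi> + h n *\<^sub>R b) - \<tau> \<xi>) * of_real (real (Suc n)) * cis (z \<bullet> \<xi>)) \<le> M * indicator (cball 0 (R + 1)) \<xi>" for n
    proof (rule AE_I2)
      fix \<xi> :: 'a
      have cont: "continuous_on {0..h n} (\<lambda>t. \<tau> (\<xi> + t *\<^sub>R b))"
        by (intro continuous_on_compose2[OF C_infinity_continuous[OF C]] continuous_intros) auto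
      obtain t where t: "t \<in> {0<..<h n}"
        "norm (\<tau> (\<xi> + h n *\<^sub>R b) - \<tau> (\<xi> + 0 *\<^sub>R b)) \<le> norm ((h n - 0) *\<^sub>R dderiv b \<tau> (\<xi> + t *\<^sub>R b))"
        using mvt_general[OF h(1) cont C_infinity_line_derivative[OF C]] by blast
      have "norm (t *\<^sub>R b) \<le> 1" using t(1) h(2)[of n] b by simp
      then have "norm \<xi> \<le> norm (\<xi> + t *\<^sub>R b) + 1"
        using norm_triangle_ineq4[of "\<xi> + t *\<^sub>R b" "t *\<^sub>R b"] by simp
      then have "M * indicator (cball 0 R) (\<xi> + t *\<^sub>R b) \<le> M * indicator (cball 0 (R + 1)) \<xi>"
        using M(2) by (auto simp: indicator_def)
      then have bd: "cmod (dderiv b \<tau> (\<xi> + t *\<^sub>R b)) \<le> M * indicator (cball 0 (R + 1)) \<xi>"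
        using M(1) order_trans by blast
      have "norm ((\<tau> (\<xi> + h n *\<^sub>R b) - \<tau> \<xi>) * of_real (real (Suc n)) * cis (z \<bullet> \<xi>)) = norm (\<tau> (\<xi> + h n *\<^sub>R b) - \<tau> \<xi>) / h n"
        by (simp add: norm_mult h_def divide_inverse del: of_nat_Suc)
      also have "\<dots> \<le> cmod (dderiv b \<tau> (\<xi> + t *\<^sub>R b))"
        using t(2) h(1)[of n] by (simp add: field_simps)
      finally show "norm ((\<tau> (\<xi> + h n *\<^sub>R b) - \<tau> \<xi>) * of_real (real (Suc n)) * cis (z \<bullet> \<xi>)) \<le> M * indicator (cball 0 (R + 1)) \<xi>"
        using bd by linarith
    qed
    show "AE \<xi> in lborel. (\<lambda>n. (\<tau> (\<xi> + h n *\<^sub>R b) - \<tau> \<xi>) * of_real (real (Suc n)) * cis (z \<bullet> \<xi>)) \<longlonglongrightarrow> dderiv b \<tau> \<xi> * cis (z \<bullet> \<xi>)"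
    proof (intro AE_I2 tendsto_mult tendsto_const)
      fix \<xi> :: 'a
      have "((\<lambda>t. \<tau> (\<xi> + t *\<^sub>R b)) has_vector_derivative dderiv b \<tau> \<xi>) (at 0)"
        using C_infinity_line_derivative[OF C, of \<xi> b 0] by (simp add: has_vector_derivative_def)
      then have "((\<lambda>t. (\<tau> (\<xi> + t *\<^sub>R b) - \<tau> \<xi>) /\<^sub>R t) \<longlongrightarrow> dderiv b \<tau> \<xi>) (at 0)"
        by (auto simp: has_vector_derivative_def dest: has_derivative_line_quotient)
      moreover have "filterlim h (at 0) sequentially"
        unfolding filterlim_at using hlim h(1) by (auto intro!: eventuallyI simp: less_imp_neq[THEN not_sym] dest: less_imp_neq)
      ultimately have "(\<lambda>n. (\<tau> (\<xi> + h n *\<^sub>R b) - \<tau> \<xi>) /\<^sub>R h n) \<longlonglongrightarrow> dderiv b \<tau> \<xi>"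
        by (rule filterlim_compose)
      then show "(\<lambda>n. (\<tau> (\<xi> + h n *\<^sub>R b) - \<tau> \<xi>) * of_real (real (Suc n))) \<longlonglongrightarrow> dderiv b \<tau> \<xi>"
        by (simp add: h_def scaleR_conv_of_real mult.commute del: of_nat_Suc)
    qed
  qed measurable
  moreover have "I \<longlonglongrightarrow> \<i> * of_real (- (z \<bullet> b)) * fint \<tau> z"
  proof -
    have "I n = (cis (h n * (- (z \<bullet> b))) - 1) * of_real (real (Suc n)) * fint \<tau> z" for n
    proof -
      have int: "integrable lborel (\<lambda>\<xi>. \<tau> \<xi> * cis (z \<bullet> \<xi>))"
        by (intro integrable_mult_cis bump_integrable \<tau>) measurable
      have "(LINT \<xi>|lborel. \<tau> (\<xi> + h n *\<^sub>R b) * cis (z \<bullet> \<xi>)) =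
          (LINT \<xi>|lborel. \<tau> (\<xi> - (- (h n *\<^sub>R b))) * cis (z \<bullet> (\<xi> - (- (h n *\<^sub>R b)) + (- (h n *\<^sub>R b)))))"
        by simp
      also have "\<dots> = (LINT \<xi>|lborel. \<tau> \<xi> * cis (z \<bullet> (\<xi> + (- (h n *\<^sub>R b)))))"
        by (rule integral_lborel_shift) measurable
      also have "\<dots> = (LINT \<xi>|lborel. cis (h n * (- (z \<bullet> b))) * (\<tau> \<xi> * cis (z \<bullet> \<xi>)))"
        by (intro Bochner_Integration.integral_cong refl) (simp add: inner_diff_right cis_mult mult.left_commute[of "cis _"] add.commute)
      also have "\<dots> = cis (h n * (- (z \<bullet> b))) * fint \<tau> z" by (simp add: fint_def)
      finally have 1: "(LINT \<xi>|lborel. \<tau> (\<xi> + h n *\<^sub>R b) * cis (z \<bullet> \<xi>)) = cis (h n * (- (z \<bullet> b))) * fint \<tau> z" .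
      have int2: "integrable lborel (\<lambda>\<xi>. \<tau> (\<xi> + h n *\<^sub>R b) * cis (z \<bullet> \<xi>))"
      proof (rule integrable_mult_cis)
        have "integrable (distr lborel borel ((+) (h n *\<^sub>R b))) \<tau>"
          using bump_integrable[OF \<tau>] by (simp add: lborel_distr_plus)
        then show "integrable lborel (\<lambda>\<xi>. \<tau> (\<xi> + h n *\<^sub>R b))"
          by (subst (asm) integrable_distr_eq) (auto simp: add.commute)
      qed measurable
      have "I n = of_real (real (Suc n)) * (LINT \<xi>|lborel. \<tau> (\<xi> + h n *\<^sub>R b) * cis (z \<bullet> \<xi>) - \<tau> \<xi> * cis (z \<bullet> \<xi>))"
        unfolding I_def integral_mult_right_zero[symmetric]
        by (intro Bochner_Integration.integral_cong refl) (simp add: algebra_simps)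
      also have "(LINT \<xi>|lborel. \<tau> (\<xi> + h n *\<^sub>R b) * cis (z \<bullet> \<xi>) - \<tau> \<xi> * cis (z \<bullet> \<xi>)) = cis (h n * (- (z \<bullet> b))) * fint \<tau> z - fint \<tau> z"
        using 1 by (subst Bochner_Integration.integral_diff[OF int2 int]) (simp add: fint_def)
      finally show ?thesis by (simp add: algebra_simps)
    qed
    then have "I = (\<lambda>n. (cis (h n * (- (z \<bullet> b))) - 1) * of_real (real (Suc n)) * fint \<tau> z)" by blast
    then show ?thesis
      unfolding h_def by (simp only:) (intro tendsto_mult cis_difference_quotient tendsto_const)
  qed
  ultimately show ?thesis using LIMSEQ_unique by fastforce
qed

text \<open>Each coordinate is paid for with two derivatives: multiplying the transform by 1 plus
  the square of the coordinate amounts to subtracting from \<tau> its second derivative. The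
  induction leaves \<tau> arbitrary because derivatives of bumps are bumps.\<close>

lemma fint_decay_partial:
  assumes "finite S" "S \<subseteq> Basis" "bump \<tau>"
  shows "\<exists>C. \<forall>z::'a::euclidean_space. (\<Prod>b\<in>S. 1 + (z \<bullet> b)\<^sup>2) * cmod (fint \<tau> z) \<le> C"
  using assms
proof (induction S arbitrary: \<tau>)
  case empty
  then show ?case using fint_bounded[OF bump_integrable] by auto
next
  case (insert b S)
  let ?\<tau> = "dderiv b (dderiv b \<tau>)"
  have b: "b \<in> Basis" and S: "S \<subseteq> Basis" using insert by auto
  have bump: "bump (dderiv b \<tau>)" "bump ?\<tau>" using insert b by (auto intro: bump_dderiv)
  obtain C C' where C: "\<And>z. (\<Prod>b\<in>S. 1 + (z \<bullet> b)\<^sup>2) * cmod (fint \<tau> z) \<le> C"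
    "\<And>z. (\<Prod>b\<in>S. 1 + (z \<bullet> b)\<^sup>2) * cmod (fint ?\<tau> z) \<le> C'"
    using insert.IH[OF S insert.prems(2)] insert.IH[OF S bump(2)] by blast
  have "(\<Prod>b\<in>insert b S. 1 + (z \<bullet> b)\<^sup>2) * cmod (fint \<tau> z) \<le> C + C'" for z
  proof -
    have "cmod (fint ?\<tau> z) = (z \<bullet> b)\<^sup>2 * cmod (fint \<tau> z)"
      using insert b bump by (simp add: fint_dderiv norm_mult power2_eq_square)
    then have "(\<Prod>b\<in>insert b S. 1 + (z \<bullet> b)\<^sup>2) * cmod (fint \<tau> z) =
       (\<Prod>b\<in>S. 1 + (z \<bullet> b)\<^sup>2) * cmod (fint \<tau> z) + (\<Prod>b\<in>S. 1 + (z \<bullet> b)\<^sup>2) * cmod (fint ?\<tau> z)"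
      using insert by (simp add: algebra_simps)
    then show ?thesis using C[of z] by simp
  qed
  then show ?case by blast
qed

text \<open>The kernel with symbol \<tau>: convolution with it multiplies frequencies by \<tau>. In
  dimension n, one factor (2 pi)^(-n/2) belongs to the inverse transform, the other to the
  convolution theorem.\<close>

definition ker :: "('a::euclidean_space \<Rightarrow> complex) \<Rightarrow> 'a \<Rightarrow> complex" where
  "ker \<tau> z = of_real ((2 * pi) powr (- real DIM('a))) * fint \<tau> z"

lemma ker_continuous: "bump \<tau> \<Longrightarrow> continuous_on UNIV (ker \<tau>)"
  unfolding ker_def[abs_def] by (intro continuous_intros fint_continuous bump_integrable)

lemma ker_measurable: "bump \<tau> \<Longrightarrow> ker \<tau> \<in> borel_measurable borel"
  by (intro borel_measurable_continuous_onI ker_continuous)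

lemma ker_decaying:
  assumes "bump \<tau>" obtains C where "decaying C (ker \<tau>)" "0 < C"
proof -
  obtain C where C: "\<And>z. (\<Prod>b\<in>Basis. 1 + (z \<bullet> b)\<^sup>2) * cmod (fint \<tau> z) \<le> C"
    using fint_decay_partial[OF finite_Basis order_refl assms] by blast
  let ?c = "(2 * pi) powr (- real DIM('a))"
  have "cmod (ker \<tau> z) \<le> (?c * \<bar>C\<bar> + 1) * decay z" for z
  proof -
    have P: "(\<Prod>b\<in>Basis. 1 + (z \<bullet> b)\<^sup>2) > 0" by (intro prod_pos) (simp add: add_pos_nonneg)
    have "cmod (fint \<tau> z) \<le> C * decay z"
      using C[of z] P by (simp add: decay_def prod_dividef field_simps)
    then have "cmod (ker \<tau> z) \<le> ?c * (C * decay z)"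
      by (simp add: ker_def norm_mult)
    also have "\<dots> \<le> (?c * \<bar>C\<bar> + 1) * decay z"
    proof -
      have "?c * (C * decay z) \<le> ?c * (\<bar>C\<bar> * decay z)" by (intro mult_left_mono mult_right_mono) auto
      moreover have "(?c * \<bar>C\<bar> + 1) * decay z = ?c * (\<bar>C\<bar> * decay z) + decay z" by (simp add: algebra_simps)
      ultimately show ?thesis using decay_nonneg[of z] by linarith
    qed
    finally show ?thesis .
  qed
  then show thesis
    using ker_measurable[OF assms] by (intro that[of "?c * \<bar>C\<bar> + 1"]) (auto simp: decaying_def add_nonneg_pos)
qed

lemma ker_integrable: "bump \<tau> \<Longrightarrow> integrable lborel (ker \<tau>)"
  using ker_decaying decaying_integrable by metis

section \<open>Fourier inversion\<close>

lemma integral_lborel_prod: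
  fixes f :: "'a::euclidean_space \<Rightarrow> real \<Rightarrow> complex"
  assumes int: "\<And>b. b \<in> Basis \<Longrightarrow> integrable lborel (f b)"
  shows "(LINT x|lborel. (\<Prod>b\<in>Basis. f b (x \<bullet> b))) = (\<Prod>b\<in>Basis. LINT t|lborel. f b t)"
proof -
  interpret product_sigma_finite "\<lambda>_::'a. lborel :: real measure"
    by standard
  have [measurable]: "f b \<in> borel_measurable borel" if "b \<in> Basis" for b
    using int[OF that] by (auto dest: borel_measurable_integrable)
  have "(LINT x|lborel. (\<Prod>b\<in>Basis. f b (x \<bullet> b))) =
      (LINT x|(\<Pi>\<^sub>M b\<in>Basis. lborel). (\<Prod>b\<in>Basis. f b ((\<Sum>b\<in>Basis. x b *\<^sub>R b) \<bullet> b)))"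
    unfolding lborel_eq[where 'a='a] by (subst integral_distr) auto
  also have "\<dots> = (LINT x|(\<Pi>\<^sub>M b\<in>Basis. lborel). (\<Prod>b\<in>Basis. f b (x b)))"
    by (intro Bochner_Integration.integral_cong refl prod.cong) simp
  also have "\<dots> = (\<Prod>b\<in>Basis. LINT t|lborel. f b t)"
    using int by (intro product_integral_prod) auto
  finally show ?thesis .
qed

definition gaussian :: "'a::euclidean_space \<Rightarrow> real" where
  "gaussian z = exp (- (norm z)\<^sup>2 / 2)"

lemma gaussian_measurable [measurable]: "gaussian \<in> borel_measurable borel"
  unfolding gaussian_def[abs_def] by measurable

lemma gaussian_prod: "gaussian z = (\<Prod>b\<in>Basis. exp (- (z \<bullet> b)\<^sup>2 / 2))"
proof -
  have "(norm z)\<^sup>2 = (\<Sum>b\<in>Basis. (z \<bullet> b)\<^sup>2)"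
    unfolding power2_norm_eq_inner euclidean_inner[of z z] by (simp add: power2_eq_square)
  then show ?thesis
    by (simp add: gaussian_def exp_sum[symmetric] sum_negf sum_divide_distrib[symmetric])
qed

text \<open>Up to the factor sqrt (2 pi), the integral is the characteristic function of the
  standard normal distribution.\<close>

lemma gaussian_1d:
  "integrable lborel (\<lambda>x. of_real (exp (- x\<^sup>2 / 2)) * cis (x * t))"
  "(LINT x|lborel. of_real (exp (- x\<^sup>2 / 2)) * cis (x * t)) = of_real (sqrt (2 * pi) * exp (- t\<^sup>2 / 2))"
proof -
  have e: "exp (- x\<^sup>2 / 2) = sqrt (2 * pi) * std_normal_density x" for x
    by (simp add: std_normal_density_def)
  have int: "integrable lborel (\<lambda>x. complex_of_real (exp (- x\<^sup>2 / 2)))"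
    unfolding e using integrable_normal_moment[of 1 0 0] by (intro integrable_of_real) simp
  then show "integrable lborel (\<lambda>x. of_real (exp (- x\<^sup>2 / 2)) * cis (x * t))"
    by (rule integrable_mult_cis) measurable
  have "(LINT x|lborel. of_real (exp (- x\<^sup>2 / 2)) * cis (x * t)) =
      of_real (sqrt (2 * pi)) * (LINT x|lborel. std_normal_density x *\<^sub>R cis (t * x))"
    unfolding e by (simp add: scaleR_conv_of_real mult.assoc mult.commute[of t])
  also have "(LINT x|lborel. std_normal_density x *\<^sub>R cis (t * x)) = char std_normal_distribution t"
    unfolding char_def by (subst integral_density) (auto simp: cis_conv_exp)
  finally show "(LINT x|lborel. of_real (exp (- x\<^sup>2 / 2)) * cis (x * t)) = of_real (sqrt (2 * pi) * exp (- t\<^sup>2 / 2))"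
    by (simp add: char_std_normal_distribution)
qed

lemma fint_gaussian:
  "fint (\<lambda>z. of_real (gaussian z)) (\<eta> :: 'a::euclidean_space) = of_real (sqrt (2 * pi) ^ DIM('a) * gaussian \<eta>)"
proof -
  have cis_sum: "cis (\<Sum>b\<in>Basis. g b) = (\<Prod>b\<in>Basis. cis (g b))" for g :: "'a \<Rightarrow> real"
    by (simp add: cis_conv_exp exp_sum[symmetric] sum_distrib_left)
  have "fint (\<lambda>z. of_real (gaussian z)) \<eta> =
      (LINT z|lborel. (\<Prod>b\<in>Basis. of_real (exp (- (z \<bullet> b)\<^sup>2 / 2)) * cis ((z \<bullet> b) * (\<eta> \<bullet> b))))"
    unfolding fint_def gaussian_prod
  proof (rule Bochner_Integration.integral_cong[OF refl])
    fix z :: 'a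
    have "cis (\<eta> \<bullet> z) = (\<Prod>b\<in>Basis. cis ((z \<bullet> b) * (\<eta> \<bullet> b)))"
      unfolding cis_sum[symmetric] by (simp only: inner_commute[of \<eta> z] euclidean_inner[of z \<eta>, symmetric])
    then show "of_real (\<Prod>b\<in>Basis. exp (- (z \<bullet> b)\<^sup>2 / 2)) * cis (\<eta> \<bullet> z) =
        (\<Prod>b\<in>Basis. of_real (exp (- (z \<bullet> b)\<^sup>2 / 2)) * cis ((z \<bullet> b) * (\<eta> \<bullet> b)))"
      by (simp add: prod.distrib)
  qed
  also have "\<dots> = (\<Prod>b\<in>Basis. of_real (sqrt (2 * pi) * exp (- (\<eta> \<bullet> b)\<^sup>2 / 2)))"
    by (subst integral_lborel_prod) (simp_all only: gaussian_1d)
  also have "\<dots> = of_real (sqrt (2 * pi) ^ DIM('a) * gaussian \<eta>)"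
    by (simp add: gaussian_prod prod.distrib)
  finally show ?thesis .
qed

text \<open>The integral of a non-integrable function is 0 by convention, whereas
  \<open>fint_gaussian\<close> gives a positive value at 0.\<close>

lemma gaussian_integrable: "integrable lborel (\<lambda>z::'a::euclidean_space. complex_of_real (gaussian z))"
proof (rule ccontr)
  assume "\<not> ?thesis"
  then have "fint (\<lambda>z::'a. complex_of_real (gaussian z)) 0 = 0"
    by (simp add: fint_def not_integrable_integral_eq del: integral_complex_of_real)
  then have "sqrt (2 * pi) ^ DIM('a) * gaussian (0::'a) = 0"
    unfolding fint_gaussian by (simp only: of_real_eq_0_iff)
  then show False by (simp add: gaussian_def)
qed


definition fhat :: "('a::euclidean_space \<Rightarrow> complex) \<Rightarrow> 'a \<Rightarrow> complex" where
  "fhat L \<omega> = (LINT z|lborel. L z * cis (- (z \<bullet> \<omega>)))"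

lemma gaussian_le_1: "gaussian z \<le> 1"
  by (simp add: gaussian_def)

lemma gaussian_nonneg [simp]: "0 \<le> gaussian z"
  by (simp add: gaussian_def)

text \<open>The Gaussian makes the double integral absolutely convergent. By Fubini the z-integral
  is carried out inside, where it is again a Gaussian, of width e and centred at \<omega>: the
  right-hand side averages \<tau> around \<omega>.\<close>

lemma regularized_inversion:
  fixes \<tau> :: "'a::euclidean_space \<Rightarrow> complex"
  assumes \<tau>: "bump \<tau>" and e: "e > 0"
  shows "(LINT z|lborel. ker \<tau> z * cis (- (z \<bullet> \<omega>)) * of_real (gaussian (e *\<^sub>R z))) =
    of_real ((2 * pi) powr (- (DIM('a) / 2))) * (LINT z|lborel. \<tau> (\<omega> + e *\<^sub>R z) * of_real (gaussian z))"
proof -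
  have [measurable]: "\<tau> \<in> borel_measurable borel" by (rule bump_measurable[OF \<tau>])
  let ?c = "complex_of_real ((2 * pi) powr (- real DIM('a)))"
  have scale: "(LINT z|lborel. complex_of_real (gaussian (e *\<^sub>R z)) * cis (z \<bullet> \<eta>)) * of_real (e ^ DIM('a)) =
      of_real (sqrt (2 * pi) ^ DIM('a) * gaussian (\<eta> /\<^sub>R e))" for \<eta> :: 'a
  proof -
    have "of_real (sqrt (2 * pi) ^ DIM('a) * gaussian (\<eta> /\<^sub>R e)) = (LINT z|lborel. complex_of_real (gaussian z) * cis ((\<eta> /\<^sub>R e) \<bullet> z))"
      unfolding fint_gaussian[symmetric] fint_def ..
    also have "\<dots> = of_real (e ^ DIM('a)) * (LINT z|lborel. complex_of_real (gaussian (0 + e *\<^sub>R z)) * cis ((\<eta> /\<^sub>R e) \<bullet> (0 + e *\<^sub>R z)))"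
      using e by (intro integral_lborel_scale) auto
    also have "(LINT z|lborel. complex_of_real (gaussian (0 + e *\<^sub>R z)) * cis ((\<eta> /\<^sub>R e) \<bullet> (0 + e *\<^sub>R z))) =
       (LINT z|lborel. complex_of_real (gaussian (e *\<^sub>R z)) * cis (z \<bullet> \<eta>))"
      using e by (intro Bochner_Integration.integral_cong refl) (simp add: inner_commute mult.assoc[symmetric])
    finally show ?thesis by (simp add: mult.commute)
  qed
  have int_e: "integrable lborel (\<lambda>z::'a. complex_of_real (gaussian (e *\<^sub>R z)))"
  proof (rule ccontr)
    \<comment> \<open>Again a non-integrable function would have integral 0, against
      \<open>scale\<close> at \<eta> = 0.\<close>
    assume "\<not> ?thesis"
    then have "of_real (sqrt (2 * pi) ^ DIM('a) * gaussian ((0::'a) /\<^sub>R e)) = (0::complex)"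
      using scale[of 0] by (simp add: not_integrable_integral_eq del: integral_complex_of_real)
    then show False by (simp only: of_real_eq_0_iff) (simp add: gaussian_def)
  qed
  have "(LINT z|lborel. ker \<tau> z * cis (- (z \<bullet> \<omega>)) * of_real (gaussian (e *\<^sub>R z))) =
      (LINT z|lborel. ?c * (LINT \<xi>|lborel. \<tau> \<xi> * (cis (z \<bullet> (\<xi> - \<omega>)) * of_real (gaussian (e *\<^sub>R z)))))"
  proof (rule Bochner_Integration.integral_cong[OF refl])
    fix z :: 'a
    have "fint \<tau> z * (cis (- (z \<bullet> \<omega>)) * of_real (gaussian (e *\<^sub>R z))) =
        (LINT \<xi>|lborel. \<tau> \<xi> * cis (z \<bullet> \<xi>) * (cis (- (z \<bullet> \<omega>)) * of_real (gaussian (e *\<^sub>R z))))"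
      by (simp add: fint_def)
    also have "\<dots> = (LINT \<xi>|lborel. \<tau> \<xi> * (cis (z \<bullet> (\<xi> - \<omega>)) * of_real (gaussian (e *\<^sub>R z))))"
      by (intro Bochner_Integration.integral_cong refl) (simp add: inner_diff_right cis_mult)
    finally show "ker \<tau> z * cis (- (z \<bullet> \<omega>)) * of_real (gaussian (e *\<^sub>R z)) =
        ?c * (LINT \<xi>|lborel. \<tau> \<xi> * (cis (z \<bullet> (\<xi> - \<omega>)) * of_real (gaussian (e *\<^sub>R z))))"
      by (simp add: ker_def mult.assoc)
  qed
  also have "\<dots> = ?c * (LINT z|lborel. (LINT \<xi>|lborel. \<tau> \<xi> * (cis (z \<bullet> (\<xi> - \<omega>)) * of_real (gaussian (e *\<^sub>R z)))))"
    by simp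
  also have "(LINT z|lborel. (LINT \<xi>|lborel. \<tau> \<xi> * (cis (z \<bullet> (\<xi> - \<omega>)) * of_real (gaussian (e *\<^sub>R z))))) =
      (LINT \<xi>|lborel. (LINT z|lborel. \<tau> \<xi> * (cis (z \<bullet> (\<xi> - \<omega>)) * of_real (gaussian (e *\<^sub>R z)))))"
  proof (rule fubini_swap[OF pair_sigma_finite_lborel])
    have "(\<integral>\<^sup>+z. \<integral>\<^sup>+\<xi>. ennreal (cmod (\<tau> \<xi> * (cis (z \<bullet> (\<xi> - \<omega>)) * of_real (gaussian (e *\<^sub>R z))))) \<partial>lborel \<partial>lborel) =
       (\<integral>\<^sup>+z. \<integral>\<^sup>+\<xi>. ennreal (gaussian (e *\<^sub>R (z::'a))) * ennreal (cmod (\<tau> \<xi>)) \<partial>lborel \<partial>lborel)"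
      by (intro nn_integral_cong) (simp add: norm_mult ennreal_mult'[symmetric] mult.commute)
    also have "\<dots> = (\<integral>\<^sup>+z. ennreal (gaussian (e *\<^sub>R (z::'a))) * (\<integral>\<^sup>+\<xi>. ennreal (cmod (\<tau> \<xi>)) \<partial>lborel) \<partial>lborel)"
      by (intro nn_integral_cong nn_integral_cmult) measurable
    also have "\<dots> = (\<integral>\<^sup>+z. ennreal (gaussian (e *\<^sub>R (z::'a))) \<partial>lborel) * (\<integral>\<^sup>+\<xi>. ennreal (cmod (\<tau> \<xi>)) \<partial>lborel)"
      by (intro nn_integral_multc) measurable
    also have "\<dots> < \<infinity>"
      using int_e bump_integrable[OF \<tau>] by (simp add: integrable_iff_bounded ennreal_mult_less_top)
    finally show "(\<integral>\<^sup>+z. \<integral>\<^sup>+\<xi>. ennreal (cmod (\<tau> \<xi> * (cis (z \<bullet> (\<xi> - \<omega>)) * of_real (gaussian (e *\<^sub>R z))))) \<partial>lborel \<partial>lborel) < \<infinity>" .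
  qed measurable
  also have "\<dots> = (LINT \<xi>|lborel. \<tau> \<xi> * (of_real (sqrt (2 * pi) ^ DIM('a) * gaussian ((\<xi> - \<omega>) /\<^sub>R e)) / of_real (e ^ DIM('a))))"
    unfolding scale[symmetric] using e by (intro Bochner_Integration.integral_cong refl) (simp add: mult.commute)
  also have "\<dots> = of_real (e ^ DIM('a)) * (LINT z|lborel. \<tau> (\<omega> + e *\<^sub>R z) * (of_real (sqrt (2 * pi) ^ DIM('a) * gaussian ((\<omega> + e *\<^sub>R z - \<omega>) /\<^sub>R e)) / of_real (e ^ DIM('a))))"
    using e by (intro integral_lborel_scale) auto
  also have "(LINT z|lborel. \<tau> (\<omega> + e *\<^sub>R z) * (of_real (sqrt (2 * pi) ^ DIM('a) * gaussian ((\<omega> + e *\<^sub>R z - \<omega>) /\<^sub>R e)) / of_real (e ^ DIM('a)))) =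
      (LINT z|lborel. (\<tau> (\<omega> + e *\<^sub>R z) * of_real (gaussian z)) * (of_real (sqrt (2 * pi) ^ DIM('a)) / of_real (e ^ DIM('a))))"
    using e by (intro Bochner_Integration.integral_cong refl) simp
  also have "\<dots> = (LINT z|lborel. \<tau> (\<omega> + e *\<^sub>R z) * of_real (gaussian z)) * (of_real (sqrt (2 * pi) ^ DIM('a)) / of_real (e ^ DIM('a)))"
    by (rule integral_mult_left_zero)
  also have "?c * (of_real (e ^ DIM('a)) * ((LINT z|lborel. \<tau> (\<omega> + e *\<^sub>R z) * of_real (gaussian z)) * (of_real (sqrt (2 * pi) ^ DIM('a)) / of_real (e ^ DIM('a))))) =
      (?c * of_real (sqrt (2 * pi) ^ DIM('a))) * (LINT z|lborel. \<tau> (\<omega> + e *\<^sub>R z) * of_real (gaussian z))"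
    using e by simp
  also have "?c * of_real (sqrt (2 * pi) ^ DIM('a)) = of_real ((2 * pi) powr (- (DIM('a) / 2)))"
  proof -
    have "sqrt (2 * pi) ^ DIM('a) = (2 * pi) powr (DIM('a) / 2)"
      by (simp add: powr_half_sqrt[symmetric] powr_realpow[symmetric] powr_powr)
    then show ?thesis by (simp add: powr_add[symmetric] of_real_mult[symmetric] del: of_real_mult)
  qed
  finally show ?thesis .
qed

text \<open>Let e tend to 0 in \<open>regularized_inversion\<close>. The left side is dominated by
  the integrable kernel, the right side by a multiple of the Gaussian, whose integral cancels the
  constant.\<close>

theorem fhat_ker:
  fixes \<tau> :: "'a::euclidean_space \<Rightarrow> complex"
  assumes \<tau>: "bump \<tau>"
  shows "fhat (ker \<tau>) \<omega> = \<tau> \<omega>"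
proof -
  have [measurable]: "\<tau> \<in> borel_measurable borel" "ker \<tau> \<in> borel_measurable borel"
    using \<tau> by (auto intro: bump_measurable ker_measurable)
  define e where "e n = inverse (real (Suc n))" for n
  have e: "e n > 0" for n by (simp add: e_def)
  have elim: "e \<longlonglongrightarrow> 0" unfolding e_def[abs_def] by (rule LIMSEQ_inverse_real_of_nat)
  let ?l = "\<lambda>n. (LINT z|lborel. ker \<tau> z * cis (- (z \<bullet> \<omega>)) * of_real (gaussian (e n *\<^sub>R z)))"
  let ?r = "\<lambda>n. of_real ((2 * pi) powr (- (DIM('a) / 2))) * (LINT z|lborel. \<tau> (\<omega> + e n *\<^sub>R z) * of_real (gaussian z))"
  obtain M where M: "\<And>\<xi>. cmod (\<tau> \<xi>) \<le> M" "0 \<le> M" using bump_bounded[OF \<tau>] by blast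
  have cont_g: "isCont (gaussian :: 'a \<Rightarrow> real) 0" unfolding gaussian_def[abs_def] by (intro continuous_intros) auto
  have l: "?l \<longlonglongrightarrow> fhat (ker \<tau>) \<omega>"
    unfolding fhat_def
  proof (rule integral_dominated_convergence[where w = "\<lambda>z. cmod (ker \<tau> z)"])
    show "integrable lborel (\<lambda>z. cmod (ker \<tau> z))" by (intro integrable_norm ker_integrable \<tau>)
    show "AE z in lborel. norm (ker \<tau> z * cis (- (z \<bullet> \<omega>)) * of_real (gaussian (e n *\<^sub>R z))) \<le> cmod (ker \<tau> z)" for n
      by (intro AE_I2) (simp add: norm_mult mult_right_le_one_le gaussian_le_1)
    show "AE z in lborel. (\<lambda>n. ker \<tau> z * cis (- (z \<bullet> \<omega>)) * of_real (gaussian (e n *\<^sub>R z))) \<longlonglongrightarrow> ker \<tau> z * cis (- (z \<bullet> \<omega>))"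
    proof (intro AE_I2)
      fix z :: 'a
      have "(\<lambda>n. e n *\<^sub>R z) \<longlonglongrightarrow> 0 *\<^sub>R z" by (intro tendsto_intros elim)
      then have "(\<lambda>n. gaussian (e n *\<^sub>R z)) \<longlonglongrightarrow> gaussian (0::'a)"
        by (intro isCont_tendsto_compose[OF cont_g]) simp
      then have "(\<lambda>n. ker \<tau> z * cis (- (z \<bullet> \<omega>)) * of_real (gaussian (e n *\<^sub>R z))) \<longlonglongrightarrow> ker \<tau> z * cis (- (z \<bullet> \<omega>)) * of_real (gaussian (0::'a))"
        by (intro tendsto_intros)
      then show "(\<lambda>n. ker \<tau> z * cis (- (z \<bullet> \<omega>)) * of_real (gaussian (e n *\<^sub>R z))) \<longlonglongrightarrow> ker \<tau> z * cis (- (z \<bullet> \<omega>))"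
        by (simp add: gaussian_def)
    qed
  qed measurable
  have r: "?r \<longlonglongrightarrow> of_real ((2 * pi) powr (- (DIM('a) / 2))) * (LINT z|lborel. \<tau> \<omega> * of_real (gaussian (z::'a)))"
  proof (intro tendsto_mult tendsto_const, rule integral_dominated_convergence[where w = "\<lambda>z. M * gaussian z"])
    have "integrable lborel (\<lambda>z::'a. cmod (complex_of_real (gaussian z)))" by (intro integrable_norm gaussian_integrable)
    then show "integrable lborel (\<lambda>z::'a. M * gaussian z)" by simp
    show "AE z in lborel. norm (\<tau> (\<omega> + e n *\<^sub>R z) * of_real (gaussian z)) \<le> M * gaussian z" for n
      using M by (intro AE_I2) (simp add: norm_mult mult_right_mono)
    show "AE z in lborel. (\<lambda>n. \<tau> (\<omega> + e n *\<^sub>R z) * of_real (gaussian z)) \<longlonglongrightarrow> \<tau> \<omega> * of_real (gaussian z)"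
    proof (intro AE_I2 tendsto_mult tendsto_const)
      fix z :: 'a
      have "(\<lambda>n. \<omega> + e n *\<^sub>R z) \<longlonglongrightarrow> \<omega> + 0 *\<^sub>R z" by (intro tendsto_intros elim)
      moreover have "isCont \<tau> \<omega>"
        using \<tau> C_infinity_continuous by (auto simp: bump_def continuous_on_eq_continuous_at)
      ultimately show "(\<lambda>n. \<tau> (\<omega> + e n *\<^sub>R z)) \<longlonglongrightarrow> \<tau> \<omega>"
        by (intro isCont_tendsto_compose[of \<omega> \<tau>]) auto
    qed
  qed measurable
  have "?l = ?r" by (intro ext regularized_inversion[OF \<tau> e])
  with l have "?r \<longlonglongrightarrow> fhat (ker \<tau>) \<omega>" by (simp only:)
  then have "fhat (ker \<tau>) \<omega> = of_real ((2 * pi) powr (- (DIM('a) / 2))) * (LINT z|lborel. \<tau> \<omega> * of_real (gaussian (z::'a)))"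
    using r by (rule LIMSEQ_unique)
  also have "(LINT z|lborel. \<tau> \<omega> * of_real (gaussian (z::'a))) = \<tau> \<omega> * fint (\<lambda>z. of_real (gaussian z)) (0::'a)"
    by (simp add: fint_def)
  also have "fint (\<lambda>z. of_real (gaussian z)) (0::'a) = of_real ((2 * pi) powr (DIM('a) / 2))"
    unfolding fint_gaussian by (simp add: gaussian_def powr_half_sqrt[symmetric] powr_realpow[symmetric] powr_powr)
  also have "of_real ((2 * pi) powr (- (DIM('a) / 2))) * (\<tau> \<omega> * of_real ((2 * pi) powr (DIM('a) / 2))) =
      \<tau> \<omega> * of_real ((2 * pi) powr (- (DIM('a) / 2)) * (2 * pi) powr (DIM('a) / 2))" by simp
  also have "\<dots> = \<tau> \<omega>" by (subst powr_add[symmetric]) simp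
  finally show ?thesis .
qed

section \<open>Products and convolutions of band-limited kernels\<close>

text \<open>The kernel factor is expanded into waves in z; the wave of frequency \<xi> shifts the
  argument of \<open>fhat L\<close> by \<xi>, and Fubini integrates these shifts against
  \<tau>.\<close>

lemma fhat_mult_ker:
  fixes L :: "'a::euclidean_space \<Rightarrow> complex"
  assumes L: "integrable lborel L" and \<tau>: "bump \<tau>"
  shows "fhat (\<lambda>z. L z * ker \<tau> (x - z)) \<omega> =
    of_real ((2 * pi) powr (- real DIM('a))) * (LINT \<xi>|lborel. \<tau> \<xi> * cis (x \<bullet> \<xi>) * fhat L (\<omega> + \<xi>))"
proof -
  have [measurable]: "\<tau> \<in> borel_measurable borel" "L \<in> borel_measurable borel"
    using \<tau> L by (auto intro: bump_measurable dest: borel_measurable_integrable)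
  let ?c = "complex_of_real ((2 * pi) powr (- real DIM('a)))"
  have "fhat (\<lambda>z. L z * ker \<tau> (x - z)) \<omega> =
      (LINT z|lborel. ?c * (LINT \<xi>|lborel. \<tau> \<xi> * cis (x \<bullet> \<xi>) * (L z * cis (- (z \<bullet> (\<omega> + \<xi>))))))"
    unfolding fhat_def
  proof (rule Bochner_Integration.integral_cong[OF refl])
    fix z
    have "fint \<tau> (x - z) * (L z * cis (- (z \<bullet> \<omega>))) =
       (LINT \<xi>|lborel. \<tau> \<xi> * cis ((x - z) \<bullet> \<xi>) * (L z * cis (- (z \<bullet> \<omega>))))"
      by (simp add: fint_def)
    also have "\<dots> = (LINT \<xi>|lborel. \<tau> \<xi> * cis (x \<bullet> \<xi>) * (L z * cis (- (z \<bullet> (\<omega> + \<xi>)))))"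
    proof (rule Bochner_Integration.integral_cong[OF refl])
      fix \<xi>
      have "cis ((x - z) \<bullet> \<xi>) * cis (- (z \<bullet> \<omega>)) = cis (x \<bullet> \<xi>) * cis (- (z \<bullet> (\<omega> + \<xi>)))"
        by (simp add: cis_mult inner_add_right inner_diff_left algebra_simps)
      then show "\<tau> \<xi> * cis ((x - z) \<bullet> \<xi>) * (L z * cis (- (z \<bullet> \<omega>))) = \<tau> \<xi> * cis (x \<bullet> \<xi>) * (L z * cis (- (z \<bullet> (\<omega> + \<xi>))))"
        by (metis mult.assoc mult.left_commute)
    qed
    finally show "L z * ker \<tau> (x - z) * cis (- (z \<bullet> \<omega>)) =
        ?c * (LINT \<xi>|lborel. \<tau> \<xi> * cis (x \<bullet> \<xi>) * (L z * cis (- (z \<bullet> (\<omega> + \<xi>)))))"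
      unfolding ker_def by (metis mult.assoc mult.left_commute)
  qed
  also have "\<dots> = ?c * (LINT z|lborel. LINT \<xi>|lborel. \<tau> \<xi> * cis (x \<bullet> \<xi>) * (L z * cis (- (z \<bullet> (\<omega> + \<xi>)))))"
    by (rule integral_mult_right_zero)
  also have "(LINT z|lborel. LINT \<xi>|lborel. \<tau> \<xi> * cis (x \<bullet> \<xi>) * (L z * cis (- (z \<bullet> (\<omega> + \<xi>))))) =
      (LINT \<xi>|lborel. LINT z|lborel. \<tau> \<xi> * cis (x \<bullet> \<xi>) * (L z * cis (- (z \<bullet> (\<omega> + \<xi>)))))"
  proof (rule fubini_swap[OF pair_sigma_finite_lborel])
    have "(\<integral>\<^sup>+z. \<integral>\<^sup>+\<xi>. ennreal (cmod (\<tau> \<xi> * cis (x \<bullet> \<xi>) * (L z * cis (- (z \<bullet> (\<omega> + \<xi>)))))) \<partial>lborel \<partial>lborel) =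
       (\<integral>\<^sup>+z. \<integral>\<^sup>+\<xi>. ennreal (cmod (L z)) * ennreal (cmod (\<tau> \<xi>)) \<partial>lborel \<partial>lborel)"
      by (intro nn_integral_cong) (simp add: norm_mult ennreal_mult'[symmetric] mult.commute)
    also have "\<dots> = (\<integral>\<^sup>+z. ennreal (cmod (L z)) * (\<integral>\<^sup>+\<xi>. ennreal (cmod (\<tau> \<xi>)) \<partial>lborel) \<partial>lborel)"
      by (intro nn_integral_cong nn_integral_cmult) measurable
    also have "\<dots> = (\<integral>\<^sup>+z. ennreal (cmod (L z)) \<partial>lborel) * (\<integral>\<^sup>+\<xi>. ennreal (cmod (\<tau> \<xi>)) \<partial>lborel)"
      by (intro nn_integral_multc) measurable
    also have "\<dots> < \<infinity>"
      using L bump_integrable[OF \<tau>] by (simp add: integrable_iff_bounded ennreal_mult_less_top)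
    finally show "(\<integral>\<^sup>+z. \<integral>\<^sup>+\<xi>. ennreal (cmod (\<tau> \<xi> * cis (x \<bullet> \<xi>) * (L z * cis (- (z \<bullet> (\<omega> + \<xi>)))))) \<partial>lborel \<partial>lborel) < \<infinity>" .
  qed measurable
  also have "\<dots> = (LINT \<xi>|lborel. \<tau> \<xi> * cis (x \<bullet> \<xi>) * fhat L (\<omega> + \<xi>))"
    by (simp add: fhat_def)
  finally show ?thesis .
qed

text \<open>The case \<omega> = 0 of \<open>fhat_mult_ker\<close>, as \<open>fhat\<close> at 0 is
  the plain integral.\<close>

lemma conv_ker:
  fixes L :: "'a::euclidean_space \<Rightarrow> complex"
  assumes L: "integrable lborel L" and \<tau>: "bump \<tau>"
  shows "conv L (ker \<tau>) x =
    of_real ((2 * pi) powr (- real DIM('a))) * (LINT \<xi>|lborel. \<tau> \<xi> * cis (x \<bullet> \<xi>) * fhat L \<xi>)"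
  using fhat_mult_ker[OF L \<tau>, of x 0] by (simp add: conv_def fhat_def)

lemma conv_ker_ker:
  assumes "bump \<tau>" "bump \<tau>'"
  shows "conv (ker \<tau>) (ker \<tau>') = ker (\<lambda>\<xi>. \<tau> \<xi> * \<tau>' \<xi>)"
  using assms by (auto simp: fun_eq_iff conv_ker[OF ker_integrable] fhat_ker ker_def fint_def ac_simps)

text \<open>Frequencies add under multiplication.\<close>

lemma conv_ker_mult_eq_0:
  fixes g h :: "'a::euclidean_space \<Rightarrow> complex"
  assumes b: "bump \<tau>" "bump \<tau>1" "bump \<tau>2" and g: "tame B g" "0 \<le> B" and h: "tame B' h" "0 \<le> B'"
    and zero: "\<And>\<omega> \<xi>. \<tau>1 \<omega> * \<tau>2 \<xi> * \<tau> (\<omega> + \<xi>) = 0"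
  shows "conv (ker \<tau>) (\<lambda>x. conv (ker \<tau>1) g x * conv (ker \<tau>2) h x) x = 0"
proof -
  obtain C where C: "decaying C (ker \<tau>)" using ker_decaying[OF b(1)] by blast
  obtain C1 where C1: "decaying C1 (ker \<tau>1)" using ker_decaying[OF b(2)] by blast
  obtain C2 where C2: "decaying C2 (ker \<tau>2)" using ker_decaying[OF b(3)] by blast
  note nonneg = decaying_nonneg[OF C] decaying_nonneg[OF C1] decaying_nonneg[OF C2]
  have [measurable]: "ker \<tau> \<in> borel_measurable borel" "ker \<tau>1 \<in> borel_measurable borel" "ker \<tau>2 \<in> borel_measurable borel"
    "g \<in> borel_measurable borel" "h \<in> borel_measurable borel"
    using b g h by (auto intro: ker_measurable tame_measurable)
  define E where "E = conv (ker \<tau>1) g"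
  have [measurable]: "E \<in> borel_measurable borel" unfolding E_def by (rule conv_measurable) measurable
  have E: "cmod (E x) \<le> C1 * B" for x unfolding E_def by (rule conv_bounded[OF C1 g])
  \<comment> \<open>For fixed y the two outer kernels combine to L. Its transform at \<omega>
    integrates \<tau>2 \<xi> times \<tau> (\<omega> + \<xi>), which vanishes wherever \<tau>1
    \<omega> does not; hence L annihilates everything filtered by \<tau>1.\<close>
  have inner: "(LINT z|lborel. ker \<tau> z * E (x - z) * ker \<tau>2 (x - z - y)) = 0" for y
  proof -
    define L where "L z = ker \<tau> z * ker \<tau>2 (x - y - z)" for z
    have [measurable]: "L \<in> borel_measurable borel" unfolding L_def by measurable
    have L: "decaying (C * C2) L"
      unfolding decaying_def
    proof (intro conjI allI)
      fix z
      have "cmod (ker \<tau>2 (x - y - z)) \<le> C2 * decay (x - y - z)" using C2 by (simp add: decaying_def)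
      also have "\<dots> \<le> C2" using nonneg by (simp add: mult_right_le_one_le decay_le_1)
      finally have "cmod (L z) \<le> (C * decay z) * C2"
        unfolding L_def norm_mult using C nonneg by (intro mult_mono) (auto simp: decaying_def)
      then show "cmod (L z) \<le> C * C2 * decay z" by (simp add: ac_simps)
    qed measurable
    have "fhat L \<omega> * \<tau>1 \<omega> = 0" for \<omega>
    proof -
      have "\<tau>1 \<omega> * fhat L \<omega> = of_real ((2 * pi) powr (- real DIM('a))) * (LINT \<xi>|lborel. \<tau>1 \<omega> * (\<tau>2 \<xi> * cis ((x - y) \<bullet> \<xi>) * \<tau> (\<omega> + \<xi>)))"
        unfolding L_def fhat_mult_ker[OF ker_integrable[OF b(1)] b(3)] fhat_ker[OF b(1)] by simp
      also have "(\<lambda>\<xi>. \<tau>1 \<omega> * (\<tau>2 \<xi> * cis ((x - y) \<bullet> \<xi>) * \<tau> (\<omega> + \<xi>))) = (\<lambda>\<xi>. 0)"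
        using zero by (auto simp: fun_eq_iff)
      finally show ?thesis by (simp add: mult.commute)
    qed
    then have "(\<lambda>\<omega>. \<tau>1 \<omega> * cis (x \<bullet> \<omega>) * fhat L \<omega>) = (\<lambda>_. 0)" for x by (metis mult_eq_0_iff)
    then have "conv L (ker \<tau>1) = (\<lambda>_. 0)"
      unfolding fun_eq_iff conv_ker[OF decaying_integrable[OF L] b(2)]
      by (simp only: Bochner_Integration.integral_zero mult_zero_right) simp
    then have "conv (conv L (ker \<tau>1)) g x = 0" by (simp add: conv_def)
    then have "conv L E x = 0" unfolding E_def conv_assoc[OF L C1 g(1)] .
    then show ?thesis by (simp add: conv_def L_def algebra_simps)
  qed
  have "conv (ker \<tau>) (\<lambda>x. E x * conv (ker \<tau>2) h x) x =
      (LINT z|lborel. LINT y|lborel. ker \<tau> z * E (x - z) * ker \<tau>2 (x - z - y) * h y)"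
    unfolding conv_def[of "ker \<tau>"] by (simp add: conv_flip mult.assoc)
  also have "\<dots> = (LINT y|lborel. LINT z|lborel. ker \<tau> z * E (x - z) * ker \<tau>2 (x - z - y) * h y)"
  proof (rule fubini_swap[OF pair_sigma_finite_lborel])
    have "(\<integral>\<^sup>+z. \<integral>\<^sup>+y. ennreal (cmod (ker \<tau> z * E (x - z) * ker \<tau>2 (x - z - y) * h y)) \<partial>lborel \<partial>lborel) \<le>
       (\<integral>\<^sup>+z. ennreal (cmod (ker \<tau> z)) * ennreal (C1 * B * (C2 * B')) \<partial>lborel)"
    proof (rule nn_integral_mono)
      fix z
      have "(\<integral>\<^sup>+y. ennreal (cmod (ker \<tau> z * E (x - z) * ker \<tau>2 (x - z - y) * h y)) \<partial>lborel) =
         (\<integral>\<^sup>+y. ennreal (cmod (ker \<tau> z * E (x - z))) * ennreal (cmod (ker \<tau>2 (x - z - y) * h y)) \<partial>lborel)"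
        by (simp add: norm_mult ennreal_mult'[symmetric] mult.assoc)
      also have "\<dots> = ennreal (cmod (ker \<tau> z * E (x - z))) * (\<integral>\<^sup>+y. ennreal (cmod (ker \<tau>2 (x - z - y) * h ((x - z) - (x - z - y)))) \<partial>lborel)"
        by (subst nn_integral_cmult) auto
      also have "(\<integral>\<^sup>+y. ennreal (cmod (ker \<tau>2 (x - z - y) * h ((x - z) - (x - z - y)))) \<partial>lborel) =
         (\<integral>\<^sup>+y. ennreal (cmod (ker \<tau>2 y * h ((x - z) - y))) \<partial>lborel)"
        by (rule nn_integral_lborel_reflect) measurable
      also have "\<dots> \<le> (\<integral>\<^sup>+y. ennreal (C2 * decay y * cmod (h (x - z - y))) \<partial>lborel)"
        using C2 by (intro nn_integral_mono ennreal_leI) (auto simp: norm_mult decaying_def mult_right_mono)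
      also have "\<dots> \<le> ennreal (C2 * B')" by (rule tame_nn_bound[OF h(1) nonneg(3)])
      finally have "(\<integral>\<^sup>+y. ennreal (cmod (ker \<tau> z * E (x - z) * ker \<tau>2 (x - z - y) * h y)) \<partial>lborel) \<le>
          ennreal (cmod (ker \<tau> z * E (x - z))) * ennreal (C2 * B')"
        by (simp add: mult_left_mono)
      also have "\<dots> \<le> ennreal (cmod (ker \<tau> z) * (C1 * B)) * ennreal (C2 * B')"
        using E by (intro mult_right_mono ennreal_leI) (auto simp: norm_mult mult_left_mono)
      also have "\<dots> = ennreal (cmod (ker \<tau> z)) * ennreal (C1 * B * (C2 * B'))"
        using nonneg g h by (simp add: ennreal_mult'[symmetric] ac_simps flip: ennreal_mult'')
      finally show "(\<integral>\<^sup>+y. ennreal (cmod (ker \<tau> z * E (x - z) * ker \<tau>2 (x - z - y) * h y)) \<partial>lborel) \<le>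
          ennreal (cmod (ker \<tau> z)) * ennreal (C1 * B * (C2 * B'))" .
    qed
    also have "\<dots> = (\<integral>\<^sup>+z. ennreal (cmod (ker \<tau> z)) \<partial>lborel) * ennreal (C1 * B * (C2 * B'))"
      by (rule nn_integral_multc) measurable
    also have "\<dots> < \<infinity>"
      using ker_integrable[OF b(1)] by (simp add: integrable_iff_bounded ennreal_mult_less_top)
    finally show "(\<integral>\<^sup>+z. \<integral>\<^sup>+y. ennreal (cmod (ker \<tau> z * E (x - z) * ker \<tau>2 (x - z - y) * h y)) \<partial>lborel \<partial>lborel) < \<infinity>" .
  qed measurable
  also have "\<dots> = 0" by (simp add: inner)
  finally show ?thesis by (simp add: E_def)
qed

text \<open>Moving the symbol changes the kernel only by a phase. This is the source of all
  constants that are uniform in k.\<close>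

lemma ker_modulate:
  assumes "bump \<tau>"
  shows "ker (\<lambda>\<xi>. \<tau> (\<xi> - a)) z = cis (z \<bullet> a) * ker \<tau> z"
proof -
  have [measurable]: "\<tau> \<in> borel_measurable borel" by (rule bump_measurable[OF assms])
  have "fint (\<lambda>\<xi>. \<tau> (\<xi> - a)) z = (LINT \<xi>|lborel. \<tau> (\<xi> - a) * cis (z \<bullet> (\<xi> - a + a)))"
    by (simp add: fint_def)
  also have "\<dots> = (LINT \<xi>|lborel. \<tau> \<xi> * cis (z \<bullet> (\<xi> + a)))"
    by (rule integral_lborel_shift) measurable
  also have "\<dots> = (LINT \<xi>|lborel. cis (z \<bullet> a) * (\<tau> \<xi> * cis (z \<bullet> \<xi>)))"
    by (intro Bochner_Integration.integral_cong refl) (simp add: inner_add_right cis_mult[symmetric] ac_simps)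
  finally show ?thesis by (simp add: ker_def fint_def)
qed

text \<open>Brings low-pass filters into the form of averages at scale t that
  \<open>tame_eq_0_AE\<close> expects.\<close>

lemma conv_ker_dilate:
  fixes h :: "'a::euclidean_space \<Rightarrow> complex"
  assumes \<tau>: "bump \<tau>" "bump (\<lambda>\<xi>. \<tau> (t *\<^sub>R \<xi>))" and t: "t > 0" and [measurable]: "h \<in> borel_measurable borel"
  shows "conv (ker (\<lambda>\<xi>. \<tau> (t *\<^sub>R \<xi>))) h x = (LINT z|lborel. ker \<tau> z * h (x - t *\<^sub>R z))"
proof -
  let ?K = "ker (\<lambda>\<xi>. \<tau> (t *\<^sub>R \<xi>))"
  have [measurable]: "\<tau> \<in> borel_measurable borel" "?K \<in> borel_measurable borel"
    using \<tau> by (auto intro: bump_measurable ker_measurable)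
  have K: "of_real (t ^ DIM('a)) * ?K (t *\<^sub>R z) = ker \<tau> z" for z
  proof -
    have "fint \<tau> z = of_real (t ^ DIM('a)) * (LINT \<xi>|lborel. \<tau> (0 + t *\<^sub>R \<xi>) * cis (z \<bullet> (0 + t *\<^sub>R \<xi>)))"
      unfolding fint_def using t by (intro integral_lborel_scale) auto
    then show ?thesis by (simp add: ker_def fint_def)
  qed
  have "conv ?K h x = of_real (t ^ DIM('a)) * (LINT z|lborel. ?K (0 + t *\<^sub>R z) * h (x - (0 + t *\<^sub>R z)))"
    unfolding conv_def using t by (intro integral_lborel_scale) auto
  also have "\<dots> = (LINT z|lborel. (of_real (t ^ DIM('a)) * ?K (t *\<^sub>R z)) * h (x - t *\<^sub>R z))"
    by (simp add: mult.assoc)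
  finally show ?thesis unfolding K .
qed

section \<open>Smoothness of the frequency windows\<close>

text \<open>A class of smooth functions closed under differentiation, large enough to contain the quotients
  \<open>\<sigma>\<^sub>k\<close>.\<close>

inductive smooth_expr :: "('a::euclidean_space \<Rightarrow> complex) \<Rightarrow> bool" where
  base: "C_infinity (r :: 'a \<Rightarrow> real) \<Longrightarrow> smooth_expr (\<lambda>\<xi>. of_real (r (c *\<^sub>R \<xi> - a)))"
| const: "smooth_expr (\<lambda>_. z)"
| add: "smooth_expr f \<Longrightarrow> smooth_expr g \<Longrightarrow> smooth_expr (\<lambda>\<xi>. f \<xi> + g \<xi>)"
| mult: "smooth_expr f \<Longrightarrow> smooth_expr g \<Longrightarrow> smooth_expr (\<lambda>\<xi>. f \<xi> * g \<xi>)"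
| inverse: "smooth_expr f \<Longrightarrow> (\<And>\<xi>. f \<xi> \<noteq> 0) \<Longrightarrow> smooth_expr (\<lambda>\<xi>. inverse (f \<xi>))"

lemma dderiv_eqI: "(\<And>x. (f has_derivative D x) (at x)) \<Longrightarrow> dderiv b f = (\<lambda>x. D x b)"
  unfolding dderiv_def by (metis frechet_derivative_at)

text \<open>Each formation rule differentiates back into the class. For \<open>base\<close> this is
  why c and a are arbitrary: the chain rule yields the constant c times another instance of
  \<open>base\<close>.\<close>

lemma smooth_expr_derivative:
  assumes "smooth_expr f"
  shows "(\<forall>x. f differentiable (at x)) \<and> (\<forall>b\<in>Basis. smooth_expr (dderiv b f))"
  using assms
proof induction
  case (base r c a)
  let ?D = "\<lambda>x h. complex_of_real (frechet_derivative r (at (c *\<^sub>R x - a)) (c *\<^sub>R h))"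
  have r: "(r has_derivative frechet_derivative r (at y)) (at y)" for y
    using C_infinity_differentiable[OF base] by (simp add: frechet_derivative_works)
  have D: "((\<lambda>\<xi>. complex_of_real (r (c *\<^sub>R \<xi> - a))) has_derivative ?D x) (at x)" for x
    by (auto intro!: derivative_eq_intros has_derivative_compose[OF _ r, simplified])
  have "smooth_expr (dderiv b (\<lambda>\<xi>. complex_of_real (r (c *\<^sub>R \<xi> - a))))" if "b \<in> Basis" for b
  proof -
    have "dderiv b (\<lambda>\<xi>. complex_of_real (r (c *\<^sub>R \<xi> - a))) = (\<lambda>\<xi>. of_real c * of_real (dderiv b r (c *\<^sub>R \<xi> - a)))"
      unfolding dderiv_eqI[OF D] dderiv_def
      by (simp add: linear_cmul[OF has_derivative_linear[OF r]])
    then show ?thesis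
      using base that by (simp only:) (intro smooth_expr.intros C_infinity_dderiv)
  qed
  then show ?case using D by (auto simp: differentiable_def)
next
  case (const z)
  have D: "((\<lambda>_. z) has_derivative (\<lambda>_. 0)) (at x)" for x :: 'a by simp
  show ?case unfolding dderiv_eqI[OF D] by (auto intro: smooth_expr.intros)
next
  case (add f g)
  have D: "((\<lambda>\<xi>. f \<xi> + g \<xi>) has_derivative (\<lambda>h. frechet_derivative f (at x) h + frechet_derivative g (at x) h)) (at x)" for x
    using add.IH by (intro has_derivative_add) (auto simp: frechet_derivative_works)
  have "dderiv b (\<lambda>\<xi>. f \<xi> + g \<xi>) = (\<lambda>\<xi>. dderiv b f \<xi> + dderiv b g \<xi>)" for b
    unfolding dderiv_eqI[OF D] by (simp add: dderiv_def)
  then show ?case using add.IH D by (auto simp: differentiable_def intro!: smooth_expr.add)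
next
  case (mult f g)
  have D: "((\<lambda>\<xi>. f \<xi> * g \<xi>) has_derivative (\<lambda>h. f x * frechet_derivative g (at x) h + frechet_derivative f (at x) h * g x)) (at x)" for x
    using mult.IH by (intro has_derivative_mult) (auto simp: frechet_derivative_works)
  have "dderiv b (\<lambda>\<xi>. f \<xi> * g \<xi>) = (\<lambda>\<xi>. f \<xi> * dderiv b g \<xi> + dderiv b f \<xi> * g \<xi>)" for b
    unfolding dderiv_eqI[OF D] by (simp add: dderiv_def)
  then show ?case using mult D by (auto simp: differentiable_def intro!: smooth_expr.add smooth_expr.mult)
next
  case (inverse f)
  have D: "((\<lambda>\<xi>. inverse (f \<xi>)) has_derivative (\<lambda>h. - (inverse (f x) * frechet_derivative f (at x) h * inverse (f x)))) (at x)" for x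
    using inverse by (intro Deriv.has_derivative_inverse) (auto simp: frechet_derivative_works)
  have "dderiv b (\<lambda>\<xi>. inverse (f \<xi>)) = (\<lambda>\<xi>. (-1) * (inverse (f \<xi>) * dderiv b f \<xi> * inverse (f \<xi>)))" for b
    unfolding dderiv_eqI[OF D] by (simp add: dderiv_def)
  then show ?case
    using inverse D smooth_expr.const[of "-1"] by (auto simp only: differentiable_def intro!: smooth_expr.mult smooth_expr.inverse)
qed

lemma smooth_expr_C_infinity: assumes "smooth_expr f" shows "C_infinity f"
proof -
  have "smooth_expr (iter_deriv bs f)" if "bs \<in> lists Basis" for bs
    using that
  proof (induction bs)
    case (Cons b bs)
    then show ?case using smooth_expr_derivative[of "iter_deriv bs f"] by (auto simp: iter_deriv_def)
  qed (simp add: assms iter_deriv_def)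
  then show ?thesis using smooth_expr_derivative by (auto simp: C_infinity_def)
qed

lemma smooth_expr_sum:
  "finite F \<Longrightarrow> (\<And>m. m \<in> F \<Longrightarrow> smooth_expr (f m)) \<Longrightarrow> smooth_expr (\<lambda>\<xi>. \<Sum>m\<in>F. f m \<xi>)"
  by (induction F rule: finite_induct) (auto intro: smooth_expr.intros)

lemma finite_lattice_box: "finite {m :: int ^ 'n. \<forall>i. \<bar>x i - real_of_int (m $ i)\<bar> \<le> r}"
proof (rule finite_subset)
  show "{m :: int ^ 'n. \<forall>i. \<bar>x i - real_of_int (m $ i)\<bar> \<le> r} \<subseteq> vec_lambda ` (\<Pi>\<^sub>E i\<in>UNIV. {\<lceil>x i - r\<rceil>..\<lfloor>x i + r\<rfloor>})"
  proof
    fix m :: "int ^ 'n" assume "m \<in> {m. \<forall>i. \<bar>x i - real_of_int (m $ i)\<bar> \<le> r}"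
    then have "m $ i \<in> {\<lceil>x i - r\<rceil>..\<lfloor>x i + r\<rfloor>}" for i
      by (simp add: ceiling_le_iff le_floor_iff abs_le_iff) (smt (verit))
    then show "m \<in> vec_lambda ` (\<Pi>\<^sub>E i\<in>UNIV. {\<lceil>x i - r\<rceil>..\<lfloor>x i + r\<rfloor>})"
      by (intro image_eqI[of _ _ "\<lambda>i. m $ i"]) auto
  qed
qed (intro finite_imageI finite_PiE, auto)

lemma lattice_pt_nth [simp]: "lattice_pt k $ i = real_of_int (k $ i)"
  by (simp add: lattice_pt_def)

lemma lattice_pt_simps [simp]:
  "lattice_pt 0 = 0" "lattice_pt (k + m) = lattice_pt k + lattice_pt m" "lattice_pt (k - m) = lattice_pt k - lattice_pt m"
  by (simp_all add: vec_eq_iff)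

section \<open>The partition of unity in frequency space\<close>

locale window =
  fixes \<rho> :: "real ^ 'n \<Rightarrow> real"
  assumes freq_window: "freq_window \<rho>"
begin

lemma rho_C_infinity: "C_infinity \<rho>" and rho_nonneg [simp]: "0 \<le> \<rho> \<xi>" and rho_le_1: "\<rho> \<xi> \<le> 1"
  and rho_eq_1: "(\<And>i. \<bar>\<xi> $ i\<bar> \<le> 1 / 2) \<Longrightarrow> \<rho> \<xi> = 1"
  using freq_window by (auto simp: freq_window_def)

lemma rho_support: "\<rho> \<xi> \<noteq> 0 \<Longrightarrow> \<bar>\<xi> $ i\<bar> \<le> 1"
  using freq_window closure_subset[of "{\<xi>. \<rho> \<xi> \<noteq> 0}"] by (auto simp: freq_window_def)

definition total :: "real ^ 'n \<Rightarrow> real" where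
  "total \<xi> = (\<Sum>\<^sub>\<infinity>m. \<rho> (\<xi> - lattice_pt m))"

lemma total_eq_sum:
  assumes "finite F" "{m. \<rho> (\<xi> - lattice_pt m) \<noteq> 0} \<subseteq> F"
  shows "total \<xi> = (\<Sum>m\<in>F. \<rho> (\<xi> - lattice_pt m))"
proof -
  have "total \<xi> = (\<Sum>\<^sub>\<infinity>m\<in>F. \<rho> (\<xi> - lattice_pt m))"
    unfolding total_def using assms(2) by (intro infsum_cong_neutral) auto
  then show ?thesis using assms(1) by simp
qed

lemma support_subset: "{m. \<rho> (\<xi> - lattice_pt m) \<noteq> 0} \<subseteq> {m. \<forall>i. \<bar>\<xi> $ i - real_of_int (m $ i)\<bar> \<le> 1}"
  using rho_support by fastforce

lemma finite_support: "finite {m. \<rho> (\<xi> - lattice_pt m) \<noteq> 0}"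
  using finite_subset[OF support_subset finite_lattice_box] .

definition nearest :: "real ^ 'n \<Rightarrow> int ^ 'n" where
  "nearest \<xi> = (\<chi> i. round (\<xi> $ i))"

lemma rho_nearest: "\<rho> (\<xi> - lattice_pt (nearest \<xi>)) = 1"
proof (rule rho_eq_1)
  show "\<bar>(\<xi> - lattice_pt (nearest \<xi>)) $ i\<bar> \<le> 1 / 2" for i
    using of_int_round_abs_le[of "\<xi> $ i"] by (simp add: nearest_def abs_minus_commute)
qed

text \<open>Rounding each coordinate moves it by at most 1/2, and there the window equals 1; all
  other terms are nonnegative.\<close>

lemma total_ge_1: "1 \<le> total \<xi>"
proof -
  let ?F = "{m. \<rho> (\<xi> - lattice_pt m) \<noteq> 0}"
  have "(\<Sum>m\<in>{nearest \<xi>}. \<rho> (\<xi> - lattice_pt m)) \<le> (\<Sum>m\<in>?F. \<rho> (\<xi> - lattice_pt m))"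
    using finite_support rho_nearest by (intro sum_mono2) auto
  then show ?thesis using total_eq_sum[OF finite_support order_refl] rho_nearest by simp
qed

lemma total_periodic: "total (\<xi> - lattice_pt k) = total \<xi>"
proof -
  have "bij_betw (\<lambda>m. m + k) UNIV UNIV" by (rule bij_betwI[of _ _ _ "\<lambda>m. m - k"]) auto
  then have "(\<Sum>\<^sub>\<infinity>m. \<rho> (\<xi> - lattice_pt (m + k))) = (\<Sum>\<^sub>\<infinity>m. \<rho> (\<xi> - lattice_pt m))"
    by (rule infsum_reindex_bij_betw)
  then show ?thesis by (simp add: total_def algebra_simps)
qed

definition sig :: "int ^ 'n \<Rightarrow> real ^ 'n \<Rightarrow> complex" where
  "sig k \<xi> = of_real (sigma_fn \<rho> k \<xi>)"

lemma sig_eq: "sig k \<xi> = of_real (\<rho> (\<xi> - lattice_pt k) / total \<xi>)"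
  by (simp add: sig_def sigma_fn_def total_def divide_inverse)

lemma sig_shift: "sig k \<xi> = sig 0 (\<xi> - lattice_pt k)"
  by (simp add: sig_eq total_periodic)

lemma sig_support: "sig k \<xi> \<noteq> 0 \<Longrightarrow> \<bar>\<xi> $ i - real_of_int (k $ i)\<bar> \<le> 1"
  using rho_support[of "\<xi> - lattice_pt k" i] by (auto simp: sig_eq)

lemma sum_sig:
  assumes "finite F" "{m. \<forall>i. \<bar>\<xi> $ i - real_of_int (m $ i)\<bar> \<le> 1} \<subseteq> F"
  shows "(\<Sum>k\<in>F. sig k \<xi>) = 1"
proof -
  have "total \<xi> = (\<Sum>m\<in>F. \<rho> (\<xi> - lattice_pt m))"
    using assms support_subset by (intro total_eq_sum) auto
  moreover have "total \<xi> \<noteq> 0" using total_ge_1[of \<xi>] by linarith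
  ultimately have "(\<Sum>m\<in>F. \<rho> (\<xi> - lattice_pt m) / total \<xi>) = 1" by (simp add: sum_divide_distrib[symmetric])
  then show ?thesis unfolding sig_eq of_real_sum[symmetric] by simp
qed

text \<open>Low-pass symbols: for t > 0, \<open>dil t\<close> is 1 where all coordinates are at most
  1 / (2 t) in absolute value and 0 where one exceeds 1 / t. They exhaust the frequency space as t
  tends to 0.\<close>

definition dil :: "real \<Rightarrow> real ^ 'n \<Rightarrow> complex" where
  "dil t \<xi> = of_real (\<rho> (t *\<^sub>R \<xi>))"

lemma smooth_rho: "smooth_expr (\<lambda>\<xi>. of_real (\<rho> (c *\<^sub>R \<xi> - a)))"
  by (intro smooth_expr.base rho_C_infinity)

lemma norm_le_if_components:
  fixes r :: real
  assumes "\<And>i. \<bar>(\<xi> :: real ^ 'n) $ i\<bar> \<le> r"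
  shows "norm \<xi> \<le> CARD('n) * r"
proof -
  have "norm \<xi> \<le> (\<Sum>i\<in>UNIV. \<bar>\<xi> $ i\<bar>)" by (rule norm_le_l1_cart)
  also have "\<dots> \<le> (\<Sum>i\<in>(UNIV::'n set). r)" by (rule sum_mono) (rule assms)
  finally show ?thesis by simp
qed

lemma bumpI:
  assumes "smooth_expr f" "\<And>\<xi> i. f \<xi> \<noteq> 0 \<Longrightarrow> \<bar>\<xi> $ i\<bar> \<le> r"
  shows "bump (f :: real ^ 'n \<Rightarrow> complex)"
  unfolding bump_def using smooth_expr_C_infinity[OF assms(1)] norm_le_if_components assms(2) not_less by blast

lemma bump_rho_affine:
  assumes c: "c \<noteq> 0" shows "bump (\<lambda>\<xi>. complex_of_real (\<rho> (c *\<^sub>R \<xi> - a)))"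
proof (rule bumpI[OF smooth_rho])
  fix \<xi> i assume "complex_of_real (\<rho> (c *\<^sub>R \<xi> - a)) \<noteq> 0"
  then have "\<bar>c * \<xi> $ i - a $ i\<bar> \<le> 1" using rho_support[of "c *\<^sub>R \<xi> - a" i] by simp
  then have "\<bar>c\<bar> * \<bar>\<xi> $ i\<bar> \<le> 1 + norm a" using component_le_norm_cart[of a i] by (simp add: abs_mult[symmetric])
  then show "\<bar>\<xi> $ i\<bar> \<le> (1 + norm a) / \<bar>c\<bar>" using c by (simp add: field_simps)
qed

lemma bump_dil: "t \<noteq> 0 \<Longrightarrow> bump (dil t)"
  using bump_rho_affine[of t 0] by (simp add: dil_def[abs_def])

text \<open>On the support of \<open>\<rho>\<close> the locally finite sum \<open>total\<close> agrees with this globally smooth and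
  nowhere vanishing function.\<close>

definition denom :: "real ^ 'n \<Rightarrow> real" where
  "denom \<xi> = (\<Sum>m\<in>{m. \<forall>i. \<bar>0 - real_of_int (m $ i)\<bar> \<le> 6}. \<rho> (\<xi> - lattice_pt m)) + (1 - \<rho> ((1/4) *\<^sub>R \<xi>))"

text \<open>In the cube of radius 4 the lattice point nearest to \<xi> has coordinates of size at
  most 4.5, so it is among those summed and contributes 1. Outside the cube the cutoff of scale 1/4
  vanishes and the last term is 1. On the support of \<rho> that cutoff equals 1, so the last term
  disappears there.\<close>

lemma denom_ge_1: "1 \<le> denom \<xi>"
proof (cases "\<forall>i. \<bar>\<xi> $ i\<bar> \<le> 4")
  case True
  have "\<bar>0 - real_of_int (nearest \<xi> $ i)\<bar> \<le> 6" for i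
    using True[rule_format, of i] of_int_round_abs_le[of "\<xi> $ i"] unfolding nearest_def vec_lambda_beta by arith
  then have "(\<Sum>m\<in>{nearest \<xi>}. \<rho> (\<xi> - lattice_pt m)) \<le> (\<Sum>m\<in>{m. \<forall>i. \<bar>0 - real_of_int (m $ i)\<bar> \<le> 6}. \<rho> (\<xi> - lattice_pt m))"
    using finite_lattice_box[of "\<lambda>_. 0" 6] by (intro sum_mono2) auto
  then show ?thesis using rho_nearest rho_le_1[of "(1/4) *\<^sub>R \<xi>"] by (simp add: denom_def)
next
  case False
  then have "\<rho> ((1/4) *\<^sub>R \<xi>) = 0" using rho_support[of "(1/4) *\<^sub>R \<xi>"] by force
  then show ?thesis by (simp add: denom_def sum_nonneg)
qed

lemma sig_0_eq: "sig 0 \<xi> = of_real (\<rho> \<xi>) * inverse (of_real (denom \<xi>))"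
proof (cases "\<rho> \<xi> = 0")
  case False
  then have \<xi>: "\<bar>\<xi> $ i\<bar> \<le> 1" for i using rho_support by blast
  have "\<bar>((1/4) *\<^sub>R \<xi>) $ i\<bar> \<le> 1 / 2" for i
    using \<xi>[of i] by (simp add: abs_le_iff)
  then have "\<rho> ((1/4) *\<^sub>R \<xi>) = 1" by (rule rho_eq_1)
  moreover have "total \<xi> = (\<Sum>m\<in>{m. \<forall>i. \<bar>0 - real_of_int (m $ i)\<bar> \<le> 6}. \<rho> (\<xi> - lattice_pt m))"
  proof (rule total_eq_sum[OF finite_lattice_box], rule order_trans[OF support_subset], safe)
    fix m i assume "\<forall>i. \<bar>\<xi> $ i - real_of_int (m $ i)\<bar> \<le> 1"
    then show "\<bar>0 - real_of_int (m $ i)\<bar> \<le> 6" using \<xi>[of i] by (smt (verit))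
  qed
  ultimately have "denom \<xi> = total \<xi>" unfolding denom_def by linarith
  then show ?thesis by (simp add: sig_eq divide_inverse)
qed (simp add: sig_eq)

lemma smooth_sig: "smooth_expr (sig k)"
proof -
  \<comment> \<open>The factor 1 in \<open>1 *\<^sub>R \<xi>\<close> and the product with -1 put
    every term literally into the shape of a formation rule.\<close>
  have "smooth_expr (\<lambda>\<xi>. of_real (\<rho> (1 *\<^sub>R \<xi> - lattice_pt k)) *
     inverse ((\<Sum>m\<in>{m. \<forall>i. \<bar>0 - real_of_int (m $ i)\<bar> \<le> 6}. of_real (\<rho> (1 *\<^sub>R \<xi> - (lattice_pt k + lattice_pt m)))) +
       (1 + (-1) * of_real (\<rho> ((1/4) *\<^sub>R \<xi> - (1/4) *\<^sub>R lattice_pt k)))))" (is "smooth_expr ?f")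
  proof (intro smooth_expr.mult smooth_expr.inverse smooth_expr.add smooth_expr_sum smooth_expr.const smooth_rho finite_lattice_box)
    fix \<xi>
    have "(\<Sum>m\<in>{m. \<forall>i. \<bar>0 - real_of_int (m $ i)\<bar> \<le> 6}. complex_of_real (\<rho> (1 *\<^sub>R \<xi> - (lattice_pt k + lattice_pt m)))) +
       (1 + (-1) * of_real (\<rho> ((1/4) *\<^sub>R \<xi> - (1/4) *\<^sub>R lattice_pt k))) = of_real (denom (\<xi> - lattice_pt k))"
      by (simp add: denom_def diff_diff_eq scaleR_diff_right)
    then show "(\<Sum>m\<in>{m. \<forall>i. \<bar>0 - real_of_int (m $ i)\<bar> \<le> 6}. complex_of_real (\<rho> (1 *\<^sub>R \<xi> - (lattice_pt k + lattice_pt m)))) +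
       (1 + (-1) * of_real (\<rho> ((1/4) *\<^sub>R \<xi> - (1/4) *\<^sub>R lattice_pt k))) \<noteq> 0"
      using denom_ge_1[of "\<xi> - lattice_pt k"] by (simp only: of_real_eq_0_iff)
  qed
  moreover have "?f = sig k"
    by (simp add: fun_eq_iff sig_shift[of k] sig_0_eq denom_def diff_diff_eq scaleR_diff_right)
  ultimately show ?thesis by simp
qed

lemma bump_sig: "bump (sig k)"
proof (rule bumpI[OF smooth_sig])
  show "\<bar>\<xi> $ i\<bar> \<le> 1 + norm (lattice_pt k)" if "sig k \<xi> \<noteq> 0" for \<xi> i
    using sig_support[OF that, of i] component_le_norm_cart[of "lattice_pt k" i] by simp
qed

text \<open>The frequency block as a function. \<open>box_op\<close> yields it only as a
  distribution; \<open>box_op_eq\<close> identifies the two.\<close>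

definition blk :: "int ^ 'n \<Rightarrow> (real ^ 'n \<Rightarrow> complex) \<Rightarrow> real ^ 'n \<Rightarrow> complex" where
  "blk k = conv (ker (sig k))"

lemma norm_ker_sig: "cmod (ker (sig k) z) = cmod (ker (sig 0) z)"
proof -
  have "sig k = (\<lambda>\<xi>. sig 0 (\<xi> - lattice_pt k))" using sig_shift by blast
  then show ?thesis using ker_modulate[OF bump_sig, of 0 "lattice_pt k" z] by (simp add: norm_mult)
qed

text \<open>All \<open>sig k\<close> are translates of \<open>sig 0\<close>, so their kernels have
  the same absolute value.\<close>

lemma ker_sig_decaying: obtains C where "\<And>k. decaying C (ker (sig k))" "0 < C"
proof -
  obtain C where C: "decaying C (ker (sig 0))" "0 < C" using ker_decaying[OF bump_sig] by blast
  have "decaying C (ker (sig k))" for k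
    using C(1) norm_ker_sig[of k] ker_measurable[OF bump_sig] by (simp add: decaying_def)
  then show thesis using C(2) that by blast
qed

end

section \<open>Vanishing of locally integrable functions\<close>

text \<open>Each coordinate factor of \<open>decay\<close> is at least (1 + |x|)^(-2). This links
  \<open>decay\<close> to the seminorms of the Schwartz space.\<close>

lemma decay_lower_bound:
  "1 / (1 + norm (x::'a::euclidean_space)) ^ (2 * DIM('a)) \<le> decay x"
proof -
  have "(\<Prod>b\<in>(Basis::'a set). 1 / (1 + norm x)\<^sup>2) \<le> decay x"
    unfolding decay_def
  proof (intro prod_mono conjI)
    fix b :: 'a assume "b \<in> Basis"
    then have "\<bar>x \<bullet> b\<bar> \<le> norm x" by (rule Basis_le_norm)
    then have "(x \<bullet> b)\<^sup>2 \<le> (norm x)\<^sup>2" by (metis abs_le_square_iff abs_norm_cancel)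
    then have "1 + (x \<bullet> b)\<^sup>2 \<le> (1 + norm x)\<^sup>2" by (simp add: power2_sum add_increasing2)
    then show "1 / (1 + norm x)\<^sup>2 \<le> 1 / (1 + (x \<bullet> b)\<^sup>2)"
      by (intro divide_left_mono mult_pos_pos zero_less_power) (auto simp: add_pos_nonneg)
  qed auto
  then show ?thesis by (simp add: power_mult power_divide)
qed

lemma bounded_le_decay:
  assumes "norm (x::'a::euclidean_space) \<le> R"
  shows "1 \<le> (1 + R) ^ (2 * DIM('a)) * decay x"
proof -
  have R: "0 \<le> R" using assms norm_ge_zero order_trans by blast
  have p: "0 < (1 + norm x) ^ (2 * DIM('a))" by (intro zero_less_power) (simp add: add_pos_nonneg)
  have "1 = (1 + norm x) ^ (2 * DIM('a)) * (1 / (1 + norm x) ^ (2 * DIM('a)))" 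
    using less_imp_neq[OF p] by (simp only: times_divide_eq_right mult_1_right) (metis divide_self)
  also have "\<dots> \<le> (1 + R) ^ (2 * DIM('a)) * decay x"
    using assms R by (intro mult_mono decay_lower_bound power_mono) auto
  finally show ?thesis .
qed

text \<open>On a ball \<open>decay\<close> is bounded below, and the tameness bound holds at every
  centre; hence the estimate is uniform in y.\<close>

lemma tame_locally_integrable:
  fixes h :: "'a::euclidean_space \<Rightarrow> complex"
  assumes h: "tame B h" and R: "0 \<le> R"
  shows "(\<integral>\<^sup>+x. ennreal (indicator (cball 0 R) x * cmod (h (x - y))) \<partial>lborel) \<le> ennreal ((1 + R) ^ (2 * DIM('a)) * B)"
proof -
  have [measurable]: "h \<in> borel_measurable borel" using h by (rule tame_measurable)
  have "(\<integral>\<^sup>+x. ennreal (indicator (cball 0 R) x * cmod (h (x - y))) \<partial>lborel) \<le>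
      (\<integral>\<^sup>+x. ennreal ((1 + R) ^ (2 * DIM('a)) * decay x * cmod (h (x - y))) \<partial>lborel)"
    using bounded_le_decay[of _ R] R
    by (intro nn_integral_mono ennreal_leI mult_right_mono) (auto simp: indicator_def)
  also have "\<dots> = (\<integral>\<^sup>+x. ennreal ((1 + R) ^ (2 * DIM('a)) * decay (0 - x) * cmod (h (0 - x - y))) \<partial>lborel)"
    by (rule nn_integral_lborel_reflect[symmetric]) measurable
  also have "\<dots> = (\<integral>\<^sup>+x. ennreal ((1 + R) ^ (2 * DIM('a)) * decay x * cmod (h (- y - x))) \<partial>lborel)"
    by (intro nn_integral_cong) (simp add: minus_diff_commute)
  also have "\<dots> \<le> ennreal ((1 + R) ^ (2 * DIM('a)) * B)"
    using R by (intro tame_nn_bound[OF h]) auto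
  finally show ?thesis .
qed

text \<open>The measures with densities the positive and the negative part of H agree on boxes,
  which are closed under intersection and generate the Borel sets. So they coincide, hence so do
  their densities almost everywhere, and equal positive and negative parts are both 0.\<close>

lemma AE_zero_if_box_integrals_zero:
  fixes H :: "'a::euclidean_space \<Rightarrow> real"
  assumes [measurable]: "H \<in> borel_measurable borel"
    and int: "\<And>a b. integrable lborel (\<lambda>x. indicator (box a b) x * H x)"
    and zero: "\<And>a b. (LINT x|lborel. indicator (box a b) x * H x) = 0"
  shows "AE x in lborel. H x = 0"
proof -
  let ?P = "density lborel (\<lambda>x. ennreal (H x))" and ?N = "density lborel (\<lambda>x. ennreal (- H x))"
  have fin: "(\<integral>\<^sup>+x. ennreal (indicator (box a b) x * H x) \<partial>lborel) < \<infinity>" for a b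
    using int[of a b] by (auto simp: real_integrable_def top.not_eq_extremum)
  have P: "emeasure ?P (box a b) = (\<integral>\<^sup>+x. ennreal (indicator (box a b) x * H x) \<partial>lborel)" for a b
    by (subst emeasure_density) (auto intro!: nn_integral_cong simp: indicator_def)
  have N: "emeasure ?N (box a b) = (\<integral>\<^sup>+x. ennreal (- (indicator (box a b) x * H x)) \<partial>lborel)" for a b
    by (subst emeasure_density) (auto intro!: nn_integral_cong simp: indicator_def)
  have eq: "emeasure ?P (box a b) = emeasure ?N (box a b)" for a b
  proof -
    have "enn2real (\<integral>\<^sup>+x. ennreal (indicator (box a b) x * H x) \<partial>lborel) =
        enn2real (\<integral>\<^sup>+x. ennreal (- (indicator (box a b) x * H x)) \<partial>lborel)"
      using zero[of a b] unfolding real_lebesgue_integral_def[OF int] by simp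
    moreover have "(\<integral>\<^sup>+x. ennreal (- (indicator (box a b) x * H x)) \<partial>lborel) < \<infinity>"
      using int[of a b] by (auto simp: real_integrable_def top.not_eq_extremum)
    ultimately show ?thesis unfolding P N using fin[of a b]
      by (metis ennreal_enn2real infinity_ennreal_def)
  qed
  have "?P = ?N"
  proof (rule measure_eqI_generator_eq[where E = "range (\<lambda>(a, b). box a b)" and \<Omega> = UNIV and A = "\<lambda>i. box (- (real i *\<^sub>R One)) (real i *\<^sub>R One)"])
    show "Int_stable (range (\<lambda>(a, b). box a b :: 'a set))"
      by (auto simp: Int_stable_def box_Int_box)
    show "emeasure ?P X = emeasure ?N X" if "X \<in> range (\<lambda>(a, b). box a b)" for X
      using that eq by auto
    show "sets ?P = sigma_sets UNIV (range (\<lambda>(a, b). box a b))" "sets ?N = sigma_sets UNIV (range (\<lambda>(a, b). box a b))"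
      unfolding sets_density sets_lborel by (subst borel_eq_box, simp add: sets_measure_of)+
    show "(\<Union>i. box (- (real i *\<^sub>R One)) (real i *\<^sub>R One)) = (UNIV :: 'a set)"
      by (rule UN_box_eq_UNIV)
    show "emeasure ?P (box (- (real i *\<^sub>R One)) (real i *\<^sub>R One)) \<noteq> \<infinity>" for i
      using fin[of "- (real i *\<^sub>R One)" "real i *\<^sub>R One"] unfolding P by simp
  qed auto
  then have "AE x in lborel. ennreal (H x) = ennreal (- H x)"
    by (subst (asm) sigma_finite_measure.density_unique_iff[OF lborel.sigma_finite_measure_axioms]) auto
  then show ?thesis
  proof eventually_elim
    case (elim x)
    then show ?case
      by (cases "H x \<ge> 0") (auto simp: ennreal_neg ennreal_eq_0_iff dest: sym)
  qed
qed

text \<open>Averaged over a box, the dilates of \<open>\<kappa>\<close> act as an approximate identity.\<close>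

lemma tame_eq_0_AE:
  fixes h :: "'a::euclidean_space \<Rightarrow> complex"
  assumes h: "tame B h" and B: "0 \<le> B" and \<kappa>: "integrable lborel \<kappa>" "(LINT z|lborel. \<kappa> z) \<noteq> 0"
    and zero: "\<And>x n. (LINT z|lborel. \<kappa> z * h (x - inverse (real (Suc n)) *\<^sub>R z)) = 0"
  shows "AE x in lborel. h x = 0"
proof -
  have [measurable]: "h \<in> borel_measurable borel" "\<kappa> \<in> borel_measurable borel"
    using h \<kappa> by (auto intro: tame_measurable dest: borel_measurable_integrable)
  define t where "t n = inverse (real (Suc n))" for n
  have t: "t \<longlonglongrightarrow> 0" unfolding t_def[abs_def] by (rule LIMSEQ_inverse_real_of_nat)
  have box: "integrable lborel (\<lambda>x. of_real (indicator (box a b) x) * h x)" (is ?I)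
    "(LINT x|lborel. of_real (indicator (box a b) x) * h x) = 0" (is ?Z) for a b
  proof -
    let ?A = "\<lambda>x. complex_of_real (indicator (box a b) x)"
    obtain R where R: "cbox a b \<subseteq> cball 0 R" "0 \<le> R"
    proof -
      obtain e where "cbox a b \<subseteq> ball 0 e" "0 < e" using bounded_subset_ballD[OF bounded_cbox[of a b]] by blast
      then show thesis using that[of e] ball_subset_cball by fastforce
    qed
    let ?M = "(1 + R) ^ (2 * DIM('a)) * B"
    have bd: "(\<integral>\<^sup>+x. ennreal (cmod (?A x * h (x - y))) \<partial>lborel) \<le> ennreal ?M" for y
    proof (rule order_trans[OF nn_integral_mono tame_locally_integrable[OF h R(2), of y]])
      show "ennreal (cmod (?A x * h (x - y))) \<le> ennreal (indicator (cball 0 R) x * cmod (h (x - y)))" for x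
        using R(1) box_subset_cbox[of a b] by (intro ennreal_leI) (auto simp: norm_mult indicator_def)
    qed
    \<comment> \<open>Unlike h, its integral over a translated box depends continuously on the
      translation y. By hypothesis the means of m against \<kappa> vanish at every scale t n, and t
      n tending to 0 leaves m 0 times the integral of \<kappa>.\<close>
    define m where "m y = (LINT x|lborel. ?A x * h (x - y))" for y
    have "integrable lborel (\<lambda>x. ?A x * h (x - 0))"
      using le_less_trans[OF bd[of 0] ennreal_less_top] by (intro integrableI_bounded) auto
    then show ?I by simp
    have [measurable]: "m \<in> borel_measurable borel"
      unfolding m_def[abs_def] by (rule lborel.borel_measurable_lebesgue_integral) measurable
    have m_bd: "cmod (m y) \<le> ?M" for y
    proof -
      have "ennreal (cmod (m y)) \<le> ennreal ?M"
        unfolding m_def by (rule order_trans[OF cmod_integral_le_nn_integral bd])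
      then show ?thesis using R B by (simp add: ennreal_le_iff)
    qed
    have m_zero: "(LINT z|lborel. \<kappa> z * m (t n *\<^sub>R z)) = 0" for n
    proof -
      have "(LINT z|lborel. \<kappa> z * m (t n *\<^sub>R z)) = (LINT z|lborel. LINT x|lborel. \<kappa> z * (?A x * h (x - t n *\<^sub>R z)))"
        by (simp add: m_def)
      also have "\<dots> = (LINT x|lborel. LINT z|lborel. \<kappa> z * (?A x * h (x - t n *\<^sub>R z)))"
      proof (rule fubini_swap[OF pair_sigma_finite_lborel])
        have "(\<integral>\<^sup>+z. \<integral>\<^sup>+x. ennreal (cmod (\<kappa> z * (?A x * h (x - t n *\<^sub>R z)))) \<partial>lborel \<partial>lborel) =
            (\<integral>\<^sup>+z. ennreal (cmod (\<kappa> z)) * (\<integral>\<^sup>+x. ennreal (cmod (?A x * h (x - t n *\<^sub>R z))) \<partial>lborel) \<partial>lborel)"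
          by (simp add: norm_mult[of "\<kappa> _"] ennreal_mult nn_integral_cmult)
        also have "\<dots> \<le> (\<integral>\<^sup>+z. ennreal (cmod (\<kappa> z)) * ennreal ?M \<partial>lborel)"
          by (intro nn_integral_mono mult_left_mono bd) auto
        also have "\<dots> = (\<integral>\<^sup>+z. ennreal (cmod (\<kappa> z)) \<partial>lborel) * ennreal ?M"
          by (rule nn_integral_multc) measurable
        also have "\<dots> < \<infinity>"
          using \<kappa>(1) by (simp add: integrable_iff_bounded ennreal_mult_less_top)
        finally show "(\<integral>\<^sup>+z. \<integral>\<^sup>+x. ennreal (cmod (\<kappa> z * (?A x * h (x - t n *\<^sub>R z)))) \<partial>lborel \<partial>lborel) < \<infinity>" .
      qed measurable
      also have "\<dots> = (LINT x|lborel. ?A x * (LINT z|lborel. \<kappa> z * h (x - t n *\<^sub>R z)))"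
        by (simp add: mult.left_commute[of "\<kappa> _"])
      also have "\<dots> = 0" using zero by (simp add: t_def)
      finally show ?thesis .
    qed
    have m_cont: "(\<lambda>n. m (Y n)) \<longlonglongrightarrow> m 0" if Y: "Y \<longlonglongrightarrow> 0" for Y
    proof -
      obtain N where N: "\<And>n. n \<ge> N \<Longrightarrow> norm (Y n) \<le> 1"
        using Y[THEN LIMSEQ_D, of 1] less_imp_le by (metis diff_zero zero_less_one)
      have m_eq: "m y = (LINT x|lborel. ?A (x + y) * h x)" for y
      proof -
        have "m y = (LINT x|lborel. ?A ((x - y) + y) * h (x - y))" by (simp add: m_def)
        also have "\<dots> = (LINT x|lborel. ?A (x + y) * h x)" by (rule integral_lborel_shift) measurable
        finally show ?thesis .
      qed
      have "(\<lambda>n. LINT x|lborel. ?A (x + Y (n + N)) * h x) \<longlonglongrightarrow> (LINT x|lborel. ?A (x + 0) * h x)"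
      proof (rule integral_dominated_convergence[where w = "\<lambda>x. indicator (cball 0 (R + 1)) x * cmod (h x)"])
        show "integrable lborel (\<lambda>x. indicator (cball 0 (R + 1)) x * cmod (h x))"
          using le_less_trans[OF tame_locally_integrable[OF h, of "R + 1" 0] ennreal_less_top] R(2)
          by (intro integrableI_bounded, measurable) (simp_all add: abs_mult)
        show "AE x in lborel. norm (?A (x + Y (n + N)) * h x) \<le> indicator (cball 0 (R + 1)) x * cmod (h x)" for n
        proof (intro AE_I2)
          fix x
          have "norm x \<le> R + 1" if "x + Y (n + N) \<in> box a b"
          proof -
            have "norm (x + Y (n + N)) \<le> R" using that R(1) box_subset_cbox[of a b] by auto
            then show ?thesis using N[of "n + N"] norm_triangle_ineq4[of "x + Y (n + N)" "Y (n + N)"] by simp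
          qed
          then show "norm (?A (x + Y (n + N)) * h x) \<le> indicator (cball 0 (R + 1)) x * cmod (h x)"
            by (auto simp: norm_mult indicator_def)
        qed
        \<comment> \<open>Only on the boundary of the box, a null set, does the indicator fail to be
          locally constant.\<close>
        have "cbox a b - box a b \<in> null_sets lborel"
          using negligible_frontier_interval[of a b] by (simp add: negligible_iff_null_sets null_sets_completion_iff)
        then have "AE x in lborel. x \<notin> cbox a b - box a b" by (rule AE_not_in)
        then show "AE x in lborel. (\<lambda>n. ?A (x + Y (n + N)) * h x) \<longlonglongrightarrow> ?A (x + 0) * h x"
        proof eventually_elim
          case (elim x)
          have lim: "(\<lambda>n. x + Y (n + N)) \<longlonglongrightarrow> x + 0"
            using Y by (intro tendsto_intros LIMSEQ_ignore_initial_segment)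
          have "eventually (\<lambda>n. ?A (x + Y (n + N)) = ?A x) sequentially"
          proof (cases "x \<in> box a b")
            case True
            have "eventually (\<lambda>n. x + Y (n + N) \<in> box a b) sequentially"
              using topological_tendstoD[OF lim open_box] True by simp
            then show ?thesis
              by eventually_elim (use True in \<open>simp add: indicator_def\<close>)
          next
            case False
            then have x: "x \<in> - cbox a b" using elim by auto
            have "eventually (\<lambda>n. x + Y (n + N) \<in> - cbox a b) sequentially"
              by (rule topological_tendstoD[OF lim]) (use x in \<open>auto intro: open_Compl closed_cbox\<close>)
            then show ?thesis
              by eventually_elim (use x box_subset_cbox[of a b] in \<open>auto simp: indicator_def\<close>)
          qed
          then have "(\<lambda>n. ?A (x + Y (n + N))) \<longlonglongrightarrow> ?A x" by (rule tendsto_eventually)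
          then show ?case by (auto intro!: tendsto_mult)
        qed
      qed measurable
      then have "(\<lambda>n. m (Y (n + N))) \<longlonglongrightarrow> m 0" by (simp only: m_eq)
      then show ?thesis by (rule LIMSEQ_offset)
    qed
    have "(\<lambda>n. LINT z|lborel. \<kappa> z * m (t n *\<^sub>R z)) \<longlonglongrightarrow> (LINT z|lborel. \<kappa> z * m 0)"
    proof (rule integral_dominated_convergence[where w = "\<lambda>z. cmod (\<kappa> z) * ?M"])
      show "integrable lborel (\<lambda>z. cmod (\<kappa> z) * ?M)" using \<kappa>(1) by (intro integrable_mult_left integrable_norm)
      show "AE z in lborel. norm (\<kappa> z * m (t n *\<^sub>R z)) \<le> cmod (\<kappa> z) * ?M" for n
        by (intro AE_I2) (simp add: norm_mult m_bd mult_left_mono)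
      show "AE z in lborel. (\<lambda>n. \<kappa> z * m (t n *\<^sub>R z)) \<longlonglongrightarrow> \<kappa> z * m 0"
      proof (intro AE_I2 tendsto_mult tendsto_const m_cont)
        show "(\<lambda>n. t n *\<^sub>R z) \<longlonglongrightarrow> 0" for z :: 'a using tendsto_scaleR[OF t tendsto_const[of z]] by simp
      qed
    qed measurable
    then have "(LINT z|lborel. \<kappa> z * m 0) = 0" unfolding m_zero using LIMSEQ_unique tendsto_const by blast
    then have "m 0 = 0" using \<kappa>(2) by simp
    then show ?Z by (simp add: m_def)
  qed
  have re: "(\<lambda>x. Re (of_real (indicator (box a b) x) * h x)) = (\<lambda>x. indicator (box a b) x * Re (h x))"
    and im: "(\<lambda>x. Im (of_real (indicator (box a b) x) * h x)) = (\<lambda>x. indicator (box a b) x * Im (h x))" for a b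
    by auto
  have "AE x in lborel. Re (h x) = 0"
    using integrable_Re[OF box(1)] integral_Re[OF box(1)]
    by (intro AE_zero_if_box_integrals_zero) (auto simp: re box(2))
  moreover have "AE x in lborel. Im (h x) = 0"
    using integrable_Im[OF box(1)] integral_Im[OF box(1)]
    by (intro AE_zero_if_box_integrals_zero) (auto simp: im box(2))
  ultimately show ?thesis by eventually_elim (simp add: complex_eq_iff)
qed


text \<open>The set of disagreement is open and null, while a nonempty open set contains a ball of
  positive measure.\<close>

lemma continuous_eq_if_AE_eq:
  fixes f g :: "'a::euclidean_space \<Rightarrow> 'b::real_normed_vector"
  assumes "continuous_on UNIV f" "continuous_on UNIV g" and ae: "AE x in lborel. f x = g x"
  shows "f = g"
proof (rule ccontr)
  assume "f \<noteq> g"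
  then obtain x where x: "f x \<noteq> g x" by auto
  have op: "open {x. f x \<noteq> g x}" using assms by (intro open_Collect_neq)
  then obtain e where e: "e > 0" "ball x e \<subseteq> {x. f x \<noteq> g x}" using x unfolding open_contains_ball by blast
  have "emeasure lborel {x. f x \<noteq> g x} = 0"
    using ae op by (intro AE_iff_measurable[THEN iffD1, of _ lborel "\<lambda>x. f x = g x"]) auto
  moreover have "emeasure lborel (ball x e) \<le> emeasure lborel {x. f x \<noteq> g x}"
    using op e by (intro emeasure_mono) auto
  ultimately have "measure lborel (ball x e) = 0" by (simp add: measure_def)
  then show False using content_ball_pos[OF e(1), of x] by simp
qed

section \<open>Test functions and the frequency-uniform decomposition\<close>

lemma schwartz_decay:
  assumes "\<phi> \<in> schwartz"
  obtains C where "decaying C (\<phi> :: 'a::euclidean_space \<Rightarrow> complex)"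
proof -
  have "bounded (range (\<lambda>x. (1 + norm x) ^ (2 * DIM('a)) *\<^sub>R iter_deriv [] \<phi> x))"
    using assms unfolding schwartz_def by blast
  then obtain C where C: "\<And>x. norm ((1 + norm x) ^ (2 * DIM('a)) *\<^sub>R \<phi> x) \<le> C" "C > 0"
    by (auto simp: bounded_pos iter_deriv_def)
  have "cmod (\<phi> x) \<le> C * decay x" for x
  proof -
    have p: "0 < (1 + norm x) ^ (2 * DIM('a))" by (intro zero_less_power) (simp add: add_pos_nonneg)
    have "cmod (\<phi> x) \<le> C * (1 / (1 + norm x) ^ (2 * DIM('a)))"
      using C(1)[of x] p by (simp add: field_simps)
    also have "\<dots> \<le> C * decay x" using C(2) by (intro mult_left_mono decay_lower_bound) auto
    finally show ?thesis .
  qed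
  moreover have "\<phi> \<in> borel_measurable borel"
    using assms by (auto simp: schwartz_def intro: C_infinity_measurable)
  ultimately show thesis by (intro that[of C]) (simp add: decaying_def)
qed

lemma bump_iter_deriv: "bump \<phi> \<Longrightarrow> bs \<in> lists Basis \<Longrightarrow> bump (iter_deriv bs \<phi>)"
  by (induction bs) (auto simp: iter_deriv_def bump_dderiv)

lemma bump_imp_schwartz:
  assumes "bump \<phi>" shows "\<phi> \<in> schwartz"
  unfolding schwartz_def
proof (intro CollectI conjI allI ballI)
  show "C_infinity \<phi>" using assms by (simp add: bump_def)
  fix N and bs :: "'a list" assume "bs \<in> lists Basis"
  then have "bump (iter_deriv bs \<phi>)" using assms by (intro bump_iter_deriv)
  then obtain M R where M: "\<And>x. cmod (iter_deriv bs \<phi> x) \<le> M * indicator (cball 0 R) x" "0 \<le> M"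
    using bump_dominated by blast
  have "norm ((1 + norm x) ^ N *\<^sub>R iter_deriv bs \<phi> x) \<le> (1 + \<bar>R\<bar>) ^ N * M" for x
  proof (cases "norm x \<le> R")
    case True
    have "norm ((1 + norm x) ^ N *\<^sub>R iter_deriv bs \<phi> x) = (1 + norm x) ^ N * cmod (iter_deriv bs \<phi> x)" by simp
    also have "\<dots> \<le> (1 + \<bar>R\<bar>) ^ N * M"
      using True M(1)[of x] by (intro mult_mono power_mono) auto
    finally show ?thesis .
  next
    case False
    then have "iter_deriv bs \<phi> x = 0" using M(1)[of x] by auto
    then show ?thesis using M(2) by simp
  qed
  then show "bounded (range (\<lambda>x. (1 + norm x) ^ N *\<^sub>R iter_deriv bs \<phi> x))" by (auto intro!: boundedI)
qed

section \<open>Distributional blocks as functions\<close>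

context window
begin

lemma integral_rho_neq_0: "(LINT z|lborel. complex_of_real (\<rho> z)) \<noteq> 0"
proof -
  have bump: "bump (\<lambda>z. complex_of_real (\<rho> z))" using bump_dil[of 1] by (simp add: dil_def[abs_def])
  have int: "integrable lborel \<rho>" using integrable_Re[OF bump_integrable[OF bump]] by simp
  let ?Q = "cbox (\<chi> i. - (1/2)) (\<chi> i. 1/2) :: (real ^ 'n) set"
  have "measure lborel ?Q = (LINT z|lborel. indicator ?Q z)" by simp
  also have "\<dots> \<le> (LINT z|lborel. \<rho> z)"
  proof (rule integral_mono[OF _ int])
    show "integrable lborel (indicator ?Q :: _ \<Rightarrow> real)" by (intro integrable_real_indicator) (auto simp: emeasure_lborel_cbox_eq)
    show "indicator ?Q z \<le> \<rho> z" for z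
    proof (cases "z \<in> ?Q")
      case True
      then have "- (1 / 2) \<le> z $ i \<and> z $ i \<le> 1 / 2" for i
        unfolding mem_box_cart by simp
      then have "\<bar>z $ i\<bar> \<le> 1 / 2" for i by (metis abs_le_iff minus_le_iff)
      then show ?thesis using rho_eq_1[of z] True by simp
    qed auto
  qed
  finally have "measure lborel ?Q \<le> (LINT z|lborel. \<rho> z)" .
  moreover have "measure lborel ?Q > 0" by (auto simp: content_pos_lt_eq Basis_vec_def inner_axis)
  ultimately have "(LINT z|lborel. \<rho> z) \<noteq> 0" by linarith
  then show ?thesis by simp
qed

text \<open>Mollifiers made of \<open>\<rho>\<close> suffice as test functions.\<close>

lemma distr_of_eq_imp_AE_eq:
  fixes g h :: "real ^ 'n \<Rightarrow> complex"
  assumes g: "tame B g" "0 \<le> B" and h: "tame B' h" "0 \<le> B'"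
    and eq: "\<And>\<phi>. \<phi> \<in> schwartz \<Longrightarrow> (LINT x|lborel. g x * \<phi> x) = (LINT x|lborel. h x * \<phi> x)"
  shows "AE x in lborel. g x = h x"
proof -
  have [measurable]: "g \<in> borel_measurable borel" "h \<in> borel_measurable borel" "\<rho> \<in> borel_measurable borel"
    using g h rho_C_infinity by (auto intro: tame_measurable C_infinity_measurable)
  define d where "d x = g x - h x" for x
  have [measurable]: "d \<in> borel_measurable borel" unfolding d_def by measurable
  have d: "tame (B + B') d"
    unfolding tame_def
  proof (intro conjI allI)
    fix x
    have "(\<integral>\<^sup>+z. ennreal (decay z * cmod (d (x - z))) \<partial>lborel) \<le>
        (\<integral>\<^sup>+z. ennreal (decay z * cmod (g (x - z))) + ennreal (decay z * cmod (h (x - z))) \<partial>lborel)"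
      by (intro nn_integral_mono) (auto simp: d_def ennreal_plus[symmetric] distrib_left[symmetric]
        intro!: ennreal_leI mult_left_mono norm_triangle_ineq4 simp del: ennreal_plus)
    also have "\<dots> = (\<integral>\<^sup>+z. ennreal (decay z * cmod (g (x - z))) \<partial>lborel) + (\<integral>\<^sup>+z. ennreal (decay z * cmod (h (x - z))) \<partial>lborel)"
      by (rule nn_integral_add) auto
    also have "\<dots> \<le> ennreal B + ennreal B'" using g h by (intro add_mono) (auto simp: tame_def)
    finally show "(\<integral>\<^sup>+z. ennreal (decay z * cmod (d (x - z))) \<partial>lborel) \<le> ennreal (B + B')"
      using g h by (simp add: ennreal_plus)
  qed measurable
  have "AE x in lborel. d x = 0"
  proof (rule tame_eq_0_AE[OF d])
    show "integrable lborel (\<lambda>z. complex_of_real (\<rho> z))"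
      using bump_integrable[OF bump_dil[of 1]] by (simp add: dil_def[abs_def])
    fix x :: "real ^ 'n" and n
    let ?t = "inverse (real (Suc n))"
    \<comment> \<open>This is y \<mapsto> \<rho> ((x - y) / t) with t = \<open>?t\<close>, so that
      pairing with d is, up to the factor t^n, the average of d at scale t around x.\<close>
    define \<phi> where "\<phi> y = complex_of_real (\<rho> ((- real (Suc n)) *\<^sub>R y - (- real (Suc n)) *\<^sub>R x))" for y
    have b: "bump \<phi>" unfolding \<phi>_def by (rule bump_rho_affine) simp
    obtain C where C: "decaying C \<phi>" using schwartz_decay[OF bump_imp_schwartz[OF b]] by blast
    have [measurable]: "\<phi> \<in> borel_measurable borel" using b by (rule bump_measurable)
    have int: "integrable lborel (\<lambda>y. f y * \<phi> y)" if f: "tame B f" for f B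
    proof -
      have [measurable]: "f \<in> borel_measurable borel" using f by (rule tame_measurable)
      have "(\<integral>\<^sup>+y. ennreal (cmod (f y * \<phi> y)) \<partial>lborel) = (\<integral>\<^sup>+y. ennreal (cmod (f (0 - y) * \<phi> (0 - y))) \<partial>lborel)"
        by (rule nn_integral_lborel_reflect[symmetric]) measurable
      also have "\<dots> \<le> (\<integral>\<^sup>+y. ennreal (C * decay y * cmod (f (0 - y))) \<partial>lborel)"
      proof (intro nn_integral_mono ennreal_leI)
        fix y
        have "cmod (\<phi> (0 - y)) \<le> C * decay y" using C unfolding decaying_def by (metis decay_minus diff_0)
        then show "cmod (f (0 - y) * \<phi> (0 - y)) \<le> C * decay y * cmod (f (0 - y))"
          by (simp add: norm_mult mult.commute[of "cmod (f _)"] mult_right_mono)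
      qed
      also have "\<dots> \<le> ennreal (C * B)" by (rule tame_nn_bound[OF f decaying_nonneg[OF C]])
      also have "\<dots> < \<infinity>" by simp
      finally show ?thesis by (intro integrableI_bounded) auto
    qed
    have "(LINT y|lborel. d y * \<phi> y) = (LINT y|lborel. g y * \<phi> y) - (LINT y|lborel. h y * \<phi> y)"
      by (simp add: d_def left_diff_distrib int[OF g(1)] int[OF h(1)])
    also have "\<dots> = 0" using eq[OF bump_imp_schwartz[OF b]] by simp
    finally have z: "(LINT y|lborel. d y * \<phi> y) = 0" .
    have "(LINT y|lborel. d y * \<phi> y) = of_real (?t ^ DIM(real ^ 'n)) * (LINT z|lborel. d (x + ?t *\<^sub>R z) * \<phi> (x + ?t *\<^sub>R z))"
      by (rule integral_lborel_scale) auto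
    also have "(\<lambda>z. d (x + ?t *\<^sub>R z) * \<phi> (x + ?t *\<^sub>R z)) = (\<lambda>z. of_real (\<rho> (0 - z)) * d (x - ?t *\<^sub>R (0 - z)))"
      by (simp add: \<phi>_def fun_eq_iff scaleR_add_right mult.commute del: of_nat_Suc)
    also have "(LINT z|lborel. of_real (\<rho> (0 - z)) * d (x - ?t *\<^sub>R (0 - z))) = (LINT z|lborel. of_real (\<rho> z) * d (x - ?t *\<^sub>R z))"
      by (rule integral_lborel_reflect) measurable
    finally show "(LINT z|lborel. of_real (\<rho> z) * d (x - ?t *\<^sub>R z)) = 0" using z by (simp del: of_nat_Suc)
  qed (use g h integral_rho_neq_0 in auto)
  then show ?thesis by eventually_elim (simp add: d_def)
qed

text \<open>The duality is unwound on the test function: Fubini turns the Fourier transform of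
  \<open>sig k\<close> times the inverse transform of \<phi> into an integral of \<phi> against the
  kernel, and a second use of Fubini moves the kernel to f. On the way the Lebesgue measurable f0 is
  exchanged for its Borel representative f.\<close>

lemma box_op_eq:
  fixes f f0 :: "real ^ 'n \<Rightarrow> complex"
  assumes f: "tame B f" "0 \<le> B" and \<phi>: "\<phi> \<in> schwartz"
    and f0: "f0 \<in> borel_measurable lebesgue" "AE x in lborel. f0 x = f x"
  shows "box_op \<rho> k f0 \<phi> = distr_of (blk k f) \<phi>"
proof -
  obtain C where C: "decaying C \<phi>" using schwartz_decay[OF \<phi>] by blast
  obtain CK where CK: "decaying CK (ker (sig k))" using ker_decaying[OF bump_sig] by blast
  have [measurable]: "f \<in> borel_measurable borel" "\<phi> \<in> borel_measurable borel" "sig k \<in> borel_measurable borel"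
    "ker (sig k) \<in> borel_measurable borel"
    using f C by (auto intro: tame_measurable decaying_measurable bump_measurable[OF bump_sig] ker_measurable[OF bump_sig])
  let ?c = "complex_of_real ((2 * pi) powr (- (real CARD('n) / 2)))"
  have int_\<phi>: "integrable lborel \<phi>" by (rule decaying_integrable[OF C])
  have inv: "inv_fourier \<phi> = (\<lambda>\<xi>. ?c * fint \<phi> \<xi>)"
    by (simp add: inv_fourier_def fint_def fun_eq_iff integral_completion cis_conv_exp)
  have [measurable]: "fint \<phi> \<in> borel_measurable borel"
    by (intro borel_measurable_continuous_onI fint_continuous int_\<phi>)
  have cc: "?c * ?c = of_real ((2 * pi) powr (- real DIM(real ^ 'n)))"
    by (simp add: of_real_mult[symmetric] powr_add[symmetric] del: of_real_mult)
  have four: "fourier (\<lambda>\<xi>. sig k \<xi> * inv_fourier \<phi> \<xi>) x = (LINT y|lborel. \<phi> y * ker (sig k) (y - x))" for x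
  proof -
    have "fourier (\<lambda>\<xi>. sig k \<xi> * inv_fourier \<phi> \<xi>) x = ?c * (LINT \<xi>|lborel. sig k \<xi> * (?c * fint \<phi> \<xi>) * cis (- (x \<bullet> \<xi>)))"
      unfolding inv by (simp add: fourier_def integral_completion cis_conv_exp inner_commute)
    also have "\<dots> = ?c * ?c * (LINT \<xi>|lborel. LINT y|lborel. \<phi> y * (sig k \<xi> * cis ((y - x) \<bullet> \<xi>)))"
    proof -
      have "sig k \<xi> * (?c * fint \<phi> \<xi>) * cis (- (x \<bullet> \<xi>)) = ?c * (LINT y|lborel. \<phi> y * (sig k \<xi> * cis ((y - x) \<bullet> \<xi>)))" for \<xi>
      proof -
        have "(LINT y|lborel. \<phi> y * (sig k \<xi> * cis ((y - x) \<bullet> \<xi>))) = (LINT y|lborel. (\<phi> y * cis (\<xi> \<bullet> y)) * (sig k \<xi> * cis (- (x \<bullet> \<xi>))))"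
          by (intro Bochner_Integration.integral_cong refl)
            (simp add: inner_diff_left cis_mult inner_commute[of \<xi>] mult.left_commute[of "cis _"])
        then show ?thesis by (simp add: fint_def)
      qed
      then have "(\<lambda>\<xi>. sig k \<xi> * (?c * fint \<phi> \<xi>) * cis (- (x \<bullet> \<xi>))) =
          (\<lambda>\<xi>. ?c * (LINT y|lborel. \<phi> y * (sig k \<xi> * cis ((y - x) \<bullet> \<xi>))))" by (rule ext)
      then show ?thesis by (simp only: integral_mult_right_zero mult.assoc)
    qed
    also have "(LINT \<xi>|lborel. LINT y|lborel. \<phi> y * (sig k \<xi> * cis ((y - x) \<bullet> \<xi>))) =
        (LINT y|lborel. LINT \<xi>|lborel. \<phi> y * (sig k \<xi> * cis ((y - x) \<bullet> \<xi>)))"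
    proof (rule fubini_swap[OF pair_sigma_finite_lborel])
      have "(\<integral>\<^sup>+\<xi>. \<integral>\<^sup>+y. ennreal (cmod (\<phi> y * (sig k \<xi> * cis ((y - x) \<bullet> \<xi>)))) \<partial>lborel \<partial>lborel) =
         (\<integral>\<^sup>+\<xi>. ennreal (cmod (sig k \<xi>)) * (\<integral>\<^sup>+y. ennreal (cmod (\<phi> y)) \<partial>lborel) \<partial>lborel)"
        by (simp add: norm_mult ennreal_mult nn_integral_multc mult.commute)
      also have "\<dots> = (\<integral>\<^sup>+\<xi>. ennreal (cmod (sig k \<xi>)) \<partial>lborel) * (\<integral>\<^sup>+y. ennreal (cmod (\<phi> y)) \<partial>lborel)"
        by (rule nn_integral_multc) measurable
      also have "\<dots> < \<infinity>"
        using int_\<phi> bump_integrable[OF bump_sig, of k] by (simp add: integrable_iff_bounded ennreal_mult_less_top)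
      finally show "(\<integral>\<^sup>+\<xi>. \<integral>\<^sup>+y. ennreal (cmod (\<phi> y * (sig k \<xi> * cis ((y - x) \<bullet> \<xi>)))) \<partial>lborel \<partial>lborel) < \<infinity>" .
    qed measurable
    finally show ?thesis unfolding cc by (simp add: ker_def fint_def mult.left_commute[of "complex_of_real _"] flip: integral_mult_right_zero)
  qed
  have "box_op \<rho> k f0 \<phi> = (LINT x|lebesgue. f0 x * (LINT y|lborel. \<phi> y * ker (sig k) (y - x)))"
    by (simp add: box_op_def distr_inv_fourier_def distr_mult_def distr_fourier_def distr_of_def four flip: sig_def)
  also have "\<dots> = (LINT x|lborel. LINT y|lborel. \<phi> y * (ker (sig k) (y - x) * f x))"
  proof -
    have [measurable]: "(\<lambda>x. LINT y|lborel. \<phi> y * ker (sig k) (y - x)) \<in> borel_measurable borel"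
      by (rule lborel.borel_measurable_lebesgue_integral) measurable
    have "(LINT x|lebesgue. f0 x * (LINT y|lborel. \<phi> y * ker (sig k) (y - x))) = (LINT x|lebesgue. f x * (LINT y|lborel. \<phi> y * ker (sig k) (y - x)))"
    proof (rule integral_cong_AE)
      show "AE x in lebesgue. f0 x * (LINT y|lborel. \<phi> y * ker (sig k) (y - x)) = f x * (LINT y|lborel. \<phi> y * ker (sig k) (y - x))"
        using AE_completion[OF f0(2)] by eventually_elim simp
      show "(\<lambda>x. f0 x * (LINT y|lborel. \<phi> y * ker (sig k) (y - x))) \<in> borel_measurable lebesgue"
        by (intro borel_measurable_times f0(1) measurable_completion) simp
      show "(\<lambda>x. f x * (LINT y|lborel. \<phi> y * ker (sig k) (y - x))) \<in> borel_measurable lebesgue"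
        by (rule measurable_completion) measurable
    qed
    also have "\<dots> = (LINT x|lborel. f x * (LINT y|lborel. \<phi> y * ker (sig k) (y - x)))"
      by (rule integral_completion) measurable
    also have "\<dots> = (LINT x|lborel. LINT y|lborel. f x * (\<phi> y * ker (sig k) (y - x)))" by simp
    finally show ?thesis by (simp only: mult.commute[of "f _"] mult.assoc)
  qed
  also have "\<dots> = (LINT y|lborel. LINT x|lborel. \<phi> y * (ker (sig k) (y - x) * f x))"
  proof (rule fubini_swap(1)[OF pair_sigma_finite_lborel, symmetric])
    have "(\<integral>\<^sup>+y. \<integral>\<^sup>+x. ennreal (cmod (\<phi> y * (ker (sig k) (y - x) * f x))) \<partial>lborel \<partial>lborel) \<le>
        (\<integral>\<^sup>+y. ennreal (cmod (\<phi> y)) * ennreal (CK * B) \<partial>lborel)"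
    proof (rule nn_integral_mono)
      fix y
      have "(\<integral>\<^sup>+x. ennreal (cmod (\<phi> y * (ker (sig k) (y - x) * f x))) \<partial>lborel) =
         (\<integral>\<^sup>+x. ennreal (cmod (\<phi> y)) * ennreal (cmod (ker (sig k) (y - x) * f (y - (y - x)))) \<partial>lborel)"
        by (simp add: norm_mult ennreal_mult'[symmetric])
      also have "\<dots> = ennreal (cmod (\<phi> y)) * (\<integral>\<^sup>+x. ennreal (cmod (ker (sig k) (y - x) * f (y - (y - x)))) \<partial>lborel)"
        by (rule nn_integral_cmult) measurable
      also have "(\<integral>\<^sup>+x. ennreal (cmod (ker (sig k) (y - x) * f (y - (y - x)))) \<partial>lborel) = (\<integral>\<^sup>+x. ennreal (cmod (ker (sig k) x * f (y - x))) \<partial>lborel)"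
        by (rule nn_integral_lborel_reflect) measurable
      also have "\<dots> \<le> (\<integral>\<^sup>+x. ennreal (CK * decay x * cmod (f (y - x))) \<partial>lborel)"
        using CK by (intro nn_integral_mono ennreal_leI) (auto simp: norm_mult decaying_def mult_right_mono)
      also have "\<dots> \<le> ennreal (CK * B)" by (rule tame_nn_bound[OF f(1) decaying_nonneg[OF CK]])
      finally show "(\<integral>\<^sup>+x. ennreal (cmod (\<phi> y * (ker (sig k) (y - x) * f x))) \<partial>lborel) \<le> ennreal (cmod (\<phi> y)) * ennreal (CK * B)"
        by (simp add: mult_left_mono)
    qed
    also have "\<dots> = (\<integral>\<^sup>+y. ennreal (cmod (\<phi> y)) \<partial>lborel) * ennreal (CK * B)" by (rule nn_integral_multc) measurable
    also have "\<dots> < \<infinity>" using int_\<phi> by (simp add: integrable_iff_bounded ennreal_mult_less_top)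
    finally show "(\<integral>\<^sup>+y. \<integral>\<^sup>+x. ennreal (cmod (\<phi> y * (ker (sig k) (y - x) * f x))) \<partial>lborel \<partial>lborel) < \<infinity>" .
  qed measurable
  also have "\<dots> = (LINT y|lborel. blk k f y * \<phi> y)"
    by (simp add: blk_def conv_flip mult.commute)
  also have "\<dots> = distr_of (blk k f) \<phi>"
    unfolding distr_of_def by (rule integral_completion[symmetric]) (auto simp: blk_def intro!: borel_measurable_times conv_measurable)
  finally show ?thesis .
qed

end

section \<open>Series of convolutions\<close>

lemma pair_sigma_finite_lborel_count: "pair_sigma_finite lborel (count_space (UNIV :: 'k::countable set))"
  by (simp add: pair_sigma_finite_def lborel.sigma_finite_measure_axioms sigma_finite_measure_count_space)

lemma measurable_pair_count_space2:
  fixes f :: "'a \<Rightarrow> 'k::countable \<Rightarrow> 'b"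
  assumes "\<And>k. (\<lambda>x. f x k) \<in> measurable M N"
  shows "case_prod f \<in> measurable (M \<Otimes>\<^sub>M count_space UNIV) N"
proof (rule measurable_compose_countable'[where f = "\<lambda>k z. f (fst z) k" and g = snd and I = UNIV, simplified, unfolded split_beta'[symmetric]])
  show "(\<lambda>z. f (fst z) k) \<in> measurable (M \<Otimes>\<^sub>M count_space UNIV) N" for k
    by (rule measurable_compose[OF measurable_fst assms])
qed simp_all

lemma integrable_count_dominated:
  fixes f :: "'k::countable \<Rightarrow> complex"
  assumes "integrable (count_space UNIV) \<beta>" "\<And>k. cmod (f k) \<le> \<beta> k"
  shows "integrable (count_space UNIV) f"
  using assms(1) by (rule Bochner_Integration.integrable_bound) (auto intro!: AE_I2 order_trans[OF assms(2)])

lemma series_bounded: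
  fixes g :: "'k::countable \<Rightarrow> 'a \<Rightarrow> complex"
  assumes \<beta>: "integrable (count_space UNIV) \<beta>" and g: "\<And>k x. cmod (g k x) \<le> \<beta> k"
  shows "cmod (LINT k|count_space UNIV. g k x) \<le> (LINT k|count_space UNIV. \<beta> k)"
  by (rule order_trans[OF integral_norm_bound integral_mono])
    (use g integrable_count_dominated[OF \<beta> g] \<beta> in auto)

lemma series_continuous:
  fixes g :: "'k::countable \<Rightarrow> 'a::euclidean_space \<Rightarrow> complex"
  assumes \<beta>: "integrable (count_space UNIV) \<beta>" and g: "\<And>k x. cmod (g k x) \<le> \<beta> k"
    and cont: "\<And>k. continuous_on UNIV (g k)"
  shows "continuous_on UNIV (\<lambda>x. LINT k|count_space UNIV. g k x)"
proof -
  have "(\<lambda>n. LINT k|count_space UNIV. g k (X n)) \<longlonglongrightarrow> (LINT k|count_space UNIV. g k x)" if X: "X \<longlonglongrightarrow> x" for X x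
  proof (rule integral_dominated_convergence[OF _ _ \<beta>])
    show "AE k in count_space UNIV. (\<lambda>n. g k (X n)) \<longlonglongrightarrow> g k x"
      using cont X by (intro AE_I2 isCont_tendsto_compose[OF _ X]) (simp add: continuous_on_eq_continuous_at)
  qed (use g in auto)
  then show ?thesis by (auto simp: continuous_on_eq_continuous_at continuous_at_sequentially o_def)
qed

text \<open>A series is an integral over the counting measure, so exchanging it with a convolution
  is an instance of \<open>fubini_swap\<close>; \<beta> supplies absolute convergence.\<close>

lemma conv_series:
  fixes g :: "'k::countable \<Rightarrow> 'a::euclidean_space \<Rightarrow> complex"
  assumes L: "decaying C L" and \<beta>: "integrable (count_space UNIV) \<beta>" and g: "\<And>k x. cmod (g k x) \<le> \<beta> k"
    and [measurable]: "\<And>k. g k \<in> borel_measurable borel"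
  shows "conv L (\<lambda>x. LINT k|count_space UNIV. g k x) x = (LINT k|count_space UNIV. conv L (g k) x)"
proof -
  have [measurable]: "L \<in> borel_measurable borel" using L by (rule decaying_measurable)
  have "conv L (\<lambda>x. LINT k|count_space UNIV. g k x) x = (LINT z|lborel. LINT k|count_space UNIV. L z * g k (x - z))"
    by (simp add: conv_def)
  also have "\<dots> = (LINT k|count_space UNIV. LINT z|lborel. L z * g k (x - z))"
  proof (rule fubini_swap[OF pair_sigma_finite_lborel_count])
    show "(\<lambda>(z, k). L z * g k (x - z)) \<in> borel_measurable (lborel \<Otimes>\<^sub>M count_space UNIV)"
      by (rule measurable_pair_count_space2) measurable
    have "(\<integral>\<^sup>+z. \<integral>\<^sup>+k. ennreal (cmod (L z * g k (x - z))) \<partial>count_space UNIV \<partial>lborel) \<le>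
        (\<integral>\<^sup>+z. ennreal (cmod (L z)) * (\<integral>\<^sup>+k. ennreal (\<beta> k) \<partial>count_space UNIV) \<partial>lborel)"
    proof (rule nn_integral_mono)
      fix z
      have "(\<integral>\<^sup>+k. ennreal (cmod (L z * g k (x - z))) \<partial>count_space UNIV) \<le> (\<integral>\<^sup>+k. ennreal (cmod (L z)) * ennreal (\<beta> k) \<partial>count_space UNIV)"
        using g by (intro nn_integral_mono) (auto simp: norm_mult ennreal_mult' intro!: mult_left_mono ennreal_leI)
      then show "(\<integral>\<^sup>+k. ennreal (cmod (L z * g k (x - z))) \<partial>count_space UNIV) \<le> ennreal (cmod (L z)) * (\<integral>\<^sup>+k. ennreal (\<beta> k) \<partial>count_space UNIV)"
        by (simp add: nn_integral_cmult)
    qed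
    also have "\<dots> = (\<integral>\<^sup>+z. ennreal (cmod (L z)) \<partial>lborel) * (\<integral>\<^sup>+k. ennreal (\<beta> k) \<partial>count_space UNIV)"
      by (rule nn_integral_multc) measurable
    also have "\<dots> < \<infinity>"
    proof -
      have "(\<integral>\<^sup>+k. ennreal (\<beta> k) \<partial>count_space UNIV) = (\<integral>\<^sup>+k. ennreal (norm (\<beta> k)) \<partial>count_space UNIV)"
        using order_trans[OF norm_ge_zero g] by (intro nn_integral_cong) simp
      then show ?thesis
        using \<beta> decaying_integrable[OF L] by (simp add: integrable_iff_bounded ennreal_mult_less_top)
    qed
    finally show "(\<integral>\<^sup>+z. \<integral>\<^sup>+k. ennreal (cmod (L z * g k (x - z))) \<partial>count_space UNIV \<partial>lborel) < \<infinity>" .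
  qed
  finally show ?thesis by (simp add: conv_def)
qed

lemma conv_sum_kernel:
  assumes "finite F" "\<And>k. k \<in> F \<Longrightarrow> decaying (C k) (K k)" "tame B g"
  shows "conv (\<lambda>z. \<Sum>k\<in>F. K k z) g x = (\<Sum>k\<in>F. conv (K k) g x)"
  unfolding conv_def sum_distrib_right
  by (rule Bochner_Integration.integral_sum) (use assms conv_integrable in blast)

lemma ker_sum:
  assumes "finite F" "\<And>k. k \<in> F \<Longrightarrow> bump (\<tau> k)"
  shows "ker (\<lambda>\<xi>. \<Sum>k\<in>F. \<tau> k \<xi>) z = (\<Sum>k\<in>F. ker (\<tau> k) z)"
proof -
  have "fint (\<lambda>\<xi>. \<Sum>k\<in>F. \<tau> k \<xi>) z = (\<Sum>k\<in>F. fint (\<tau> k) z)"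
    unfolding fint_def sum_distrib_right
    by (rule Bochner_Integration.integral_sum) (intro integrable_mult_cis bump_integrable assms, auto)
  then show ?thesis by (simp add: ker_def sum_distrib_left)
qed

lemma tame_diff:
  assumes g: "tame B g" "0 \<le> B" and h: "tame B' h" "0 \<le> B'"
  shows "tame (B + B') (\<lambda>x. g x - h x)"
  unfolding tame_def
proof (intro conjI allI)
  have [measurable]: "g \<in> borel_measurable borel" "h \<in> borel_measurable borel"
    using g h by (auto intro: tame_measurable)
  show "(\<lambda>x. g x - h x) \<in> borel_measurable borel" by measurable
  fix x
  have "(\<integral>\<^sup>+z. ennreal (decay z * cmod (g (x - z) - h (x - z))) \<partial>lborel) \<le>
      (\<integral>\<^sup>+z. ennreal (decay z * cmod (g (x - z))) + ennreal (decay z * cmod (h (x - z))) \<partial>lborel)"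
    by (intro nn_integral_mono) (auto simp: ennreal_plus[symmetric] distrib_left[symmetric]
      intro!: ennreal_leI mult_left_mono norm_triangle_ineq4 simp del: ennreal_plus)
  also have "\<dots> = (\<integral>\<^sup>+z. ennreal (decay z * cmod (g (x - z))) \<partial>lborel) + (\<integral>\<^sup>+z. ennreal (decay z * cmod (h (x - z))) \<partial>lborel)"
    by (rule nn_integral_add) auto
  also have "\<dots> \<le> ennreal B + ennreal B'" using g h by (intro add_mono) (auto simp: tame_def)
  finally show "(\<integral>\<^sup>+z. ennreal (decay z * cmod (g (x - z) - h (x - z))) \<partial>lborel) \<le> ennreal (B + B')"
    using g h by (simp add: ennreal_plus)
qed

lemma conv_diff:
  assumes "decaying C K" "tame B g" "tame B' h"
  shows "conv K (\<lambda>x. g x - h x) x = conv K g x - conv K h x"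
  unfolding conv_def right_diff_distrib using assms conv_integrable
  by (intro Bochner_Integration.integral_diff) blast+

section \<open>Reconstruction from blocks and Bernstein's inequality\<close>

context window
begin

lemma blk_measurable: "g \<in> borel_measurable borel \<Longrightarrow> blk k g \<in> borel_measurable borel"
  unfolding blk_def by (intro conv_measurable ker_measurable bump_sig)

lemma blk_continuous: assumes "tame B g" shows "continuous_on UNIV (blk k g)"
proof -
  obtain C where "decaying C (ker (sig k))" using ker_decaying[OF bump_sig] by blast
  then show ?thesis unfolding blk_def by (intro conv_continuous[OF _ ker_continuous[OF bump_sig] assms])
qed

text \<open>Any low-pass filter \<open>dil t\<close> meets only finitely many blocks, and on its
  support the corresponding \<open>sig k\<close> add up to 1; so it does not distinguish v from V.
  The kernels of these filters form an approximate identity as t tends to 0, whence v = V almost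
  everywhere.\<close>

theorem blk_series_eq_AE:
  fixes v :: "real ^ 'n \<Rightarrow> complex"
  assumes v: "tame B v" "0 \<le> B" and \<beta>: "integrable (count_space UNIV) \<beta>" "\<And>k x. cmod (blk k v x) \<le> \<beta> k"
  defines "V \<equiv> \<lambda>x. LINT k|count_space UNIV. blk k v x"
  shows "continuous_on UNIV V" "AE x in lborel. v x = V x" "\<And>x. cmod (V x) \<le> (LINT k|count_space UNIV. \<beta> k)"
proof -
  have [measurable]: "v \<in> borel_measurable borel" using v by (auto intro: tame_measurable)
  show cont: "continuous_on UNIV V"
    unfolding V_def by (rule series_continuous[OF \<beta> blk_continuous[OF v(1)]])
  show bd: "cmod (V x) \<le> (LINT k|count_space UNIV. \<beta> k)" for x
    unfolding V_def by (rule series_bounded[OF \<beta>])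
  let ?M = "LINT k|count_space UNIV. \<beta> k"
  have M: "0 \<le> ?M" using bd norm_ge_zero order_trans by blast
  have [measurable]: "V \<in> borel_measurable borel" using cont by (rule borel_measurable_continuous_onI)
  have tV: "tame (decay_mass TYPE(real ^ 'n) * ?M) V" by (rule tame_bounded[OF _ bd]) measurable
  have td: "tame (B + decay_mass TYPE(real ^ 'n) * ?M) (\<lambda>x. v x - V x)"
    by (rule tame_diff[OF v tV]) (simp add: M less_imp_le)
  have low: "conv (ker (dil t)) V x = conv (ker (dil t)) v x" if t: "t > 0" for t x
  proof -
    have bt: "bump (dil t)" using t by (intro bump_dil) simp
    obtain C where C: "decaying C (ker (dil t))" using ker_decaying[OF bt] by blast
    \<comment> \<open>\<open>dil t\<close> vanishes beyond 1 / t in each coordinate and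
      \<open>sig k\<close> lives within distance 1 of k, so all other k have product 0.\<close>
    define F where "F = {m :: int ^ 'n. \<forall>i. \<bar>(\<lambda>_. 0) i - real_of_int (m $ i)\<bar> \<le> 1 / t + 1}"
    have F: "finite F" unfolding F_def by (rule finite_lattice_box)
    have supp: "\<bar>\<xi> $ i\<bar> \<le> 1 / t" if "dil t \<xi> \<noteq> 0" for \<xi> i
      using rho_support[of "t *\<^sub>R \<xi>" i] that t by (simp add: dil_def abs_mult field_simps)
    have prod: "conv (ker (dil t)) (blk k v) x = conv (ker (\<lambda>\<xi>. dil t \<xi> * sig k \<xi>)) v x" for k
    proof -
      obtain C' where "decaying C' (ker (sig k))" using ker_decaying[OF bump_sig] by blast
      then show ?thesis unfolding blk_def by (simp add: conv_assoc[OF C _ v(1)] conv_ker_ker[OF bt bump_sig])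
    qed
    have zero: "(\<lambda>\<xi>. dil t \<xi> * sig k \<xi>) = (\<lambda>_. 0)" if "k \<notin> F" for k
    proof (rule ext, rule ccontr)
      fix \<xi> assume "dil t \<xi> * sig k \<xi> \<noteq> 0"
      then have "\<bar>\<xi> $ i\<bar> \<le> 1 / t" "\<bar>\<xi> $ i - real_of_int (k $ i)\<bar> \<le> 1" for i
        using supp[of \<xi> i] sig_support[of k \<xi> i] by auto
      then have "\<bar>0 - real_of_int (k $ i)\<bar> \<le> 1 / t + 1" for i by (smt (verit))
      then show False using that by (simp add: F_def)
    qed
    have bm: "bump (\<lambda>\<xi>. dil t \<xi> * sig k \<xi>)" for k
    proof -
      have "smooth_expr (\<lambda>\<xi>. dil t \<xi> * sig k \<xi>)"
        using smooth_rho[of t 0] smooth_sig by (auto simp: dil_def intro!: smooth_expr.mult)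
      then show ?thesis by (rule bumpI[where r = "1 / t"]) (use supp in auto)
    qed
    have sum: "(\<Sum>k\<in>F. dil t \<xi> * sig k \<xi>) = dil t \<xi>" for \<xi>
    proof (cases "dil t \<xi> = 0")
      case False
      have "{m. \<forall>i. \<bar>\<xi> $ i - real_of_int (m $ i)\<bar> \<le> 1} \<subseteq> F"
      proof safe
        fix m assume m: "\<forall>i. \<bar>\<xi> $ i - real_of_int (m $ i)\<bar> \<le> 1"
        have "\<bar>0 - real_of_int (m $ i)\<bar> \<le> 1 / t + 1" for i
          using supp[OF False, of i] m[rule_format, of i] by linarith
        then show "m \<in> F" by (simp add: F_def)
      qed
      then show ?thesis using sum_sig[OF F] by (simp add: sum_distrib_left[symmetric])
    qed simp
    have "conv (ker (dil t)) V x = (LINT k|count_space UNIV. conv (ker (dil t)) (blk k v) x)"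
      unfolding V_def by (rule conv_series[OF C \<beta> blk_measurable]) measurable
    also have "\<dots> = (LINT k|count_space UNIV. conv (ker (\<lambda>\<xi>. dil t \<xi> * sig k \<xi>)) v x)" by (simp only: prod)
    also have "\<dots> = (\<Sum>k\<in>F. conv (ker (\<lambda>\<xi>. dil t \<xi> * sig k \<xi>)) v x)"
    proof -
      have z: "conv (ker (\<lambda>\<xi>. dil t \<xi> * sig k \<xi>)) v x = 0" if "k \<notin> F" for k
        unfolding zero[OF that] by (simp add: conv_def ker_def fint_def)
      then have sub: "{k. conv (ker (\<lambda>\<xi>. dil t \<xi> * sig k \<xi>)) v x \<noteq> 0} \<subseteq> F" by blast
      then have "(LINT k|count_space UNIV. conv (ker (\<lambda>\<xi>. dil t \<xi> * sig k \<xi>)) v x) =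
          (\<Sum>k | conv (ker (\<lambda>\<xi>. dil t \<xi> * sig k \<xi>)) v x \<noteq> 0. conv (ker (\<lambda>\<xi>. dil t \<xi> * sig k \<xi>)) v x)"
        using finite_subset[OF sub F] by (subst lebesgue_integral_count_space_finite_support) auto
      also have "\<dots> = (\<Sum>k\<in>F. conv (ker (\<lambda>\<xi>. dil t \<xi> * sig k \<xi>)) v x)"
        using sub F by (intro sum.mono_neutral_left) auto
      finally show ?thesis .
    qed
    also have "\<dots> = conv (\<lambda>z. \<Sum>k\<in>F. ker (\<lambda>\<xi>. dil t \<xi> * sig k \<xi>) z) v x"
    proof -
      have "\<forall>k. \<exists>C. decaying C (ker (\<lambda>\<xi>. dil t \<xi> * sig k \<xi>))" using ker_decaying[OF bm] by blast
      then obtain C' where "\<And>k. decaying (C' k) (ker (\<lambda>\<xi>. dil t \<xi> * sig k \<xi>))" by metis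
      then show ?thesis by (intro conv_sum_kernel[OF F _ v(1), symmetric])
    qed
    also have "(\<lambda>z. \<Sum>k\<in>F. ker (\<lambda>\<xi>. dil t \<xi> * sig k \<xi>) z) = ker (dil t)"
      by (simp add: ker_sum[OF F bm, symmetric] sum fun_eq_iff)
    finally show ?thesis .
  qed
  have "AE x in lborel. v x - V x = 0"
  proof (rule tame_eq_0_AE[OF td])
    show "0 \<le> B + decay_mass TYPE(real ^ 'n) * ?M" using v(2) M by (simp add: less_imp_le)
    have b1: "bump (dil 1)" by (rule bump_dil) simp
    show "integrable lborel (ker (dil 1))" by (rule ker_integrable[OF b1])
    \<comment> \<open>The integral of a kernel is its symbol at 0, here 1; so the averages do not
      degenerate.\<close>
    have "fhat (ker (dil 1)) 0 = 1" unfolding fhat_ker[OF b1] by (simp add: dil_def rho_eq_1)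
    then show "(LINT z|lborel. ker (dil 1) z) \<noteq> 0" by (simp add: fhat_def)
    fix x n
    let ?t = "inverse (real (Suc n))"
    have bt: "bump (\<lambda>\<xi>. dil 1 (?t *\<^sub>R \<xi>))" "(\<lambda>\<xi>. dil 1 (?t *\<^sub>R \<xi>)) = dil ?t"
      using bump_dil[of ?t] by (simp_all add: dil_def[abs_def])
    obtain C where C: "decaying C (ker (dil ?t))" using ker_decaying[OF bump_dil[of ?t]] by auto
    have "(LINT z|lborel. ker (dil 1) z * (v (x - ?t *\<^sub>R z) - V (x - ?t *\<^sub>R z))) = conv (ker (dil ?t)) (\<lambda>x. v x - V x) x"
      using conv_ker_dilate[OF b1 bt(1), of "\<lambda>x. v x - V x" x] unfolding bt(2) by simp
    also have "\<dots> = 0" using low[of ?t x] by (simp add: conv_diff[OF C v(1) tV] del: of_nat_Suc)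
    finally show "(LINT z|lborel. ker (dil 1) z * (v (x - ?t *\<^sub>R z) - V (x - ?t *\<^sub>R z))) = 0" .
  qed
  then show "AE x in lborel. v x = V x" by eventually_elim simp
qed

text \<open>A block reproduces itself under convolution with the kernel of a wider window, and such
  a convolution maps L^p to L^\<infinity> by \<open>tame_lp\<close>. The constant is the same for
  all k because moving the window only modulates the kernel.\<close>

lemma blk_bernstein:
  assumes p: "p \<ge> 1"
  obtains C where "C > 0"
    "\<And>k g A B x. tame B g \<Longrightarrow> 0 \<le> B \<Longrightarrow> lp_le p (blk k g) A \<Longrightarrow> 0 \<le> A \<Longrightarrow> cmod (blk k g x) \<le> C * A"
proof -
  have b: "bump (dil (1/2))" by (rule bump_dil) simp
  obtain C where C: "decaying C (ker (dil (1/2)))" "C > 0" using ker_decaying[OF b] by blast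
  let ?C = "C * decay_mass TYPE(real ^ 'n) powr (1 - 1 / p)"
  have "cmod (blk k g x) \<le> ?C * A" if g: "tame B g" "0 \<le> B" and lp: "lp_le p (blk k g) A" "0 \<le> A" for k g A B x
  proof -
    \<comment> \<open>\<open>dil (1/2)\<close> equals 1 where all coordinates are at most 1 in
      absolute value; moved to k it is therefore 1 on the support of \<open>sig k\<close>.\<close>
    define fat where "fat \<xi> = dil (1/2) (\<xi> - lattice_pt k)" for \<xi>
    have bf: "bump fat"
      using bump_rho_affine[of "1/2" "(1/2) *\<^sub>R lattice_pt k"] by (simp add: fat_def[abs_def] dil_def scaleR_diff_right)
    have Cf: "decaying C (ker fat)"
      unfolding decaying_def
    proof (intro conjI allI)
      show "ker fat \<in> borel_measurable borel" by (rule ker_measurable[OF bf])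
      fix z
      have "cmod (ker fat z) = cmod (ker (dil (1/2)) z)"
        unfolding fat_def[abs_def] ker_modulate[OF b] by (simp add: norm_mult)
      then show "cmod (ker fat z) \<le> C * decay z" using C(1) by (simp add: decaying_def)
    qed
    obtain CK where CK: "decaying CK (ker (sig k))" using ker_decaying[OF bump_sig] by blast
    have "(\<lambda>\<xi>. fat \<xi> * sig k \<xi>) = sig k"
    proof
      fix \<xi>
      show "fat \<xi> * sig k \<xi> = sig k \<xi>"
      proof (cases "sig k \<xi> = 0")
        case False
        then have "\<bar>((1/2) *\<^sub>R (\<xi> - lattice_pt k)) $ i\<bar> \<le> 1 / 2" for i
          using sig_support[OF False, of i] by simp
        then show ?thesis by (simp add: fat_def dil_def rho_eq_1)
      qed simp
    qed
    then have "conv (ker fat) (blk k g) = blk k g"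
      unfolding blk_def by (simp add: conv_assoc[OF Cf CK g(1)] conv_ker_ker[OF bf bump_sig])
    moreover have "cmod (conv (ker fat) (blk k g) x) \<le> C * (decay_mass TYPE(real ^ 'n) powr (1 - 1 / p) * A)"
      using p lp blk_measurable[OF tame_measurable[OF g(1)]]
      by (intro conv_bounded[OF Cf tame_lp]) auto
    ultimately show ?thesis by (simp add: mult.assoc)
  qed
  moreover have "?C > 0" using C(2) by (simp add: decay_mass_def)
  ultimately show thesis using that by blast
qed

end

section \<open>Weights on the frequency lattice\<close>

text \<open>By concavity (x + y)^a - x^a decreases in x, so it is largest at x = y, where equality
  holds. The coefficient 2^a - 1 < 1 is what the doubling argument lives on.\<close>

lemma powr_add_gain:
  fixes a x y :: real
  assumes a: "0 < a" "a < 1" and y: "0 \<le> y" "y \<le> x"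
  shows "(x + y) powr a \<le> x powr a + (2 powr a - 1) * y powr a"
proof (cases "y = 0")
  case False
  then have y0: "y > 0" using y by simp
  have "(x + y) powr a - x powr a \<le> (y + y) powr a - y powr a"
  proof (rule DERIV_nonpos_imp_nonincreasing[OF y(2)])
    fix t assume t: "y \<le> t" "t \<le> x"
    have "((\<lambda>t. (t + y) powr a - t powr a) has_real_derivative (a * (t + y) powr (a - 1) - a * t powr (a - 1))) (at t)"
      using t y0 by (auto intro!: derivative_eq_intros)
    moreover have "(t + y) powr (a - 1) \<le> t powr (a - 1)"
      using a t y0 by (intro powr_mono2') auto
    ultimately show "\<exists>d. ((\<lambda>t. (t + y) powr a - t powr a) has_real_derivative d) (at t) \<and> d \<le> 0"
      using a by (intro exI conjI) auto
  qed
  also have "(y + y) powr a - y powr a = (2 powr a - 1) * y powr a"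
    using y0 by (simp add: powr_mult left_diff_distrib flip: mult_2)
  finally show ?thesis by simp
qed simp

lemma powr_subadd:
  fixes a x y :: real
  assumes a: "0 < a" "a < 1" and "0 \<le> x" "0 \<le> y"
  shows "(x + y) powr a \<le> x powr a + y powr a"
proof -
  have "2 powr a \<le> (2::real) powr 1" using a by (intro powr_mono) auto
  then have g: "(2 powr a - 1) * z powr a \<le> z powr a" for z :: real
    using mult_right_mono[of "2 powr a - 1" 1 "z powr a"] by simp
  show ?thesis
  proof (cases "y \<le> x")
    case True
    then show ?thesis using powr_add_gain[OF a, of y x] g[of y] assms by linarith
  next
    case False
    then show ?thesis using powr_add_gain[OF a, of x y] g[of x] assms by (simp add: add.commute)
  qed
qed

lemma nn_integral_count_le:
  fixes f :: "'k::countable \<Rightarrow> ennreal"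
  assumes "\<And>F. finite F \<Longrightarrow> sum f F \<le> T"
  shows "(\<integral>\<^sup>+k. f k \<partial>count_space UNIV) \<le> T"
proof -
  let ?F = "\<lambda>n::nat. {k :: 'k. to_nat k \<le> n}"
  have fin: "finite (?F n)" for n
    by (rule finite_imageD[of to_nat]) (auto intro: finite_subset[of _ "{..n}"] inj_onI)
  have "(\<integral>\<^sup>+k. f k \<partial>count_space UNIV) = (\<integral>\<^sup>+k. (SUP n. f k * indicator (?F n) k) \<partial>count_space UNIV)"
  proof (rule nn_integral_cong)
    fix k
    show "f k = (SUP n. f k * indicator (?F n) k)"
    proof (rule antisym)
      show "f k \<le> (SUP n. f k * indicator (?F n) k)" by (rule SUP_upper2[of "to_nat k"]) auto
      show "(SUP n. f k * indicator (?F n) k) \<le> f k" by (rule SUP_least) (auto simp: indicator_def)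
    qed
  qed
  also have "\<dots> = (SUP n. \<integral>\<^sup>+k. f k * indicator (?F n) k \<partial>count_space UNIV)"
    by (rule nn_integral_monotone_convergence_SUP) (auto simp: incseq_def le_fun_def indicator_def)
  also have "\<dots> \<le> T"
  proof (rule SUP_least)
    fix n
    have "(\<integral>\<^sup>+k. f k * indicator (?F n) k \<partial>count_space UNIV) = (\<Sum>k\<in>?F n. f k * indicator (?F n) k)"
      by (rule nn_integral_count_space'[OF fin]) auto
    also have "\<dots> = sum f (?F n)" by (intro sum.cong) auto
    finally show "(\<integral>\<^sup>+k. f k * indicator (?F n) k \<partial>count_space UNIV) \<le> T" using assms[OF fin] by simp
  qed
  finally show ?thesis .
qed

text \<open>The correction 2 / (M + 1) makes the induction telescope, through 2 / ((M + 1) (M + 2))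
  = 2 / (M + 1) - 2 / (M + 2).\<close>

lemma sum_inverse_square_int: "(\<Sum>t\<in>{- int M..int M}. 1 / (1 + \<bar>real_of_int t\<bar>)\<^sup>2) \<le> 3 - 2 / (real M + 1)"
proof (induction M)
  case (Suc M)
  have "{- int (Suc M)..int (Suc M)} = insert (int (Suc M)) (insert (- int (Suc M)) {- int M..int M})" by auto
  then have "(\<Sum>t\<in>{- int (Suc M)..int (Suc M)}. 1 / (1 + \<bar>real_of_int t\<bar>)\<^sup>2) =
      2 / (real M + 2)\<^sup>2 + (\<Sum>t\<in>{- int M..int M}. 1 / (1 + \<bar>real_of_int t\<bar>)\<^sup>2)"
    by (simp add: add.commute)
  also have "\<dots> \<le> 2 / (real M + 2)\<^sup>2 + (3 - 2 / (real M + 1))" using Suc by simp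
  also have "2 / (real M + 2)\<^sup>2 \<le> 2 / ((real M + 1) * (real M + 2))"
    by (intro divide_left_mono) (auto simp: power2_eq_square intro!: mult_right_mono)
  also have "2 / ((real M + 1) * (real M + 2)) = 2 / (real M + 1) - 2 / (real M + 2)"
    by (simp add: field_simps)
  finally show ?case by (simp add: add.commute)
qed simp

text \<open>A power of the norm, so that the triangle inequality makes it stable under convolution;
  the exponent is twice the dimension, so that it is dominated by a product of summable inverse
  squares.\<close>

definition lat :: "int ^ 'n \<Rightarrow> real" where
  "lat k = 1 / (1 + norm (lattice_pt k)) ^ (2 * CARD('n))"

lemma lat_pos: "0 < lat k"
  unfolding lat_def by (intro divide_pos_pos zero_less_power) (auto simp: add_pos_nonneg)

lemma lat_summable: obtains c where "(\<integral>\<^sup>+k. ennreal (lat (k :: int ^ 'n)) \<partial>count_space UNIV) \<le> ennreal c" "0 < c"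
proof -
  have "(\<integral>\<^sup>+k. ennreal (lat (k :: int ^ 'n)) \<partial>count_space UNIV) \<le> ennreal (3 ^ CARD('n))"
  proof (rule nn_integral_count_le)
    fix F :: "(int ^ 'n) set" assume F: "finite F"
    \<comment> \<open>Chosen so that all coordinates of points of F lie in [-M, M]; over the
      resulting box the sum of products is a product of one-dimensional sums.\<close>
    define X where "X = Max (insert 0 ((\<lambda>(k, i). \<bar>k $ i\<bar>) ` (F \<times> (UNIV :: 'n set))))"
    define M where "M = nat X"
    have M: "\<bar>k $ i\<bar> \<le> int M" if "k \<in> F" for k i
    proof -
      have "\<bar>k $ i\<bar> \<le> X"
        unfolding X_def using F that by (intro Max_ge) (auto intro!: image_eqI[of _ _ "(k, i)"])
      then show ?thesis unfolding M_def by linarith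
    qed
    let ?B = "\<Pi>\<^sub>E i\<in>(UNIV :: 'n set). {- int M..int M}"
    have "lat k \<le> (\<Prod>i\<in>UNIV. 1 / (1 + \<bar>real_of_int (k $ i)\<bar>)\<^sup>2)" for k :: "int ^ 'n"
    proof -
      have "lat k = (\<Prod>i\<in>(UNIV::'n set). 1 / (1 + norm (lattice_pt k))\<^sup>2)"
        by (simp add: lat_def power_mult power_divide)
      also have "\<dots> \<le> (\<Prod>i\<in>UNIV. 1 / (1 + \<bar>real_of_int (k $ i)\<bar>)\<^sup>2)"
      proof (intro prod_mono conjI divide_left_mono power_mono)
        show "1 + \<bar>real_of_int (k $ i)\<bar> \<le> 1 + norm (lattice_pt k)" for i
          using component_le_norm_cart[of "lattice_pt k" i] by simp
      qed (auto intro!: mult_pos_pos zero_less_power add_pos_nonneg)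
      finally show ?thesis .
    qed
    then have "sum lat F \<le> (\<Sum>k\<in>F. \<Prod>i\<in>UNIV. 1 / (1 + \<bar>real_of_int (k $ i)\<bar>)\<^sup>2)" by (intro sum_mono)
    also have "\<dots> = (\<Sum>g\<in>vec_nth ` F. \<Prod>i\<in>UNIV. 1 / (1 + \<bar>real_of_int (g i)\<bar>)\<^sup>2)"
      by (subst sum.reindex) (auto simp: inj_on_def vec_nth_inject)
    also have "\<dots> \<le> (\<Sum>g\<in>?B. \<Prod>i\<in>UNIV. 1 / (1 + \<bar>real_of_int (g i)\<bar>)\<^sup>2)"
      using M by (intro sum_mono2 finite_PiE prod_nonneg) (auto simp: abs_le_iff, smt (verit))
    also have "\<dots> = (\<Prod>i\<in>(UNIV :: 'n set). \<Sum>t\<in>{- int M..int M}. 1 / (1 + \<bar>real_of_int t\<bar>)\<^sup>2)"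
      by (rule prod_sum_PiE[symmetric]) auto
    also have "\<dots> \<le> (\<Prod>i\<in>(UNIV :: 'n set). 3)"
    proof (intro prod_mono conjI sum_nonneg)
      have "3 - 2 / (real M + 1) \<le> 3" by simp
      then show "(\<Sum>t\<in>{- int M..int M}. 1 / (1 + \<bar>real_of_int t\<bar>)\<^sup>2) \<le> 3"
        using sum_inverse_square_int[of M] by linarith
    qed auto
    finally have "sum lat F \<le> 3 ^ CARD('n)" by simp
    then show "(\<Sum>k\<in>F. ennreal (lat k)) \<le> ennreal (3 ^ CARD('n))"
      by (subst sum_ennreal) (auto simp: lat_pos less_imp_le intro!: ennreal_leI)
  qed
  then show thesis by (rule that) simp
qed

lemma nn_integral_lattice_reflect:
  fixes f :: "int ^ 'n \<Rightarrow> ennreal"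
  shows "(\<integral>\<^sup>+k. f (l - k) \<partial>count_space UNIV) = (\<integral>\<^sup>+k. f k \<partial>count_space UNIV)"
  by (rule nn_integral_bij_count_space, rule bij_betwI[of _ _ _ "\<lambda>k. l - k"]) auto

text \<open>One of 1 + |m| and 1 + |l - m| is at least half of 1 + |l|. So the product of the two
  terms is at most a constant times \<open>lat l\<close> times their sum, which is summable in
  m.\<close>

lemma lat_conv_le:
  obtains C where "C > 0"
    "\<And>l :: int ^ 'n. (\<integral>\<^sup>+m. ennreal (lat m * lat (l - m)) \<partial>count_space UNIV) \<le> ennreal (C * lat l)"
proof -
  obtain c where c: "(\<integral>\<^sup>+k. ennreal (lat (k :: int ^ 'n)) \<partial>count_space UNIV) \<le> ennreal c" "0 < c"
    by (rule lat_summable)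
  let ?d = "2 * CARD('n)"
  let ?C = "2 ^ ?d * (c + c)"
  have gen: "1 / X * (1 / Y) \<le> c * (1 / Z) * (1 / X + 1 / Y)" if "Z \<le> c * (X + Y)" "X > 0" "Y > 0" "Z > 0" for X Y Z c :: real
  proof -
    have "1 / X * (1 / Y) = (1 / (X * Y * Z)) * Z" using that by simp
    also have "\<dots> \<le> (1 / (X * Y * Z)) * (c * (X + Y))" using that by (intro mult_left_mono) auto
    also have "\<dots> = c * (1 / Z) * (1 / X + 1 / Y)" using that by (simp add: field_simps)
    finally show ?thesis .
  qed
  have pt: "lat m * lat (l - m) \<le> 2 ^ ?d * lat l * (lat m + lat (l - m))" for l m :: "int ^ 'n"
  proof -
    define x y z where "x = 1 + norm (lattice_pt m)" and "y = 1 + norm (lattice_pt (l - m))" and "z = 1 + norm (lattice_pt l)"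
    have pos: "x > 0" "y > 0" "z > 0" unfolding x_def y_def z_def by (auto simp: add_pos_nonneg)
    have "norm (lattice_pt l) \<le> norm (lattice_pt m) + norm (lattice_pt (l - m))"
      using norm_triangle_ineq[of "lattice_pt m" "lattice_pt (l - m)"] by simp
    then have "z \<le> x + y" unfolding x_def y_def z_def by linarith
    then have "z \<le> 2 * max x y" using max.cobounded1[of x y] max.cobounded2[of y x] by linarith
    then have "z ^ ?d \<le> (2 * max x y) ^ ?d" using pos by (intro power_mono) auto
    also have "\<dots> \<le> 2 ^ ?d * (x ^ ?d + y ^ ?d)"
      using pos by (auto simp: power_mult_distrib max_def)
    finally have "z ^ ?d \<le> 2 ^ ?d * (x ^ ?d + y ^ ?d)" .
    moreover have P: "x ^ ?d > 0" "y ^ ?d > 0" "z ^ ?d > 0" using pos by (auto intro: zero_less_power)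
    ultimately have "1 / x ^ ?d * (1 / y ^ ?d) \<le> 2 ^ ?d * (1 / z ^ ?d) * (1 / x ^ ?d + 1 / y ^ ?d)"
      by (rule gen)
    then show ?thesis by (simp add: lat_def x_def y_def z_def)
  qed
  have "(\<integral>\<^sup>+m. ennreal (lat m * lat (l - m)) \<partial>count_space UNIV) \<le> ennreal (?C * lat l)" for l :: "int ^ 'n"
  proof -
    have "(\<integral>\<^sup>+m. ennreal (lat m * lat (l - m)) \<partial>count_space UNIV) \<le>
        (\<integral>\<^sup>+m. ennreal (2 ^ ?d * lat l) * (ennreal (lat m) + ennreal (lat (l - m))) \<partial>count_space UNIV)"
      using pt by (intro nn_integral_mono) (simp add: ennreal_mult'[symmetric] ennreal_plus[symmetric] lat_pos less_imp_le ennreal_leI del: ennreal_plus)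
    also have "\<dots> = ennreal (2 ^ ?d * lat l) * ((\<integral>\<^sup>+m. ennreal (lat (m :: int ^ 'n)) \<partial>count_space UNIV) + (\<integral>\<^sup>+m. ennreal (lat (l - m)) \<partial>count_space UNIV))"
      by (simp add: nn_integral_cmult nn_integral_add)
    also have "(\<integral>\<^sup>+m. ennreal (lat (l - m)) \<partial>count_space UNIV) = (\<integral>\<^sup>+m. ennreal (lat (m :: int ^ 'n)) \<partial>count_space UNIV)"
      by (rule nn_integral_lattice_reflect)
    also have "ennreal (2 ^ ?d * lat l) * ((\<integral>\<^sup>+m. ennreal (lat (m :: int ^ 'n)) \<partial>count_space UNIV) + (\<integral>\<^sup>+m. ennreal (lat (m :: int ^ 'n)) \<partial>count_space UNIV)) \<le>
        ennreal (2 ^ ?d * lat l) * (ennreal c + ennreal c)"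
      by (intro mult_left_mono add_mono c) auto
    also have "\<dots> = ennreal (?C * lat l)"
      using c(2) lat_pos[of l] by (simp add: ennreal_mult'[symmetric] ennreal_plus[symmetric] ac_simps less_imp_le del: ennreal_plus)
    finally show ?thesis .
  qed
  moreover have "?C > 0" using c(2) by simp
  ultimately show thesis using that by blast
qed

section \<open>The product estimate\<close>

text \<open>The sequence \<open>b\<close> majorizes the weighted block norms of the inner function. As it
  absorbs convolution with \<open>lat\<close>, all estimates of compositions become pointwise in \<open>k\<close>.\<close>

locale gevrey = window \<rho> for \<rho> :: "real ^ 'n \<Rightarrow> real" +
  fixes s p Cb :: real and b :: "int ^ 'n \<Rightarrow> real"
  assumes s: "s > 1" and p: "p \<ge> 1" and b_pos: "\<And>k. 0 < b k" and Cb: "0 < Cb"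
    and b_conv: "\<And>l. (\<integral>\<^sup>+k. ennreal (b k * lat (l - k)) \<partial>count_space UNIV) \<le> ennreal (Cb * b l)"
begin

definition wt :: "int ^ 'n \<Rightarrow> real" where
  "wt k = exp (norm (lattice_pt k) powr (1 / s))"

text \<open>The share of its weight exponent that the lower of two frequencies contributes to a
  product; below 1 because s > 1.\<close>

definition gain :: real where
  "gain = 2 powr (1 / s) - 1"

lemma wt_pos [simp]: "0 < wt k" and wt_neq_0 [simp]: "wt k \<noteq> 0" and wt_ge_1: "1 \<le> wt k"
  by (simp_all add: wt_def)

lemma gain: "0 < gain" "gain < 1"
proof -
  have "(2::real) powr 0 < 2 powr (1 / s)" "2 powr (1 / s) < (2::real) powr 1"
    using s by (intro powr_less_mono; simp)+
  then show "0 < gain" "gain < 1" by (simp_all add: gain_def)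
qed

text \<open>c accounts for the width of the windows: blocks k and m feed not only the block k + m
  but also nearby ones, which by subadditivity costs a constant factor.\<close>

lemma wt_gain:
  assumes "norm (lattice_pt l) \<le> norm (lattice_pt k) + norm (lattice_pt m) + c" "norm (lattice_pt m) \<le> norm (lattice_pt k)" "0 \<le> c"
  shows "wt l \<le> exp (c powr (1 / s)) * wt k * wt m powr gain"
proof -
  have a: "0 < 1 / s" "1 / s < 1" using s by auto
  have "norm (lattice_pt l) powr (1 / s) \<le> (norm (lattice_pt k) + norm (lattice_pt m) + c) powr (1 / s)"
    using assms a by (intro powr_mono2) auto
  also have "\<dots> \<le> (norm (lattice_pt k) + norm (lattice_pt m)) powr (1 / s) + c powr (1 / s)"
    using assms by (intro powr_subadd[OF a]) auto
  also have "(norm (lattice_pt k) + norm (lattice_pt m)) powr (1 / s) \<le> norm (lattice_pt k) powr (1 / s) + gain * norm (lattice_pt m) powr (1 / s)"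
    unfolding gain_def using assms by (intro powr_add_gain[OF a]) auto
  finally show ?thesis
    by (simp add: wt_def exp_powr_real mult.commute[of _ gain] flip: exp_add)
qed


text \<open>Full weight in L^p, measured against \<open>b\<close>: what a product demands of the
  factor of higher frequency.\<close>

definition lp_dom :: "real \<Rightarrow> (real ^ 'n \<Rightarrow> complex) \<Rightarrow> bool" where
  "lp_dom N v \<longleftrightarrow> (\<forall>k. lp_le p (blk k v) (N * b k / wt k))"

text \<open>What a product demands of the factor of lower frequency: uniform bounds with the reduced
  weight, and a factor \<open>lat\<close> that makes the block series absolutely convergent.\<close>

definition sup_dom :: "real \<Rightarrow> (real ^ 'n \<Rightarrow> complex) \<Rightarrow> bool" where
  "sup_dom S v \<longleftrightarrow> (\<forall>k x. cmod (blk k v x) \<le> S * lat k / wt k powr gain)"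

lemma sup_domD: assumes "sup_dom S v" "0 \<le> S"
  shows "cmod (blk k v x) \<le> S * lat k"
proof -
  have w: "1 \<le> wt k powr gain" using gain wt_ge_1 by (simp add: ge_one_powr_ge_zero)
  have "cmod (blk k v x) \<le> S * lat k / wt k powr gain" using assms(1) by (simp add: sup_dom_def)
  also have "\<dots> \<le> S * lat k"
    using divide_left_mono[OF w, of "S * lat k"] assms(2) lat_pos[of k] by (simp add: less_imp_le)
  finally show ?thesis .
qed

lemma lat_integrable: "integrable (count_space UNIV) (\<lambda>k :: int ^ 'n. S * lat k)"
proof -
  obtain c where c: "(\<integral>\<^sup>+k. ennreal (lat (k :: int ^ 'n)) \<partial>count_space UNIV) \<le> ennreal c"
    by (rule lat_summable)
  have "integrable (count_space UNIV) (\<lambda>k :: int ^ 'n. lat k)"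
    using le_less_trans[OF c ennreal_less_top] by (intro integrableI_bounded) (auto simp: lat_pos less_imp_le)
  then show ?thesis by simp
qed

text \<open>Both sides are continuous, which turns equality almost everywhere into equality at every
  point.\<close>

lemma blk_series_eq:
  assumes v: "continuous_on UNIV v" "\<And>x. cmod (v x) \<le> M" and S: "sup_dom S v" "0 \<le> S"
  shows "v x = (LINT k|count_space UNIV. blk k v x)"
proof -
  have M: "0 \<le> M" using v(2) norm_ge_zero order_trans by blast
  have t: "tame (decay_mass TYPE(real ^ 'n) * M) v"
    by (rule tame_bounded[OF borel_measurable_continuous_onI[OF v(1)] v(2)])
  have nn: "0 \<le> decay_mass TYPE(real ^ 'n) * M" using M by (simp add: less_imp_le)
  note V = blk_series_eq_AE[OF t nn lat_integrable sup_domD[OF S]]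
  show ?thesis using continuous_eq_if_AE_eq[OF v(1) V(1,2)] by (rule fun_cong)
qed

lemma lp_le_mult_bounded:
  fixes g h :: "real ^ 'n \<Rightarrow> complex"
  assumes "lp_le p g A" "\<And>x. cmod (h x) \<le> B" "0 \<le> A" and [measurable]: "g \<in> borel_measurable borel"
  shows "lp_le p (\<lambda>x. g x * h x) (A * B)"
proof -
  have B: "0 \<le> B" using assms(2) norm_ge_zero order_trans by blast
  have "(\<integral>\<^sup>+x. ennreal (cmod (g x * h x) powr p) \<partial>lborel) \<le> (\<integral>\<^sup>+x. ennreal (B powr p) * ennreal (cmod (g x) powr p) \<partial>lborel)"
  proof (intro nn_integral_mono)
    fix x
    have "cmod (g x * h x) powr p = cmod (h x) powr p * cmod (g x) powr p"
      by (simp add: norm_mult powr_mult mult.commute)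
    also have "\<dots> \<le> B powr p * cmod (g x) powr p"
      using assms(2)[of x] p by (intro mult_right_mono powr_mono2) auto
    finally show "ennreal (cmod (g x * h x) powr p) \<le> ennreal (B powr p) * ennreal (cmod (g x) powr p)"
      by (simp add: ennreal_mult'[symmetric] ennreal_leI)
  qed
  also have "\<dots> = ennreal (B powr p) * (\<integral>\<^sup>+x. ennreal (cmod (g x) powr p) \<partial>lborel)"
    by (rule nn_integral_cmult) measurable
  also have "\<dots> \<le> ennreal (B powr p) * ennreal (A powr p)"
    using assms(1) by (intro mult_left_mono) (auto simp: lp_le_def)
  also have "\<dots> = ennreal ((A * B) powr p)"
    using assms(3) B by (simp add: powr_mult ennreal_mult'[symmetric] mult.commute)
  finally show ?thesis by (simp add: lp_le_def)
qed

lemma blk_lp: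
  obtains C where "C > 0"
    "\<And>k g A. g \<in> borel_measurable borel \<Longrightarrow> lp_le p g A \<Longrightarrow> 0 < A \<Longrightarrow> lp_le p (blk k g) (C * A)"
proof -
  obtain C where C: "\<And>k. decaying C (ker (sig k))" "0 < C" using ker_sig_decaying by blast
  show thesis
  proof (rule that[of "C * decay_mass TYPE(real ^ 'n)"])
    show "0 < C * decay_mass TYPE(real ^ 'n)" using C(2) by simp
    show "lp_le p (blk k g) (C * decay_mass TYPE(real ^ 'n) * A)"
      if "g \<in> borel_measurable borel" "lp_le p g A" "0 < A" for k g A
      unfolding blk_def using conv_lp[OF C(1) that(1) p that(2,3) C(2)] .
  qed
qed

definition dominated :: "real \<Rightarrow> real \<Rightarrow> real \<Rightarrow> (real ^ 'n \<Rightarrow> complex) \<Rightarrow> bool" where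
  "dominated M N S v \<longleftrightarrow> continuous_on UNIV v \<and> (\<forall>x. cmod (v x) \<le> M) \<and> lp_dom N v \<and> sup_dom S v \<and> 0 < N \<and> 0 < S"

text \<open>Unless l is close to k + m the block vanishes, since frequencies add. Otherwise the
  factor of higher frequency is taken in L^p and the other in L^\<infinity>, and
  \<open>wt_gain\<close> distributes the weight. The factor \<open>lat (l - k - m)\<close> encodes
  the closeness in a form that can be summed by convolution.\<close>

lemma blk_mult_blk_lp:
  obtains C where "C > 0"
    "\<And>v v' M M' N N' S S' l k m. dominated M N S v \<Longrightarrow> dominated M' N' S' v' \<Longrightarrow>
      lp_le p (blk l (\<lambda>x. blk k v x * blk m v' x)) (C * (N * S' * (b k * lat m) + N' * S * (b m * lat k)) * lat (l - k - m) / wt l)"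
proof -
  obtain C where C: "C > 0" "\<And>k g A. g \<in> borel_measurable borel \<Longrightarrow> lp_le p g A \<Longrightarrow> 0 < A \<Longrightarrow> lp_le p (blk k g) (C * A)"
    using blk_lp by blast
  \<comment> \<open>Three windows, each of radius 1 per coordinate, allow l - k - m coordinates up
    to 3; r bounds its norm, and the next constant is a lower bound of \<open>lat\<close>
    there.\<close>
  define r where "r = 3 * real CARD('n)"
  define c0 where "c0 = 1 / (1 + r) ^ (2 * CARD('n))"
  have r: "0 \<le> r" by (simp add: r_def)
  have c0: "c0 > 0" unfolding c0_def using r by (intro divide_pos_pos zero_less_power) auto
  define D where "D = C * exp (r powr (1 / s)) / c0"
  have D: "D > 0" using C(1) c0 by (simp add: D_def)
  \<comment> \<open>The case where m is the lower frequency; the other case follows by exchanging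
    the factors.\<close>
  have one_side: "lp_le p (blk l g) (D * (N * S' * (b k * lat m)) * lat (l - k - m) / wt l)"
    if g: "g \<in> borel_measurable borel" "lp_le p g (N * b k / wt k * (S' * lat m / wt m powr gain))"
      and pos: "0 < N" "0 < S'" and near: "\<And>i. \<bar>real_of_int ((l - k - m) $ i)\<bar> \<le> 3"
      and le: "norm (lattice_pt m) \<le> norm (lattice_pt k)" for g N S' l k m
  proof -
    let ?A = "N * b k / wt k * (S' * lat m / wt m powr gain)"
    have A: "0 < ?A" using pos b_pos lat_pos by (auto intro!: mult_pos_pos divide_pos_pos)
    have nr: "norm (lattice_pt (l - k - m)) \<le> r"
      unfolding r_def mult.commute[of 3] by (rule norm_le_if_components) (use near in \<open>simp only: lattice_pt_nth\<close>)
    have latn: "c0 \<le> lat (l - k - m)"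
      unfolding c0_def lat_def using nr r
      by (intro divide_left_mono power_mono mult_pos_pos zero_less_power) (auto simp: add_pos_nonneg)
    have "norm (lattice_pt l) \<le> norm (lattice_pt k) + norm (lattice_pt m) + r"
    proof -
      have "lattice_pt l = lattice_pt k + lattice_pt m + lattice_pt (l - k - m)" by (simp add: vec_eq_iff)
      then show ?thesis
        using norm_triangle_ineq[of "lattice_pt k + lattice_pt m" "lattice_pt (l - k - m)"]
          norm_triangle_ineq[of "lattice_pt k" "lattice_pt m"] nr by simp
    qed
    then have w: "wt l \<le> exp (r powr (1 / s)) * wt k * wt m powr gain" by (rule wt_gain[OF _ le r])
    have wm: "0 < wt m powr gain" by simp
    have "C * ?A * (wt l * c0) \<le> C * ?A * ((exp (r powr (1 / s)) * wt k * wt m powr gain) * lat (l - k - m))"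
    proof (rule mult_left_mono[OF mult_mono[OF w latn _ less_imp_le[OF c0]]])
      show "0 \<le> C * ?A" by (rule mult_nonneg_nonneg[OF less_imp_le[OF C(1)] less_imp_le[OF A]])
      show "0 \<le> exp (r powr (1 / s)) * wt k * wt m powr gain" by (simp add: less_imp_le)
    qed
    also have "\<dots> = C * exp (r powr (1 / s)) * (N * S' * (b k * lat m)) * lat (l - k - m)"
      using wm by (simp add: field_simps)
    finally have "C * ?A \<le> D * (N * S' * (b k * lat m)) * lat (l - k - m) / wt l"
      using c0 by (simp add: D_def field_simps)
    then show ?thesis
      using p by (intro lp_le_mono[OF C(2)[OF g A] mult_nonneg_nonneg[OF less_imp_le[OF C(1)] less_imp_le[OF A]]]) auto
  qed
  have main: "lp_le p (blk l (\<lambda>x. blk k v x * blk m v' x)) (D * (N * S' * (b k * lat m) + N' * S * (b m * lat k)) * lat (l - k - m) / wt l)"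
    if dom: "dominated M N S v" "dominated M' N' S' v'" for v v' M M' N N' S S' l k m
  proof -
    have v: "v \<in> borel_measurable borel" "\<And>x. cmod (v x) \<le> M" "lp_dom N v" "sup_dom S v" "0 < N" "0 < S"
      and v': "v' \<in> borel_measurable borel" "\<And>x. cmod (v' x) \<le> M'" "lp_dom N' v'" "sup_dom S' v'" "0 < N'" "0 < S'"
      using dom by (auto simp: dominated_def intro: borel_measurable_continuous_onI)
  show ?thesis
  proof (cases "\<forall>i. \<bar>real_of_int ((l - k - m) $ i)\<bar> \<le> 3")
    case False
    then obtain i where i: "3 < \<bar>real_of_int ((l - k - m) $ i)\<bar>" by (auto simp: not_le)
    have M: "0 \<le> decay_mass TYPE(real ^ 'n) * M" "0 \<le> decay_mass TYPE(real ^ 'n) * M'"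
      using order_trans[OF norm_ge_zero v(2)] order_trans[OF norm_ge_zero v'(2)] by (simp_all add: less_imp_le)
    have "sig k \<omega> * sig m \<xi> * sig l (\<omega> + \<xi>) = 0" for \<omega> \<xi>
    proof (rule ccontr)
      assume "\<not> ?thesis"
      then have "\<bar>\<omega> $ i - real_of_int (k $ i)\<bar> \<le> 1" "\<bar>\<xi> $ i - real_of_int (m $ i)\<bar> \<le> 1"
        "\<bar>(\<omega> + \<xi>) $ i - real_of_int (l $ i)\<bar> \<le> 1"
        using sig_support[of k \<omega> i] sig_support[of m \<xi> i] sig_support[of l "\<omega> + \<xi>" i] by auto
      then show False using i by simp
    qed
    then have "blk l (\<lambda>x. blk k v x * blk m v' x) = (\<lambda>x. 0)"
      unfolding blk_def
      by (intro ext conv_ker_mult_eq_0[OF bump_sig bump_sig bump_sig tame_bounded[OF v(1,2)] M(1) tame_bounded[OF v'(1,2)] M(2)])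
    then show ?thesis using p by (simp add: lp_le_def)
  next
    case True
    have meas: "blk k v \<in> borel_measurable borel" "blk m v' \<in> borel_measurable borel"
      using v v' by (auto intro: blk_measurable)
    have mm: "(\<lambda>x. blk k v x * blk m v' x) \<in> borel_measurable borel" "(\<lambda>x. blk m v' x * blk k v x) \<in> borel_measurable borel"
      using meas by (auto intro: borel_measurable_times)
    have pos: "0 < D * (N * S' * (b k * lat m)) * lat (l - k - m) / wt l" "0 < D * (N' * S * (b m * lat k)) * lat (l - k - m) / wt l"
      using D v v' b_pos lat_pos by (auto intro!: mult_pos_pos divide_pos_pos)
    show ?thesis
    proof (cases "norm (lattice_pt m) \<le> norm (lattice_pt k)")
      case le: True
      have "lp_le p (\<lambda>x. blk k v x * blk m v' x) (N * b k / wt k * (S' * lat m / wt m powr gain))"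
        using v v' b_pos[of k] meas by (intro lp_le_mult_bounded) (auto simp: lp_dom_def sup_dom_def less_imp_le)
      then have "lp_le p (blk l (\<lambda>x. blk k v x * blk m v' x)) (D * (N * S' * (b k * lat m)) * lat (l - k - m) / wt l)"
        using True by (intro one_side[OF mm(1) _ v(5) v'(6) _ le]) auto
      then show ?thesis
        by (rule lp_le_mono) (use pos p in \<open>auto simp: distrib_left distrib_right add_divide_distrib\<close>)
    next
      case False
      then have le: "norm (lattice_pt k) \<le> norm (lattice_pt m)" by simp
      have sw: "l - m - k = l - k - m" by (simp add: algebra_simps)
      have "lp_le p (\<lambda>x. blk m v' x * blk k v x) (N' * b m / wt m * (S * lat k / wt k powr gain))"
        using v v' b_pos[of m] meas by (intro lp_le_mult_bounded) (auto simp: lp_dom_def sup_dom_def less_imp_le)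
      then have "lp_le p (blk l (\<lambda>x. blk m v' x * blk k v x)) (D * (N' * S * (b m * lat k)) * lat (l - m - k) / wt l)"
        using True by (intro one_side[OF mm(2) _ v'(5) v(6) _ le]) (auto simp: sw)
      then have "lp_le p (blk l (\<lambda>x. blk k v x * blk m v' x)) (D * (N' * S * (b m * lat k)) * lat (l - k - m) / wt l)"
        by (simp only: sw mult.commute[of "blk m v' _"])
      then show ?thesis
        by (rule lp_le_mono) (use pos p in \<open>auto simp: distrib_left distrib_right add_divide_distrib\<close>)
    qed
  qed
  qed
  show thesis by (rule that[OF D], rule main)
qed

end

context gevrey
begin

text \<open>Summing over m with \<open>lat_conv_le\<close> leaves a multiple of
  \<open>lat (l - k)\<close>, and \<open>b_conv\<close> absorbs the sum over k. The second form is
  the first with k and m exchanged.\<close>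

lemma nn_integral_triple:
  obtains C where "C > 0"
    "\<And>l. (\<integral>\<^sup>+(k, m). ennreal (b k * lat m * lat (l - k - m)) \<partial>count_space UNIV) \<le> ennreal (C * b l)"
    "\<And>l. (\<integral>\<^sup>+(k, m). ennreal (b m * lat k * lat (l - k - m)) \<partial>count_space UNIV) \<le> ennreal (C * b l)"
proof -
  obtain c where c: "c > 0" "\<And>l :: int ^ 'n. (\<integral>\<^sup>+m. ennreal (lat m * lat (l - m)) \<partial>count_space UNIV) \<le> ennreal (c * lat l)"
    using lat_conv_le by blast
  have it: "(\<integral>\<^sup>+k. \<integral>\<^sup>+m. ennreal (b k * lat m * lat (l - k - m)) \<partial>count_space UNIV \<partial>count_space UNIV) \<le> ennreal (c * Cb * b l)" for l
  proof -
    have "(\<integral>\<^sup>+k. \<integral>\<^sup>+m. ennreal (b k * lat m * lat (l - k - m)) \<partial>count_space UNIV \<partial>count_space UNIV) =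
        (\<integral>\<^sup>+k. ennreal (b k) * (\<integral>\<^sup>+m. ennreal (lat m * lat ((l - k) - m)) \<partial>count_space UNIV) \<partial>count_space UNIV)"
      by (intro nn_integral_cong) (simp add: nn_integral_cmult[symmetric] ennreal_mult'[symmetric] b_pos less_imp_le mult.assoc)
    also have "\<dots> \<le> (\<integral>\<^sup>+k. ennreal (b k) * ennreal (c * lat (l - k)) \<partial>count_space UNIV)"
      by (intro nn_integral_mono mult_left_mono c) auto
    also have "\<dots> = ennreal c * (\<integral>\<^sup>+k. ennreal (b k * lat (l - k)) \<partial>count_space UNIV)"
      using c(1) by (subst nn_integral_cmult[symmetric]) (auto simp: ennreal_mult'[symmetric] b_pos less_imp_le ac_simps intro!: nn_integral_cong)
    also have "\<dots> \<le> ennreal c * ennreal (Cb * b l)" by (intro mult_left_mono b_conv) auto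
    finally show ?thesis using c(1) by (simp add: ennreal_mult'[symmetric] mult.assoc)
  qed
  have 1: "(\<integral>\<^sup>+(k, m). ennreal (b k * lat m * lat (l - k - m)) \<partial>count_space UNIV) \<le> ennreal (c * Cb * b l)" for l
    using it[of l] by (subst nn_integral_fst_count_space[symmetric]) simp
  have 2: "(\<integral>\<^sup>+(k, m). ennreal (b m * lat k * lat (l - k - m)) \<partial>count_space UNIV) \<le> ennreal (c * Cb * b l)" for l
    using it[of l] by (subst nn_integral_snd_count_space[symmetric]) (simp add: diff_diff_eq add.commute)
  show thesis by (rule that[OF _ 1 2]) (simp add: c(1) Cb)
qed

text \<open>Minkowski's inequality over pairs of blocks. Each term pairs one strong constant N with
  one weak constant S: in a square the full bound enters once and is multiplied only by the weaker
  one.\<close>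

theorem lp_dom_mult:
  obtains C where "C > 0"
    "\<And>v v' M M' N N' S S'. dominated M N S v \<Longrightarrow> dominated M' N' S' v' \<Longrightarrow>
      lp_dom (C * (N * S' + N' * S)) (\<lambda>x. v x * v' x)"
proof -
  obtain C where C: "C > 0" and pair: "\<And>v v' M M' N N' S S' l k m. dominated M N S v \<Longrightarrow> dominated M' N' S' v' \<Longrightarrow>
      lp_le p (blk l (\<lambda>x. blk k v x * blk m v' x)) (C * (N * S' * (b k * lat m) + N' * S * (b m * lat k)) * lat (l - k - m) / wt l)"
    using blk_mult_blk_lp by blast
  obtain D where D: "D > 0"
    "\<And>l. (\<integral>\<^sup>+(k, m). ennreal (b k * lat m * lat (l - k - m)) \<partial>count_space UNIV) \<le> ennreal (D * b l)"
    "\<And>l. (\<integral>\<^sup>+(k, m). ennreal (b m * lat k * lat (l - k - m)) \<partial>count_space UNIV) \<le> ennreal (D * b l)"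
    using nn_integral_triple by blast
  have main: "lp_dom (C * D * (N * S' + N' * S)) (\<lambda>x. v x * v' x)"
    if dom: "dominated M N S v" "dominated M' N' S' v'" for v v' M M' N N' S S'
    unfolding lp_dom_def
  proof
    fix l
    have v: "continuous_on UNIV v" "\<And>x. cmod (v x) \<le> M" "lp_dom N v" "sup_dom S v" "0 < N" "0 < S"
      and v': "continuous_on UNIV v'" "\<And>x. cmod (v' x) \<le> M'" "lp_dom N' v'" "sup_dom S' v'" "0 < N'" "0 < S'"
      using dom by (auto simp: dominated_def)
    obtain CK where CK: "decaying CK (ker (sig l))" using ker_decaying[OF bump_sig] by blast
    have [measurable]: "v \<in> borel_measurable borel" "v' \<in> borel_measurable borel"
      using v(1) v'(1) by (auto intro: borel_measurable_continuous_onI)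
    have [measurable]: "blk k v \<in> borel_measurable borel" "blk k v' \<in> borel_measurable borel" for k
      by (auto intro: blk_measurable)
    have M: "0 \<le> M" "0 \<le> M'" using order_trans[OF norm_ge_zero v(2)] order_trans[OF norm_ge_zero v'(2)] by auto
    note bv = sup_domD[OF v(4) less_imp_le[OF v(6)]] and bv' = sup_domD[OF v'(4) less_imp_le[OF v'(6)]]
    let ?q = "\<lambda>k m. blk l (\<lambda>x. blk k v x * blk m v' x)"
    have meas_q: "?q k m \<in> borel_measurable borel" for k m by (intro blk_measurable) measurable
    \<comment> \<open>The two block series are inserted one after the other; each exchange with the
      convolution is covered by the uniform bounds from \<open>sup_domD\<close>.\<close>
    have expand: "blk l (\<lambda>x. v x * v' x) x = (LINT k|count_space UNIV. LINT m|count_space UNIV. ?q k m x)" for x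
    proof -
      have "(\<lambda>x. v x * v' x) = (\<lambda>x. LINT k|count_space UNIV. blk k v x * v' x)"
        using blk_series_eq[OF v(1,2,4) less_imp_le[OF v(6)]] by simp
      moreover have "blk l (\<lambda>x. LINT k|count_space UNIV. blk k v x * v' x) x = (LINT k|count_space UNIV. blk l (\<lambda>x. blk k v x * v' x) x)"
        unfolding blk_def[of l]
      proof (rule conv_series[OF CK lat_integrable[of "M' * S"]])
        show "cmod (blk k v x * v' x) \<le> M' * S * lat k" for k x
          using mult_mono[OF bv[of k x] v'(2)[of x]] v(6) lat_pos[of k] by (simp add: norm_mult ac_simps less_imp_le)
      qed measurable
      moreover have "blk l (\<lambda>x. blk k v x * v' x) x = (LINT m|count_space UNIV. ?q k m x)" for k
      proof -
        have "(\<lambda>x. blk k v x * v' x) = (\<lambda>x. LINT m|count_space UNIV. blk k v x * blk m v' x)"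
          using blk_series_eq[OF v'(1,2,4) less_imp_le[OF v'(6)]] by simp
        moreover have "blk l (\<lambda>x. LINT m|count_space UNIV. blk k v x * blk m v' x) x = (LINT m|count_space UNIV. ?q k m x)"
          unfolding blk_def[of l]
        proof (rule conv_series[OF CK lat_integrable[of "S * lat k * S'"]])
          show "cmod (blk k v x * blk m v' x) \<le> S * lat k * S' * lat m" for m x
            using mult_mono[OF bv[of k x] bv'[of m x]] v(6) lat_pos[of k] by (simp add: norm_mult ac_simps less_imp_le)
        qed measurable
        ultimately show ?thesis by simp
      qed
      ultimately show ?thesis by simp
    qed
    define \<alpha> where "\<alpha> = (\<lambda>(k, m). C * (N * S' * (b k * lat m) + N' * S * (b m * lat k)) * lat (l - k - m) / wt l)"
    have \<alpha>_pos: "0 < \<alpha> km" for km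
      using C v v' b_pos lat_pos by (auto simp: \<alpha>_def intro!: mult_pos_pos divide_pos_pos add_pos_pos split: prod.splits)
    show "lp_le p (blk l (\<lambda>x. v x * v' x)) (C * D * (N * S' + N' * S) * b l / wt l)"
      unfolding lp_le_def
    proof (rule minkowski_integral[OF pair_sigma_finite_lborel_count p, where g = "\<lambda>x (k, m). cmod (?q k m x)" and \<alpha> = \<alpha>])
      show "case_prod (\<lambda>x (k, m). cmod (?q k m x)) \<in> borel_measurable (lborel \<Otimes>\<^sub>M count_space UNIV)"
        using meas_q by (intro measurable_pair_count_space2) (auto split: prod.splits)
      show "(\<integral>\<^sup>+x. ennreal ((case km of (k, m) \<Rightarrow> cmod (?q k m x)) powr p) \<partial>lborel) \<le> ennreal (\<alpha> km powr p)" for km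
        using pair[OF dom, of l "fst km" "snd km"] by (simp add: lp_le_def \<alpha>_def split_beta)
      show "ennreal (cmod (blk l (\<lambda>x. v x * v' x) x)) \<le> (\<integral>\<^sup>+km. ennreal (case km of (k, m) \<Rightarrow> cmod (?q k m x)) \<partial>count_space UNIV)" for x
      proof -
        have "ennreal (cmod (blk l (\<lambda>x. v x * v' x) x)) \<le> (\<integral>\<^sup>+k. \<integral>\<^sup>+m. ennreal (cmod (?q k m x)) \<partial>count_space UNIV \<partial>count_space UNIV)"
          unfolding expand by (intro order_trans[OF cmod_integral_le_nn_integral] nn_integral_mono cmod_integral_le_nn_integral)
        also have "\<dots> = (\<integral>\<^sup>+km. ennreal (case km of (k, m) \<Rightarrow> cmod (?q k m x)) \<partial>count_space UNIV)"
          by (subst nn_integral_fst_count_space[symmetric]) simp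
        finally show ?thesis .
      qed
      have "(\<integral>\<^sup>+km. ennreal (\<alpha> km) \<partial>count_space UNIV) =
         (\<integral>\<^sup>+km. ennreal (C * N * S' / wt l) * (case km of (k, m) \<Rightarrow> ennreal (b k * lat m * lat (l - k - m))) +
            ennreal (C * N' * S / wt l) * (case km of (k, m) \<Rightarrow> ennreal (b m * lat k * lat (l - k - m))) \<partial>count_space UNIV)"
      proof (rule nn_integral_cong)
        fix km :: "(int ^ 'n) \<times> (int ^ 'n)"
        obtain k m where km: "km = (k, m)" by (cases km)
        have "\<alpha> km = C * N * S' / wt l * (b k * lat m * lat (l - k - m)) + C * N' * S / wt l * (b m * lat k * lat (l - k - m))"
          by (simp add: \<alpha>_def km field_simps)
        moreover have "0 \<le> C * N * S' / wt l * (b k * lat m * lat (l - k - m))" "0 \<le> C * N' * S / wt l * (b m * lat k * lat (l - k - m))"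
          "0 \<le> C * N * S' / wt l" "0 \<le> C * N' * S / wt l"
          using C v v' b_pos[of k] b_pos[of m] less_imp_le[OF lat_pos]
          by (auto intro!: mult_nonneg_nonneg divide_nonneg_nonneg simp: less_imp_le)
        ultimately show "ennreal (\<alpha> km) = ennreal (C * N * S' / wt l) * (case km of (k, m) \<Rightarrow> ennreal (b k * lat m * lat (l - k - m))) +
            ennreal (C * N' * S / wt l) * (case km of (k, m) \<Rightarrow> ennreal (b m * lat k * lat (l - k - m)))"
          unfolding km by (simp only: prod.case ennreal_mult'[symmetric] ennreal_plus[symmetric])
      qed
      also have "\<dots> = ennreal (C * N * S' / wt l) * (\<integral>\<^sup>+(k, m). ennreal (b k * lat m * lat (l - k - m)) \<partial>count_space UNIV) +
          ennreal (C * N' * S / wt l) * (\<integral>\<^sup>+(k, m). ennreal (b m * lat k * lat (l - k - m)) \<partial>count_space UNIV)"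
        by (simp add: nn_integral_add nn_integral_cmult)
      also have "\<dots> \<le> ennreal (C * N * S' / wt l) * ennreal (D * b l) + ennreal (C * N' * S / wt l) * ennreal (D * b l)"
        by (intro add_mono mult_left_mono D) auto
      also have "\<dots> = ennreal (C * D * (N * S' + N' * S) * b l / wt l)"
      proof -
        have "C * D * (N * S' + N' * S) * b l / wt l = C * N * S' / wt l * (D * b l) + C * N' * S / wt l * (D * b l)"
          by (simp add: field_simps)
        moreover have "0 \<le> C * N * S' / wt l * (D * b l)" "0 \<le> C * N' * S / wt l * (D * b l)" "0 \<le> C * N * S' / wt l" "0 \<le> C * N' * S / wt l"
          using C D(1) v v' b_pos[of l] by (auto intro!: mult_nonneg_nonneg divide_nonneg_nonneg simp: less_imp_le)
        ultimately show ?thesis by (simp only: ennreal_mult'[symmetric] ennreal_plus[symmetric])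
      qed
      finally show "(\<integral>\<^sup>+km. ennreal (\<alpha> km) \<partial>count_space UNIV) \<le> ennreal (C * D * (N * S' + N' * S) * b l / wt l)" .
      show "0 < C * D * (N * S' + N' * S) * b l / wt l"
        using C D(1) v v' b_pos[of l] by (auto intro!: mult_pos_pos divide_pos_pos add_pos_pos)
    qed (auto simp: \<alpha>_pos split: prod.splits)
  qed
  have CD: "C * D > 0" using C D(1) by simp
  show thesis by (rule that[OF CD], rule main)
qed

end

section \<open>Exponentials of a real function\<close>

lemma ln_le_linear:
  assumes "0 < (z::real)" "0 < c" shows "ln z \<le> c * z - 1 - ln c"
  using ln_le_minus_one[of "c * z"] assms by (simp add: ln_mult)

lemma poly_le_exp:
  assumes P: "0 < P" and d: "0 < (d::real)"
  obtains C where "0 < C" "\<And>y. 0 \<le> y \<Longrightarrow> (1 + y) powr P \<le> C * exp (d * y)"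
proof
  let ?C = "exp (d - P - P * ln (d / P))"
  show "0 < ?C" by simp
  fix y :: real assume y: "0 \<le> y"
  have "P * ln (1 + y) \<le> P * (d / P * (1 + y) - 1 - ln (d / P))"
    using y P d by (intro mult_left_mono ln_le_linear) auto
  also have "\<dots> = (d - P - P * ln (d / P)) + d * y" using P by (simp add: field_simps)
  finally have "exp (P * ln (1 + y)) \<le> exp ((d - P - P * ln (d / P)) + d * y)" by simp
  then show "(1 + y) powr P \<le> ?C * exp (d * y)"
    using y by (simp add: powr_def exp_add mult.commute)
qed

text \<open>Multiplying out the recursion of the doubling argument, the additive polynomial losses cost only the
  factor \<open>j\<close>, which becomes the logarithm in the final exponent.\<close>

lemma doubling_growth:
  fixes a P B Q :: real
  assumes a: "0 < a" and P: "0 < P"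
  obtains c where "c \<ge> Q" "c > 0"
    "\<And>j::nat. B + P * ln (1 + c * (real j + 1) * 2 powr (a * real j)) \<le> c * 2 powr (a * (real j + 1))"
proof -
  \<comment> \<open>Makes j + 1 \<le> D 2^(a j), through 1 + x \<le> exp x.\<close>
  define D where "D = max 1 (1 / (a * ln 2))"
  have D: "D \<ge> 1" "D * (a * ln 2) \<ge> 1"
  proof -
    show "D \<ge> 1" by (simp add: D_def)
    have "1 / (a * ln 2) * (a * ln 2) \<le> D * (a * ln 2)" using a by (intro mult_right_mono) (auto simp: D_def)
    then show "D * (a * ln 2) \<ge> 1" using a by simp
  qed
  \<comment> \<open>c stands on both sides of the claim, but on the left only under a logarithm, so
    a large c works for all j at once.\<close>
  have "eventually (\<lambda>c. (\<bar>B\<bar> + P * ln (2 * D) + 2 * P) + P * ln c \<le> c) at_top"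
    using P by real_asymp
  then obtain c0 where c0: "\<And>c. c \<ge> c0 \<Longrightarrow> (\<bar>B\<bar> + P * ln (2 * D) + 2 * P) + P * ln c \<le> c"
    by (auto simp: eventually_at_top_linorder)
  define c where "c = max c0 (max Q 1)"
  have c: "c \<ge> 1" "c \<ge> Q" "c \<ge> c0" by (auto simp: c_def)
  show thesis
  proof (rule that[of c])
    fix j :: nat
    define y where "y = 2 powr (a * real j)"
    have y_exp: "y = exp (real j * (a * ln 2))" by (simp add: y_def powr_def ac_simps)
    have y1: "y \<ge> 1" using a by (simp add: y_exp)
    have "real j + 1 \<le> D * (1 + real j * (a * ln 2))"
      using mult_right_mono[OF D(2), of "real j"] D(1) by (simp add: algebra_simps)
    also have "\<dots> \<le> D * y" unfolding y_exp using D(1) by (intro mult_left_mono exp_ge_add_one_self) auto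
    finally have j: "real j + 1 \<le> D * y" .
    have "1 + c * (real j + 1) * y \<le> 2 * D * c * (y * y)"
    proof -
      have "c * (real j + 1) * y \<le> c * (D * y) * y" using c(1) y1 j by (intro mult_right_mono mult_left_mono) auto
      moreover have "1 * 1 \<le> (c * D) * (y * y)"
        using c(1) D(1) y1 mult_mono[of 1 c 1 D] mult_mono[of 1 y 1 y] by (intro mult_mono) auto
      ultimately show ?thesis by (simp add: ac_simps)
    qed
    then have "ln (1 + c * (real j + 1) * y) \<le> ln (2 * D * c * (y * y))"
      using c(1) y1 by (subst ln_le_cancel_iff) (auto intro!: add_pos_nonneg mult_pos_pos simp: D(1) less_le_trans[OF zero_less_one D(1)])
    also have "\<dots> = ln (2 * D) + ln c + 2 * ln y"
      using c(1) y1 D(1) by (simp add: ln_mult)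
    also have "\<dots> \<le> ln (2 * D) + ln c + 2 * y" using ln_le_minus_one[of y] y1 by simp
    finally have "P * ln (1 + c * (real j + 1) * y) \<le> P * (ln (2 * D) + ln c + 2 * y)" using P by (intro mult_left_mono) auto
    then have "B + P * ln (1 + c * (real j + 1) * y) \<le> (\<bar>B\<bar> + P * ln (2 * D) + P * ln c) * 1 + 2 * P * y"
      by (simp add: algebra_simps)
    also have "\<dots> \<le> (\<bar>B\<bar> + P * ln (2 * D) + P * ln c) * y + 2 * P * y"
      using y1 P c(1) D(1) by (intro add_mono mult_left_mono) (auto intro!: add_nonneg_nonneg)
    also have "\<dots> = ((\<bar>B\<bar> + P * ln (2 * D) + 2 * P) + P * ln c) * y" by (simp add: algebra_simps)
    also have "\<dots> \<le> c * y" using c0[OF c(3)] y1 by (intro mult_right_mono) auto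
    also have "\<dots> \<le> c * 2 powr (a * (real j + 1))" unfolding y_def using a c(1) by (intro mult_left_mono powr_mono) auto
    finally show "B + P * ln (1 + c * (real j + 1) * 2 powr (a * real j)) \<le> c * 2 powr (a * (real j + 1))"
      by (simp add: y_def)
  qed (use c in auto)
qed

text \<open>The exponent is negative for |t| < 1; the lower bound keeps the associated exponential
  weight away from 0. It is ln x \<le> x - 1 at x = |t|^(-a).\<close>

lemma powr_mult_ln_ge:
  fixes a t :: real
  assumes a: "0 < a" shows "- (1 / a) \<le> \<bar>t\<bar> powr a * ln \<bar>t\<bar>"
proof (cases "t = 0")
  case False
  then have t: "\<bar>t\<bar> > 0" by simp
  have "ln (\<bar>t\<bar> powr (- a)) \<le> \<bar>t\<bar> powr (- a) - 1" using t by (intro ln_le_minus_one) simp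
  then have "- (a * ln \<bar>t\<bar>) \<le> \<bar>t\<bar> powr (- a)" using t by (simp add: ln_powr)
  then have "\<bar>t\<bar> powr a * (- (a * ln \<bar>t\<bar>)) \<le> \<bar>t\<bar> powr a * \<bar>t\<bar> powr (- a)" by (intro mult_left_mono) auto
  also have "\<dots> = 1" using t by (simp add: powr_add[symmetric])
  finally have "a * - (\<bar>t\<bar> powr a * ln \<bar>t\<bar>) \<le> 1" by (simp add: algebra_simps)
  then show ?thesis using a by (simp add: field_simps)
qed (use a in simp)

text \<open>With j the least number of doublings from 1 to beyond |\<xi>|, 2^(a j) is at most 2^a
  |\<xi>|^a and j + 1 is at most log_2 |\<xi>| + 2.\<close>

lemma dyadic_growth:
  fixes a c :: real
  assumes a: "0 < a" "a < 1" and c: "0 < c"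
  obtains l C where "0 < l"
    "\<And>\<xi>::real. \<exists>j::nat. \<bar>\<xi>\<bar> \<le> 2 ^ j \<and> c * (real j + 1) * 2 powr (a * real j) \<le> l * (\<bar>\<xi>\<bar> powr a * ln \<bar>\<xi>\<bar>) + C"
proof -
  \<comment> \<open>The 3 comes from log_2 t + 2 \<le> 3 log_2 t for t \<ge> 2. The terms of C serve
    1 < t < 2, the value c at j = 0, and the lower bound of t^a ln t for t \<le> 1.\<close>
  define l where "l = c * 2 powr a * (3 / ln 2)"
  define C where "C = c * 2 powr a * 2 powr a * 3 + c + l / a"
  have l: "l > 0" using c by (simp add: l_def)
  have "\<exists>j::nat. \<bar>\<xi>\<bar> \<le> 2 ^ j \<and> c * (real j + 1) * 2 powr (a * real j) \<le> l * (\<bar>\<xi>\<bar> powr a * ln \<bar>\<xi>\<bar>) + C" for \<xi> :: real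
  proof (cases "\<bar>\<xi>\<bar> \<le> 1")
    case True
    have "- (1 / a) \<le> \<bar>\<xi>\<bar> powr a * ln \<bar>\<xi>\<bar>" by (rule powr_mult_ln_ge[OF a(1)])
    then have "l * (- (1 / a)) \<le> l * (\<bar>\<xi>\<bar> powr a * ln \<bar>\<xi>\<bar>)" using l by (intro mult_left_mono) auto
    moreover have "0 \<le> c * 2 powr a * 2 powr a * 3" using c by simp
    ultimately have "c * (real 0 + 1) * 2 powr (a * real 0) \<le> l * (\<bar>\<xi>\<bar> powr a * ln \<bar>\<xi>\<bar>) + C"
      by (simp add: C_def)
    moreover have "\<bar>\<xi>\<bar> \<le> 2 ^ 0" using True by simp
    ultimately show ?thesis by blast
  next
    case False
    define t where "t = \<bar>\<xi>\<bar>"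
    have t: "t > 1" using False by (simp add: t_def)
    define j where "j = nat \<lceil>log 2 t\<rceil>"
    have lt: "log 2 t > 0" using t by simp
    have jge: "log 2 t \<le> real j" unfolding j_def by linarith
    have jle: "real j \<le> log 2 t + 1" unfolding j_def using lt by linarith
    have "t = 2 powr (log 2 t)" using t by simp
    also have "\<dots> \<le> 2 powr (real j)" using jge by (intro powr_mono) auto
    finally have tj: "t \<le> 2 ^ j" by (simp add: powr_realpow)
    have pw: "2 powr (a * real j) \<le> 2 powr a * t powr a"
    proof -
      have "2 powr (a * real j) \<le> 2 powr (a * (log 2 t + 1))" using jle a by (intro powr_mono mult_left_mono) auto
      also have "\<dots> = 2 powr a * (2 powr (log 2 t)) powr a" by (simp add: powr_powr powr_add[symmetric] algebra_simps)
      finally show ?thesis using t by simp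
    qed
    have tl: "0 \<le> t powr a * ln t" using t by (intro mult_nonneg_nonneg) auto
    have "c * (real j + 1) * 2 powr (a * real j) \<le> c * (log 2 t + 2) * (2 powr a * t powr a)"
      using c jle pw by (intro mult_mono) auto
    also have "\<dots> \<le> l * (t powr a * ln t) + C"
    proof (cases "t \<ge> 2")
      case True
      then have "1 \<le> log 2 t" by (simp add: le_log_iff)
      then have "log 2 t + 2 \<le> 3 / ln 2 * ln t" by (simp add: log_def field_simps)
      then have "c * (log 2 t + 2) * (2 powr a * t powr a) \<le> c * (3 / ln 2 * ln t) * (2 powr a * t powr a)"
        using c by (intro mult_right_mono mult_left_mono) auto
      also have "\<dots> = l * (t powr a * ln t)" by (simp add: l_def)
      also have "\<dots> \<le> \<dots> + C" using c l a by (simp add: C_def)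
      finally show ?thesis .
    next
      case F: False
      have "log 2 t \<le> 1" using F t by (simp add: log_le_iff)
      moreover have "t powr a \<le> 2 powr a" using F t a by (intro powr_mono2) auto
      ultimately have "c * (log 2 t + 2) * (2 powr a * t powr a) \<le> c * 3 * (2 powr a * 2 powr a)"
        using c lt by (intro mult_mono mult_left_mono) auto
      moreover have "0 \<le> l * (t powr a * ln t)" using l tl by simp
      moreover have "0 \<le> l / a" using l a by simp
      moreover have "c * 3 * (2 powr a * 2 powr a) = c * 2 powr a * 2 powr a * 3" by simp
      ultimately show ?thesis using c unfolding C_def by linarith
    qed
    finally show ?thesis using tj by (auto simp: t_def)
  qed
  then show thesis using that[OF l] by blast
qed

text \<open>The triangle inequality as the integral version over a two-point space.\<close>

lemma lp_le_add:
  fixes f g :: "'a::euclidean_space \<Rightarrow> complex"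
  assumes p: "p \<ge> 1" and f: "lp_le p f A" "0 < A" and g: "lp_le p g B" "0 < B"
    and [measurable]: "f \<in> borel_measurable borel" "g \<in> borel_measurable borel"
  shows "lp_le p (\<lambda>x. f x + g x) (A + B)"
  unfolding lp_le_def
proof (rule minkowski_integral[OF pair_sigma_finite_lborel_count p,
    where g = "\<lambda>x i. if i then cmod (f x) else cmod (g x)" and \<alpha> = "\<lambda>i. if i then A else B"])
  show "case_prod (\<lambda>x i. if i then cmod (f x) else cmod (g x)) \<in> borel_measurable (lborel \<Otimes>\<^sub>M count_space UNIV)"
    by (rule measurable_pair_count_space2) measurable
  show "(\<integral>\<^sup>+x. ennreal ((if i then cmod (f x) else cmod (g x)) powr p) \<partial>lborel) \<le> ennreal ((if i then A else B) powr p)" for i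
    using f g by (cases i) (auto simp: lp_le_def)
  have UN: "(UNIV :: bool set) = {True, False}" by auto
  show "(\<integral>\<^sup>+i. ennreal (if i then A else B) \<partial>count_space UNIV) \<le> ennreal (A + B)"
    using f(2) g(2) by (simp add: UN nn_integral_count_space_finite)
  show "ennreal (cmod (f x + g x)) \<le> (\<integral>\<^sup>+i. ennreal (if i then cmod (f x) else cmod (g x)) \<partial>count_space UNIV)" for x
    by (simp add: UN nn_integral_count_space_finite norm_triangle_ineq ennreal_leI flip: ennreal_plus)
qed (use f g in auto)

lemma lp_le_scale:
  assumes "lp_le p g A" "0 \<le> A" "p \<ge> 1" and [measurable]: "g \<in> borel_measurable borel"
  shows "lp_le p (\<lambda>x. c * g x) (cmod c * A)"
proof -
  have "(\<integral>\<^sup>+x. ennreal (cmod (c * g x) powr p) \<partial>lborel) = (\<integral>\<^sup>+x. ennreal (cmod c powr p) * ennreal (cmod (g x) powr p) \<partial>lborel)"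
    by (simp add: norm_mult powr_mult ennreal_mult'[symmetric])
  also have "\<dots> = ennreal (cmod c powr p) * (\<integral>\<^sup>+x. ennreal (cmod (g x) powr p) \<partial>lborel)"
    by (rule nn_integral_cmult) measurable
  also have "\<dots> \<le> ennreal (cmod c powr p) * ennreal (A powr p)"
    using assms by (intro mult_left_mono) (auto simp: lp_le_def)
  also have "\<dots> = ennreal ((cmod c * A) powr p)" using assms by (simp add: powr_mult ennreal_mult'[symmetric])
  finally show ?thesis by (simp add: lp_le_def)
qed

lemma conv_add:
  assumes "decaying C K" "tame B g" "tame B' h"
  shows "conv K (\<lambda>x. g x + h x) x = conv K g x + conv K h x"
  unfolding conv_def distrib_left using assms conv_integrable
  by (intro Bochner_Integration.integral_add) blast+

lemma conv_scale: "conv K (\<lambda>x. c * g x) x = c * conv K g x"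
  by (simp add: conv_def mult.left_commute)

section \<open>From weighted L^p bounds to uniform bounds on blocks\<close>

locale gevrey_bdd = gevrey \<rho> s p Cb b for \<rho> :: "real ^ 'n \<Rightarrow> real" and s p Cb b +
  fixes Bb :: real
  assumes b_le: "\<And>k. b k \<le> Bb"
begin

lemma Bb_pos: "0 < Bb"
  using b_le[of 0] b_pos[of 0] by linarith

definition ly :: "int ^ 'n \<Rightarrow> real" where
  "ly k = norm (lattice_pt k) powr (1 / s)"

text \<open>The power of 1 + \<open>ly k\<close> that dominates 1 / \<open>lat k\<close>: the norm
  of the lattice point is the s-th power of \<open>ly k\<close>, and \<open>lat\<close> involves its
  power 2 n.\<close>

definition P :: real where
  "P = 2 * CARD('n) * s"

lemma wt_eq: "wt k = exp (ly k)"
  by (simp add: wt_def ly_def)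

lemma ly_nonneg [simp]: "0 \<le> ly k"
  by (simp add: ly_def)

lemma P_pos: "0 < P"
  using s by (simp add: P_def)

lemma inverse_lat_le: "1 / lat k \<le> 2 ^ (2 * CARD('n)) * (1 + ly k) powr P"
proof -
  have "norm (lattice_pt k) = ly k powr s" using s by (simp add: ly_def powr_powr)
  also have "\<dots> \<le> (1 + ly k) powr s" using s by (intro powr_mono2) auto
  finally have "1 + norm (lattice_pt k) \<le> 2 * (1 + ly k) powr s"
    using s ge_one_powr_ge_zero[of "1 + ly k" s] by simp
  then have "(1 + norm (lattice_pt k)) ^ (2 * CARD('n)) \<le> (2 * (1 + ly k) powr s) ^ (2 * CARD('n))"
    by (intro power_mono) auto
  also have "\<dots> = 2 ^ (2 * CARD('n)) * ((1 + ly k) powr s) ^ (2 * CARD('n))" by (simp add: power_mult_distrib)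
  also have "((1 + ly k) powr s) ^ (2 * CARD('n)) = (1 + ly k) powr P"
  proof -
    have "0 < 1 + ly k" using ly_nonneg[of k] by linarith
    then have "0 < (1 + ly k) powr s" by simp
    then show ?thesis
      using powr_realpow[of "(1 + ly k) powr s" "2 * CARD('n)"] by (simp add: P_def powr_powr mult.commute)
  qed
  finally show ?thesis by (simp add: lat_def)
qed

text \<open>Interpolation between \<open>L\<^sup>\<infinity>\<close> and the weighted norm \<open>exp X\<close>: only the fraction \<open>gain\<close> of
  the exponent is lost. Since \<open>1 + gain = 2 powr (1/s)\<close>, this is what makes doubling the
  frequency multiply the exponent by \<open>2 powr (1/s)\<close>.\<close>

lemma sup_dom_interpolate:
  obtains C where "0 < C"
    "\<And>X v. continuous_on UNIV v \<Longrightarrow> (\<And>x. cmod (v x) \<le> 2) \<Longrightarrow> lp_dom (exp X) v \<Longrightarrow> 0 \<le> X \<Longrightarrow>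
      sup_dom (C * (1 + X) powr P * exp (gain * X)) v"
proof -
  obtain CB where CB: "CB > 0" and bern: "\<And>k g A B x. tame B g \<Longrightarrow> 0 \<le> B \<Longrightarrow> lp_le p (blk k g) A \<Longrightarrow> 0 \<le> A \<Longrightarrow> cmod (blk k g x) \<le> CB * A"
    using blk_bernstein[OF p] by blast
  obtain CK where CK: "\<And>k. decaying CK (ker (sig k))" "0 < CK" using ker_sig_decaying by blast
  obtain CE where CE: "0 < CE" "\<And>y. 0 \<le> y \<Longrightarrow> (1 + y) powr P \<le> CE * exp ((1 - gain) * y)"
    using poly_le_exp[OF P_pos, of "1 - gain"] gain by auto
  let ?I = "decay_mass TYPE(real ^ 'n)"
  \<comment> \<open>Covers both available bounds: the trivial one from |v| \<le> 2, and Bernstein's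
    inequality for the weighted norm.\<close>
  define A where "A = max (CK * (?I * 2)) (CB * Bb)"
  define K where "K = (2::real) ^ (2 * CARD('n))"
  have A: "0 < A" "CK * (?I * 2) \<le> A" "CB * Bb \<le> A" using CB Bb_pos by (auto simp: A_def less_max_iff_disj)
  have K: "0 < K" by (simp add: K_def)
  have main: "sup_dom (A * K * (CE + 1) * (1 + X) powr P * exp (gain * X)) v"
    if v: "continuous_on UNIV v" "\<And>x. cmod (v x) \<le> 2" "lp_dom (exp X) v" and X: "0 \<le> X" for X v
    unfolding sup_dom_def
  proof (intro allI)
    fix k x
    have t: "tame (?I * 2) v" by (rule tame_bounded[OF borel_measurable_continuous_onI[OF v(1)] v(2)])
    have nn: "0 \<le> ?I * 2" by (simp add: less_imp_le)
    have b1: "cmod (blk k v x) \<le> A"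
      using conv_bounded[OF CK(1) t nn, of k x] A(2) by (simp add: blk_def)
    have b2: "cmod (blk k v x) \<le> A * exp (X - ly k)"
    proof -
      have "cmod (blk k v x) \<le> CB * (exp X * b k / wt k)"
        using v(3) b_pos[of k] by (intro bern[OF t nn]) (auto simp: lp_dom_def less_imp_le)
      also have "\<dots> \<le> CB * (exp X * Bb / wt k)"
        using CB b_le by (intro mult_left_mono divide_right_mono) (auto simp: less_imp_le)
      also have "\<dots> = (CB * Bb) * exp (X - ly k)" by (simp add: wt_eq exp_diff)
      also have "\<dots> \<le> A * exp (X - ly k)" using A by (intro mult_right_mono) auto
      finally show ?thesis .
    qed
    have wg: "wt k powr gain = exp (gain * ly k)" by (simp add: wt_eq exp_powr_real mult.commute)
    have inv: "1 / lat k \<le> K * (1 + ly k) powr P" unfolding K_def by (rule inverse_lat_le)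
    have "cmod (blk k v x) * exp (gain * ly k) * (1 / lat k) \<le> A * K * (CE + 1) * (1 + X) powr P * exp (gain * X)"
    \<comment> \<open>X is the level at which the two bounds cross. Below it the trivial one is used
      and the reduced weight is at most exp (gain X); above it the decay exp (X - ly k) outweighs
      the reduced weight.\<close>
    proof (cases "ly k \<le> X")
      case True
      have "cmod (blk k v x) * exp (gain * ly k) * (1 / lat k) \<le> A * exp (gain * X) * (K * (1 + X) powr P)"
      proof (intro mult_mono b1)
        show "exp (gain * ly k) \<le> exp (gain * X)" using True gain by simp
        have "(1 + ly k) powr P \<le> (1 + X) powr P" using True P_pos by (intro powr_mono2) auto
        then show "1 / lat k \<le> K * (1 + X) powr P" using inv K by (meson less_imp_le mult_left_mono order_trans)
      qed (use A lat_pos[of k] in \<open>auto simp: less_imp_le\<close>)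
      also have "\<dots> = A * K * 1 * (1 + X) powr P * exp (gain * X)" by simp
      also have "\<dots> \<le> A * K * (CE + 1) * (1 + X) powr P * exp (gain * X)"
        using A K CE(1) by (intro mult_right_mono mult_left_mono) auto
      finally show ?thesis .
    next
      case False
      \<comment> \<open>The surplus d over the level enters with exp (-(1 - gain) d), which absorbs
        the polynomial in d; only the polynomial in X is lost.\<close>
      define d where "d = ly k - X"
      have d: "0 \<le> d" "ly k = X + d" using False by (auto simp: d_def)
      have "(1 + ly k) powr P \<le> ((1 + X) * (1 + d)) powr P"
        using X d P_pos by (intro powr_mono2) (auto simp: algebra_simps)
      also have "\<dots> = (1 + X) powr P * (1 + d) powr P" using X d by (simp add: powr_mult)
      also have "\<dots> \<le> (1 + X) powr P * (CE * exp ((1 - gain) * d))" by (intro mult_left_mono CE(2) d) auto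
      finally have "1 / lat k \<le> K * ((1 + X) powr P * (CE * exp ((1 - gain) * d)))"
        using inv K by (meson less_imp_le mult_left_mono order_trans)
      then have "cmod (blk k v x) * exp (gain * ly k) * (1 / lat k) \<le>
          (A * exp (X - ly k)) * exp (gain * ly k) * (K * ((1 + X) powr P * (CE * exp ((1 - gain) * d))))"
        using A lat_pos[of k] by (intro mult_mono b2) (auto simp: less_imp_le)
      also have "\<dots> = A * K * CE * (1 + X) powr P * (exp (X - ly k) * exp (gain * ly k) * exp ((1 - gain) * d))"
        by (simp add: ac_simps)
      also have "exp (X - ly k) * exp (gain * ly k) * exp ((1 - gain) * d) = exp (gain * X)"
        unfolding exp_add[symmetric] d(2) by (simp add: algebra_simps)
      also have "A * K * CE * (1 + X) powr P * exp (gain * X) \<le> A * K * (CE + 1) * (1 + X) powr P * exp (gain * X)"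
        using A K by (intro mult_right_mono mult_left_mono) auto
      finally show ?thesis .
    qed
    then show "cmod (blk k v x) \<le> A * K * (CE + 1) * (1 + X) powr P * exp (gain * X) * lat k / wt k powr gain"
      using lat_pos[of k] unfolding wg by (simp add: field_simps)
  qed
  have pos: "0 < A * K * (CE + 1)" using A K CE(1) by simp
  show thesis by (rule that[OF pos], rule main)
qed

text \<open>The non-interpolated version, linear in N: Bernstein's inequality gives the full decay
  exp (-ly k), of which the reduced weight leaves exp (-(1 - gain) ly k) to absorb 1 /
  \<open>lat k\<close>.\<close>

lemma sup_dom_of_lp_dom:
  obtains C where "0 < C"
    "\<And>N v B. tame B v \<Longrightarrow> 0 \<le> B \<Longrightarrow> lp_dom N v \<Longrightarrow> 0 < N \<Longrightarrow> sup_dom (C * N) v"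
proof -
  obtain CB where CB: "CB > 0" and bern: "\<And>k g A B x. tame B g \<Longrightarrow> 0 \<le> B \<Longrightarrow> lp_le p (blk k g) A \<Longrightarrow> 0 \<le> A \<Longrightarrow> cmod (blk k g x) \<le> CB * A"
    using blk_bernstein[OF p] by blast
  obtain CE where CE: "0 < CE" "\<And>y. 0 \<le> y \<Longrightarrow> (1 + y) powr P \<le> CE * exp ((1 - gain) * y)"
    using poly_le_exp[OF P_pos, of "1 - gain"] gain by auto
  define K where "K = (2::real) ^ (2 * CARD('n))"
  have K: "0 < K" by (simp add: K_def)
  have main: "sup_dom (CB * Bb * K * CE * N) v"
    if t: "tame B v" "0 \<le> B" and v: "lp_dom N v" and N: "0 < N" for N v B
    unfolding sup_dom_def
  proof (intro allI)
    fix k x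
    have "cmod (blk k v x) \<le> CB * (N * b k / wt k)"
      using v b_pos[of k] N by (intro bern[OF t]) (auto simp: lp_dom_def less_imp_le)
    also have "\<dots> \<le> CB * (N * Bb / wt k)"
      using CB b_le N by (intro mult_left_mono divide_right_mono) (auto simp: less_imp_le)
    finally have b1: "cmod (blk k v x) \<le> CB * N * Bb * exp (- ly k)"
      by (simp add: wt_eq exp_minus divide_inverse)
    have "1 / lat k \<le> K * (CE * exp ((1 - gain) * ly k))"
      using inverse_lat_le[of k] CE(2)[of "ly k"] K unfolding K_def[symmetric] by (meson less_imp_le mult_left_mono order_trans ly_nonneg)
    then have "cmod (blk k v x) * exp (gain * ly k) * (1 / lat k) \<le>
        (CB * N * Bb * exp (- ly k)) * exp (gain * ly k) * (K * (CE * exp ((1 - gain) * ly k)))"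
      using CB N Bb_pos lat_pos[of k] by (intro mult_mono b1) (auto simp: less_imp_le)
    also have "\<dots> = CB * Bb * K * CE * N * (exp (- ly k) * exp (gain * ly k) * exp ((1 - gain) * ly k))" by (simp add: ac_simps)
    also have "exp (- ly k) * exp (gain * ly k) * exp ((1 - gain) * ly k) = 1"
      unfolding exp_add[symmetric] by (simp add: algebra_simps)
    finally have "cmod (blk k v x) * exp (gain * ly k) * (1 / lat k) \<le> CB * Bb * K * CE * N" by simp
    moreover have "wt k powr gain = exp (gain * ly k)" by (simp add: wt_eq exp_powr_real mult.commute)
    ultimately show "cmod (blk k v x) \<le> CB * Bb * K * CE * N * lat k / wt k powr gain"
      using lat_pos[of k] by (simp add: field_simps)
  qed
  have pos: "0 < CB * Bb * K * CE" using CB Bb_pos K CE(1) by simp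
  show thesis by (rule that[OF pos], rule main)
qed

end

section \<open>Powers, exponentials and doubling\<close>

locale gevrey_fun = gevrey_bdd \<rho> s p Cb b Bb for \<rho> :: "real ^ 'n \<Rightarrow> real" and s p Cb b Bb +
  fixes U :: "real ^ 'n \<Rightarrow> real" and MU :: real
  assumes U_cont: "continuous_on UNIV U" and U_le: "\<And>x. \<bar>U x\<bar> \<le> MU"
    and U_dom: "lp_dom 1 (\<lambda>x. complex_of_real (U x))"
begin

lemma MU_nonneg: "0 \<le> MU"
  using U_le[of 0] by linarith

abbreviation cU :: "real ^ 'n \<Rightarrow> complex" where
  "cU \<equiv> \<lambda>x. complex_of_real (U x)"

text \<open>Iterates the product estimate. By \<open>sup_dom_of_lp_dom\<close> the weak constant is
  proportional to the strong one, so the bounds grow geometrically. Powers start at 1 because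
  nonzero constants are not in L^p.\<close>

lemma power_lp_dom:
  obtains Q where "0 < Q" "\<And>j. lp_dom (Q ^ j) (\<lambda>x. cU x ^ Suc j)"
proof -
  obtain C where C: "C > 0" "\<And>v v' M M' N N' S S'. dominated M N S v \<Longrightarrow> dominated M' N' S' v' \<Longrightarrow>
      lp_dom (C * (N * S' + N' * S)) (\<lambda>x. v x * v' x)"
    using lp_dom_mult by blast
  obtain S0 where S0: "0 < S0" "\<And>N v B. tame B v \<Longrightarrow> 0 \<le> B \<Longrightarrow> lp_dom N v \<Longrightarrow> 0 < N \<Longrightarrow> sup_dom (S0 * N) v"
    using sup_dom_of_lp_dom by blast
  define Q where "Q = 2 * C * S0"
  have Q: "Q > 0" using C S0 by (simp add: Q_def)
  have dom: "dominated (MU ^ Suc j) N (S0 * N) (\<lambda>x. cU x ^ Suc j)" if "lp_dom N (\<lambda>x. cU x ^ Suc j)" "0 < N" for j N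
  proof -
    have c: "continuous_on UNIV (\<lambda>x. cU x ^ Suc j)" by (intro continuous_intros U_cont)
    have m: "cmod (cU x ^ Suc j) \<le> MU ^ Suc j" for x
      unfolding norm_power using U_le[of x] by (intro power_mono) auto
    have t: "tame (decay_mass TYPE(real ^ 'n) * MU ^ Suc j) (\<lambda>x. cU x ^ Suc j)"
      by (rule tame_bounded[OF borel_measurable_continuous_onI[OF c] m])
    have "0 \<le> decay_mass TYPE(real ^ 'n) * MU ^ Suc j"
      by (rule mult_nonneg_nonneg[OF less_imp_le[OF decay_mass_pos] zero_le_power[OF MU_nonneg]])
    then have "sup_dom (S0 * N) (\<lambda>x. cU x ^ Suc j)" by (rule S0(2)[OF t _ that])
    then show ?thesis using c m that S0(1) by (simp only: dominated_def) auto
  qed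
  have U1: "lp_dom 1 (\<lambda>x. cU x ^ Suc 0)" using U_dom by simp
  have main: "lp_dom (Q ^ j) (\<lambda>x. cU x ^ Suc j)" for j
  proof (induction j)
    case 0
    then show ?case using U1 by simp
  next
    case (Suc j)
    have "lp_dom (C * (Q ^ j * (S0 * 1) + 1 * (S0 * Q ^ j))) (\<lambda>x. cU x ^ Suc j * cU x ^ Suc 0)"
      using Q by (intro C(2)[OF dom[OF Suc] dom[OF U1]]) auto
    moreover have "C * (Q ^ j * (S0 * 1) + 1 * (S0 * Q ^ j)) = Q ^ Suc j" by (simp add: Q_def algebra_simps)
    moreover have "(\<lambda>x. cU x ^ Suc j * cU x ^ Suc 0) = (\<lambda>x. cU x ^ Suc (Suc j))" by (simp add: mult.commute)
    ultimately show ?case by metis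
  qed
  show thesis by (rule that[OF Q main])
qed

definition ee :: "real \<Rightarrow> real ^ 'n \<Rightarrow> complex" where
  "ee \<xi> x = cis (\<xi> * U x) - 1"

lemma ee_continuous: "continuous_on UNIV (ee \<xi>)"
  unfolding ee_def[abs_def] by (intro continuous_intros U_cont)

lemma ee_bounded: "cmod (ee \<xi> x) \<le> 2"
  unfolding ee_def using norm_triangle_ineq4[of "cis (\<xi> * U x)" 1] by simp

lemma ee_double: "ee (2 * \<xi>) x = ee \<xi> x * ee \<xi> x + (ee \<xi> x + ee \<xi> x)"
  by (simp add: ee_def algebra_simps cis_mult)

lemma lp_dom_mono:
  assumes "lp_dom N v" "0 \<le> N" "N \<le> N'" shows "lp_dom N' v"
  unfolding lp_dom_def
proof
  fix k
  have "lp_le p (blk k v) (N * b k / wt k)" using assms(1) by (simp add: lp_dom_def)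
  then show "lp_le p (blk k v) (N' * b k / wt k)"
  proof (rule lp_le_mono)
    show "0 \<le> N * b k / wt k" "N * b k / wt k \<le> N' * b k / wt k"
      using assms(2,3) b_pos[of k] by (simp_all add: less_imp_le divide_right_mono mult_right_mono)
  qed (use p in simp)
qed

lemma lp_dom_add:
  assumes f: "lp_dom N f" "0 < N" "continuous_on UNIV f" "\<And>x. cmod (f x) \<le> M"
    and g: "lp_dom N' g" "0 < N'" "continuous_on UNIV g" "\<And>x. cmod (g x) \<le> M'"
  shows "lp_dom (N + N') (\<lambda>x. f x + g x)"
  unfolding lp_dom_def
proof
  fix k
  have bm: "f \<in> borel_measurable borel" "g \<in> borel_measurable borel"
    using f g by (auto intro: borel_measurable_continuous_onI)
  obtain C where C: "decaying C (ker (sig k))" using ker_decaying[OF bump_sig] by blast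
  have "blk k (\<lambda>x. f x + g x) = (\<lambda>x. blk k f x + blk k g x)"
    unfolding blk_def by (rule ext) (rule conv_add[OF C tame_bounded[OF bm(1) f(4)] tame_bounded[OF bm(2) g(4)]])
  moreover have "lp_le p (\<lambda>x. blk k f x + blk k g x) (N * b k / wt k + N' * b k / wt k)"
    using f g b_pos[of k] by (intro lp_le_add[OF p] blk_measurable bm) (auto simp: lp_dom_def)
  ultimately show "lp_le p (blk k (\<lambda>x. f x + g x)) ((N + N') * b k / wt k)"
    by (simp add: distrib_right add_divide_distrib)
qed

text \<open>The exponential series, read as an integral over the counting measure, is estimated
  termwise by Minkowski's inequality with the bounds of \<open>power_lp_dom\<close>. For |\<xi>|
  \<le> 1 the coefficients are at most 1 / j!, and the terms Q^j / j! sum to exp Q.\<close>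

lemma ee_base:
  obtains Q where "0 < Q" "\<And>\<xi>. \<bar>\<xi>\<bar> \<le> 1 \<Longrightarrow> lp_dom (exp Q) (ee \<xi>)"
proof -
  obtain Q where Q: "0 < Q" "\<And>j. lp_dom (Q ^ j) (\<lambda>x. cU x ^ Suc j)" using power_lp_dom by blast
  have main: "lp_dom (exp Q) (ee \<xi>)" if \<xi>: "\<bar>\<xi>\<bar> \<le> 1" for \<xi>
    unfolding lp_dom_def
  proof
    fix k
    obtain C where C: "decaying C (ker (sig k))" using ker_decaying[OF bump_sig] by blast
    \<comment> \<open>Index j belongs to the power j + 1, as the constant term is removed by the -1
      in \<open>ee\<close>. Below, 1 / (j + 1)! is weakened to 1 / j! to match Q^j.\<close>
    define c where "c j = (\<i> * of_real \<xi>) ^ Suc j / fact (Suc j)" for j :: nat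
    define g where "g j x = c j * cU x ^ Suc j" for j x
    have c: "cmod (c j) \<le> 1 / fact j" for j
    proof -
      have "cmod (c j) = \<bar>\<xi>\<bar> ^ Suc j / fact (Suc j)" by (simp add: c_def norm_mult norm_power norm_divide del: fact_Suc)
      also have "\<dots> \<le> 1 / fact j" using \<xi> by (intro frac_le power_le_one fact_mono) (auto simp del: fact_Suc)
      finally show ?thesis .
    qed
    have gm: "g j \<in> borel_measurable borel" for j
      unfolding g_def[abs_def] by (intro borel_measurable_continuous_onI continuous_intros U_cont)
    let ?\<beta> = "\<lambda>j. MU ^ Suc j / fact j"
    have fs: "summable (\<lambda>j. x ^ j / fact j :: real)" for x
      using summable_exp[of x] by (simp add: field_simps)
    have \<beta>: "integrable (count_space UNIV) ?\<beta>"
      using summable_mult[OF fs[of MU], of MU] MU_nonneg by (simp add: integrable_count_space_nat_iff)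
    have g_le: "cmod (g j x) \<le> ?\<beta> j" for j x
    proof -
      have "cmod (g j x) = cmod (c j) * \<bar>U x\<bar> ^ Suc j" by (simp add: g_def norm_mult norm_power)
      also have "\<dots> \<le> 1 / fact j * MU ^ Suc j" using c[of j] U_le[of x] by (intro mult_mono power_mono) auto
      finally show ?thesis by simp
    qed
    have series: "ee \<xi> x = (LINT j|count_space UNIV. g j x)" for x
    proof -
      have "(\<lambda>j. (\<i> * of_real (\<xi> * U x)) ^ j /\<^sub>R fact j) sums exp (\<i> * of_real (\<xi> * U x))" by (rule exp_converges)
      then have "(\<lambda>j. (\<i> * of_real (\<xi> * U x)) ^ Suc j /\<^sub>R fact (Suc j)) sums (exp (\<i> * of_real (\<xi> * U x)) - 1)"
        by (subst sums_Suc_iff) simp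
      moreover have "(\<i> * of_real (\<xi> * U x)) ^ Suc j /\<^sub>R fact (Suc j) = g j x" for j
        by (simp add: g_def c_def power_mult_distrib scaleR_conv_of_real field_simps del: fact_Suc)
      ultimately have "(\<lambda>j. g j x) sums ee \<xi> x" by (simp add: ee_def cis_conv_exp)
      moreover have "(\<lambda>j. g j x) sums (LINT j|count_space UNIV. g j x)"
        by (rule sums_integral_count_space_nat[OF integrable_count_dominated[OF \<beta> g_le]])
      ultimately show ?thesis by (rule sums_unique2)
    qed
    have blk: "blk k (ee \<xi>) x = (LINT j|count_space UNIV. c j * blk k (\<lambda>x. cU x ^ Suc j) x)" for x
    proof -
      have "ee \<xi> = (\<lambda>x. LINT j|count_space UNIV. g j x)" using series by blast
      then have "blk k (ee \<xi>) x = (LINT j|count_space UNIV. blk k (g j) x)"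
        unfolding blk_def using conv_series[OF C \<beta> g_le gm] by simp
      then show ?thesis by (simp only: blk_def g_def[abs_def] conv_scale)
    qed
    define \<alpha> where "\<alpha> j = Q ^ j / fact j * (b k / wt k)" for j :: nat
    have pm: "(\<lambda>x. cU x ^ Suc j) \<in> borel_measurable borel" for j
      by (intro borel_measurable_continuous_onI continuous_intros U_cont)
    have bk: "0 < b k / wt k" using b_pos[of k] by simp
    have \<alpha>_pos: "0 < \<alpha> j" for j unfolding \<alpha>_def by (rule mult_pos_pos[OF divide_pos_pos bk]) (use Q(1) in auto)
    show "lp_le p (blk k (ee \<xi>)) (exp Q * b k / wt k)"
      unfolding lp_le_def
    proof (rule minkowski_integral[OF pair_sigma_finite_lborel_count p, where g = "\<lambda>x j. cmod (c j * blk k (\<lambda>x. cU x ^ Suc j) x)" and \<alpha> = \<alpha>])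
      show "case_prod (\<lambda>x j. cmod (c j * blk k (\<lambda>x. cU x ^ Suc j) x)) \<in> borel_measurable (lborel \<Otimes>\<^sub>M count_space UNIV)"
        using blk_measurable[OF pm] by (intro measurable_pair_count_space2) auto
      show "(\<integral>\<^sup>+x. ennreal (cmod (c j * blk k (\<lambda>x. cU x ^ Suc j) x) powr p) \<partial>lborel) \<le> ennreal (\<alpha> j powr p)" for j
      proof -
        have q: "lp_le p (blk k (\<lambda>x. cU x ^ Suc j)) (Q ^ j * b k / wt k)" using Q(2)[of j] unfolding lp_dom_def by blast
        have nn: "0 \<le> Q ^ j * b k / wt k" using Q(1) b_pos[of k] by (simp add: less_imp_le)
        have sc: "lp_le p (\<lambda>x. c j * blk k (\<lambda>x. cU x ^ Suc j) x) (cmod (c j) * (Q ^ j * b k / wt k))"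
          by (rule lp_le_scale[OF q nn p blk_measurable[OF pm]])
        have le: "cmod (c j) * (Q ^ j * b k / wt k) \<le> \<alpha> j"
          using mult_right_mono[OF c[of j] nn] by (simp add: \<alpha>_def)
        have "lp_le p (\<lambda>x. c j * blk k (\<lambda>x. cU x ^ Suc j) x) (\<alpha> j)"
          by (rule lp_le_mono[OF sc mult_nonneg_nonneg[OF norm_ge_zero nn] le]) (use p in simp)
        then show ?thesis by (simp add: lp_le_def)
      qed
      show "ennreal (cmod (blk k (ee \<xi>) x)) \<le> (\<integral>\<^sup>+j. ennreal (cmod (c j * blk k (\<lambda>x. cU x ^ Suc j) x)) \<partial>count_space UNIV)" for x
        unfolding blk by (rule cmod_integral_le_nn_integral)
      have "(\<lambda>j. Q ^ j /\<^sub>R fact j) sums exp Q" by (rule exp_converges)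
      then have "(\<lambda>j. Q ^ j /\<^sub>R fact j * (b k / wt k)) sums (exp Q * (b k / wt k))" by (rule sums_mult2)
      then have s: "\<alpha> sums (exp Q * (b k / wt k))"
        by (simp add: \<alpha>_def[abs_def] divide_inverse mult.commute mult.left_commute)
      have "(\<integral>\<^sup>+j. ennreal (\<alpha> j) \<partial>count_space UNIV) = ennreal (exp Q * (b k / wt k))"
        using suminf_ennreal_eq[OF less_imp_le[OF \<alpha>_pos] s] by (simp add: nn_integral_count_space_nat)
      then show "(\<integral>\<^sup>+j. ennreal (\<alpha> j) \<partial>count_space UNIV) \<le> ennreal (exp Q * b k / wt k)" by simp
      show "0 < exp Q * b k / wt k" using b_pos[of k] by simp
    qed (use \<alpha>_pos in auto)
  qed
  show thesis by (rule that[OF Q(1)], rule main)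
qed

text \<open>The square in \<open>ee_double\<close> is bounded by exp X times exp (gain X), up to a
  polynomial in X. So the exponents after j doublings may be any sequence X with X (j + 1) \<ge> 2^a
  X j + P ln (1 + X j) + ln K that starts at \<open>ee_base\<close>.\<close>

theorem ee_lp_dom:
  obtains l C where "0 < l" "0 < C" "\<And>\<xi>. lp_dom (C * exp (l * (\<bar>\<xi>\<bar> powr (1 / s) * ln \<bar>\<xi>\<bar>))) (ee \<xi>)"
proof -
  obtain C where C: "C > 0" "\<And>v v' M M' N N' S S'. dominated M N S v \<Longrightarrow> dominated M' N' S' v' \<Longrightarrow>
      lp_dom (C * (N * S' + N' * S)) (\<lambda>x. v x * v' x)"
    using lp_dom_mult by blast
  obtain C2 where C2: "0 < C2"
    "\<And>X v. continuous_on UNIV v \<Longrightarrow> (\<And>x. cmod (v x) \<le> 2) \<Longrightarrow> lp_dom (exp X) v \<Longrightarrow> 0 \<le> X \<Longrightarrow>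
      sup_dom (C2 * (1 + X) powr P * exp (gain * X)) v"
    using sup_dom_interpolate by blast
  obtain Q where Q: "0 < Q" "\<And>\<xi>. \<bar>\<xi>\<bar> \<le> 1 \<Longrightarrow> lp_dom (exp Q) (ee \<xi>)" using ee_base by blast
  \<comment> \<open>2 C C2 stems from the square, whose two mixed terms coincide, and 2 from the
    linear part of \<open>ee_double\<close>.\<close>
  define K where "K = 2 * C * C2 + 2"
  have K: "K > 0" using mult_pos_pos[OF C(1) C2(1)] by (simp add: K_def)
  define a where "a = 1 / s"
  have a: "0 < a" "a < 1" using s by (auto simp: a_def)
  have gain_a: "1 + gain = 2 powr a" by (simp add: gain_def a_def)
  obtain c where c: "c \<ge> Q" "c > 0"
    "\<And>j::nat. ln K + P * ln (1 + c * (real j + 1) * 2 powr (a * real j)) \<le> c * 2 powr (a * (real j + 1))"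
    using doubling_growth[OF a(1) P_pos, of Q "ln K"] by blast
  \<comment> \<open>Multiplication by 2^a accounts for the power of 2; raising the factor j + 1 to j
    + 2 leaves room c 2^(a (j + 1)) for the losses of one doubling, which is the inequality
    \<open>doubling_growth\<close> provides.\<close>
  define X where "X j = c * (real j + 1) * 2 powr (a * real j)" for j :: nat
  have X: "0 \<le> X j" for j using c(2) by (simp add: X_def)
  have step: "lp_dom (exp (X (Suc j))) (ee (2 * \<xi>))" if e: "lp_dom (exp (X j)) (ee \<xi>)" for j \<xi>
  proof -
    let ?x = "X j"
    let ?S = "C2 * (1 + ?x) powr P * exp (gain * ?x)"
    have xp: "1 \<le> (1 + ?x) powr P" using X[of j] P_pos by (intro ge_one_powr_ge_zero) auto
    have S: "0 < ?S" using C2(1) X[of j] by (intro mult_pos_pos) auto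
    have d: "dominated 2 (exp ?x) ?S (ee \<xi>)"
      using C2(2)[OF ee_continuous ee_bounded e X] e S by (auto simp: dominated_def ee_continuous ee_bounded)
    have pos: "0 < C * (exp ?x * ?S + exp ?x * ?S)"
      by (rule mult_pos_pos[OF C(1) add_pos_pos[OF mult_pos_pos[OF exp_gt_zero S] mult_pos_pos[OF exp_gt_zero S]]])
    have sq: "lp_dom (C * (exp ?x * ?S + exp ?x * ?S)) (\<lambda>x. ee \<xi> x * ee \<xi> x)" by (rule C(2)[OF d d])
    have tw: "lp_dom (exp ?x + exp ?x) (\<lambda>x. ee \<xi> x + ee \<xi> x)"
      by (rule lp_dom_add[OF e _ ee_continuous ee_bounded e _ ee_continuous ee_bounded]) auto
    have "lp_dom (C * (exp ?x * ?S + exp ?x * ?S) + (exp ?x + exp ?x)) (\<lambda>x. ee \<xi> x * ee \<xi> x + (ee \<xi> x + ee \<xi> x))"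
    proof (rule lp_dom_add[OF sq _ _ _ tw])
      show "0 < C * (exp ?x * ?S + exp ?x * ?S)" by (rule pos)
      show "cmod (ee \<xi> x * ee \<xi> x) \<le> 2 * 2" for x unfolding norm_mult by (intro mult_mono ee_bounded) auto
      show "cmod (ee \<xi> x + ee \<xi> x) \<le> 2 + 2" for x by (intro norm_triangle_mono ee_bounded)
    qed (auto intro!: continuous_intros ee_continuous)
    then have "lp_dom (C * (exp ?x * ?S + exp ?x * ?S) + (exp ?x + exp ?x)) (ee (2 * \<xi>))"
      by (simp add: ee_double[abs_def])
    moreover have "C * (exp ?x * ?S + exp ?x * ?S) + (exp ?x + exp ?x) \<le> exp (X (Suc j))"
    proof -
      \<comment> \<open>The linear part is dominated by the bound for the square, whose extra
        factors are at least 1.\<close>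
      have "exp ?x = exp ?x * 1 * 1" by simp
      also have "\<dots> \<le> exp ?x * (1 + ?x) powr P * exp (gain * ?x)"
        using xp X[of j] gain by (intro mult_mono) auto
      finally have "C * (exp ?x * ?S + exp ?x * ?S) + (exp ?x + exp ?x) \<le> K * (exp ?x * (1 + ?x) powr P * exp (gain * ?x))"
        by (simp add: K_def algebra_simps)
      also have "\<dots> = exp (ln K + P * ln (1 + ?x) + (1 + gain) * ?x)"
        using K X[of j] by (simp add: exp_add powr_def algebra_simps)
      also have "\<dots> \<le> exp (c * 2 powr (a * (real j + 1)) + 2 powr a * ?x)"
        using c(3)[of j] unfolding gain_a X_def by simp
      also have "c * 2 powr (a * (real j + 1)) + 2 powr a * ?x = X (Suc j)"
        by (simp add: X_def algebra_simps powr_add)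
      finally show ?thesis .
    qed
    ultimately show ?thesis
      by (rule lp_dom_mono[OF _ less_imp_le[OF add_pos_pos[OF pos add_pos_pos[OF exp_gt_zero exp_gt_zero]]]])
  qed
  have all: "\<bar>\<xi>\<bar> \<le> 2 ^ j \<Longrightarrow> lp_dom (exp (X j)) (ee \<xi>)" for j \<xi>
  proof (induction j arbitrary: \<xi>)
    case 0
    then have "lp_dom (exp Q) (ee \<xi>)" using Q(2) by simp
    then show ?case by (rule lp_dom_mono) (auto simp: X_def c)
  next
    case (Suc j)
    then have "lp_dom (exp (X j)) (ee (\<xi> / 2))" by (intro Suc.IH) auto
    then show ?case using step[of j "\<xi> / 2"] by simp
  qed
  obtain l E where l: "0 < l" "\<And>\<xi>::real. \<exists>j::nat. \<bar>\<xi>\<bar> \<le> 2 ^ j \<and> c * (real j + 1) * 2 powr (a * real j) \<le> l * (\<bar>\<xi>\<bar> powr a * ln \<bar>\<xi>\<bar>) + E"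
    using dyadic_growth[OF a c(2)] by blast
  have main: "lp_dom (exp E * exp (l * (\<bar>\<xi>\<bar> powr (1 / s) * ln \<bar>\<xi>\<bar>))) (ee \<xi>)" for \<xi>
  proof -
    obtain j where j: "\<bar>\<xi>\<bar> \<le> 2 ^ j" "X j \<le> l * (\<bar>\<xi>\<bar> powr a * ln \<bar>\<xi>\<bar>) + E"
      using l(2)[of \<xi>] unfolding X_def by blast
    have "exp (X j) \<le> exp E * exp (l * (\<bar>\<xi>\<bar> powr (1 / s) * ln \<bar>\<xi>\<bar>))"
      using j(2) by (simp add: a_def add.commute flip: exp_add)
    then show ?thesis by (intro lp_dom_mono[OF all[OF j(1)]]) auto
  qed
  show thesis by (rule that[OF l(1) _ main]) simp
qed

end

section \<open>Fourier transforms of measures with all moments\<close>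

lemma norm_cis_minus_1_le: "cmod (cis x - 1) \<le> \<bar>x\<bar>"
  using iexp_approx1[of x 0] by (simp add: cis_conv_exp)

lemma has_vector_derivativeI_quotient:
  fixes f :: "real \<Rightarrow> 'b::real_normed_vector"
  assumes "\<And>X. (\<And>n. X n \<noteq> 0) \<Longrightarrow> X \<longlonglongrightarrow> 0 \<Longrightarrow> (\<lambda>n. (f (t + X n) - f t) /\<^sub>R X n) \<longlonglongrightarrow> d"
  shows "(f has_vector_derivative d) (at t)"
proof -
  have "((\<lambda>h. (f (t + h) - f t) /\<^sub>R h) \<longlongrightarrow> d) (at 0)"
    unfolding tendsto_at_iff_sequentially using assms by (auto simp: o_def)
  then have "((\<lambda>h. norm ((f (t + h) - f t) /\<^sub>R h - d)) \<longlongrightarrow> 0) (at 0)"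
    by (simp add: LIM_zero_iff tendsto_norm_zero_iff)
  then have "((\<lambda>h. norm (f (t + h) - f t - h *\<^sub>R d) / norm h) \<longlongrightarrow> 0) (at 0)"
  proof (rule Lim_transform_eventually)
    have "norm ((f (t + h) - f t) /\<^sub>R h - d) = norm (f (t + h) - f t - h *\<^sub>R d) / norm h" if "h \<noteq> 0" for h
    proof -
      have "(f (t + h) - f t) /\<^sub>R h - d = (f (t + h) - f t - h *\<^sub>R d) /\<^sub>R h" using that by (simp add: scaleR_diff_right)
      then show ?thesis by (simp add: divide_inverse_commute)
    qed
    then show "\<forall>\<^sub>F h in at 0. norm ((f (t + h) - f t) /\<^sub>R h - d) = norm (f (t + h) - f t - h *\<^sub>R d) / norm h"
      by (auto simp: eventually_at_filter)
  qed
  then show ?thesis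
    unfolding has_vector_derivative_def has_derivative_at by (simp add: bounded_linear_scaleR_left)
qed

lemma cis_quotient_LIMSEQ:
  assumes "\<And>n. X n \<noteq> 0" "X \<longlonglongrightarrow> (0::real)"
  shows "(\<lambda>n. (cis (c * X n) - 1) /\<^sub>R X n) \<longlonglongrightarrow> \<i> * of_real c"
proof -
  have "((\<lambda>t. cis (c * t)) has_derivative (\<lambda>s. s *\<^sub>R (\<i> * of_real c))) (at 0)"
    by (rule derivative_eq_intros refl | simp add: scaleR_conv_of_real fun_eq_iff ac_simps)+
  from has_derivative_line_quotient[OF this]
  have "((\<lambda>t. (cis (c * t) - 1) /\<^sub>R t) \<longlongrightarrow> \<i> * of_real c) (at 0)" by simp
  then show ?thesis
    unfolding tendsto_at_iff_sequentially using assms by (auto simp: o_def)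
qed

definition moment_fn :: "real measure \<Rightarrow> nat \<Rightarrow> real \<Rightarrow> complex" where
  "moment_fn m j t = (LINT \<xi>|m. (\<i> * of_real \<xi>) ^ j * cis (\<xi> * t))"

text \<open>Differentiation under the integral: |cis x - 1| \<le> |x| bounds the quotients by
  |\<xi>|^(j + 1), whose integrability is the next moment.\<close>

lemma moment_fn_derivative:
  assumes [measurable_cong]: "sets m = sets borel" and mom: "\<And>j. integrable m (\<lambda>\<xi>. \<bar>\<xi>\<bar> ^ j)"
  shows "(moment_fn m j has_vector_derivative moment_fn m (Suc j) t) (at t)"
proof (rule has_vector_derivativeI_quotient)
  fix X :: "nat \<Rightarrow> real" assume X: "\<And>n. X n \<noteq> 0" "X \<longlonglongrightarrow> 0"
  have int: "integrable m (\<lambda>\<xi>. (\<i> * of_real \<xi>) ^ j * cis (\<xi> * t))" for t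
    by (rule Bochner_Integration.integrable_bound[OF mom[of j]])
      (measurable, auto simp: norm_mult norm_power power_abs)
  have q: "(moment_fn m j (t + X n) - moment_fn m j t) /\<^sub>R X n =
      (LINT \<xi>|m. (\<i> * of_real \<xi>) ^ j * cis (\<xi> * t) * ((cis (\<xi> * X n) - 1) /\<^sub>R X n))" for n
  proof -
    have "moment_fn m j (t + X n) - moment_fn m j t =
        (LINT \<xi>|m. (\<i> * of_real \<xi>) ^ j * cis (\<xi> * (t + X n)) - (\<i> * of_real \<xi>) ^ j * cis (\<xi> * t))"
      unfolding moment_fn_def by (rule Bochner_Integration.integral_diff[OF int int, symmetric])
    also have "\<dots> /\<^sub>R X n = (LINT \<xi>|m. ((\<i> * of_real \<xi>) ^ j * cis (\<xi> * (t + X n)) - (\<i> * of_real \<xi>) ^ j * cis (\<xi> * t)) /\<^sub>R X n)"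
      by (rule integral_scaleR_right[symmetric])
    also have "\<dots> = (LINT \<xi>|m. (\<i> * of_real \<xi>) ^ j * cis (\<xi> * t) * ((cis (\<xi> * X n) - 1) /\<^sub>R X n))"
      by (intro Bochner_Integration.integral_cong refl)
        (simp add: distrib_left cis_mult[symmetric] scaleR_conv_of_real algebra_simps)
    finally show ?thesis .
  qed
  show "(\<lambda>n. (moment_fn m j (t + X n) - moment_fn m j t) /\<^sub>R X n) \<longlonglongrightarrow> moment_fn m (Suc j) t"
    unfolding q moment_fn_def[of m "Suc j"]
  proof (rule integral_dominated_convergence[OF _ _ mom[of "Suc j"]])
    show "AE \<xi> in m. (\<lambda>n. (\<i> * of_real \<xi>) ^ j * cis (\<xi> * t) * ((cis (\<xi> * X n) - 1) /\<^sub>R X n)) \<longlonglongrightarrow> (\<i> * of_real \<xi>) ^ Suc j * cis (\<xi> * t)"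
    proof (rule AE_I2)
      fix \<xi> :: real
      have "(\<lambda>n. (\<i> * of_real \<xi>) ^ j * cis (\<xi> * t) * ((cis (\<xi> * X n) - 1) /\<^sub>R X n)) \<longlonglongrightarrow> (\<i> * of_real \<xi>) ^ j * cis (\<xi> * t) * (\<i> * of_real \<xi>)"
        by (intro tendsto_mult tendsto_const cis_quotient_LIMSEQ X)
      then show "(\<lambda>n. (\<i> * of_real \<xi>) ^ j * cis (\<xi> * t) * ((cis (\<xi> * X n) - 1) /\<^sub>R X n)) \<longlonglongrightarrow> (\<i> * of_real \<xi>) ^ Suc j * cis (\<xi> * t)"
        by (simp add: ac_simps)
    qed
    show "AE \<xi> in m. norm ((\<i> * of_real \<xi>) ^ j * cis (\<xi> * t) * ((cis (\<xi> * X n) - 1) /\<^sub>R X n)) \<le> \<bar>\<xi>\<bar> ^ Suc j" for n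
    proof (rule AE_I2)
      fix \<xi> :: real
      have "cmod ((cis (\<xi> * X n) - 1) /\<^sub>R X n) \<le> \<bar>\<xi>\<bar>"
        unfolding norm_scaleR using norm_cis_minus_1_le[of "\<xi> * X n"] X(1)[of n] by (simp add: abs_mult field_simps)
      then have "\<bar>\<xi>\<bar> ^ j * cmod ((cis (\<xi> * X n) - 1) /\<^sub>R X n) \<le> \<bar>\<xi>\<bar> ^ j * \<bar>\<xi>\<bar>" by (intro mult_left_mono) auto
      then show "norm ((\<i> * of_real \<xi>) ^ j * cis (\<xi> * t) * ((cis (\<xi> * X n) - 1) /\<^sub>R X n)) \<le> \<bar>\<xi>\<bar> ^ Suc j"
        unfolding norm_mult by (simp add: norm_mult norm_power mult.commute del: norm_scaleR scaleR_right_diff_distrib mult_scaleR_left mult_scaleR_right)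
    qed
  qed measurable
qed

text \<open>On the real line the only basis vector is 1, so an iterated derivative depends only on
  the length of the list.\<close>

lemma C_infinity_if_derivative_sequence:
  fixes G :: "nat \<Rightarrow> real \<Rightarrow> complex"
  assumes "\<And>j t. (G j has_vector_derivative G (Suc j) t) (at t)"
  shows "C_infinity (G 0)"
proof -
  have D: "(G j has_derivative (\<lambda>s. s *\<^sub>R G (Suc j) t)) (at t)" for j t
    using assms by (simp add: has_vector_derivative_def)
  have d: "dderiv 1 (G j) = G (Suc j)" for j
    unfolding dderiv_eqI[OF D] by simp
  have "iter_deriv bs (G 0) = G (length bs)" if "bs \<in> lists Basis" for bs :: "real list"
    using that by (induction bs) (auto simp: iter_deriv_def d)
  then show ?thesis using D unfolding C_infinity_def differentiable_def by metis
qed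

text \<open>At \<xi> = 0 the exponent is 0 because \<open>0 powr x = 0\<close>, in accordance with
  the convention that the integrand is 1 there.\<close>

definition gevrey_exp :: "real \<Rightarrow> real \<Rightarrow> real \<Rightarrow> real" where
  "gevrey_exp s l \<xi> = exp (l * (\<bar>\<xi>\<bar> powr (1 / s) * ln \<bar>\<xi>\<bar>))"

lemma gevrey_exp_measurable [measurable]: "gevrey_exp s l \<in> borel_measurable borel"
  unfolding gevrey_exp_def[abs_def] by measurable

lemma gevrey_exp_ge: assumes "s > 0" "l \<ge> 0" shows "exp (- (l * s)) \<le> gevrey_exp s l \<xi>"
proof -
  have "l * (- (1 / (1 / s))) \<le> l * (\<bar>\<xi>\<bar> powr (1 / s) * ln \<bar>\<xi>\<bar>)"
    using assms by (intro mult_left_mono powr_mult_ln_ge) auto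
  then show ?thesis by (simp add: gevrey_exp_def)
qed

text \<open>Once |\<xi>| exceeds j^s and 1, the exponent |\<xi>|^(1/s) ln |\<xi>| is at least j ln
  |\<xi>|. On the remaining bounded set the lower bound exp (-s) of the weight suffices.\<close>

lemma moment_le_gevrey_exp:
  assumes s: "s > 0"
  obtains C where "\<And>\<xi>. \<bar>\<xi>\<bar> ^ j \<le> C * gevrey_exp s 1 \<xi>" "0 < C"
proof -
  define R where "R = max 1 (real j powr s)"
  have R: "1 \<le> R" by (simp add: R_def)
  define C where "C = 1 + R ^ j * exp s"
  have C: "1 \<le> C" using R by (simp add: C_def)
  have "\<bar>\<xi>\<bar> ^ j \<le> C * gevrey_exp s 1 \<xi>" for \<xi>
  proof (cases "\<bar>\<xi>\<bar> \<le> R")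
    case True
    then have "\<bar>\<xi>\<bar> ^ j \<le> R ^ j" by (intro power_mono) auto
    also have "\<dots> = R ^ j * exp s * exp (- (1 * s))" by (simp add: exp_minus)
    also have "\<dots> \<le> C * gevrey_exp s 1 \<xi>"
      using R s by (intro mult_mono gevrey_exp_ge) (auto simp: C_def)
    finally show ?thesis .
  next
    case False
    then have t: "1 < \<bar>\<xi>\<bar>" "real j powr s \<le> \<bar>\<xi>\<bar>" by (auto simp: R_def)
    have "(real j powr s) powr (1 / s) \<le> \<bar>\<xi>\<bar> powr (1 / s)" using t s by (intro powr_mono2) auto
    then have "real j \<le> \<bar>\<xi>\<bar> powr (1 / s)" using s by (cases "j = 0") (auto simp: powr_powr)
    then have "real j * ln \<bar>\<xi>\<bar> \<le> \<bar>\<xi>\<bar> powr (1 / s) * ln \<bar>\<xi>\<bar>" using t by (intro mult_right_mono) auto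
    moreover have "\<bar>\<xi>\<bar> ^ j = exp (real j * ln \<bar>\<xi>\<bar>)" using t by (simp add: exp_of_nat_mult)
    ultimately have "\<bar>\<xi>\<bar> ^ j \<le> gevrey_exp s 1 \<xi>" by (simp add: gevrey_exp_def)
    also have "\<dots> \<le> C * gevrey_exp s 1 \<xi>" using C by (simp add: gevrey_exp_def)
    finally show ?thesis .
  qed
  then show thesis using C that[of C] by simp
qed

section \<open>Superposition of exponentials over the frequency variable\<close>

context gevrey_fun
begin

text \<open>Minkowski's inequality over \<xi>. Blocks pass through the integral by Fubini, since
  \<open>ee\<close> is bounded by 2, m is finite and the kernel is integrable.\<close>

lemma lp_dom_integral:
  fixes m :: "real measure"
  assumes m: "finite_measure m" and [measurable_cong]: "sets m = sets borel"
    and dom: "\<And>\<xi>. lp_dom (C * gevrey_exp s l \<xi>) (ee \<xi>)" "0 < C"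
    and T: "(\<integral>\<^sup>+\<xi>. ennreal (gevrey_exp s l \<xi>) \<partial>m) \<le> ennreal T" "0 < T"
  shows "lp_dom (C * T) (\<lambda>x. LINT \<xi>|m. ee \<xi> x)"
  unfolding lp_dom_def
proof
  fix k
  interpret finite_measure m by fact
  have psf: "pair_sigma_finite lborel m"
    by (simp add: pair_sigma_finite_def lborel.sigma_finite_measure_axioms sigma_finite_measure_axioms)
  let ?K = "ker (sig k)"
  have [measurable]: "?K \<in> borel_measurable borel" by (rule ker_measurable[OF bump_sig])
  have [measurable]: "U \<in> borel_measurable borel" by (rule borel_measurable_continuous_onI[OF U_cont])
  have joint [measurable]: "(\<lambda>(x, \<xi>). ee \<xi> x) \<in> borel_measurable (borel \<Otimes>\<^sub>M borel)"
    unfolding ee_def by measurable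
  have blk: "blk k (\<lambda>x. LINT \<xi>|m. ee \<xi> x) x = (LINT \<xi>|m. blk k (ee \<xi>) x)" for x
  proof -
    have "blk k (\<lambda>x. LINT \<xi>|m. ee \<xi> x) x = (LINT z|lborel. LINT \<xi>|m. ?K z * ee \<xi> (x - z))"
      by (simp add: blk_def conv_def)
    also have "\<dots> = (LINT \<xi>|m. LINT z|lborel. ?K z * ee \<xi> (x - z))"
    proof (rule fubini_swap[OF psf])
      show "(\<lambda>(z, \<xi>). ?K z * ee \<xi> (x - z)) \<in> borel_measurable (lborel \<Otimes>\<^sub>M m)" unfolding ee_def by measurable
      have "(\<integral>\<^sup>+z. \<integral>\<^sup>+\<xi>. ennreal (cmod (?K z * ee \<xi> (x - z))) \<partial>m \<partial>lborel) \<le> (\<integral>\<^sup>+z. \<integral>\<^sup>+\<xi>. ennreal (cmod (?K z) * 2) \<partial>m \<partial>lborel)"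
        using ee_bounded by (intro nn_integral_mono ennreal_leI) (auto simp: norm_mult mult_left_mono)
      also have "\<dots> = (\<integral>\<^sup>+z. ennreal (cmod (?K z)) * (2 * emeasure m (space m)) \<partial>lborel)"
        by (simp add: ennreal_mult mult.assoc)
      also have "\<dots> = (\<integral>\<^sup>+z. ennreal (cmod (?K z)) \<partial>lborel) * (2 * emeasure m (space m))"
        by (rule nn_integral_multc) measurable
      also have "\<dots> < \<infinity>"
      proof -
        have "emeasure m (space m) < \<infinity>" using emeasure_finite by (simp add: less_top[symmetric])
        then show ?thesis
          using ker_integrable[OF bump_sig, of k] by (simp add: integrable_iff_bounded ennreal_mult_less_top)
      qed
      finally show "(\<integral>\<^sup>+z. \<integral>\<^sup>+\<xi>. ennreal (cmod (?K z * ee \<xi> (x - z))) \<partial>m \<partial>lborel) < \<infinity>" .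
    qed
    finally show ?thesis by (simp add: blk_def conv_def)
  qed
  have bk: "0 < b k / wt k" using b_pos[of k] by simp
  have ge: "0 < gevrey_exp s l \<xi>" for \<xi> by (simp add: gevrey_exp_def)
  show "lp_le p (blk k (\<lambda>x. LINT \<xi>|m. ee \<xi> x)) (C * T * b k / wt k)"
    unfolding lp_le_def
  proof (rule minkowski_integral[OF psf p, where g = "\<lambda>x \<xi>. cmod (blk k (ee \<xi>) x)" and \<alpha> = "\<lambda>\<xi>. C * gevrey_exp s l \<xi> * b k / wt k"])
    have "(\<lambda>z. LINT y|lborel. ?K y * ee (snd z) (fst z - y)) \<in> borel_measurable (lborel \<Otimes>\<^sub>M m)"
      unfolding ee_def by (rule lborel.borel_measurable_lebesgue_integral) measurable
    then show "(\<lambda>(x, \<xi>). cmod (blk k (ee \<xi>) x)) \<in> borel_measurable (lborel \<Otimes>\<^sub>M m)"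
      by (simp add: blk_def conv_def split_beta)
    show "(\<integral>\<^sup>+x. ennreal (cmod (blk k (ee \<xi>) x) powr p) \<partial>lborel) \<le> ennreal ((C * gevrey_exp s l \<xi> * b k / wt k) powr p)" for \<xi>
      using dom(1)[of \<xi>] by (simp add: lp_dom_def lp_le_def)
    show "0 < C * gevrey_exp s l \<xi> * b k / wt k" for \<xi> using dom(2) ge b_pos[of k] by simp
    have "(\<integral>\<^sup>+\<xi>. ennreal (C * gevrey_exp s l \<xi> * b k / wt k) \<partial>m) = (\<integral>\<^sup>+\<xi>. ennreal (C * (b k / wt k)) * ennreal (gevrey_exp s l \<xi>) \<partial>m)"
    proof (rule nn_integral_cong)
      fix \<xi>
      have "C * gevrey_exp s l \<xi> * b k / wt k = C * (b k / wt k) * gevrey_exp s l \<xi>" by simp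
      then show "ennreal (C * gevrey_exp s l \<xi> * b k / wt k) = ennreal (C * (b k / wt k)) * ennreal (gevrey_exp s l \<xi>)"
        using ennreal_mult'[of "C * (b k / wt k)" "gevrey_exp s l \<xi>"] dom(2) bk by (simp only: mult_pos_pos less_imp_le)
    qed
    also have "\<dots> = ennreal (C * (b k / wt k)) * (\<integral>\<^sup>+\<xi>. ennreal (gevrey_exp s l \<xi>) \<partial>m)"
      by (rule nn_integral_cmult) measurable
    also have "\<dots> \<le> ennreal (C * (b k / wt k)) * ennreal T" by (intro mult_left_mono T) auto
    also have "\<dots> = ennreal (C * T * b k / wt k)"
    proof -
      have "C * T * b k / wt k = C * (b k / wt k) * T" by simp
      then show ?thesis using ennreal_mult''[of T "C * (b k / wt k)"] T(2) by (simp only: less_imp_le)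
    qed
    finally show "(\<integral>\<^sup>+\<xi>. ennreal (C * gevrey_exp s l \<xi> * b k / wt k) \<partial>m) \<le> ennreal (C * T * b k / wt k)" .
    show "0 < C * T * b k / wt k" using dom(2) T(2) b_pos[of k] by simp
    show "ennreal (cmod (blk k (\<lambda>x. LINT \<xi>|m. ee \<xi> x) x)) \<le> (\<integral>\<^sup>+\<xi>. ennreal (cmod (blk k (ee \<xi>) x)) \<partial>m)" for x
      unfolding blk by (rule cmod_integral_le_nn_integral)
  qed (auto simp: gevrey_exp_def)
qed

lemma integral_ee_bounded:
  assumes "finite_measure m"
  shows "cmod (LINT \<xi>|m. ee \<xi> x) \<le> 2 * measure m (space m)"
proof -
  interpret finite_measure m by fact
  have "ennreal (cmod (LINT \<xi>|m. ee \<xi> x)) \<le> (\<integral>\<^sup>+\<xi>. ennreal 2 \<partial>m)"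
    by (rule order_trans[OF cmod_integral_le_nn_integral nn_integral_mono]) (intro ennreal_leI ee_bounded)
  also have "\<dots> = ennreal (2 * measure m (space m))"
    by (simp add: emeasure_eq_measure ennreal_mult)
  finally show ?thesis by (simp add: ennreal_le_iff)
qed

lemma integral_ee_continuous:
  assumes "finite_measure m" and [measurable_cong]: "sets m = sets borel"
  shows "continuous_on UNIV (\<lambda>x. LINT \<xi>|m. ee \<xi> x)"
proof -
  interpret finite_measure m by fact
  have "(\<lambda>n. LINT \<xi>|m. ee \<xi> (X n)) \<longlonglongrightarrow> (LINT \<xi>|m. ee \<xi> x)" if X: "X \<longlonglongrightarrow> x" for X x
  proof (rule integral_dominated_convergence[where w = "\<lambda>_. 2"])
    show "AE \<xi> in m. (\<lambda>n. ee \<xi> (X n)) \<longlonglongrightarrow> ee \<xi> x"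
      using ee_continuous by (intro AE_I2 isCont_tendsto_compose[OF _ X]) (simp add: continuous_on_eq_continuous_at)
    show "(\<lambda>\<xi>. ee \<xi> y) \<in> borel_measurable m" for y unfolding ee_def by measurable
    then show "(\<lambda>\<xi>. ee \<xi> (X n)) \<in> borel_measurable m" for n .
  qed (use ee_bounded in auto)
  then show ?thesis by (auto simp: continuous_on_eq_continuous_at continuous_at_sequentially o_def)
qed

lemma lp_dom_scale:
  assumes "lp_dom N v" "0 \<le> N" "v \<in> borel_measurable borel"
  shows "lp_dom (cmod c * N) (\<lambda>x. c * v x)"
  unfolding lp_dom_def
proof
  fix k
  have "lp_le p (blk k v) (N * b k / wt k)" using assms(1) by (simp add: lp_dom_def)
  then have "lp_le p (\<lambda>x. c * blk k v x) (cmod c * (N * b k / wt k))"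
    using assms(2) b_pos[of k] p by (intro lp_le_scale blk_measurable assms) (auto simp: less_imp_le)
  moreover have "blk k (\<lambda>x. c * v x) = (\<lambda>x. c * blk k v x)" by (simp add: blk_def conv_scale fun_eq_iff)
  ultimately show "lp_le p (blk k (\<lambda>x. c * v x)) (cmod c * N * b k / wt k)" by (simp add: mult.assoc)
qed

lemma lp_dom_sum:
  assumes "finite I" "I \<noteq> {}" "\<And>i. i \<in> I \<Longrightarrow> lp_dom (N i) (v i) \<and> 0 < N i \<and> continuous_on UNIV (v i) \<and> (\<forall>x. cmod (v i x) \<le> M i)"
  shows "lp_dom (\<Sum>i\<in>I. N i) (\<lambda>x. \<Sum>i\<in>I. v i x)"
  using assms
proof (induction I rule: finite_ne_induct)
  case (insert i I)
  have "lp_dom (N i + (\<Sum>i\<in>I. N i)) (\<lambda>x. v i x + (\<Sum>i\<in>I. v i x))"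
  proof (rule lp_dom_add)
    show "cmod (\<Sum>i\<in>I. v i x) \<le> (\<Sum>i\<in>I. M i)" for x
      using insert.prems by (intro order_trans[OF norm_sum] sum_mono) auto
    show "0 < (\<Sum>i\<in>I. N i)" using insert by (intro sum_pos) auto
    show "continuous_on UNIV (\<lambda>x. \<Sum>i\<in>I. v i x)" using insert.prems by (intro continuous_on_sum) auto
  qed (use insert in auto)
  then show ?case using insert by simp
qed simp

end

section \<open>Majorants of sequences\<close>

text \<open>b is the convolution with \<open>lat\<close> of a plus the unit sequence at 0. Then
  \<open>lat_conv_le\<close> gives the absorption property, the term m = 0 gives a \<le> b because
  \<open>lat 0\<close> is 1, and Young's inequality for sequences, through Minkowski, preserves
  summability of powers.\<close>

lemma majorant_exists:
  fixes a :: "int ^ 'n \<Rightarrow> real"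
  assumes a: "\<And>k. 0 \<le> a k" "\<And>k. a k \<le> A"
  obtains b Cb Bb where "\<forall>k. a k \<le> b k \<and> 0 < b k \<and> b k \<le> Bb" "0 < Cb"
    "\<forall>l. (\<integral>\<^sup>+k. ennreal (b k * lat (l - k)) \<partial>count_space UNIV) \<le> ennreal (Cb * b l)"
    "\<forall>r\<ge>1. (\<integral>\<^sup>+k. ennreal (a k powr r) \<partial>count_space UNIV) < \<infinity> \<longrightarrow>
      (\<integral>\<^sup>+k. ennreal (b k powr r) \<partial>count_space UNIV) < \<infinity>"
proof -
  obtain cs where cs: "(\<integral>\<^sup>+k. ennreal (lat (k :: int ^ 'n)) \<partial>count_space UNIV) \<le> ennreal cs" "0 < cs"
    using lat_summable by blast
  obtain C where C: "0 < C" "\<And>l :: int ^ 'n. (\<integral>\<^sup>+m. ennreal (lat m * lat (l - m)) \<partial>count_space UNIV) \<le> ennreal (C * lat l)"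
    using lat_conv_le by blast
  \<comment> \<open>The additional 1 at k = 0 makes b strictly positive even when a vanishes, as the
    locale \<open>gevrey\<close> requires.\<close>
  define e where "e k = a k + indicator {0} k" for k
  have e: "0 \<le> e k" "e k \<le> A + 1" "a k \<le> e k" for k
    using a[of k] by (auto simp: e_def indicator_def)
  have A: "0 < A + 1" using a[of 0] by linarith
  have latn: "0 \<le> lat k" for k :: "int ^ 'n" using lat_pos by (rule less_imp_le)
  let ?I = "\<lambda>k. \<integral>\<^sup>+m. ennreal (e (k - m) * lat m) \<partial>count_space UNIV"
  have I_le: "?I k \<le> ennreal ((A + 1) * cs)" for k
  proof -
    have "?I k \<le> (\<integral>\<^sup>+m. ennreal (A + 1) * ennreal (lat (m :: int ^ 'n)) \<partial>count_space UNIV)"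
    proof (rule nn_integral_mono)
      fix m
      have "ennreal (e (k - m) * lat m) \<le> ennreal ((A + 1) * lat m)"
        by (intro ennreal_leI mult_right_mono e latn)
      then show "ennreal (e (k - m) * lat m) \<le> ennreal (A + 1) * ennreal (lat m)"
        using A latn[of m] by (simp add: ennreal_mult)
    qed
    also have "\<dots> = ennreal (A + 1) * (\<integral>\<^sup>+m. ennreal (lat (m :: int ^ 'n)) \<partial>count_space UNIV)" by (rule nn_integral_cmult) simp
    also have "\<dots> \<le> ennreal (A + 1) * ennreal cs" by (intro mult_left_mono cs) auto
    finally show ?thesis using A by (simp add: ennreal_mult')
  qed
  define b where "b k = enn2real (?I k)" for k
  have b: "ennreal (b k) = ?I k" for k
    unfolding b_def using le_less_trans[OF I_le[of k] ennreal_less_top] by (simp add: ennreal_enn2real)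
  have single: "e (k - m) * lat m \<le> b k" for k m
  proof -
    have "ennreal (e (k - m) * lat m) = (\<integral>\<^sup>+m'. ennreal (e (k - m') * lat m') * indicator {m} m' \<partial>count_space UNIV)"
      by (subst nn_integral_indicator_singleton) auto
    also have "\<dots> \<le> ?I k" by (intro nn_integral_mono) (auto simp: indicator_def)
    finally have "ennreal (e (k - m) * lat m) \<le> ennreal (b k)" unfolding b .
    moreover have "0 \<le> b k" by (simp add: b_def)
    ultimately show ?thesis by (simp add: ennreal_le_iff)
  qed
  have lat0: "lat (0 :: int ^ 'n) = 1" by (simp add: lat_def)
  have ab: "a k \<le> b k" for k using single[of k 0] e(3)[of k] by (simp add: lat0)
  have bpos: "0 < b k" for k
  proof -
    have "0 < e (k - k) * lat k" using a(1)[of 0] lat_pos[of k] by (simp add: e_def add_nonneg_pos)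
    then show ?thesis using single[of k k] by linarith
  qed
  have ble: "b k \<le> (A + 1) * cs" for k
    using I_le[of k] A cs(2) unfolding b[symmetric] by (simp add: ennreal_le_iff)
  have bconv: "(\<integral>\<^sup>+k. ennreal (b k * lat (l - k)) \<partial>count_space UNIV) \<le> ennreal (C * b l)" for l
  proof -
    have I2: "ennreal (b k) = (\<integral>\<^sup>+m. ennreal (e m * lat (k - m)) \<partial>count_space UNIV)" for k
      unfolding b by (subst nn_integral_lattice_reflect[of _ k, symmetric]) simp
    have "(\<integral>\<^sup>+k. ennreal (b k * lat (l - k)) \<partial>count_space UNIV) =
        (\<integral>\<^sup>+k. \<integral>\<^sup>+m. ennreal (e m * lat (k - m)) * ennreal (lat (l - k)) \<partial>count_space UNIV \<partial>count_space UNIV)"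
      using bpos by (intro nn_integral_cong) (simp add: ennreal_mult' less_imp_le I2 nn_integral_multc)
    also have "\<dots> = (\<integral>\<^sup>+m. \<integral>\<^sup>+k. ennreal (e m * lat (k - m)) * ennreal (lat (l - k)) \<partial>count_space UNIV \<partial>count_space UNIV)"
      by (rule nn_integral_count_space_nn_integral) auto
    also have "\<dots> = (\<integral>\<^sup>+m. ennreal (e m) * (\<integral>\<^sup>+k. ennreal (lat k * lat ((l - m) - k)) \<partial>count_space UNIV) \<partial>count_space UNIV)"
    proof (rule nn_integral_cong)
      fix m
      have "(\<integral>\<^sup>+k. ennreal (e m * lat (k - m)) * ennreal (lat (l - k)) \<partial>count_space UNIV) =
          (\<integral>\<^sup>+k. ennreal (e m) * ennreal (lat (k - m) * lat (l - k)) \<partial>count_space UNIV)"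
        using e(1)[of m] latn by (simp add: ennreal_mult mult.assoc)
      also have "\<dots> = ennreal (e m) * (\<integral>\<^sup>+k. ennreal (lat (k - m) * lat (l - k)) \<partial>count_space UNIV)"
        by (rule nn_integral_cmult) simp
      also have "(\<integral>\<^sup>+k. ennreal (lat (k - m) * lat (l - k)) \<partial>count_space UNIV) = (\<integral>\<^sup>+k. ennreal (lat k * lat ((l - m) - k)) \<partial>count_space UNIV)"
        by (subst nn_integral_lattice_reflect[of _ l, symmetric]) (simp add: mult.commute diff_right_commute)
      finally show "(\<integral>\<^sup>+k. ennreal (e m * lat (k - m)) * ennreal (lat (l - k)) \<partial>count_space UNIV) =
          ennreal (e m) * (\<integral>\<^sup>+k. ennreal (lat k * lat ((l - m) - k)) \<partial>count_space UNIV)" .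
    qed
    also have "\<dots> \<le> (\<integral>\<^sup>+m. ennreal (e m) * ennreal (C * lat (l - m)) \<partial>count_space UNIV)"
      by (intro nn_integral_mono mult_left_mono C) auto
    also have "\<dots> = ennreal C * (\<integral>\<^sup>+m. ennreal (e m * lat (l - m)) \<partial>count_space UNIV)"
      using C(1) e(1) latn by (subst nn_integral_cmult[symmetric]) (auto simp: ennreal_mult'[symmetric] ac_simps intro!: nn_integral_cong)
    also have "\<dots> = ennreal (C * b l)" using C(1) by (simp add: I2[symmetric] ennreal_mult')
    finally show ?thesis .
  qed
  have blr: "(\<integral>\<^sup>+k. ennreal (b k powr r) \<partial>count_space UNIV) < \<infinity>"
    if r: "1 \<le> r" and fin: "(\<integral>\<^sup>+k. ennreal (a k powr r) \<partial>count_space UNIV) < \<infinity>" for r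
  proof -
    have "(\<integral>\<^sup>+k. ennreal (e k powr r) \<partial>count_space UNIV) \<le>
        (\<integral>\<^sup>+k. ennreal (a k powr r) + ennreal ((A + 1) powr r) * indicator {0} k \<partial>count_space UNIV)"
    proof (rule nn_integral_mono)
      fix k
      show "ennreal (e k powr r) \<le> ennreal (a k powr r) + ennreal ((A + 1) powr r) * indicator {0} k"
      proof (cases "k = 0")
        case True
        have "ennreal (e k powr r) \<le> ennreal ((A + 1) powr r)"
          using e[of k] r by (intro ennreal_leI powr_mono2) auto
        then show ?thesis using True by (simp add: add_increasing)
      qed (simp add: e_def)
    qed
    also have "\<dots> = (\<integral>\<^sup>+k. ennreal (a k powr r) \<partial>count_space UNIV) + ennreal ((A + 1) powr r)"
      by (subst nn_integral_add) (auto simp: nn_integral_cmult_indicator)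
    also have "\<dots> < \<infinity>" using fin by simp
    finally obtain E where E: "(\<integral>\<^sup>+k. ennreal (e k powr r) \<partial>count_space UNIV) = ennreal E" "0 \<le> E"
      by (cases "\<integral>\<^sup>+k. ennreal (e k powr r) \<partial>count_space UNIV") auto
    \<comment> \<open>E + 1 instead of E, because the majorant in \<open>minkowski_integral\<close>
      has to be positive.\<close>
    define F where "F = (E + 1) powr (1 / r)"
    have F: "0 < F" "F powr r = E + 1" using E(2) r by (auto simp: F_def powr_powr)
    have psf: "pair_sigma_finite (count_space (UNIV :: (int ^ 'n) set)) (count_space (UNIV :: (int ^ 'n) set))"
      by (simp add: pair_sigma_finite_def sigma_finite_measure_count_space)
    have "(\<integral>\<^sup>+k. ennreal (b k powr r) \<partial>count_space UNIV) \<le> ennreal ((cs * F) powr r)"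
    proof (rule minkowski_integral[OF psf r, where g = "\<lambda>k m. e (k - m) * lat m" and \<alpha> = "\<lambda>m. lat m * F"])
      show "case_prod (\<lambda>k m. e (k - m) * lat m) \<in> borel_measurable (count_space UNIV \<Otimes>\<^sub>M count_space UNIV)"
        by (rule measurable_pair_count_space2) simp
      fix m :: "int ^ 'n"
      have "(\<integral>\<^sup>+k. ennreal ((e (k - m) * lat m) powr r) \<partial>count_space UNIV) = ennreal (lat m powr r) * (\<integral>\<^sup>+k. ennreal (e (k - m) powr r) \<partial>count_space UNIV)"
        using e(1) latn by (subst nn_integral_cmult[symmetric]) (auto simp: powr_mult ennreal_mult'[symmetric] mult.commute)
      also have "(\<integral>\<^sup>+k. ennreal (e (k - m) powr r) \<partial>count_space UNIV) = (\<integral>\<^sup>+k. ennreal (e k powr r) \<partial>count_space UNIV)"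
        by (rule nn_integral_bij_count_space[of "\<lambda>k. k - m"], rule bij_betwI[of _ _ _ "\<lambda>k. k + m"]) auto
      also have "ennreal (lat m powr r) * \<dots> \<le> ennreal (lat m powr r) * ennreal (F powr r)"
        unfolding E F by (intro mult_left_mono ennreal_leI) auto
      also have "\<dots> = ennreal ((lat m * F) powr r)"
        using latn F(1) by (simp add: powr_mult ennreal_mult'[symmetric])
      finally show "(\<integral>\<^sup>+k. ennreal ((e (k - m) * lat m) powr r) \<partial>count_space UNIV) \<le> ennreal ((lat m * F) powr r)" .
    next
      have "(\<integral>\<^sup>+m. ennreal (lat (m :: int ^ 'n) * F) \<partial>count_space UNIV) = (\<integral>\<^sup>+m. ennreal (lat (m :: int ^ 'n)) \<partial>count_space UNIV) * ennreal F"
        using F(1) by (subst nn_integral_multc[symmetric]) (auto simp: ennreal_mult'' less_imp_le)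
      also have "\<dots> \<le> ennreal cs * ennreal F" by (intro mult_right_mono cs) auto
      finally show "(\<integral>\<^sup>+m. ennreal (lat (m :: int ^ 'n) * F) \<partial>count_space UNIV) \<le> ennreal (cs * F)"
        using F(1) by (simp add: ennreal_mult'')
    next
      show "ennreal (b k) \<le> (\<integral>\<^sup>+m. ennreal (e (k - m) * lat m) \<partial>count_space UNIV)" for k by (simp add: b)
    qed (use e latn F cs lat_pos bpos in \<open>auto simp: less_imp_le intro!: mult_pos_pos\<close>)
    then show ?thesis by (rule le_less_trans) simp
  qed
  show thesis by (rule that[of b "(A + 1) * cs" C]) (use ab bpos ble C(1) bconv blr in blast)+
qed

section \<open>Norms of Lebesgue classes\<close>

lemma Lp_norm_cong_AE:
  fixes f g :: "real ^ 'n \<Rightarrow> complex"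
  assumes "0 < p" "AE x in lborel. f x = g x"
  shows "Lp_norm (ennreal p) f = Lp_norm (ennreal p) g"
proof -
  have "(\<integral>\<^sup>+x. ennreal (cmod (f x) powr p) \<partial>lebesgue) = (\<integral>\<^sup>+x. ennreal (cmod (g x) powr p) \<partial>lebesgue)"
    unfolding nn_integral_completion using assms(2) by (intro nn_integral_cong_AE) (auto elim: eventually_mono)
  then show ?thesis using assms(1) by (simp add: Lp_norm_def)
qed

lemma Lp_norm_le_iff:
  fixes g :: "real ^ 'n \<Rightarrow> complex"
  assumes p: "1 \<le> p" and A: "0 \<le> A"
  shows "Lp_norm (ennreal p) g \<le> ennreal A \<longleftrightarrow> lp_le p g A"
proof (cases "\<integral>\<^sup>+x. ennreal (cmod (g x) powr p) \<partial>lborel")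
  case (real I)
  have "Lp_norm (ennreal p) g = ennreal (I powr (1 / p))"
    using p real by (simp add: Lp_norm_def ennreal_powr_def nn_integral_completion)
  moreover have "I powr (1 / p) \<le> A \<longleftrightarrow> I \<le> A powr p"
  proof
    assume "I powr (1 / p) \<le> A"
    then have "(I powr (1 / p)) powr p \<le> A powr p" using p by (intro powr_mono2) auto
    then show "I \<le> A powr p" using p real(1) by (simp add: powr_powr)
  next
    assume "I \<le> A powr p"
    then have "I powr (1 / p) \<le> (A powr p) powr (1 / p)" using p real(1) by (intro powr_mono2) auto
    then show "I powr (1 / p) \<le> A" using p A by (simp add: powr_powr)
  qed
  ultimately show ?thesis using A real by (simp add: lp_le_def ennreal_le_iff)
next
  case top
  then show ?thesis using p by (simp add: Lp_norm_def ennreal_powr_def nn_integral_completion lp_le_def top_unique)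
qed

lemma completion_ex_borel_measurable_complex:
  fixes g :: "'a \<Rightarrow> complex"
  assumes g: "g \<in> borel_measurable (completion M)"
  shows "\<exists>g'\<in>borel_measurable M. AE x in M. g x = g' x"
proof -
  have "(\<lambda>x. Re (g x)) \<in> borel_measurable (completion M)" "(\<lambda>x. Im (g x)) \<in> borel_measurable (completion M)"
    using g by measurable
  from this[THEN completion_ex_borel_measurable_real]
  obtain r i where [measurable]: "r \<in> borel_measurable M" "i \<in> borel_measurable M"
    and ae: "AE x in M. Re (g x) = r x" "AE x in M. Im (g x) = i x" by blast
  show ?thesis
  proof
    show "(\<lambda>x. complex_of_real (r x) + \<i> * complex_of_real (i x)) \<in> borel_measurable M"
      by measurable
    show "AE x in M. g x = complex_of_real (r x) + \<i> * complex_of_real (i x)" using ae by eventually_elim (simp add: complex_eq_iff)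
  qed
qed

lemma conv_cong_AE:
  fixes K g h :: "'a::euclidean_space \<Rightarrow> complex"
  assumes [measurable]: "K \<in> borel_measurable borel" "g \<in> borel_measurable borel" "h \<in> borel_measurable borel"
    and ae: "AE x in lborel. g x = h x"
  shows "conv K g = conv K h"
proof
  fix x
  have "AE z in distr lborel borel (\<lambda>z. x - z). g z = h z" using ae unfolding distr_lborel_reflect .
  then have "AE z in lborel. g (x - z) = h (x - z)" by (subst (asm) AE_distr_iff) auto
  then show "conv K g x = conv K h x"
    unfolding conv_def by (intro integral_cong_AE) (auto elim: eventually_mono)
qed

context window
begin

lemma Lp_borel_lp_le:
  assumes p: "1 \<le> p" and g: "g \<in> Lp (ennreal p)"
  obtains gb A where "gb \<in> borel_measurable borel" "AE x in lborel. g x = gb x" "lp_le p gb A" "0 < A"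
proof -
  have "g \<in> borel_measurable (completion lborel)" using g by (simp add: Lp_def)
  then obtain gb where gb: "gb \<in> borel_measurable lborel" "AE x in lborel. g x = gb x"
    using completion_ex_borel_measurable_complex by blast
  have "Lp_norm (ennreal p) gb < \<infinity>"
    using g Lp_norm_cong_AE[OF _ gb(2), of p] p by (simp add: Lp_def)
  then obtain A where A: "Lp_norm (ennreal p) gb = ennreal A" "0 \<le> A" by (cases "Lp_norm (ennreal p) gb") auto
  have "lp_le p gb (A + 1)"
    using A p by (subst Lp_norm_le_iff[symmetric]) (auto intro!: ennreal_leI)
  then show thesis using gb A(2) that[of gb "A + 1"] by simp
qed

lemma lp_le_imp_Lp:
  assumes p: "1 \<le> p" and g: "g \<in> borel_measurable borel" "lp_le p g A" "0 \<le> A"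
  shows "g \<in> Lp (ennreal p)"
proof -
  have "Lp_norm (ennreal p) g \<le> ennreal A" using Lp_norm_le_iff[OF p g(3)] g(2) by blast
  then have "Lp_norm (ennreal p) g < \<infinity>" by (rule le_less_trans) simp
  moreover have "g \<in> borel_measurable lebesgue" using g(1) by (intro measurable_completion) simp
  ultimately show ?thesis by (simp add: Lp_def)
qed

text \<open>\<open>blk k f\<close> is one L^p function representing the distribution, and testing
  against Schwartz functions shows that every other agrees with it almost everywhere. So the infimum
  is taken over a single value.\<close>

lemma distr_Lp_norm_box_op:
  assumes p: "1 \<le> p" and f0: "f0 \<in> borel_measurable lebesgue" "AE x in lborel. f0 x = f x"
    and f: "f \<in> borel_measurable borel" "lp_le p f A" "0 < A"
  shows "distr_Lp_norm (ennreal p) (box_op \<rho> k f0) = Lp_norm (ennreal p) (blk k f)"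
proof -
  let ?I = "decay_mass TYPE(real ^ 'n) powr (1 - 1 / p)"
  have tame: "tame (?I * B) g" "0 \<le> ?I * B" if "g \<in> borel_measurable borel" "lp_le p g B" "0 < B" for g :: "real ^ 'n \<Rightarrow> complex" and B
    using tame_lp[OF that(1) p that(2)] that(3) by auto
  note tf = tame[OF f]
  obtain C where C: "0 < C" "decaying C (ker (sig k))" using ker_decaying[OF bump_sig] by blast
  have bm: "blk k f \<in> borel_measurable borel" by (rule blk_measurable[OF f(1)])
  have bl: "lp_le p (blk k f) (C * decay_mass TYPE(real ^ 'n) * A)"
    unfolding blk_def by (rule conv_lp[OF C(2) f(1) p f(2,3) C(1)])
  have pos: "0 < C * decay_mass TYPE(real ^ 'n) * A" using C(1) f(3) by simp
  note tb = tame[OF bm bl pos]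
  have box: "box_op \<rho> k f0 \<phi> = distr_of (blk k f) \<phi>" if "\<phi> \<in> schwartz" for \<phi>
    by (rule box_op_eq[OF tf that f0])
  let ?S = "{g \<in> Lp (ennreal p). \<forall>\<phi> \<in> schwartz. box_op \<rho> k f0 \<phi> = distr_of g \<phi>}"
  have mem: "blk k f \<in> ?S" using lp_le_imp_Lp[OF p bm bl] pos box by simp
  have "Lp_norm (ennreal p) g = Lp_norm (ennreal p) (blk k f)" if g: "g \<in> ?S" for g
  proof -
    obtain gb B where gb: "gb \<in> borel_measurable borel" "AE x in lborel. g x = gb x" "lp_le p gb B" "0 < B"
      using Lp_borel_lp_le[OF p] g by blast
    have gl: "g \<in> borel_measurable lebesgue" using g by (simp add: Lp_def)
    have "AE x in lborel. gb x = blk k f x"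
    proof (rule distr_of_eq_imp_AE_eq[OF tame[OF gb(1,3,4)] tb])
      fix \<phi> :: "real ^ 'n \<Rightarrow> complex" assume \<phi>: "\<phi> \<in> schwartz"
      obtain C' where "decaying C' \<phi>" using schwartz_decay[OF \<phi>] by blast
      then have \<phi>m [measurable]: "\<phi> \<in> borel_measurable borel" by (rule decaying_measurable)
      have [measurable]: "gb \<in> borel_measurable borel" by (rule gb)
      have "(LINT x|lborel. gb x * \<phi> x) = (LINT x|lebesgue. gb x * \<phi> x)"
        by (rule integral_completion[symmetric]) measurable
      also have "\<dots> = (LINT x|lebesgue. g x * \<phi> x)"
      proof (rule integral_cong_AE)
        show "AE x in lebesgue. gb x * \<phi> x = g x * \<phi> x"
          using AE_completion[OF gb(2)] by eventually_elim simp
        show "(\<lambda>x. gb x * \<phi> x) \<in> borel_measurable lebesgue" by (rule measurable_completion) measurable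
        have "\<phi> \<in> borel_measurable lebesgue" by (rule measurable_completion) measurable
        then show "(\<lambda>x. g x * \<phi> x) \<in> borel_measurable lebesgue" using gl by (rule borel_measurable_times[rotated])
      qed
      also have "\<dots> = distr_of (blk k f) \<phi>" using g \<phi> box[OF \<phi>] by (simp add: distr_of_def)
      also have "\<dots> = (LINT x|lborel. blk k f x * \<phi> x)"
        unfolding distr_of_def using bm \<phi>m by (intro integral_completion borel_measurable_times) simp_all
      finally show "(LINT x|lborel. gb x * \<phi> x) = (LINT x|lborel. blk k f x * \<phi> x)" .
    qed
    then have "AE x in lborel. g x = blk k f x" using gb(2) by eventually_elim simp
    then show ?thesis using p by (intro Lp_norm_cong_AE) auto
  qed
  then have "Lp_norm (ennreal p) ` ?S = {Lp_norm (ennreal p) (blk k f)}" using mem by blast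
  then show ?thesis by (simp add: distr_Lp_norm_def)
qed

end

section \<open>Gevrey-modulation norms through frequency blocks\<close>

lemma ennreal_powr_ennreal: "0 \<le> x \<Longrightarrow> ennreal_powr (ennreal x) r = ennreal (x powr r)"
  by (simp add: ennreal_powr_def)

lemma ennreal_powr_less_top_iff: "ennreal_powr x r < top \<longleftrightarrow> x < top"
  by (auto simp: ennreal_powr_def less_top)

lemma infsum_ennreal_eq_SUP:
  "(\<Sum>\<^sub>\<infinity>k. f k :: ennreal) = (SUP F \<in> {F. finite F}. sum f F)"
  using nonneg_infsum_complete[of UNIV f] by simp

lemma infsum_le_nn_integral_count: "(\<Sum>\<^sub>\<infinity>k. f k) \<le> (\<integral>\<^sup>+k. f k \<partial>count_space UNIV)"
  unfolding infsum_ennreal_eq_SUP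
proof (rule SUP_least)
  fix F :: "'a set" assume F: "F \<in> {F. finite F}"
  have "sum f F = (\<Sum>k\<in>F. f k * indicator F k)" by (intro sum.cong) auto
  also have "\<dots> = (\<integral>\<^sup>+k. f k * indicator F k \<partial>count_space UNIV)"
    using F by (intro nn_integral_count_space'[symmetric]) auto
  also have "\<dots> \<le> (\<integral>\<^sup>+k. f k \<partial>count_space UNIV)"
    by (intro nn_integral_mono) (auto simp: indicator_def)
  finally show "sum f F \<le> (\<integral>\<^sup>+k. f k \<partial>count_space UNIV)" .
qed

context window
begin

text \<open>a consists of the weighted block norms, which are finite because each kernel maps L^p to
  itself. For finite q a single term is at most the whole sum, so a is bounded in this case as
  well.\<close>

lemma GM_imp_blk_le:
  assumes p: "1 \<le> p" and q: "1 \<le> q" and g: "g \<in> GM \<rho> s (ennreal p) q" "AE x in lborel. g x = v x"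
    and v: "v \<in> borel_measurable borel" "lp_le p v A" "0 < A"
  obtains a B where "\<forall>k. 0 \<le> a k \<and> a k \<le> B"
    "\<forall>k. lp_le p (blk k v) (a k / exp (norm (lattice_pt k) powr (1 / s)))"
    "q \<noteq> \<infinity> \<longrightarrow> (\<integral>\<^sup>+k. ennreal (a k powr enn2real q) \<partial>count_space UNIV) < \<infinity>"
proof -
  have gm: "g \<in> borel_measurable lebesgue" using g(1) by (simp add: GM_def Lp_def)
  obtain C where C: "\<And>k. decaying C (ker (sig k))" "0 < C" using ker_sig_decaying by blast
  define w where "w k = exp (norm (lattice_pt k) powr (1 / s))" for k :: "int ^ 'n"
  have w: "0 < w k" for k by (simp add: w_def)
  define t where "t k = enn2real (Lp_norm (ennreal p) (blk k v))" for k
  have t0: "0 \<le> t k" for k by (simp add: t_def)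
  have t: "Lp_norm (ennreal p) (blk k v) = ennreal (t k)" for k
  proof -
    have "lp_le p (blk k v) (C * decay_mass TYPE(real ^ 'n) * A)"
      unfolding blk_def by (rule conv_lp[OF C(1) v(1) p v(2,3) C(2)])
    then have "Lp_norm (ennreal p) (blk k v) \<le> ennreal (C * decay_mass TYPE(real ^ 'n) * A)"
      using C(2) v(3) p by (subst Lp_norm_le_iff) (auto simp: less_imp_le)
    from le_less_trans[OF this ennreal_less_top] show ?thesis by (simp add: t_def ennreal_enn2real)
  qed
  have d: "distr_Lp_norm (ennreal p) (box_op \<rho> k g) = ennreal (t k)" for k
    using distr_Lp_norm_box_op[OF p gm g(2) v] by (simp add: t)
  define a where "a k = w k * t k" for k
  have a0: "0 \<le> a k" for k using w[of k] t0[of k] by (simp add: a_def)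
  have lp: "lp_le p (blk k v) (a k / w k)" for k
    using Lp_norm_le_iff[OF p t0[of k], of "blk k v"] t[of k] w[of k] by (simp add: a_def)
  have N: "GM_norm \<rho> s (ennreal p) q g < \<infinity>" using g(1) by (simp add: GM_def)
  show thesis
  proof (cases "q = \<infinity>")
    case True
    have "(SUP k. ennreal (a k)) < \<infinity>"
      using N True t0 w by (simp add: GM_norm_def d a_def w_def[symmetric] ennreal_mult less_imp_le)
    then obtain B where B: "(SUP k. ennreal (a k)) = ennreal B" "0 \<le> B"
      by (cases "SUP k. ennreal (a k)") auto
    have "a k \<le> B" for k
    proof -
      have "ennreal (a k) \<le> ennreal B" unfolding B(1)[symmetric] by (rule SUP_upper) simp
      then show ?thesis using B(2) by (simp add: ennreal_le_iff)
    qed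
    then show thesis using a0 lp True by (intro that[of a B]) (auto simp: w_def)
  next
    case False
    define r where "r = enn2real q"
    have r: "1 \<le> r"
      using q False by (cases q) (auto simp: r_def ennreal_le_iff one_ennreal_def[symmetric] simp flip: ennreal_1)
    have e: "ennreal (exp (r * norm (lattice_pt k) powr (1 / s))) * ennreal_powr (ennreal (t k)) r = ennreal (a k powr r)" for k :: "int ^ 'n"
    proof -
      have "exp (r * norm (lattice_pt k) powr (1 / s)) = w k powr r"
        by (simp add: w_def powr_def)
      then show ?thesis
        using t0[of k] w[of k] by (simp add: ennreal_powr_ennreal a_def powr_mult ennreal_mult'[symmetric])
    qed
    have "(\<Sum>\<^sub>\<infinity>k. ennreal (a k powr r)) < \<infinity>"
      using N False by (simp add: GM_norm_def d ennreal_powr_less_top_iff r_def[symmetric] e del: ennreal_powr_ennreal)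
    then obtain X where X: "(\<Sum>\<^sub>\<infinity>k. ennreal (a k powr r)) = ennreal X" "0 \<le> X"
      by (cases "\<Sum>\<^sub>\<infinity>k. ennreal (a k powr r)") auto
    have fin: "sum (\<lambda>k. ennreal (a k powr r)) F \<le> ennreal X" if "finite F" for F
      unfolding X(1)[symmetric] infsum_ennreal_eq_SUP by (rule SUP_upper) (use that in simp)
    have "a k \<le> X powr (1 / r)" for k
    proof -
      have "a k powr r \<le> X" using fin[of "{k}"] X(2) by (simp add: ennreal_le_iff)
      then have "(a k powr r) powr (1 / r) \<le> X powr (1 / r)" using r by (intro powr_mono2) auto
      then show ?thesis using a0[of k] r by (simp add: powr_powr)
    qed
    moreover have "(\<integral>\<^sup>+k. ennreal (a k powr r) \<partial>count_space UNIV) < \<infinity>"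
      using le_less_trans[OF nn_integral_count_le[OF fin] ennreal_less_top] by simp
    ultimately show thesis using a0 lp by (intro that[of a "X powr (1 / r)"]) (auto simp: w_def r_def)
  qed
qed

text \<open>Converse of \<open>GM_imp_blk_le\<close>. A majorant c of the weighted block norms is
  enough, as \<open>GM_norm\<close> is monotone in them.\<close>

lemma GM_if_blk_le:
  assumes p: "1 \<le> p" and q: "1 \<le> q" and g: "g \<in> borel_measurable lebesgue" "AE x in lborel. g x = v x"
    and v: "v \<in> borel_measurable borel" "lp_le p v A" "0 < A"
    and c: "\<And>k. 0 \<le> c k" "\<And>k. c k \<le> B"
    "\<And>k. lp_le p (blk k v) (c k / exp (norm (lattice_pt k) powr (1 / s)))"
    "q \<noteq> \<infinity> \<Longrightarrow> (\<integral>\<^sup>+k. ennreal (c k powr enn2real q) \<partial>count_space UNIV) < \<infinity>"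
  shows "g \<in> GM \<rho> s (ennreal p) q"
proof -
  define w where "w k = exp (norm (lattice_pt k) powr (1 / s))" for k :: "int ^ 'n"
  have w: "0 < w k" for k by (simp add: w_def)
  have "v \<in> Lp (ennreal p)" using v by (intro lp_le_imp_Lp[OF p]) auto
  then have gLp: "g \<in> Lp (ennreal p)"
    using Lp_norm_cong_AE[OF _ g(2), of p] p g(1) by (simp add: Lp_def)
  define t where "t k = enn2real (Lp_norm (ennreal p) (blk k v))" for k
  have t0: "0 \<le> t k" for k by (simp add: t_def)
  have le: "Lp_norm (ennreal p) (blk k v) \<le> ennreal (c k / w k)" for k
    using c(1)[of k] c(3)[of k] w[of k] by (subst Lp_norm_le_iff[OF p]) (auto simp: w_def)
  have t: "Lp_norm (ennreal p) (blk k v) = ennreal (t k)" for k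
    using le_less_trans[OF le[of k] ennreal_less_top] by (simp add: t_def ennreal_enn2real)
  have tc: "w k * t k \<le> c k" for k
  proof -
    have "t k \<le> c k / w k" using le[of k] c(1)[of k] w[of k] by (simp add: t ennreal_le_iff)
    then show ?thesis using w[of k] by (simp add: field_simps)
  qed
  have d: "distr_Lp_norm (ennreal p) (box_op \<rho> k g) = ennreal (t k)" for k
    using distr_Lp_norm_box_op[OF p g v] by (simp add: t)
  have "GM_norm \<rho> s (ennreal p) q g < \<infinity>"
  proof (cases "q = \<infinity>")
    case True
    have "GM_norm \<rho> s (ennreal p) q g = (SUP k. ennreal (w k * t k))"
      using True t0 w by (simp add: GM_norm_def d w_def[symmetric] ennreal_mult less_imp_le)
    also have "\<dots> \<le> ennreal B"
      by (intro SUP_least ennreal_leI order_trans[OF tc c(2)])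
    also have "\<dots> < \<infinity>" by simp
    finally show ?thesis .
  next
    case False
    define r where "r = enn2real q"
    have r: "1 \<le> r"
      using q False by (cases q) (auto simp: r_def ennreal_le_iff one_ennreal_def[symmetric] simp flip: ennreal_1)
    have e: "ennreal (exp (r * norm (lattice_pt k) powr (1 / s))) * ennreal_powr (ennreal (t k)) r = ennreal ((w k * t k) powr r)" for k :: "int ^ 'n"
    proof -
      have "exp (r * norm (lattice_pt k) powr (1 / s)) = w k powr r"
        by (simp add: w_def powr_def)
      then show ?thesis
        using t0[of k] w[of k] by (simp add: ennreal_powr_ennreal powr_mult ennreal_mult'[symmetric])
    qed
    have "(\<Sum>\<^sub>\<infinity>k. ennreal ((w k * t k) powr r)) \<le> (\<integral>\<^sup>+k. ennreal ((w k * t k) powr r) \<partial>count_space UNIV)"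
      by (rule infsum_le_nn_integral_count)
    also have "\<dots> \<le> (\<integral>\<^sup>+k. ennreal (c k powr r) \<partial>count_space UNIV)"
      using tc t0 w r by (intro nn_integral_mono ennreal_leI powr_mono2) (auto simp: less_imp_le)
    also have "\<dots> < \<infinity>" using c(4)[OF False] by (simp add: r_def)
    finally show ?thesis
      using False by (simp add: GM_norm_def d ennreal_powr_less_top_iff r_def[symmetric] e)
  qed
  then show ?thesis using gLp by (simp add: GM_def)
qed

end

section \<open>Continuous representative and conclusion\<close>

context gevrey_bdd
begin

text \<open>The weighted L^p bounds give uniform bounds with the summable factor \<open>lat\<close>,
  so the block series converges uniformly to a continuous function that equals v almost everywhere.
  Taking real parts keeps U real, and blocks do not see a change on a null set.\<close>

lemma continuous_representative:
  assumes v: "v \<in> borel_measurable borel" "lp_le p (\<lambda>x. complex_of_real (v x)) A" "0 < A"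
    and dom: "lp_dom 1 (\<lambda>x. complex_of_real (v x))"
  obtains U MU where "gevrey_fun \<rho> s p Cb b Bb U MU" "AE x in lborel. v x = U x"
proof -
  let ?v = "\<lambda>x. complex_of_real (v x)"
  have vm: "?v \<in> borel_measurable borel" using v(1) by measurable
  let ?B = "decay_mass TYPE(real ^ 'n) powr (1 - 1 / p) * A"
  have tm: "tame ?B ?v" "0 \<le> ?B" using tame_lp[OF vm p v(2)] v(3) by auto
  obtain C where C: "0 < C"
    "\<And>N v B. tame B v \<Longrightarrow> 0 \<le> B \<Longrightarrow> lp_dom N v \<Longrightarrow> 0 < N \<Longrightarrow> sup_dom (C * N) v"
    using sup_dom_of_lp_dom by blast
  have S: "sup_dom (C * 1) ?v" by (rule C(2)[OF tm dom]) simp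
  have C0: "0 \<le> C * 1" using C(1) by simp
  note V = blk_series_eq_AE[OF tm lat_integrable sup_domD[OF S C0]]
  define U where "U x = Re (LINT k|count_space UNIV. blk k ?v x)" for x
  define MU where "MU = (LINT k|count_space UNIV. C * 1 * lat (k :: int ^ 'n))"
  have Uc: "continuous_on UNIV U" unfolding U_def by (intro continuous_intros V(1))
  have ae: "AE x in lborel. v x = U x"
    using V(2) by eventually_elim (metis Re_complex_of_real U_def)
  have "lp_dom 1 (\<lambda>x. complex_of_real (U x))"
  proof -
    have "(\<lambda>x. complex_of_real (U x)) \<in> borel_measurable borel"
      by (intro borel_measurable_continuous_onI continuous_intros Uc)
    moreover have "AE x in lborel. ?v x = complex_of_real (U x)" using ae by eventually_elim simp
    ultimately have "blk k ?v = blk k (\<lambda>x. complex_of_real (U x))" for k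
      unfolding blk_def by (intro conv_cong_AE ker_measurable bump_sig vm)
    then show ?thesis using dom by (simp add: lp_dom_def)
  qed
  moreover have "\<bar>U x\<bar> \<le> MU" for x
    unfolding U_def MU_def using order_trans[OF abs_Re_le_cmod V(3)] .
  ultimately have "gevrey_fun \<rho> s p Cb b Bb U MU"
    using Uc by unfold_locales
  then show thesis using ae by (rule that)
qed

end

context gevrey_fun
begin

lemma lp_dom_measure_combination:
  fixes m :: "nat \<Rightarrow> real measure" and W :: "nat \<Rightarrow> complex"
  assumes m: "\<And>i. finite_measure (m i)" "\<And>i. sets (m i) = sets borel"
    and fin: "\<And>i l. 0 < l \<Longrightarrow> (\<integral>\<^sup>+\<xi>. ennreal (gevrey_exp s l \<xi>) \<partial>m i) < \<infinity>"
    and W: "\<And>i. W i \<noteq> 0" and n: "0 < n"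
  obtains N where "0 < N" "lp_dom N (\<lambda>x. \<Sum>i<n. W i * (LINT \<xi>|m i. ee \<xi> x))"
proof -
  obtain l C where l: "0 < l" "0 < C" "\<And>\<xi>. lp_dom (C * exp (l * (\<bar>\<xi>\<bar> powr (1 / s) * ln \<bar>\<xi>\<bar>))) (ee \<xi>)"
    using ee_lp_dom by metis
  \<comment> \<open>The summand 1 makes T i positive, as \<open>lp_dom_integral\<close>
    demands.\<close>
  define T where "T i = enn2real (\<integral>\<^sup>+\<xi>. ennreal (gevrey_exp s l \<xi>) \<partial>m i) + 1" for i
  have T: "(\<integral>\<^sup>+\<xi>. ennreal (gevrey_exp s l \<xi>) \<partial>m i) \<le> ennreal (T i)" "0 < T i" for i
  proof -
    show "0 < T i" by (simp add: T_def add_nonneg_pos)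
    show "(\<integral>\<^sup>+\<xi>. ennreal (gevrey_exp s l \<xi>) \<partial>m i) \<le> ennreal (T i)"
      using fin[OF l(1), of i]
      by (cases "\<integral>\<^sup>+\<xi>. ennreal (gevrey_exp s l \<xi>) \<partial>m i") (auto simp: T_def intro!: ennreal_leI)
  qed
  let ?F = "\<lambda>i x. LINT \<xi>|m i. ee \<xi> x"
  define N where "N i = cmod (W i) * (C * T i)" for i
  have cont: "continuous_on UNIV (?F i)" for i by (rule integral_ee_continuous[OF m])
  have dom: "lp_dom (C * T i) (?F i)" for i
    by (rule lp_dom_integral[OF m _ l(2) T]) (simp add: gevrey_exp_def l(3))
  have "lp_dom (\<Sum>i<n. N i) (\<lambda>x. \<Sum>i<n. W i * ?F i x)"
  proof (rule lp_dom_sum)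
    fix i
    have "lp_dom (N i) (\<lambda>x. W i * ?F i x)"
      unfolding N_def using l(2) T(2)[of i]
      by (intro lp_dom_scale dom borel_measurable_continuous_onI cont) simp
    moreover have "0 < N i" using W l(2) T(2)[of i] by (simp add: N_def)
    moreover have "continuous_on UNIV (\<lambda>x. W i * ?F i x)" by (intro continuous_intros cont)
    moreover have "cmod (W i * ?F i x) \<le> cmod (W i) * (2 * measure (m i) (space (m i)))" for x
      unfolding norm_mult by (intro mult_left_mono integral_ee_bounded m) auto
    ultimately show "lp_dom (N i) (\<lambda>x. W i * ?F i x) \<and> 0 < N i \<and> continuous_on UNIV (\<lambda>x. W i * ?F i x) \<and>
        (\<forall>x. cmod (W i * ?F i x) \<le> cmod (W i) * (2 * measure (m i) (space (m i))))" by blast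
  qed (use n in auto)
  moreover have "0 < (\<Sum>i<n. N i)"
    using W l(2) T(2) n by (intro sum_pos) (auto simp: N_def)
  ultimately show thesis by (rule that[rotated])
qed

end

text \<open>Source of a bound of f t by a multiple of |t|, through which the composition inherits
  membership in L^p from the inner function.\<close>

lemma cmod_integral_cis_le:
  fixes m :: "real measure"
  assumes [measurable_cong]: "sets m = sets borel" and mom: "integrable m (\<lambda>\<xi>. \<bar>\<xi>\<bar>)"
  shows "cmod (LINT \<xi>|m. cis (\<xi> * t) - 1) \<le> (LINT \<xi>|m. \<bar>\<xi>\<bar>) * \<bar>t\<bar>"
proof -
  have b: "cmod (cis (\<xi> * t) - 1) \<le> \<bar>\<xi>\<bar> * \<bar>t\<bar>" for \<xi>
    using norm_cis_minus_1_le[of "\<xi> * t"] by (simp add: abs_mult)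
  have i: "integrable m (\<lambda>\<xi>. \<bar>\<xi>\<bar> * \<bar>t\<bar>)" using mom by simp
  have "integrable m (\<lambda>\<xi>. cis (\<xi> * t) - 1)"
    by (rule Bochner_Integration.integrable_bound[OF i]) (measurable, use b in auto)
  from Bochner_Integration.integral_norm_bound_integral[OF this i] show ?thesis using b by simp
qed

theorem theorem3p9:
  fixes \<rho> :: "real ^ 'n \<Rightarrow> real" and s :: real and p q :: ennreal
    and \<mu> :: "real set \<Rightarrow> complex" and f :: "real \<Rightarrow> complex"
  assumes "freq_window \<rho>"
    and "s > 1" and "1 < p" and "p < \<infinity>" and "1 \<le> q"
    and "complex_measure borel \<mu>"
    and "\<And>l :: real. l > 0 \<Longrightarrow>
      (\<integral>\<^sup>+\<xi>. ennreal (exp (l * (\<bar>\<xi>\<bar> powr (1 / s) * ln \<bar>\<xi>\<bar>))) \<partial>total_variation borel \<mu>) < \<infinity>"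
    and "\<mu> UNIV = 0"
    and "\<And>t. f t = complex_of_real (1 / sqrt (2 * pi)) *
      complex_integral borel \<mu> (\<lambda>\<xi>. exp (\<i> * complex_of_real (\<xi> * t)))"
  shows "C_infinity f \<and>
    (\<forall>u :: real ^ 'n \<Rightarrow> real.
      (\<lambda>x. complex_of_real (u x)) \<in> GM \<rho> s p q \<longrightarrow> (\<lambda>x. f (u x)) \<in> GM \<rho> s p q)"
proof -
  interpret window \<rho> using assms(1) by unfold_locales
  have s: "0 < s" using assms(2) by simp
  obtain P where P: "p = ennreal P" "1 < P"
    using assms(3,4) by (cases p) (auto simp: ennreal_less_iff simp flip: ennreal_1)
  have P1: "1 \<le> P" using P(2) by simp
  let ?TV = "total_variation borel \<mu>"
  have TV: "(\<integral>\<^sup>+\<xi>. ennreal (gevrey_exp s l \<xi>) \<partial>?TV) < \<infinity>" if "0 < l" for l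
    using assms(7)[OF that] by (simp add: gevrey_exp_def)
  have [measurable_cong]: "sets ?TV = sets borel" by simp
  \<comment> \<open>The total variation is finite because the weight with \<lambda> = 1 is bounded
    below by exp (-s).\<close>
  have "emeasure ?TV (space borel) = (\<integral>\<^sup>+\<xi>. 1 \<partial>?TV)" by simp
  also have "\<dots> \<le> (\<integral>\<^sup>+\<xi>. ennreal (exp s) * ennreal (gevrey_exp s 1 \<xi>) \<partial>?TV)"
  proof (rule nn_integral_mono)
    fix \<xi>
    have "1 \<le> exp s * gevrey_exp s 1 \<xi>"
      using gevrey_exp_ge[OF s, of 1 \<xi>] by (simp add: exp_minus field_simps)
    then show "1 \<le> ennreal (exp s) * ennreal (gevrey_exp s 1 \<xi>)"
      by (simp add: ennreal_mult'[symmetric] flip: ennreal_1 del: ennreal_1)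
  qed
  also have "\<dots> = ennreal (exp s) * (\<integral>\<^sup>+\<xi>. ennreal (gevrey_exp s 1 \<xi>) \<partial>?TV)"
    by (rule nn_integral_cmult) measurable
  also have "\<dots> < \<infinity>" using TV[of 1] by (simp add: ennreal_mult_less_top)
  finally obtain m :: "nat \<Rightarrow> real measure" where m: "\<And>i. finite_measure (m i)" "\<And>i. sets (m i) = sets borel"
    and m_le: "\<And>i h. integral\<^sup>N (m i) h \<le> integral\<^sup>N ?TV h"
    and m_eq: "\<And>g. complex_integral borel \<mu> g =
      ((LINT x|m 0. g x) - (LINT x|m 1. g x)) + \<i> * ((LINT x|m 2. g x) - (LINT x|m 3. g x))"
    and m_1: "complex_integral borel \<mu> (\<lambda>_. 1) = \<mu> (space borel)"
    using complex_integral_decomposition[OF assms(6)] by blast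
  have fin: "(\<integral>\<^sup>+\<xi>. ennreal (gevrey_exp s l \<xi>) \<partial>m i) < \<infinity>" if "0 < l" for l i
    by (rule le_less_trans[OF m_le TV[OF that]])
  have mom: "integrable (m i) (\<lambda>\<xi>. \<bar>\<xi>\<bar> ^ j)" for i j
  proof -
    obtain C where C: "\<And>\<xi>. \<bar>\<xi>\<bar> ^ j \<le> C * gevrey_exp s 1 \<xi>" "0 < C" using moment_le_gevrey_exp[OF s] by metis
    have [measurable_cong]: "sets (m i) = sets borel" by (rule m)
    have "integrable (m i) (gevrey_exp s 1)"
      using fin[of 1 i] by (intro integrableI_bounded) (measurable, simp add: gevrey_exp_def)
    then have "integrable (m i) (\<lambda>\<xi>. C * gevrey_exp s 1 \<xi>)" by simp
    then show ?thesis
      by (rule Bochner_Integration.integrable_bound) (measurable, use C(1) in \<open>auto intro!: AE_I2 order_trans[OF C(1)]\<close>)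
  qed
  define c where "c = complex_of_real (1 / sqrt (2 * pi))"
  have c: "c \<noteq> 0" by (simp add: c_def)
  \<comment> \<open>The Jordan parts of Re \<mu> carry the factors 1 and -1, those of Im \<mu> the
    factors \<i> and -\<i>.\<close>
  define W where "W i = c * (if i = 0 then 1 else if i = 1 then - 1 else if i = 2 then \<i> else - \<i>)" for i :: nat
  have W: "W i \<noteq> 0" for i using c by (simp add: W_def)
  have W_sum: "c * complex_integral borel \<mu> g = (\<Sum>i<4. W i * (LINT \<xi>|m i. g \<xi>))" for g
    unfolding m_eq by (simp add: W_def eval_nat_numeral algebra_simps)
  define G where "G j t = (\<Sum>i<4. W i * moment_fn (m i) j t)" for j t
  have f_G: "f = G 0"
    unfolding fun_eq_iff assms(9) G_def moment_fn_def c_def[symmetric] W_sum by (simp add: cis_conv_exp)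
  have G: "(G j has_vector_derivative G (Suc j) t) (at t)" for j t
    unfolding G_def
    by (intro has_vector_derivative_sum has_vector_derivative_mult_right moment_fn_derivative m mom)
  have f_smooth: "C_infinity f"
    unfolding f_G by (rule C_infinity_if_derivative_sequence) (rule G)
  have f_cont: "continuous_on UNIV f"
    unfolding f_G using G by (intro continuous_at_imp_continuous_on ballI has_vector_derivative_continuous)
  have int: "integrable (m i) (\<lambda>\<xi>. cis (\<xi> * t))" for i t
  proof -
    interpret finite_measure "m i" by (rule m)
    have [measurable_cong]: "sets (m i) = sets borel" by (rule m)
    show ?thesis by (rule integrable_const_bound[where B = 1]) (simp, measurable)
  qed
  \<comment> \<open>Since \<mu> has total mass 0, the four integrals of 1 cancel, so that 1 may be
    subtracted under each integral.\<close>
  have f_eq: "f t = (\<Sum>i<4. W i * (LINT \<xi>|m i. cis (\<xi> * t) - 1))" for t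
  proof -
    have "(\<Sum>i<4. W i * (LINT \<xi>|m i. 1)) = 0"
      using W_sum[of "\<lambda>_. 1"] m_1 assms(8) by simp
    moreover have "(LINT \<xi>|m i. cis (\<xi> * t) - 1) = moment_fn (m i) 0 t - (LINT \<xi>|m i. 1)" for i
      using int[of i t] int[of i 0] by (simp add: moment_fn_def)
    ultimately show ?thesis
      by (simp add: f_G G_def right_diff_distrib sum_subtractf)
  qed
  define L where "L = (\<Sum>i<4. cmod (W i) * (LINT \<xi>|m i. \<bar>\<xi>\<bar>)) + 1"
  have L: "0 < L" by (simp add: L_def add_nonneg_pos sum_nonneg)
  have f_le: "cmod (f t) \<le> L * \<bar>t\<bar>" for t
  proof -
    have "cmod (f t) \<le> (\<Sum>i<4. cmod (W i) * ((LINT \<xi>|m i. \<bar>\<xi>\<bar>) * \<bar>t\<bar>))"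
      unfolding f_eq using mom[of _ 1]
      by (intro order_trans[OF norm_sum] sum_mono) (auto simp: norm_mult intro!: mult_left_mono cmod_integral_cis_le m)
    also have "\<dots> \<le> L * \<bar>t\<bar>" by (simp add: L_def sum_distrib_right mult.assoc distrib_right)
    finally show ?thesis .
  qed
  have "(\<lambda>x. f (u x)) \<in> GM \<rho> s p q" if u: "(\<lambda>x. complex_of_real (u x)) \<in> GM \<rho> s p q" for u :: "real ^ 'n \<Rightarrow> real"
  proof -
    have uLp: "(\<lambda>x. complex_of_real (u x)) \<in> Lp (ennreal P)" using u by (simp add: GM_def P)
    have um: "u \<in> borel_measurable lebesgue"
      using uLp borel_measurable_complex_iff[of "\<lambda>x. complex_of_real (u x)" lebesgue] by (simp add: Lp_def)
    obtain vc A where vc: "vc \<in> borel_measurable borel" "AE x in lborel. complex_of_real (u x) = vc x" "lp_le P vc A" "0 < A"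
      by (rule Lp_borel_lp_le[OF P1 uLp])
    \<comment> \<open>The Borel representative is a priori complex valued; as u is real, its real
      part still agrees with u almost everywhere.\<close>
    define v where "v x = Re (vc x)" for x
    have vm: "v \<in> borel_measurable borel" unfolding v_def using vc(1) by measurable
    have ae_v: "AE x in lborel. u x = v x" using vc(2) by eventually_elim (metis Re_complex_of_real v_def)
    have ae_vc: "AE x in lborel. vc x = complex_of_real (v x)"
      using vc(2) by eventually_elim (metis Re_complex_of_real v_def)
    have lp_le_cong: "lp_le P h B" if "lp_le P g B" "AE x in lborel. g x = h x" for g h :: "real ^ 'n \<Rightarrow> complex" and B
    proof -
      have "(\<integral>\<^sup>+x. ennreal (cmod (g x) powr P) \<partial>lborel) = (\<integral>\<^sup>+x. ennreal (cmod (h x) powr P) \<partial>lborel)"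
        using that(2) by (intro nn_integral_cong_AE) (auto elim: eventually_mono)
      then show ?thesis using that(1) by (simp add: lp_le_def)
    qed
    have vlp: "lp_le P (\<lambda>x. complex_of_real (v x)) A" by (rule lp_le_cong[OF vc(3) ae_vc])
    have vm': "(\<lambda>x. complex_of_real (v x)) \<in> borel_measurable borel" using vm by measurable
    have ae_v': "AE x in lborel. complex_of_real (u x) = complex_of_real (v x)" using ae_v by eventually_elim simp
    obtain a A' where a: "\<forall>k. 0 \<le> a k \<and> a k \<le> A'"
      and a_lp: "\<forall>k. lp_le P (blk k (\<lambda>x. complex_of_real (v x))) (a k / exp (norm (lattice_pt k) powr (1 / s)))"
      and a_q: "q \<noteq> \<infinity> \<longrightarrow> (\<integral>\<^sup>+k. ennreal (a k powr enn2real q) \<partial>count_space UNIV) < \<infinity>"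
      by (rule GM_imp_blk_le[OF P1 assms(5) u[unfolded P(1)] ae_v' vm' vlp vc(4)])
    obtain b Cb Bb where b: "\<forall>k. a k \<le> b k \<and> 0 < b k \<and> b k \<le> Bb" "0 < Cb"
      "\<forall>l. (\<integral>\<^sup>+k. ennreal (b k * lat (l - k)) \<partial>count_space UNIV) \<le> ennreal (Cb * b l)"
      and b_q: "\<forall>r\<ge>1. (\<integral>\<^sup>+k. ennreal (a k powr r) \<partial>count_space UNIV) < \<infinity> \<longrightarrow>
        (\<integral>\<^sup>+k. ennreal (b k powr r) \<partial>count_space UNIV) < \<infinity>"
      by (rule majorant_exists[of a A']) (use a in auto)
    interpret B: gevrey_bdd \<rho> s P Cb b Bb
      using assms(2) P1 b by unfold_locales auto
    \<comment> \<open>The constant is 1 because a \<le> b: the size of u is carried entirely by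
      b.\<close>
    have dom_v: "B.lp_dom 1 (\<lambda>x. complex_of_real (v x))"
      unfolding B.lp_dom_def B.wt_def using a b(1) P1
      by (auto intro!: lp_le_mono[OF a_lp[rule_format]] divide_right_mono)
    obtain U MU where "gevrey_fun \<rho> s P Cb b Bb U MU" and ae_U: "AE x in lborel. v x = U x"
      using B.continuous_representative[OF vm vlp vc(4) dom_v] by blast
    interpret gevrey_fun \<rho> s P Cb b Bb U MU by fact
    obtain N where N: "0 < N" "B.lp_dom N (\<lambda>x. \<Sum>i<4. W i * (LINT \<xi>|m i. ee \<xi> x))"
      using lp_dom_measure_combination[of m W 4, OF m fin W] by auto
    have fU: "(\<lambda>x. \<Sum>i<4. W i * (LINT \<xi>|m i. ee \<xi> x)) = (\<lambda>x. f (U x))"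
      by (simp add: f_eq ee_def)
    have ae_f: "AE x in lborel. f (u x) = f (U x)" using ae_v ae_U by eventually_elim simp
    have fU_cont: "continuous_on UNIV (\<lambda>x. f (U x))"
      by (rule continuous_on_compose2[OF f_cont U_cont]) simp
    have U_lp: "lp_le P (\<lambda>x. complex_of_real (U x)) A"
      by (rule lp_le_cong[OF vlp]) (use ae_U in \<open>eventually_elim, simp\<close>)
    have fU_lp: "lp_le P (\<lambda>x. f (U x)) (L * A)"
    proof -
      have "lp_le P (\<lambda>x. of_real L * complex_of_real (U x)) (cmod (of_real L) * A)"
        using U_lp vc(4) P1 U_cont
        by (intro lp_le_scale borel_measurable_continuous_onI continuous_intros) auto
      moreover have "cmod (f (U x)) powr P \<le> cmod (of_real L * complex_of_real (U x)) powr P" for x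
        using f_le[of "U x"] L P1 by (intro powr_mono2) (auto simp: norm_mult)
      then have "(\<integral>\<^sup>+x. ennreal (cmod (f (U x)) powr P) \<partial>lborel) \<le>
          (\<integral>\<^sup>+x. ennreal (cmod (of_real L * complex_of_real (U x)) powr P) \<partial>lborel)"
        by (intro nn_integral_mono ennreal_leI)
      ultimately show ?thesis using L unfolding lp_le_def by (auto intro: order_trans)
    qed
    have fu: "(\<lambda>x. f (u x)) \<in> borel_measurable lebesgue"
      using measurable_compose[OF um borel_measurable_continuous_onI[OF f_cont]] .
    have "(\<lambda>x. f (u x)) \<in> GM \<rho> s (ennreal P) q"
    proof (rule GM_if_blk_le[OF P1 assms(5) fu ae_f borel_measurable_continuous_onI[OF fU_cont] fU_lp])
      show "0 < L * A" using L vc(4) by simp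
      show "0 \<le> N * b k" for k using N(1) b(1) by (simp add: less_imp_le)
      show "N * b k \<le> N * Bb" for k using N(1) b(1) by simp
      show "lp_le P (blk k (\<lambda>x. f (U x))) (N * b k / exp (norm (lattice_pt k) powr (1 / s)))" for k
        using N(2) unfolding fU B.lp_dom_def B.wt_def by blast
      \<comment> \<open>For finite q the summability of the block norms of u reaches f \<circ> u
        through b, whose q-th powers are summable by construction.\<close>
      show "(\<integral>\<^sup>+k. ennreal ((N * b k) powr enn2real q) \<partial>count_space UNIV) < \<infinity>" if q: "q \<noteq> \<infinity>"
      proof -
        have r: "1 \<le> enn2real q"
          using assms(5) q by (cases q) (auto simp: ennreal_le_iff simp flip: ennreal_1)
        have "(\<integral>\<^sup>+k. ennreal ((N * b k) powr enn2real q) \<partial>count_space UNIV) =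
            (\<integral>\<^sup>+k. ennreal (N powr enn2real q) * ennreal (b k powr enn2real q) \<partial>count_space UNIV)"
          using N(1) b(1) by (intro nn_integral_cong) (simp add: powr_mult ennreal_mult less_imp_le)
        also have "\<dots> = ennreal (N powr enn2real q) * (\<integral>\<^sup>+k. ennreal (b k powr enn2real q) \<partial>count_space UNIV)"
          by (rule nn_integral_cmult) simp
        also have "\<dots> < \<infinity>" using b_q r a_q q by (simp add: ennreal_mult_less_top)
        finally show ?thesis .
      qed
    qed
    then show ?thesis by (simp add: P)
  qed
  then show ?thesis using f_smooth by blast
qed

end
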